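(* Let $\sigma>0$, $\theta\in(1/2,1)$ and let the data $\ell^c,f^c,g^c,m_0^c$ satisfy assumptions (A), (B), (C) of the context, with $r\in(0,1)$ the exponent in (B). There exist two constants $C_\theta>0$ and $\bar C_\theta>0$, independent of $\Delta t$ and $h$, such that the following holds for all discretization parameters $\Delta t=1/T$, $h=1/N$ ($T,N\in\mathbb{N}_+$) satisfying $$\Delta t\le \frac{h^2}{2d(1-\theta)\sigma},\qquad h\le\frac{2(1-\theta)\sigma}{M}.$$ Let $(m_h^k,w_h^k)_{k\ge1}$ be generated by the generalized Frank-Wolfe algorithm described in the context, from an initialization $m_h^0\in\mathcal{P}(\tilde{\mathcal T},S)$, with $\lambda_k=2/(k+2)$ for all $k\ge1$; let $u_h^k=\mathbf{HJB}_\theta(m_h^k)$ and $\gamma_k=\tilde J(m_h^k,w_h^k)-\tilde J(m_h,m_hv_h)$. Then $$\gamma_k\le\frac{C_\theta}{k},\qquad\forall k\ge1,$$ and, for all $k\ge1$, $$\|u_h^k-u_h\|_{\infty,\infty}+\|m_h^k-m_h\|_{\infty,1}\le\frac{\bar C_\theta}{\sqrt{kh^{d/2}}},$$ $$\|u_h^k-u_h^*\|_{\infty,\infty}+\|m_h^k-m_h^*\|_{\infty,1}\le\bar C_\theta\Big(h^r+\frac1{\sqrt{kh^{d/2}}}\Big).$$ In particular, for $k\ge h^{-(2r+d/2)}$, $$\|u_h^k-u_h^*\|_{\infty,\infty}+\|m_h^k-m_h^*\|_{\infty,1}\le2\bar C_\theta h^r.$$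
   Context: **Continuous problem.** $\mathbb{T}^d=\mathbb{R}^d/\mathbb{Z}^d$, $Q=[0,1]\times\mathbb{T}^d$, $\mathcal D=\{\mu\in L^2(\mathbb{T}^d):\mu\ge0,\int_{\mathbb{T}^d}\mu=1\}$. Data: $\ell^c:Q\times\mathbb{R}^d\to\mathbb{R}$, $f^c:Q\times\mathcal D\to\mathbb{R}$, $g^c:\mathbb{T}^d\to\mathbb{R}$, $m_0^c\in\mathcal D$. $H^c(t,x,p)=\sup_{v\in\mathbb{R}^d}\langle -p,v\rangle-\ell^c(t,x,v)$. The mean field game is $$-\partial_tu-\sigma\Delta u+H^c(t,x,\nabla u)=f^c(t,x,m(t)),\quad v=-H^c_p(t,x,\nabla u),\quad \partial_tm-\sigma\Delta m+\mathrm{div}(vm)=0\ \text{ on }Q,$$ $$m(0,x)=m_0^c(x),\quad u(1,x)=g^c(x)\ \text{ on }\mathbb{T}^d.$$ **Assumption (A).** $\ell^c$ is continuously differentiable in $v$. There are constants $L_\ell^c,L_g^c,L_f^c>0$ such that, for all $(t,x)\in Q$, $v\in\mathbb{R}^d$, $m\in\mathcal D$: $\ell^c(\cdot,x,v)$, $\ell^c(t,\cdot,v)$, $\ell^c_v(\cdot,x,v)$ are $L_\ell^c$-Lipschitz; $g^c$ is $L_g^c$-Lipschitz; $f^c(\cdot,x,m)$, $f^c(t,\cdot,m)$, $f^c(t,x,\cdot)$ are $L_f^c$-Lipschitz (for the $L^2$-norm in the third variable). There is $\alpha^c>0$ with $\ell^c(t,x,v_2)\ge\ell^c(t,x,v_1)+\langle\ell^c_v(t,x,v_1),v_2-v_1\rangle+\frac{\alpha^c}{2}\|v_2-v_1\|^2$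 for all $(t,x)\in Q$, $v_1,v_2\in\mathbb{R}^d$. Monotonicity: $\int_{\mathbb{T}^d}(f^c(t,x,m_1)-f^c(t,x,m_2))(m_1(x)-m_2(x))dx\ge0$ for all $t\in[0,1]$, $m_1,m_2\in\mathcal D$. **Assumption (B).** The mean field game admits a unique solution $(u^*,v^*,m^* )$, with $u^*,m^*\in\mathcal C^{1+r/2,2+r}(Q)$ and $v^*\in\mathcal C^r(Q)\cap L^\infty([0,1];\mathcal C^{1+r}(\mathbb{T}^d))$, where $r\in(0,1)$. **Assumption (C).** There is $F^c:[0,1]\times\mathcal D\to\mathbb{R}$ with $F^c(t,m_2)-F^c(t,m_1)=\int_0^1\int_{\mathbb{T}^d}f^c(t,x,m_1+s(m_2-m_1))(m_2(x)-m_1(x))\,dx\,ds$ for all $t\in[0,1]$, $m_1,m_2\in\mathcal D$. **Discretization.** $M=\frac1{\alpha^c}\big(2\max_{(t,x)\in Q}\|\ell_v^c(t,x,0)\|+\sqrt d(L_\ell^c+L_f^c+L_g^c)\big)$. $\mathcal T=\{0,\dots,T-1\}$, $\tilde{\mathcal T}=\{0,\dots,T\}$, $S=\{(i_1,\dots,i_d)h: i_j\in\mathbb{Z}/N\mathbb{Z}\}\subset\mathbb{T}^d$. $\mathbb{R}(X)$, $\mathbb{R}^d(X)$ are the sets of functions from $X$ to $\mathbb{R}$, $\mathbb{R}^d$. $\mathcal P(S)$ is the set of $m:S\to[0,\infty)$ with $\sum_Sm=1$, and $\mathcal P(\tilde{\mathcal T},S)$ is the set of $m:\tilde{\mathcal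 T}\times S\to\mathbb{R}$ with $m(t,\cdot)\in\mathcal P(S)$ for all $t$. $\|\mu\|_{\infty,p}=\max_t\|\mu(t,\cdot)\|_p$, where $\|\nu\|_p=(\sum_{x\in S}\|\nu(x)\|^p)^{1/p}$ for $p<\infty$ and $\|\nu\|_\infty=\max_S\|\nu\|$. $B_h(x)=\prod_{i=1}^d[x_i-h/2,x_i+h/2)$. $\mathcal R_h(m)(y)=m(x)/h^d$ for $y\in B_h(x)$, $x\in S$; $\mathcal I_h(\mu)(x)=\int_{B_h(x)}\mu$. Discrete data: $\ell(t,x,v)=\ell^c(t\Delta t,x,v)$ if $\|v\|\le M$ and $+\infty$ otherwise; $g(x)=g^c(x)$; $f(t,x,m)=h^{-d}\int_{B_h(x)}f^c(t\Delta t,y,\mathcal R_h(m))dy$; $m_0=\mathcal I_h(m_0^c)$; $F(t,m)=F^c(t\Delta t,\mathcal R_h(m))$; $H(t,x,p)=\sup_v-\langle p,v\rangle-\ell(t,x,v)$. With $(e_i)$ the canonical basis: $\Delta_h\mu(x)=\sum_i\frac{\mu(x+he_i)+\mu(x-he_i)-2\mu(x)}{h^2}$, $\nabla_h\mu(x)=\big(\frac{\mu(x+he_i)-\mu(x-he_i)}{2h}\big)_i$, $\mathrm{div}_h\mu(x)=\sum_i\frac{\mu_i(x+he_i)-\mu_i(x-he_i)}{2h}$. **Theta-scheme.** $u=\mathbf{HJB}_\theta(m)\in\mathbb{R}(\tilde{\mathcal T}\times S)$ is defined by $u(T,\cdot)=g$ and, for $t\in\mathcal T$: $(Id-\theta\sigma\Delta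 t\Delta_h)u(t+1/2)=u(t+1)$ and $-\frac{u(t+1/2,x)-u(t,x)}{\Delta t}-(1-\theta)\sigma\Delta_hu(t+1/2,x)+H(t,x,\nabla_hu(t+1/2,x))=f(t,x,m(t))$. $v=\mathbf V_\theta(u)\in\mathbb{R}^d(\mathcal T\times S)$ is $v(t,x)=-H_p(t,x,\nabla_hu(t+1/2,x))$ with $u(t+1/2)$ obtained from $u(t+1)$ by solving $(Id-\theta\sigma\Delta t\Delta_h)u(t+1/2)=u(t+1)$. $m=\mathbf{FP}_\theta(v)$ is defined by $m(0)=m_0$ and $\frac{m(t+1)-m(t)}{\Delta t}-\theta\sigma\Delta_hm(t+1)-(1-\theta)\sigma\Delta_hm(t)+\mathrm{div}_h(v(t)m(t))=0$, $t\in\mathcal T$. Under (A), (B) and the bounds $\Delta t\le \frac{h^2}{2d(1-\theta)\sigma}$, $h\le\frac{2(1-\theta)\sigma}{M}$, the system $u=\mathbf{HJB}_\theta(m)$, $v=\mathbf V_\theta(u)$, $m=\mathbf{FP}_\theta(v)$ has a unique solution, denoted $(u_h,v_h,m_h)$. Traces of the continuous solution: $u_h^*(t,x)=u^*(t\Delta t,x)$, $m_h^*(t,\cdot)=\mathcal I_h(m^*(t\Delta t,\cdot))$. **Cost.** For $m\in\mathcal P(\tilde{\mathcal T},S)$, $w\in\mathbb{R}^d(\mathcal T\times S)$: $\tilde J(m,w)=\Delta t\sum_{t\in\mathcal T}\sum_{x\in S}\tilde\ell[m,w](t,x)+\Delta t\sum_{t\in\mathcal T}F(t,m(t))+\sum_{x\in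 S}g(x)m(T,x)$, where $\tilde\ell[m,w](t,x)=\ell(t,x,w(t,x)/m(t,x))m(t,x)$ if $m(t,x)\ne0$, $0$ if $m(t,x)=w(t,x)=0$, $+\infty$ otherwise. **Algorithm.** $\mathbf{BR}_\theta(m')=(\tilde m,\tilde m\tilde v)$ (pointwise product) with $\tilde v=\mathbf V_\theta(\mathbf{HJB}_\theta(m'))$ and $\tilde m=\mathbf{FP}_\theta(\tilde v)$. Given $m_h^0\in\mathcal P(\tilde{\mathcal T},S)$, set $(m_h^1,w_h^1)=\mathbf{BR}_\theta(m_h^0)$; for $k\ge1$ set $(\bar m_h^k,\bar w_h^k)=\mathbf{BR}_\theta(m_h^k)$ and $(m_h^{k+1},w_h^{k+1})=(1-\lambda_k)(m_h^k,w_h^k)+\lambda_k(\bar m_h^k,\bar w_h^k)$ with $\lambda_k\in[0,1]$. *)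

theory Defs
  imports "HOL-Analysis.Analysis"
begin

text \<open>Functions on the torus are functions on \<open>real ^ 'd\<close> that are 1-periodic in every coordinate;
  \<open>CARD('d)\<close> is the dimension.  Elements of \<open>L\<^sup>2\<close> of the torus are represented by Borel functions;
  the Lipschitz condition in the third variable of \<open>fc\<close> and the defining identity of the
  potential \<open>Fc\<close> make both insensitive to the choice of the representative.\<close>

definition periodic :: "(real ^ 'd::finite \<Rightarrow> 'b) \<Rightarrow> bool" where
  "periodic \<phi> \<longleftrightarrow> (\<forall>x j. \<phi> (x + axis j 1) = \<phi> x)"

definition torus_cell :: "(real ^ 'd::finite) set" where
  "torus_cell = {x. \<forall>j. 0 \<le> x $ j \<and> x $ j < 1}"

definition torus_integral :: "(real ^ 'd::finite \<Rightarrow> real) \<Rightarrow> real" where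
  "torus_integral \<phi> = (LINT x:torus_cell|lborel. \<phi> x)"

definition L2_norm_torus :: "(real ^ 'd::finite \<Rightarrow> real) \<Rightarrow> real" where
  "L2_norm_torus \<mu> = sqrt (torus_integral (\<lambda>x. (\<mu> x)\<^sup>2))"

definition densities :: "(real ^ 'd::finite \<Rightarrow> real) set" where
  "densities = {\<mu>. periodic \<mu> \<and> \<mu> \<in> borel_measurable lborel \<and>
     set_integrable lborel torus_cell (\<lambda>x. (\<mu> x)\<^sup>2) \<and>
     (AE x in lborel. 0 \<le> \<mu> x) \<and> torus_integral \<mu> = 1}"

text \<open>Data of the continuous problem, together with the constants of assumption (A), on which the
  truncation radius \<open>M\<close> below depends.\<close>

record ('d::finite) mfg_data =
  lc :: "real \<Rightarrow> real ^ 'd \<Rightarrow> real ^ 'd \<Rightarrow> real"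
  fc :: "real \<Rightarrow> real ^ 'd \<Rightarrow> (real ^ 'd \<Rightarrow> real) \<Rightarrow> real"
  gc :: "real ^ 'd \<Rightarrow> real"
  m0c :: "real ^ 'd \<Rightarrow> real"
  Fc :: "real \<Rightarrow> (real ^ 'd \<Rightarrow> real) \<Rightarrow> real"
  L_l :: real
  L_f :: real
  L_g :: real
  alpha :: real

definition torus_data :: "('d::finite) mfg_data \<Rightarrow> bool" where
  "torus_data D \<longleftrightarrow>
     (\<forall>t\<in>{0..1}. \<forall>v. periodic (\<lambda>x. lc D t x v)) \<and>
     (\<forall>t\<in>{0..1}. \<forall>m\<in>densities. periodic (\<lambda>x. fc D t x m)) \<and>
     periodic (gc D) \<and> m0c D \<in> densities"

definition grad :: "(real ^ 'd::finite \<Rightarrow> real) \<Rightarrow> real ^ 'd \<Rightarrow> real ^ 'd" where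
  "grad \<phi> x = (THE D. GDERIV \<phi> x :> D)"

definition assumption_A :: "('d::finite) mfg_data \<Rightarrow> bool" where
  "assumption_A D \<longleftrightarrow>
     L_l D > 0 \<and> L_f D > 0 \<and> L_g D > 0 \<and> alpha D > 0 \<and>
     (\<forall>t\<in>{0..1}. \<forall>x. (\<forall>v. lc D t x differentiable (at v)) \<and>
        continuous_on UNIV (grad (lc D t x))) \<and>
     (\<forall>x v. (L_l D)-lipschitz_on {0..1} (\<lambda>t. lc D t x v)) \<and>
     (\<forall>t\<in>{0..1}. \<forall>v. (L_l D)-lipschitz_on UNIV (\<lambda>x. lc D t x v)) \<and>
     (\<forall>x v. (L_l D)-lipschitz_on {0..1} (\<lambda>t. grad (lc D t x) v)) \<and>
     (L_g D)-lipschitz_on UNIV (gc D) \<and>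
     (\<forall>x. \<forall>m\<in>densities. (L_f D)-lipschitz_on {0..1} (\<lambda>t. fc D t x m)) \<and>
     (\<forall>t\<in>{0..1}. \<forall>m\<in>densities. (L_f D)-lipschitz_on UNIV (\<lambda>x. fc D t x m)) \<and>
     (\<forall>t\<in>{0..1}. \<forall>x. \<forall>m1\<in>densities. \<forall>m2\<in>densities.
        \<bar>fc D t x m1 - fc D t x m2\<bar> \<le> L_f D * L2_norm_torus (\<lambda>y. m1 y - m2 y)) \<and>
     (\<forall>t\<in>{0..1}. \<forall>x v1 v2. lc D t x v2 \<ge>
        lc D t x v1 + grad (lc D t x) v1 \<bullet> (v2 - v1) + alpha D / 2 * (norm (v2 - v1))\<^sup>2) \<and>
     (\<forall>t\<in>{0..1}. \<forall>m1\<in>densities. \<forall>m2\<in>densities.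
        torus_integral (\<lambda>x. (fc D t x m1 - fc D t x m2) * (m1 x - m2 x)) \<ge> 0)"

definition assumption_C :: "('d::finite) mfg_data \<Rightarrow> bool" where
  "assumption_C D \<longleftrightarrow> (\<forall>t\<in>{0..1}. \<forall>m1\<in>densities. \<forall>m2\<in>densities.
     Fc D t m2 - Fc D t m1 =
       (LINT s:{0..1}|lborel.
          torus_integral (\<lambda>x. fc D t x (\<lambda>y. m1 y + s * (m2 y - m1 y)) * (m2 x - m1 x))))"


section \<open>The continuous mean field game\<close>

definition Hc :: "('d::finite) mfg_data \<Rightarrow> real \<Rightarrow> real ^ 'd \<Rightarrow> real ^ 'd \<Rightarrow> real" where
  "Hc D t x p = (SUP v. - p \<bullet> v - lc D t x v)"

definition dt :: "(real \<Rightarrow> real ^ 'd::finite \<Rightarrow> real) \<Rightarrow> real \<Rightarrow> real ^ 'd \<Rightarrow> real" where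
  "dt u t x = vector_derivative (\<lambda>s. u s x) (at t within {0..1})"

definition pd :: "'d::finite \<Rightarrow> (real ^ 'd \<Rightarrow> real) \<Rightarrow> real ^ 'd \<Rightarrow> real" where
  "pd i \<phi> x = grad \<phi> x $ i"

definition laplacian :: "(real ^ 'd::finite \<Rightarrow> real) \<Rightarrow> real ^ 'd \<Rightarrow> real" where
  "laplacian \<phi> x = (\<Sum>i\<in>UNIV. pd i (pd i \<phi>) x)"

definition divergence :: "(real ^ 'd::finite \<Rightarrow> real ^ 'd) \<Rightarrow> real ^ 'd \<Rightarrow> real" where
  "divergence \<phi> x = (\<Sum>i\<in>UNIV. pd i (\<lambda>y. \<phi> y $ i) x)"

text \<open>Hoelder continuity on \<open>[0,1] \<times> \<real>\<^sup>d\<close> with exponent \<open>a\<close> in time and \<open>b\<close> in space.  For periodic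
  functions it does not matter that the Euclidean distance replaces the torus distance.\<close>

definition holder_Q :: "real \<Rightarrow> real \<Rightarrow> (real \<Rightarrow> real ^ 'd::finite \<Rightarrow> 'b::metric_space) \<Rightarrow> bool" where
  "holder_Q a b w \<longleftrightarrow> (\<exists>C. \<forall>t\<in>{0..1}. \<forall>s\<in>{0..1}. \<forall>x y.
     dist (w t x) (w s y) \<le> C * (\<bar>t - s\<bar> powr a + dist x y powr b))"

text \<open>The parabolic Hoelder space of order \<open>1 + r/2\<close> in time and \<open>2 + r\<close> in space.\<close>

definition C_parabolic :: "real \<Rightarrow> (real \<Rightarrow> real ^ 'd::finite \<Rightarrow> real) set" where
  "C_parabolic r = {u.
     (\<forall>t\<in>{0..1}. periodic (u t)) \<and>
     (\<forall>t\<in>{0..1}. \<forall>x. (\<lambda>s. u s x) differentiable (at t within {0..1})) \<and>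
     (\<forall>t\<in>{0..1}. \<forall>x. u t differentiable (at x) \<and> (\<forall>i. pd i (u t) differentiable (at x))) \<and>
     holder_Q (r / 2) r u \<and> holder_Q (r / 2) r (dt u) \<and>
     (\<forall>i. holder_Q (r / 2) r (\<lambda>t. pd i (u t))) \<and>
     (\<forall>i j. holder_Q (r / 2) r (\<lambda>t. pd j (pd i (u t))))}"

definition C_holder :: "real \<Rightarrow> (real \<Rightarrow> real ^ 'd::finite \<Rightarrow> real ^ 'd) set" where
  "C_holder r = {v. (\<forall>t\<in>{0..1}. periodic (v t)) \<and> holder_Q r r v}"

definition C1r_bounded :: "real \<Rightarrow> real \<Rightarrow> (real ^ 'd::finite \<Rightarrow> real ^ 'd) \<Rightarrow> bool" where
  "C1r_bounded r C \<phi> \<longleftrightarrow> (\<forall>x. norm (\<phi> x) \<le> C) \<and>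
     (\<forall>i. (\<forall>x. (\<lambda>y. \<phi> y $ i) differentiable (at x)) \<and>
       (\<forall>j. (\<forall>x. \<bar>pd j (\<lambda>y. \<phi> y $ i) x\<bar> \<le> C) \<and>
         (\<forall>x z. \<bar>pd j (\<lambda>y. \<phi> y $ i) x - pd j (\<lambda>y. \<phi> y $ i) z\<bar> \<le> C * dist x z powr r)))"

definition Linf_C1r :: "real \<Rightarrow> (real \<Rightarrow> real ^ 'd::finite \<Rightarrow> real ^ 'd) set" where
  "Linf_C1r r = {v. \<exists>C. AE t in lborel. t \<in> {0..1} \<longrightarrow> C1r_bounded r C (v t)}"

text \<open>Solutions with the regularity of assumption (B).  The initial condition is an identity in
  \<open>L\<^sup>2\<close>.\<close>

definition mfg_solution :: "('d::finite) mfg_data \<Rightarrow> real \<Rightarrow> real \<Rightarrow>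
    (real \<Rightarrow> real ^ 'd \<Rightarrow> real) \<Rightarrow> (real \<Rightarrow> real ^ 'd \<Rightarrow> real ^ 'd) \<Rightarrow>
    (real \<Rightarrow> real ^ 'd \<Rightarrow> real) \<Rightarrow> bool" where
  "mfg_solution D \<sigma> r u v m \<longleftrightarrow>
     u \<in> C_parabolic r \<and> m \<in> C_parabolic r \<and> v \<in> C_holder r \<inter> Linf_C1r r \<and>
     (\<forall>t\<in>{0..1}. m t \<in> densities) \<and>
     (\<forall>t\<in>{0..1}. \<forall>x.
        - dt u t x - \<sigma> * laplacian (u t) x + Hc D t x (grad (u t) x) = fc D t x (m t) \<and>
        v t x = - grad (Hc D t x) (grad (u t) x) \<and>
        dt m t x - \<sigma> * laplacian (m t) x + divergence (\<lambda>y. m t y *\<^sub>R v t y) x = 0) \<and>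
     (AE x in lborel. m 0 x = m0c D x) \<and>
     (\<forall>x. u 1 x = gc D x)"

definition assumption_B :: "('d::finite) mfg_data \<Rightarrow> real \<Rightarrow> real \<Rightarrow>
    (real \<Rightarrow> real ^ 'd \<Rightarrow> real) \<Rightarrow> (real \<Rightarrow> real ^ 'd \<Rightarrow> real ^ 'd) \<Rightarrow>
    (real \<Rightarrow> real ^ 'd \<Rightarrow> real) \<Rightarrow> bool" where
  "assumption_B D \<sigma> r u v m \<longleftrightarrow> mfg_solution D \<sigma> r u v m \<and>
     (\<forall>u' v' m'. mfg_solution D \<sigma> r u' v' m' \<longrightarrow>
        (\<forall>t\<in>{0..1}. \<forall>x. u' t x = u t x \<and> v' t x = v t x \<and> m' t x = m t x))"


section \<open>Discretization\<close>

text \<open>The time step is \<open>1 / T\<close> and the space step is \<open>1 / N\<close>.  The grid point \<open>h i\<close> is referred to by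
  its index \<open>i\<close>, so that functions on the grid \<open>S\<close> of the torus are \<open>N\<close>-periodic functions on
  \<open>int ^ 'd\<close>, and \<open>index_box N\<close> contains exactly one index for each element of \<open>S\<close>.\<close>

definition radius_M :: "('d::finite) mfg_data \<Rightarrow> real" where
  "radius_M D = 1 / alpha D *
     (2 * (SUP (t, x)\<in>{0..1} \<times> UNIV. norm (grad (lc D t x) 0))
       + sqrt (real CARD('d)) * (L_l D + L_f D + L_g D))"

definition grid_funs :: "nat \<Rightarrow> (int ^ 'd::finite \<Rightarrow> 'b) set" where
  "grid_funs N = {\<phi>. \<forall>x j. \<phi> (x + axis j (int N)) = \<phi> x}"

definition index_box :: "nat \<Rightarrow> (int ^ 'd::finite) set" where
  "index_box N = {x. \<forall>j. 0 \<le> x $ j \<and> x $ j < int N}"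

definition gpoint :: "nat \<Rightarrow> int ^ 'd::finite \<Rightarrow> real ^ 'd" where
  "gpoint N x = (\<chi> j. real_of_int (x $ j) / real N)"

definition B_h :: "nat \<Rightarrow> int ^ 'd::finite \<Rightarrow> (real ^ 'd) set" where
  "B_h N x = {y. \<forall>j. gpoint N x $ j - 1 / (2 * real N) \<le> y $ j \<and>
                      y $ j < gpoint N x $ j + 1 / (2 * real N)}"

definition R_h :: "nat \<Rightarrow> (int ^ 'd::finite \<Rightarrow> real) \<Rightarrow> real ^ 'd \<Rightarrow> real" where
  "R_h N m y = m (THE x. y \<in> B_h N x) / (1 / real N) ^ CARD('d)"

definition I_h :: "nat \<Rightarrow> (real ^ 'd::finite \<Rightarrow> real) \<Rightarrow> int ^ 'd \<Rightarrow> real" where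
  "I_h N \<mu> x = (LINT y:B_h N x|lborel. \<mu> y)"

definition prob_grid :: "nat \<Rightarrow> (int ^ 'd::finite \<Rightarrow> real) set" where
  "prob_grid N = {m \<in> grid_funs N. (\<forall>x. 0 \<le> m x) \<and> (\<Sum>x\<in>index_box N. m x) = 1}"

definition prob_curves :: "nat \<Rightarrow> nat \<Rightarrow> (nat \<Rightarrow> int ^ 'd::finite \<Rightarrow> real) set" where
  "prob_curves T N = {m. \<forall>t\<le>T. m t \<in> prob_grid N}"

definition norm_inf_inf :: "nat \<Rightarrow> nat \<Rightarrow> (nat \<Rightarrow> int ^ 'd::finite \<Rightarrow> real) \<Rightarrow> real" where
  "norm_inf_inf T N \<mu> = Max ((\<lambda>t. Max ((\<lambda>x. \<bar>\<mu> t x\<bar>) ` index_box N)) ` {..T})"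

definition norm_inf_1 :: "nat \<Rightarrow> nat \<Rightarrow> (nat \<Rightarrow> int ^ 'd::finite \<Rightarrow> real) \<Rightarrow> real" where
  "norm_inf_1 T N \<mu> = Max ((\<lambda>t. \<Sum>x\<in>index_box N. \<bar>\<mu> t x\<bar>) ` {..T})"

definition l_h :: "('d::finite) mfg_data \<Rightarrow> nat \<Rightarrow> nat \<Rightarrow>
    nat \<Rightarrow> int ^ 'd \<Rightarrow> real ^ 'd \<Rightarrow> ereal" where
  "l_h D T N t x v =
     (if norm v \<le> radius_M D then ereal (lc D (real t / real T) (gpoint N x) v) else \<infinity>)"

definition H_h :: "('d::finite) mfg_data \<Rightarrow> nat \<Rightarrow> nat \<Rightarrow>
    nat \<Rightarrow> int ^ 'd \<Rightarrow> real ^ 'd \<Rightarrow> real" where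
  "H_h D T N t x p = real_of_ereal (SUP v. ereal (- p \<bullet> v) - l_h D T N t x v)"

definition f_h :: "('d::finite) mfg_data \<Rightarrow> nat \<Rightarrow> nat \<Rightarrow>
    nat \<Rightarrow> int ^ 'd \<Rightarrow> (int ^ 'd \<Rightarrow> real) \<Rightarrow> real" where
  "f_h D T N t x m =
     (LINT y:B_h N x|lborel. fc D (real t / real T) y (R_h N m)) / (1 / real N) ^ CARD('d)"

definition F_h :: "('d::finite) mfg_data \<Rightarrow> nat \<Rightarrow> nat \<Rightarrow> nat \<Rightarrow> (int ^ 'd \<Rightarrow> real) \<Rightarrow> real" where
  "F_h D T N t m = Fc D (real t / real T) (R_h N m)"

definition laplacian_h :: "nat \<Rightarrow> (int ^ 'd::finite \<Rightarrow> real) \<Rightarrow> int ^ 'd \<Rightarrow> real" where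
  "laplacian_h N \<mu> x =
     (\<Sum>i\<in>UNIV. (\<mu> (x + axis i 1) + \<mu> (x - axis i 1) - 2 * \<mu> x) / (1 / real N)\<^sup>2)"

definition nabla_h :: "nat \<Rightarrow> (int ^ 'd::finite \<Rightarrow> real) \<Rightarrow> int ^ 'd \<Rightarrow> real ^ 'd" where
  "nabla_h N \<mu> x = (\<chi> i. (\<mu> (x + axis i 1) - \<mu> (x - axis i 1)) / (2 * (1 / real N)))"

definition div_h :: "nat \<Rightarrow> (int ^ 'd::finite \<Rightarrow> real ^ 'd) \<Rightarrow> int ^ 'd \<Rightarrow> real" where
  "div_h N \<mu> x = (\<Sum>i\<in>UNIV. (\<mu> (x + axis i 1) $ i - \<mu> (x - axis i 1) $ i) / (2 * (1 / real N)))"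


section \<open>The theta-scheme\<close>

text \<open>The maps of the scheme are given as relations between input and output, by their defining
  equations.  Only times \<open>t \<le> T\<close> (resp. \<open>t < T\<close> for \<open>v\<close> and \<open>w\<close>) are constrained.\<close>

definition half_step :: "real \<Rightarrow> real \<Rightarrow> nat \<Rightarrow> nat \<Rightarrow>
    (int ^ 'd::finite \<Rightarrow> real) \<Rightarrow> (int ^ 'd \<Rightarrow> real) \<Rightarrow> bool" where
  "half_step \<sigma> \<theta> T N \<phi> \<psi> \<longleftrightarrow> \<psi> \<in> grid_funs N \<and>
     (\<forall>x. \<psi> x - \<theta> * \<sigma> * (1 / real T) * laplacian_h N \<psi> x = \<phi> x)"

definition HJB :: "('d::finite) mfg_data \<Rightarrow> real \<Rightarrow> real \<Rightarrow> nat \<Rightarrow> nat \<Rightarrow>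
    (nat \<Rightarrow> int ^ 'd \<Rightarrow> real) \<Rightarrow> (nat \<Rightarrow> int ^ 'd \<Rightarrow> real) \<Rightarrow> bool" where
  "HJB D \<sigma> \<theta> T N m u \<longleftrightarrow> (\<forall>t\<le>T. u t \<in> grid_funs N) \<and> (\<forall>x. u T x = gc D (gpoint N x)) \<and>
     (\<forall>t<T. \<exists>w. half_step \<sigma> \<theta> T N (u (t + 1)) w \<and>
        (\<forall>x. - (w x - u t x) / (1 / real T) - (1 - \<theta>) * \<sigma> * laplacian_h N w x
              + H_h D T N t x (nabla_h N w x) = f_h D T N t x (m t)))"

definition V :: "('d::finite) mfg_data \<Rightarrow> real \<Rightarrow> real \<Rightarrow> nat \<Rightarrow> nat \<Rightarrow>
    (nat \<Rightarrow> int ^ 'd \<Rightarrow> real) \<Rightarrow> (nat \<Rightarrow> int ^ 'd \<Rightarrow> real ^ 'd) \<Rightarrow> bool" where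
  "V D \<sigma> \<theta> T N u v \<longleftrightarrow>
     (\<forall>t<T. \<exists>w. half_step \<sigma> \<theta> T N (u (t + 1)) w \<and>
        (\<forall>x. v t x = - grad (H_h D T N t x) (nabla_h N w x)))"

definition FP :: "('d::finite) mfg_data \<Rightarrow> real \<Rightarrow> real \<Rightarrow> nat \<Rightarrow> nat \<Rightarrow>
    (nat \<Rightarrow> int ^ 'd \<Rightarrow> real ^ 'd) \<Rightarrow> (nat \<Rightarrow> int ^ 'd \<Rightarrow> real) \<Rightarrow> bool" where
  "FP D \<sigma> \<theta> T N v m \<longleftrightarrow> (\<forall>t\<le>T. m t \<in> grid_funs N) \<and> (\<forall>x. m 0 x = I_h N (m0c D) x) \<and>
     (\<forall>t<T. \<forall>x. (m (t + 1) x - m t x) / (1 / real T)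
          - \<theta> * \<sigma> * laplacian_h N (m (t + 1)) x - (1 - \<theta>) * \<sigma> * laplacian_h N (m t) x
          + div_h N (\<lambda>y. m t y *\<^sub>R v t y) x = 0)"

definition discrete_mfg :: "('d::finite) mfg_data \<Rightarrow> real \<Rightarrow> real \<Rightarrow> nat \<Rightarrow> nat \<Rightarrow>
    (nat \<Rightarrow> int ^ 'd \<Rightarrow> real) \<Rightarrow> (nat \<Rightarrow> int ^ 'd \<Rightarrow> real ^ 'd) \<Rightarrow>
    (nat \<Rightarrow> int ^ 'd \<Rightarrow> real) \<Rightarrow> bool" where
  "discrete_mfg D \<sigma> \<theta> T N u v m \<longleftrightarrow>
     HJB D \<sigma> \<theta> T N m u \<and> V D \<sigma> \<theta> T N u v \<and> FP D \<sigma> \<theta> T N v m"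


section \<open>Cost and generalized Frank-Wolfe algorithm\<close>

definition l_tilde :: "('d::finite) mfg_data \<Rightarrow> nat \<Rightarrow> nat \<Rightarrow>
    (nat \<Rightarrow> int ^ 'd \<Rightarrow> real) \<Rightarrow> (nat \<Rightarrow> int ^ 'd \<Rightarrow> real ^ 'd) \<Rightarrow> nat \<Rightarrow> int ^ 'd \<Rightarrow> ereal" where
  "l_tilde D T N m w t x =
     (if m t x \<noteq> 0 then l_h D T N t x ((1 / m t x) *\<^sub>R w t x) * ereal (m t x)
      else if w t x = 0 then 0 else \<infinity>)"

definition J_tilde :: "('d::finite) mfg_data \<Rightarrow> nat \<Rightarrow> nat \<Rightarrow>
    (nat \<Rightarrow> int ^ 'd \<Rightarrow> real) \<Rightarrow> (nat \<Rightarrow> int ^ 'd \<Rightarrow> real ^ 'd) \<Rightarrow> ereal" where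
  "J_tilde D T N m w =
     ereal (1 / real T) * (\<Sum>t<T. \<Sum>x\<in>index_box N. l_tilde D T N m w t x)
     + ereal (1 / real T * (\<Sum>t<T. F_h D T N t (m t)))
     + ereal (\<Sum>x\<in>index_box N. gc D (gpoint N x) * m T x)"

definition BR :: "('d::finite) mfg_data \<Rightarrow> real \<Rightarrow> real \<Rightarrow> nat \<Rightarrow> nat \<Rightarrow>
    (nat \<Rightarrow> int ^ 'd \<Rightarrow> real) \<Rightarrow>
    (nat \<Rightarrow> int ^ 'd \<Rightarrow> real) \<Rightarrow> (nat \<Rightarrow> int ^ 'd \<Rightarrow> real ^ 'd) \<Rightarrow> bool" where
  "BR D \<sigma> \<theta> T N m' m w \<longleftrightarrow> (\<exists>u v.
     HJB D \<sigma> \<theta> T N m' u \<and> V D \<sigma> \<theta> T N u v \<and> FP D \<sigma> \<theta> T N v m \<and>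
     (\<forall>t<T. \<forall>x. w t x = m t x *\<^sub>R v t x))"

text \<open>\<open>m k\<close> and \<open>w k\<close> are the iterates; \<open>m 0\<close> is the initialization and \<open>w 0\<close> is irrelevant.\<close>

definition frank_wolfe :: "('d::finite) mfg_data \<Rightarrow> real \<Rightarrow> real \<Rightarrow> nat \<Rightarrow> nat \<Rightarrow> (nat \<Rightarrow> real) \<Rightarrow>
    (nat \<Rightarrow> nat \<Rightarrow> int ^ 'd \<Rightarrow> real) \<Rightarrow> (nat \<Rightarrow> nat \<Rightarrow> int ^ 'd \<Rightarrow> real ^ 'd) \<Rightarrow> bool" where
  "frank_wolfe D \<sigma> \<theta> T N lam m w \<longleftrightarrow>
     m 0 \<in> prob_curves T N \<and> BR D \<sigma> \<theta> T N (m 0) (m 1) (w 1) \<and>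
     (\<forall>k\<ge>1. \<exists>mbar wbar. BR D \<sigma> \<theta> T N (m k) mbar wbar \<and>
        (\<forall>t\<le>T. \<forall>x. m (k + 1) t x = (1 - lam k) * m k t x + lam k * mbar t x) \<and>
        (\<forall>t<T. \<forall>x. w (k + 1) t x = (1 - lam k) *\<^sub>R w k t x + lam k *\<^sub>R wbar t x))"

end

theory Submission
  imports Defs
begin

text \<open>In the variables \<open>(m, w) = (m, m v)\<close> the discrete game is a convex control problem, and a best
  response minimizes the cost linearized at the current density. The coupling is Lipschitz in the
  \<open>L\<^sup>2\<close>-norm and admissible densities are bounded in \<open>L\<^sup>2\<close>, so the Frank-Wolfe recursion gives
  the gap \<open>O(1/k)\<close>. By strong convexity of the Lagrangian the gap controls the velocities in the
  mean weighted by the density; since an admissible density is at most a multiple of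
  \<open>h\<^sup>d\<^sup>/\<^sup>2\<close>, the discrete \<open>L\<^sup>2\<close> energy estimate, which needs \<open>\<theta> > 1/2\<close>, turns this into the
  distance of the densities, and the maximum principle into the distance of the value functions.

  The traces of the continuous solution satisfy the scheme up to \<open>O(h\<^sup>r)\<close>. The duality between the
  two equations, crossed between the discrete solution and the traces, then gives
  \<open>X\<^sup>2 \<le> C h\<^sup>r X + C h\<^sup>2\<^sup>r\<close> for the distance \<open>X\<close> of the densities, hence \<open>X = O(h\<^sup>r)\<close>.\<close>

section \<open>Calculus on the periodic grid\<close>

text \<open>The discrete Lagrangian is truncated at radius \<open>M\<close>, the continuous one is
  not. The two meet because a maximum principle bounds the gradient of the continuous value function
  by \<open>L_l + L_f + L_g\<close>, and \<open>M\<close> is large enough for the optimal velocities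
  at such gradients; the trace of the continuous feedback is therefore a legitimate competitor in
  the scheme.

  Both distances of densities end in the same energy estimate, whose source is a density times a
  velocity discrepancy; what differs is the sup bound for the weight. The trace of the continuous
  density is of order \<open>h^d\<close>, so nothing is lost. For the iterates only the L2 bound is
  available; it gives \<open>h^(d/2)\<close>, and this is the origin of the factor
  \<open>h^(d/2)\<close> beside \<open>k\<close>.

  The rate \<open>h^r\<close> rather than \<open>h^(r/2)\<close> requires that no first-order
  residual be summed against a density alone. All residuals but one meet a difference of the two
  solutions. The exception is the error of the discrete gradient, and strong convexity makes its
  effect quadratic.\<close>

lemma finite_index_box [simp]: "finite (index_box N :: (int ^ 'd::finite) set)"
  and card_index_box: "card (index_box N :: (int ^ 'd::finite) set) = N ^ CARD('d)"
proof -
  let ?P = "PiE (UNIV :: 'd set) (\<lambda>_. {0..<int N})"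
  have eq: "(index_box N :: (int ^ 'd) set) = vec_lambda ` ?P"
  proof (intro equalityI subsetI)
    fix x :: "int ^ 'd" assume "x \<in> index_box N"
    then have "vec_nth x \<in> ?P" by (auto simp: index_box_def PiE_def)
    then have "vec_lambda (vec_nth x) \<in> vec_lambda ` ?P" by blast
    then show "x \<in> vec_lambda ` ?P" by simp
  next
    fix x :: "int ^ 'd" assume "x \<in> vec_lambda ` ?P"
    then show "x \<in> index_box N" by (auto simp: index_box_def PiE_def Pi_def)
  qed
  have inj: "inj_on vec_lambda ?P"
    by (auto simp: inj_on_def vec_lambda_inject)
  show "finite (index_box N :: (int ^ 'd) set)"
    unfolding eq by (intro finite_imageI finite_PiE) auto
  show "card (index_box N :: (int ^ 'd) set) = N ^ CARD('d)"
    unfolding eq card_image[OF inj] by (simp add: card_PiE)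
qed

lemma grid_funsD: "\<phi> \<in> grid_funs N \<Longrightarrow> \<phi> (x + axis j (int N)) = \<phi> x"
  by (simp add: grid_funs_def)

lemma grid_funs_const [intro, simp]: "(\<lambda>x. c) \<in> grid_funs N"
  by (simp add: grid_funs_def)

lemma grid_funs_shift: "\<phi> \<in> grid_funs N \<Longrightarrow> (\<lambda>x. \<phi> (x + a)) \<in> grid_funs N"
  by (simp add: grid_funs_def) (metis (no_types, lifting) add.assoc add.commute)

lemma grid_funs_shift': "\<phi> \<in> grid_funs N \<Longrightarrow> (\<lambda>x. \<phi> (x - a)) \<in> grid_funs N"
  using grid_funs_shift[of \<phi> N "- a"] by simp

lemma grid_funs_add: "\<phi> \<in> grid_funs N \<Longrightarrow> \<psi> \<in> grid_funs N \<Longrightarrow> (\<lambda>x. \<phi> x + \<psi> x) \<in> grid_funs N"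
  and grid_funs_diff: "\<phi>' \<in> grid_funs N \<Longrightarrow> \<psi>' \<in> grid_funs N \<Longrightarrow> (\<lambda>x. \<phi>' x - \<psi>' x) \<in> grid_funs N"
  and grid_funs_mult: "f \<in> grid_funs N \<Longrightarrow> g \<in> grid_funs N \<Longrightarrow> (\<lambda>x. f x * g x) \<in> grid_funs N"
  and grid_funs_uminus: "\<phi>' \<in> grid_funs N \<Longrightarrow> (\<lambda>x. - \<phi>' x) \<in> grid_funs N"
  and grid_funs_scaleR: "a \<in> grid_funs N \<Longrightarrow> q \<in> grid_funs N \<Longrightarrow> (\<lambda>x. a x *\<^sub>R q x) \<in> grid_funs N"
  and grid_funs_nth: "v \<in> grid_funs N \<Longrightarrow> (\<lambda>x. v x $ i) \<in> grid_funs N"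
  by (simp_all add: grid_funs_def)

lemma grid_funs_comp: "\<phi> \<in> grid_funs N \<Longrightarrow> (\<lambda>x. F (\<phi> x)) \<in> grid_funs N"
  by (simp add: grid_funs_def)

lemma grid_funs_sum:
  "(\<And>i. i \<in> I \<Longrightarrow> \<phi> i \<in> grid_funs N) \<Longrightarrow> (\<lambda>x. \<Sum>i\<in>I. \<phi> i x) \<in> grid_funs N"
  by (simp add: grid_funs_def cong: sum.cong)

section \<open>Difference operators and summation by parts\<close>

lemma laplacian_h_eq:
  "laplacian_h N \<mu> x = (\<Sum>i\<in>UNIV. (real N)\<^sup>2 * (\<mu> (x + axis i 1) + \<mu> (x - axis i 1) - 2 * \<mu> x))"
  unfolding laplacian_h_def by (intro sum.cong refl) (simp add: power_one_over mult.commute)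

lemma nabla_h_eq: "nabla_h N \<mu> x = (\<chi> i. real N / 2 * (\<mu> (x + axis i 1) - \<mu> (x - axis i 1)))"
  unfolding nabla_h_def by (simp add: mult.commute)

lemma div_h_eq: "div_h N q x = (\<Sum>i\<in>UNIV. real N / 2 * (q (x + axis i 1) $ i - q (x - axis i 1) $ i))"
  unfolding div_h_def by (intro sum.cong refl) (simp add: mult.commute)

lemma grid_funs_laplacian: "\<phi> \<in> grid_funs N \<Longrightarrow> laplacian_h n \<phi> \<in> grid_funs N"
  unfolding laplacian_h_def[abs_def] divide_inverse
  by (intro grid_funs_sum grid_funs_mult grid_funs_add grid_funs_diff grid_funs_const
      grid_funs_shift[of \<phi>] grid_funs_shift'[of \<phi>])

lemma grid_funs_nabla: "\<phi> \<in> grid_funs N \<Longrightarrow> nabla_h n \<phi> \<in> grid_funs N"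
  unfolding grid_funs_def nabla_h_def
  by (simp add: vec_eq_iff) (metis (no_types, lifting) add.commute add.left_commute add_diff_eq)

text \<open>Multiples of the period are removed one coordinate at a time, by induction on the set of
  coordinates already reduced. A maximum over the finite box thereby becomes a maximum over all
  indices.\<close>

lemma grid_funs_mod:
  fixes \<phi> :: "int ^ 'd::finite \<Rightarrow> 'b"
  assumes "\<phi> \<in> grid_funs N"
  shows "\<phi> (\<chi> j. x $ j mod int N) = \<phi> x"
proof -
  have step: "\<phi> (y + axis j (int N * k)) = \<phi> y" for y j k
  proof (induction k arbitrary: y rule: int_induct[where k = 0])
    case base
    have "y + axis j (int N * 0) = y" by (simp add: axis_def vec_eq_iff)
    then show ?case by (rule arg_cong)
  next
    case (step1 i)
    have "y + axis j (int N * (i + 1)) = (y + axis j (int N * i)) + axis j (int N)"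
      by (simp add: axis_def vec_eq_iff algebra_simps)
    then show ?case by (simp only: grid_funsD[OF assms] step1)
  next
    case (step2 i)
    have "y + axis j (int N * i) = (y + axis j (int N * (i - 1))) + axis j (int N)"
      by (simp add: axis_def vec_eq_iff algebra_simps)
    then have "\<phi> (y + axis j (int N * i)) = \<phi> (y + axis j (int N * (i - 1)))"
      by (simp only: grid_funsD[OF assms])
    from this[symmetric] step2(2) show ?case by (rule trans)
  qed
  have "\<phi> (\<chi> j. if j \<in> S then x $ j mod int N else x $ j) = \<phi> x" if "finite S" for S
    using that
  proof induction
    case empty
    then show ?case by simp
  next
    case (insert i S)
    have "(\<chi> j. if j \<in> S then x $ j mod int N else x $ j) =
        (\<chi> j. if j \<in> insert i S then x $ j mod int N else x $ j) + axis i (int N * (x $ i div int N))"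
      using insert.hyps by (auto simp: vec_eq_iff axis_def)
    then have "\<phi> (\<chi> j. if j \<in> S then x $ j mod int N else x $ j) =
        \<phi> (\<chi> j. if j \<in> insert i S then x $ j mod int N else x $ j)"
      by (simp only: step)
    then show ?case by (simp only: insert.IH)
  qed
  from this[of UNIV] show ?thesis by simp
qed

lemma mod_in_index_box: "N > 0 \<Longrightarrow> (\<chi> j. x $ j mod int N) \<in> index_box N"
  by (simp add: index_box_def)

lemma index_box_nonempty: "N > 0 \<Longrightarrow> index_box N \<noteq> {}"
  using mod_in_index_box by blast

lemma grid_funs_max:
  fixes \<phi> :: "int ^ 'd::finite \<Rightarrow> real"
  assumes "\<phi> \<in> grid_funs N" "N > 0"
  obtains x0 where "\<And>x. \<phi> x \<le> \<phi> x0"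
proof -
  have "finite (\<phi> ` index_box N)" "\<phi> ` index_box N \<noteq> {}"
    using index_box_nonempty[OF assms(2)] by auto
  then obtain x0 where "x0 \<in> index_box N" and x0: "\<phi> x0 = Max (\<phi> ` index_box N)"
    using Max_in by (metis imageE)
  have "\<phi> x \<le> \<phi> x0" for x
    unfolding x0 grid_funs_mod[OF assms(1), of x, symmetric]
    by (rule Max_ge) (auto simp: mod_in_index_box assms)
  then show ?thesis by (rule that)
qed

text \<open>A unit shift is a bijection of the discrete torus. Inside the box this means wrapping
  the layer \<open>x $ i = N - 1\<close> around to \<open>x $ i = 0\<close>, which periodicity of
  \<open>\<phi>\<close> allows.\<close>

lemma sum_grid_shift:
  fixes \<phi> :: "int ^ 'd::finite \<Rightarrow> real"
  assumes "\<phi> \<in> grid_funs N" "N > 0"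
  shows "(\<Sum>x\<in>index_box N. \<phi> (x + axis i 1)) = (\<Sum>x\<in>index_box N. \<phi> x)"
proof (rule sum.reindex_bij_witness[where
      j = "\<lambda>x. if x $ i = int N - 1 then x - axis i (int N - 1) else x + axis i 1" and
      i = "\<lambda>x. if x $ i = 0 then x + axis i (int N - 1) else x - axis i 1"])
  fix x :: "int ^ 'd" assume x: "x \<in> index_box N"
  show "(if x $ i = int N - 1 then x - axis i (int N - 1) else x + axis i 1) \<in> index_box N"
    using x assms(2) by (auto simp: index_box_def axis_def) (smt (verit))+
  show "(if x $ i = 0 then x + axis i (int N - 1) else x - axis i 1) \<in> index_box N"
    using x assms(2) by (auto simp: index_box_def axis_def) (smt (verit))+
  let ?f = "\<lambda>x::int^'d. if x $ i = int N - 1 then x - axis i (int N - 1) else x + axis i 1"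
  let ?g = "\<lambda>x::int^'d. if x $ i = 0 then x + axis i (int N - 1) else x - axis i 1"
  show "?g (?f x) = x" "?f (?g x) = x"
    using x assms(2) by (auto simp: index_box_def axis_def vec_eq_iff) (smt (verit))+
  have "x + axis i 1 = (x - axis i (int N - 1)) + axis i (int N)"
    by (simp add: axis_def vec_eq_iff)
  then have "\<phi> (x + axis i 1) = \<phi> (x - axis i (int N - 1))"
    by (simp only: grid_funsD[OF assms(1)])
  then show "\<phi> (if x $ i = int N - 1 then x - axis i (int N - 1) else x + axis i 1) = \<phi> (x + axis i 1)"
    by simp
qed

lemma sum_grid_shift':
  fixes \<phi> :: "int ^ 'd::finite \<Rightarrow> real"
  assumes "\<phi> \<in> grid_funs N" "N > 0"
  shows "(\<Sum>x\<in>index_box N. \<phi> (x - axis i 1)) = (\<Sum>x\<in>index_box N. \<phi> x)"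
  using sum_grid_shift[OF grid_funs_shift'[OF assms(1), of "axis i 1"] assms(2), of i] by simp

text \<open>Central differences are skew-symmetric under the shift, so the adjointness is exact,
  with no lower-order remainder. The duality between the backward and the forward equation depends
  on this exactness.\<close>

lemma sum_grad_by_parts:
  fixes \<phi> :: "int ^ 'd::finite \<Rightarrow> real" and q :: "int ^ 'd \<Rightarrow> real ^ 'd"
  assumes "\<phi> \<in> grid_funs N" "q \<in> grid_funs N" "N > 0"
  shows "(\<Sum>x\<in>index_box N. \<phi> x * div_h N q x) = - (\<Sum>x\<in>index_box N. nabla_h N \<phi> x \<bullet> q x)"
proof -
  define c where "c = real N / 2"
  have per_i: "(\<lambda>x. \<phi> (x - axis i 1) * q x $ i) \<in> grid_funs N" "(\<lambda>x. \<phi> (x + axis i 1) * q x $ i) \<in> grid_funs N" for i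
    by (intro grid_funs_mult grid_funs_shift grid_funs_shift' grid_funs_nth assms)+
  have 1: "(\<Sum>x\<in>index_box N. \<phi> x * q (x + axis i 1) $ i) = (\<Sum>x\<in>index_box N. \<phi> (x - axis i 1) * q x $ i)" for i
    using sum_grid_shift[of "\<lambda>x. \<phi> (x - axis i 1) * q x $ i" N i] assms
      per_i[of i] by (simp add: mult.commute)
  have 2: "(\<Sum>x\<in>index_box N. \<phi> x * q (x - axis i 1) $ i) = (\<Sum>x\<in>index_box N. \<phi> (x + axis i 1) * q x $ i)" for i
    using sum_grid_shift'[of "\<lambda>x. \<phi> (x + axis i 1) * q x $ i" N i] assms
      per_i[of i] by (simp add: mult.commute)
  have "(\<Sum>x\<in>index_box N. \<phi> x * div_h N q x) =
      (\<Sum>i\<in>UNIV. c * ((\<Sum>x\<in>index_box N. \<phi> x * q (x + axis i 1) $ i) - (\<Sum>x\<in>index_box N. \<phi> x * q (x - axis i 1) $ i)))"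
    unfolding div_h_eq c_def[symmetric] sum_distrib_left sum_distrib_right
    by (subst sum.swap) (simp add: sum.distrib sum_subtractf sum_negf sum_distrib_left algebra_simps)
  also have "\<dots> = (\<Sum>i\<in>UNIV. c * ((\<Sum>x\<in>index_box N. \<phi> (x - axis i 1) * q x $ i) - (\<Sum>x\<in>index_box N. \<phi> (x + axis i 1) * q x $ i)))"
    by (simp only: 1 2)
  also have "\<dots> = - (\<Sum>x\<in>index_box N. nabla_h N \<phi> x \<bullet> q x)"
    unfolding nabla_h_eq inner_vec_def c_def[symmetric] sum_distrib_left sum_distrib_right
    by (subst sum.swap) (simp add: sum.distrib sum_subtractf sum_negf sum_distrib_left algebra_simps)
  finally show ?thesis .
qed

lemma sum_laplacian_sym:
  fixes \<phi> \<psi> :: "int ^ 'd::finite \<Rightarrow> real"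
  assumes "\<phi> \<in> grid_funs N" "\<psi> \<in> grid_funs N" "N > 0"
  shows "(\<Sum>x\<in>index_box N. \<phi> x * laplacian_h N \<psi> x) = (\<Sum>x\<in>index_box N. laplacian_h N \<phi> x * \<psi> x)"
proof -
  have per_i: "(\<lambda>x. \<phi> (x - axis i 1) * \<psi> x) \<in> grid_funs N" "(\<lambda>x. \<phi> (x + axis i 1) * \<psi> x) \<in> grid_funs N" for i
    by (intro grid_funs_mult grid_funs_shift grid_funs_shift' assms)+
  have 1: "(\<Sum>x\<in>index_box N. \<phi> x * \<psi> (x + axis i 1)) = (\<Sum>x\<in>index_box N. \<phi> (x - axis i 1) * \<psi> x)" for i
    using sum_grid_shift[of "\<lambda>x. \<phi> (x - axis i 1) * \<psi> x" N i] assms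
      per_i[of i] by (simp add: mult.commute)
  have 2: "(\<Sum>x\<in>index_box N. \<phi> x * \<psi> (x - axis i 1)) = (\<Sum>x\<in>index_box N. \<phi> (x + axis i 1) * \<psi> x)" for i
    using sum_grid_shift'[of "\<lambda>x. \<phi> (x + axis i 1) * \<psi> x" N i] assms
      per_i[of i] by (simp add: mult.commute)
  have "(\<Sum>x\<in>index_box N. \<phi> x * laplacian_h N \<psi> x) =
      (\<Sum>i\<in>UNIV. (real N)\<^sup>2 * ((\<Sum>x\<in>index_box N. \<phi> x * \<psi> (x + axis i 1)) + (\<Sum>x\<in>index_box N. \<phi> x * \<psi> (x - axis i 1)) - (\<Sum>x\<in>index_box N. 2 * \<phi> x * \<psi> x)))"
    unfolding laplacian_h_eq sum_distrib_left sum_distrib_right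
    by (subst sum.swap) (simp add: sum.distrib sum_subtractf sum_negf sum_distrib_left algebra_simps)
  also have "\<dots> = (\<Sum>i\<in>UNIV. (real N)\<^sup>2 * ((\<Sum>x\<in>index_box N. \<phi> (x - axis i 1) * \<psi> x) + (\<Sum>x\<in>index_box N. \<phi> (x + axis i 1) * \<psi> x) - (\<Sum>x\<in>index_box N. 2 * \<phi> x * \<psi> x)))"
    by (simp only: 1 2)
  also have "\<dots> = (\<Sum>x\<in>index_box N. laplacian_h N \<phi> x * \<psi> x)"
    unfolding laplacian_h_eq sum_distrib_left sum_distrib_right
    by (subst sum.swap) (simp add: sum.distrib sum_subtractf sum_negf sum_distrib_left algebra_simps)
  finally show ?thesis .
qed

text \<open>The Laplacian couples nearest neighbours, \<open>nabla_h\<close> points two steps apart.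
  A central difference is the mean of two one-sided differences, so its sum of squares cannot exceed
  the Dirichlet form; equality fails for oscillations of period two, which \<open>nabla_h\<close>
  does not see.\<close>

lemma sum_laplacian_self:
  fixes \<phi> :: "int ^ 'd::finite \<Rightarrow> real"
  assumes "\<phi> \<in> grid_funs N" "N > 0"
  shows "(\<Sum>x\<in>index_box N. \<phi> x * laplacian_h N \<phi> x) \<le> - (\<Sum>x\<in>index_box N. (norm (nabla_h N \<phi> x))\<^sup>2)"
proof -
  define A where "A i = (\<Sum>x\<in>index_box N. \<phi> x * \<phi> (x + axis i 1))" for i
  define B where "B i = (\<Sum>x\<in>index_box N. \<phi> (x - axis i 1) * \<phi> (x + axis i 1))" for i
  define S where "S = (\<Sum>x\<in>index_box N. (\<phi> x)\<^sup>2)"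
  define c where "c = real N / 2"
  have c2: "(real N)\<^sup>2 / 4 = c * c" by (simp add: c_def power2_eq_square)
  have per_i: "(\<lambda>x. \<phi> (x + axis i 1) * \<phi> x) \<in> grid_funs N" for i
    by (intro grid_funs_mult grid_funs_shift assms)
  have 1: "(\<Sum>x\<in>index_box N. \<phi> x * \<phi> (x - axis i 1)) = A i" for i
    unfolding A_def using sum_grid_shift'[OF per_i assms(2), of i i] by (simp add: mult.commute)
  have 2: "(\<Sum>x\<in>index_box N. (\<phi> (x + axis i 1))\<^sup>2) = S" "(\<Sum>x\<in>index_box N. (\<phi> (x - axis i 1))\<^sup>2) = S" for i
    unfolding S_def using sum_grid_shift[of "\<lambda>x. (\<phi> x)\<^sup>2" N i] sum_grid_shift'[of "\<lambda>x. (\<phi> x)\<^sup>2" N i] assms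
      grid_funs_comp[of \<phi> N "\<lambda>y. y\<^sup>2"] by simp_all
  have lap: "(\<Sum>x\<in>index_box N. \<phi> x * laplacian_h N \<phi> x) = (\<Sum>i\<in>UNIV. (real N)\<^sup>2 * (2 * A i - 2 * S))"
  proof -
    have "(\<Sum>x\<in>index_box N. \<phi> x * laplacian_h N \<phi> x) =
      (\<Sum>i\<in>UNIV. (real N)\<^sup>2 * ((\<Sum>x\<in>index_box N. \<phi> x * \<phi> (x + axis i 1)) + (\<Sum>x\<in>index_box N. \<phi> x * \<phi> (x - axis i 1)) - 2 * (\<Sum>x\<in>index_box N. (\<phi> x)\<^sup>2)))"
      unfolding laplacian_h_eq sum_distrib_left
      by (subst sum.swap) (simp add: sum.distrib sum_subtractf sum_distrib_left algebra_simps power2_eq_square)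
    then show ?thesis unfolding 1 A_def[symmetric] S_def[symmetric] by (simp add: algebra_simps)
  qed
  have nab: "(\<Sum>x\<in>index_box N. (norm (nabla_h N \<phi> x))\<^sup>2) = (\<Sum>i\<in>UNIV. (real N)\<^sup>2 / 4 * (2 * S - 2 * B i))"
  proof -
    have "(\<Sum>x\<in>index_box N. (norm (nabla_h N \<phi> x))\<^sup>2) = (\<Sum>i\<in>UNIV. (real N)\<^sup>2 / 4 *
       ((\<Sum>x\<in>index_box N. (\<phi> (x + axis i 1))\<^sup>2) + (\<Sum>x\<in>index_box N. (\<phi> (x - axis i 1))\<^sup>2) - 2 * B i))"
      unfolding nabla_h_eq power2_norm_eq_inner inner_vec_def B_def c2 c_def[symmetric]
      by (subst sum.swap) (simp add: sum.distrib sum_subtractf sum_distrib_left algebra_simps power2_eq_square)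
    then show ?thesis unfolding 2 by (simp add: algebra_simps)
  qed
  \<comment> \<open>\<open>S\<close>, \<open>A i\<close>, \<open>B i\<close> are the correlations at
    distance zero, one and two; the inequality is the nonnegativity of the sum of squared second
    differences.\<close>
  have key: "(2 * S - 2 * B i) \<le> 4 * (2 * S - 2 * A i)" for i
  proof -
    have "0 \<le> (\<Sum>x\<in>index_box N. (\<phi> (x + axis i 1) + \<phi> (x - axis i 1) - 2 * \<phi> x)\<^sup>2)"
      by (intro sum_nonneg) simp
    also have "\<dots> = (\<Sum>x\<in>index_box N. (\<phi> (x + axis i 1))\<^sup>2) + (\<Sum>x\<in>index_box N. (\<phi> (x - axis i 1))\<^sup>2) + 4 * S + 2 * B i
       - 4 * A i - 4 * (\<Sum>x\<in>index_box N. \<phi> x * \<phi> (x - axis i 1))"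
      by (simp add: S_def A_def B_def sum.distrib sum_subtractf sum_distrib_left power2_eq_square algebra_simps)
    also have "\<dots> = 6 * S + 2 * B i - 8 * A i" unfolding 1 2 by simp
    finally show ?thesis by simp
  qed
  have "(\<Sum>i\<in>UNIV. (real N)\<^sup>2 / 4 * (2 * S - 2 * B i)) \<le> (\<Sum>i\<in>UNIV. (real N)\<^sup>2 / 4 * (4 * (2 * S - 2 * A i)))"
    by (intro sum_mono mult_left_mono key) simp
  also have "\<dots> = - (\<Sum>x\<in>index_box N. \<phi> x * laplacian_h N \<phi> x)"
    unfolding lap sum_negf[symmetric] by (intro sum.cong refl) (simp add: algebra_simps)
  finally show ?thesis using nab by simp
qed

lemma sum_laplacian_zero:
  fixes \<phi> :: "int ^ 'd::finite \<Rightarrow> real"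
  assumes "\<phi> \<in> grid_funs N" "N > 0"
  shows "(\<Sum>x\<in>index_box N. laplacian_h N \<phi> x) = 0"
  using sum_laplacian_sym[of "\<lambda>_. 1" N \<phi>] assms by (simp add: laplacian_h_eq)

lemma sum_div_zero:
  fixes q :: "int ^ 'd::finite \<Rightarrow> real ^ 'd"
  assumes "q \<in> grid_funs N" "N > 0"
  shows "(\<Sum>x\<in>index_box N. div_h N q x) = 0"
  using sum_grad_by_parts[of "\<lambda>_. 1" N q] assms by (simp add: nabla_h_eq inner_vec_def)

lemma laplacian_h_linear:
  "laplacian_h N (\<lambda>x. \<phi> x + \<psi> x) x = laplacian_h N \<phi> x + laplacian_h N \<psi> x"
  "laplacian_h N (\<lambda>x. \<phi> x - \<psi> x) x = laplacian_h N \<phi> x - laplacian_h N \<psi> x"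
  "laplacian_h N (\<lambda>x. c * \<phi> x) x = c * laplacian_h N \<phi> x"
  "laplacian_h N (\<lambda>x. - \<phi> x) x = - laplacian_h N \<phi> x"
  unfolding laplacian_h_eq sum_distrib_left sum_negf[symmetric] sum.distrib[symmetric] sum_subtractf[symmetric]
  by (intro sum.cong refl, simp add: algebra_simps)+

lemma nabla_h_linear:
  "nabla_h N (\<lambda>x. \<phi> x + \<psi> x) x = nabla_h N \<phi> x + nabla_h N \<psi> x"
  "nabla_h N (\<lambda>x. \<phi> x - \<psi> x) x = nabla_h N \<phi> x - nabla_h N \<psi> x"
  "nabla_h N (\<lambda>x. c * \<phi> x) x = c *\<^sub>R nabla_h N \<phi> x"
  "nabla_h N (\<lambda>x. - \<phi> x) x = - nabla_h N \<phi> x"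
  unfolding nabla_h_eq by (simp_all add: vec_eq_iff algebra_simps)

lemma div_h_linear:
  fixes q q' :: "int ^ 'd::finite \<Rightarrow> real ^ 'd"
  shows "div_h N (\<lambda>x. q x + q' x) x = div_h N q x + div_h N q' x"
  "div_h N (\<lambda>x. q x - q' x) x = div_h N q x - div_h N q' x"
  "div_h N (\<lambda>x. c *\<^sub>R q x) x = c * div_h N q x"
  unfolding div_h_eq sum_distrib_left sum.distrib[symmetric] sum_subtractf[symmetric]
  by (intro sum.cong refl, simp add: algebra_simps)+

section \<open>Maximum principles for the implicit and the explicit half step\<close>

lemma half_step_le:
  fixes \<psi> :: "int ^ 'd::finite \<Rightarrow> real"
  assumes "\<psi> \<in> grid_funs N" "N > 0" "\<kappa> \<ge> 0" "\<And>x. \<psi> x - \<kappa> * laplacian_h N \<psi> x \<le> c"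
  shows "\<psi> x \<le> c"
proof -
  obtain x0 where x0: "\<And>x. \<psi> x \<le> \<psi> x0" using grid_funs_max[OF assms(1,2)] by blast
  \<comment> \<open>At a maximum every second difference is nonpositive, whatever the size of
    \<open>\<kappa>\<close>: the implicit half imposes no restriction on the steps.\<close>
  have "laplacian_h N \<psi> x0 \<le> 0"
    unfolding laplacian_h_eq
  proof (rule sum_nonpos)
    fix i :: 'd
    show "(real N)\<^sup>2 * (\<psi> (x0 + axis i 1) + \<psi> (x0 - axis i 1) - 2 * \<psi> x0) \<le> 0"
      using x0[of "x0 + axis i 1"] x0[of "x0 - axis i 1"] by (intro mult_nonneg_nonpos) auto
  qed
  then have "\<kappa> * laplacian_h N \<psi> x0 \<le> 0" using assms(3) by (simp add: mult_nonneg_nonpos)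
  with assms(4)[of x0] x0[of x] show ?thesis by linarith
qed

lemma half_step_ge:
  fixes \<psi> :: "int ^ 'd::finite \<Rightarrow> real"
  assumes "\<psi> \<in> grid_funs N" "N > 0" "\<kappa> \<ge> 0" "\<And>x. \<psi> x - \<kappa> * laplacian_h N \<psi> x \<ge> c"
  shows "\<psi> x \<ge> c"
proof -
  have "- \<psi> x - \<kappa> * laplacian_h N (\<lambda>x. - \<psi> x) x \<le> - c" for x
    using assms(4)[of x] unfolding laplacian_h_linear by simp
  from half_step_le[OF grid_funs_uminus[OF assms(1)] assms(2,3) this] show ?thesis by simp
qed

text \<open>The bounds on \<open>a\<close> and \<open>M\<close> are the two step size restrictions with \<open>a = (1 - \<theta>) \<sigma>\<close>; they
  make the explicit half of the scheme a convex combination of neighbouring values.\<close>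

lemma explicit_weights:
  fixes v :: "real ^ 'd::finite"
  assumes "N > 0" "\<delta> \<ge> 0" "norm v \<le> M" "M / real N \<le> 2 * a"
  shows "0 \<le> a * \<delta> * (real N)\<^sup>2 + \<delta> * (v $ i) * (real N / 2)"
    and "0 \<le> a * \<delta> * (real N)\<^sup>2 - \<delta> * (v $ i) * (real N / 2)"
proof -
  have "\<bar>v $ i\<bar> \<le> M" using component_le_norm_cart[of v i] assms(3) by linarith
  moreover have "M \<le> 2 * a * real N" using assms(1,4) by (simp add: field_simps)
  ultimately have *: "\<bar>v $ i\<bar> \<le> 2 * a * real N" by linarith
  have "\<delta> * (real N / 2) * \<bar>v $ i\<bar> \<le> \<delta> * (real N / 2) * (2 * a * real N)"
    using assms(1,2) * by (intro mult_left_mono) auto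
  then have "\<delta> * \<bar>v $ i\<bar> * (real N / 2) \<le> a * \<delta> * (real N)\<^sup>2"
    by (simp add: power2_eq_square mult_ac)
  moreover have "\<bar>\<delta> * (v $ i) * (real N / 2)\<bar> = \<delta> * \<bar>v $ i\<bar> * (real N / 2)"
    using assms(1,2) by (simp add: abs_mult)
  ultimately show "0 \<le> a * \<delta> * (real N)\<^sup>2 + \<delta> * (v $ i) * (real N / 2)"
    "0 \<le> a * \<delta> * (real N)\<^sup>2 - \<delta> * (v $ i) * (real N / 2)" by linarith+
qed

lemma explicit_step_le:
  fixes \<phi> :: "int ^ 'd::finite \<Rightarrow> real"
  assumes "N > 0" "\<delta> \<ge> 0" "norm v \<le> M" "M / real N \<le> 2 * a"
    and cfl: "2 * real CARD('d) * a * \<delta> * (real N)\<^sup>2 \<le> 1"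
    and c: "\<And>x. \<phi> x \<le> c"
  shows "\<phi> x + a * \<delta> * laplacian_h N \<phi> x + \<delta> * (v \<bullet> nabla_h N \<phi> x) \<le> c"
proof -
  define wp where "wp i = a * \<delta> * (real N)\<^sup>2 + \<delta> * (v $ i) * (real N / 2)" for i
  define wm where "wm i = a * \<delta> * (real N)\<^sup>2 - \<delta> * (v $ i) * (real N / 2)" for i
  have w: "0 \<le> wp i" "0 \<le> wm i" for i
    unfolding wp_def wm_def using explicit_weights[OF assms(1-4)] by auto
  have "a * \<delta> * laplacian_h N \<phi> x + \<delta> * (v \<bullet> nabla_h N \<phi> x) =
     (\<Sum>i\<in>UNIV. wp i * \<phi> (x + axis i 1) + wm i * \<phi> (x - axis i 1) - 2 * a * \<delta> * (real N)\<^sup>2 * \<phi> x)"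
    by (simp add: laplacian_h_eq nabla_h_eq inner_vec_def wp_def wm_def sum.distrib sum_subtractf sum_distrib_left algebra_simps)
  also have "\<dots> = (\<Sum>i\<in>UNIV. wp i * \<phi> (x + axis i 1) + wm i * \<phi> (x - axis i 1)) - 2 * real CARD('d) * a * \<delta> * (real N)\<^sup>2 * \<phi> x"
    by (simp add: sum_subtractf)
  also have "(\<Sum>i\<in>UNIV. wp i * \<phi> (x + axis i 1) + wm i * \<phi> (x - axis i 1)) \<le> (\<Sum>i\<in>UNIV. wp i * c + wm i * c)"
    using w c by (intro sum_mono add_mono mult_left_mono) auto
  also have "(\<Sum>i\<in>UNIV. wp i * c + wm i * c) = 2 * real CARD('d) * a * \<delta> * (real N)\<^sup>2 * c"
    by (simp add: wp_def wm_def algebra_simps)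
  finally have "\<phi> x + a * \<delta> * laplacian_h N \<phi> x + \<delta> * (v \<bullet> nabla_h N \<phi> x) \<le>
      (1 - 2 * real CARD('d) * a * \<delta> * (real N)\<^sup>2) * \<phi> x + 2 * real CARD('d) * a * \<delta> * (real N)\<^sup>2 * c"
    by (simp add: algebra_simps)
  also have "\<dots> \<le> (1 - 2 * real CARD('d) * a * \<delta> * (real N)\<^sup>2) * c + 2 * real CARD('d) * a * \<delta> * (real N)\<^sup>2 * c"
    using cfl c by (intro add_mono mult_left_mono order_refl) auto
  finally show ?thesis by (simp add: algebra_simps)
qed

text \<open>This is the transpose of the averaging in \<open>explicit_step_le\<close>. The weights
  now carry the velocity at the neighbour from which the mass arrives; they are still nonnegative
  but need not sum to one, so positivity survives and an upper bound does not.\<close>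

lemma explicit_transport_nonneg:
  fixes m :: "int ^ 'd::finite \<Rightarrow> real" and v :: "int ^ 'd \<Rightarrow> real ^ 'd"
  assumes "N > 0" "\<delta> \<ge> 0" "\<And>x. norm (v x) \<le> M" "M / real N \<le> 2 * a"
    and cfl: "2 * real CARD('d) * a * \<delta> * (real N)\<^sup>2 \<le> 1"
    and m: "\<And>x. 0 \<le> m x"
  shows "0 \<le> m x + a * \<delta> * laplacian_h N m x - \<delta> * div_h N (\<lambda>y. m y *\<^sub>R v y) x"
proof -
  have A: "a * \<delta> * laplacian_h N m x - \<delta> * div_h N (\<lambda>y. m y *\<^sub>R v y) x =
     (\<Sum>i\<in>UNIV. (a * \<delta> * (real N)\<^sup>2 - \<delta> * (v (x + axis i 1) $ i) * (real N / 2)) * m (x + axis i 1)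
       + (a * \<delta> * (real N)\<^sup>2 + \<delta> * (v (x - axis i 1) $ i) * (real N / 2)) * m (x - axis i 1)
       - 2 * a * \<delta> * (real N)\<^sup>2 * m x)"
    by (simp add: laplacian_h_eq div_h_eq sum.distrib sum_subtractf sum_distrib_left algebra_simps)
  have "a * \<delta> * laplacian_h N m x - \<delta> * div_h N (\<lambda>y. m y *\<^sub>R v y) x \<ge> (\<Sum>i\<in>(UNIV::'d set). - 2 * a * \<delta> * (real N)\<^sup>2 * m x)"
    unfolding A
  proof (rule sum_mono)
    fix i :: 'd
    have "0 \<le> (a * \<delta> * (real N)\<^sup>2 - \<delta> * (v (x + axis i 1) $ i) * (real N / 2)) * m (x + axis i 1)"
      "0 \<le> (a * \<delta> * (real N)\<^sup>2 + \<delta> * (v (x - axis i 1) $ i) * (real N / 2)) * m (x - axis i 1)"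
      using explicit_weights[OF assms(1,2) assms(3) assms(4)] m by auto
    then show "- 2 * a * \<delta> * (real N)\<^sup>2 * m x \<le> (a * \<delta> * (real N)\<^sup>2 - \<delta> * (v (x + axis i 1) $ i) * (real N / 2)) * m (x + axis i 1)
       + (a * \<delta> * (real N)\<^sup>2 + \<delta> * (v (x - axis i 1) $ i) * (real N / 2)) * m (x - axis i 1)
       - 2 * a * \<delta> * (real N)\<^sup>2 * m x" by simp
  qed
  moreover have "(\<Sum>i\<in>(UNIV::'d set). - 2 * a * \<delta> * (real N)\<^sup>2 * m x) = - (2 * real CARD('d) * a * \<delta> * (real N)\<^sup>2 * m x)"
    by simp
  moreover have "(2 * real CARD('d) * a * \<delta> * (real N)\<^sup>2) * m x \<le> 1 * m x"
    using cfl m by (intro mult_right_mono) auto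
  ultimately show ?thesis by linarith
qed

text \<open>The half-step value \<open>w\<close> mediates: in the pairing with \<open>w\<close>, the
  implicit operator moves onto \<open>m'\<close> and the explicit one onto \<open>m\<close>. The
  source \<open>G\<close> and the residuals \<open>\<rho>\<close>, \<open>\<eta>\<close> are kept
  general so that the identity covers both exact solutions and differences between a solution and a
  trace.\<close>

lemma one_step_duality:
  fixes u u' w m m' G \<rho> \<eta> :: "int ^ 'd::finite \<Rightarrow> real" and q :: "int ^ 'd \<Rightarrow> real ^ 'd"
  assumes "N > 0" and per: "w \<in> grid_funs N" "m \<in> grid_funs N" "m' \<in> grid_funs N" "q \<in> grid_funs N"
    and 1: "\<And>x. w x - b * laplacian_h N w x = u' x + \<delta> * \<rho> x"
    and 2: "\<And>x. u x = w x + a * laplacian_h N w x + \<delta> * G x"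
    and 3: "\<And>x. m' x - b * laplacian_h N m' x = m x + a * laplacian_h N m x - \<delta> * div_h N q x + \<delta> * \<eta> x"
  shows "(\<Sum>x\<in>index_box N. u' x * m' x) - (\<Sum>x\<in>index_box N. u x * m x) =
     \<delta> * ((\<Sum>x\<in>index_box N. nabla_h N w x \<bullet> q x) - (\<Sum>x\<in>index_box N. G x * m x)
       + (\<Sum>x\<in>index_box N. w x * \<eta> x) - (\<Sum>x\<in>index_box N. \<rho> x * m' x))"
proof -
  have u': "u' x = w x - b * laplacian_h N w x - \<delta> * \<rho> x" for x using 1[of x] by simp
  have "(\<Sum>x\<in>index_box N. u' x * m' x) + \<delta> * (\<Sum>x\<in>index_box N. \<rho> x * m' x) =
      (\<Sum>x\<in>index_box N. w x * m' x) - b * (\<Sum>x\<in>index_box N. laplacian_h N w x * m' x)"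
    by (simp add: u' sum.distrib sum_subtractf sum_distrib_left algebra_simps)
  also have "\<dots> = (\<Sum>x\<in>index_box N. w x * m' x) - b * (\<Sum>x\<in>index_box N. w x * laplacian_h N m' x)"
    using sum_laplacian_sym[OF per(1,3) assms(1)] by simp
  also have "\<dots> = (\<Sum>x\<in>index_box N. w x * (m' x - b * laplacian_h N m' x))"
    by (simp add:  sum.distrib sum_subtractf sum_distrib_left algebra_simps)
  also have "\<dots> = (\<Sum>x\<in>index_box N. w x * m x) + a * (\<Sum>x\<in>index_box N. w x * laplacian_h N m x)
      - \<delta> * (\<Sum>x\<in>index_box N. w x * div_h N q x) + \<delta> * (\<Sum>x\<in>index_box N. w x * \<eta> x)"
    by (simp add: 3 sum.distrib sum_subtractf sum_distrib_left algebra_simps)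
  also have "\<dots> = (\<Sum>x\<in>index_box N. w x * m x) + a * (\<Sum>x\<in>index_box N. laplacian_h N w x * m x)
      + \<delta> * (\<Sum>x\<in>index_box N. nabla_h N w x \<bullet> q x) + \<delta> * (\<Sum>x\<in>index_box N. w x * \<eta> x)"
    using sum_laplacian_sym[OF per(1,2) assms(1)] sum_grad_by_parts[OF per(1,4) assms(1)] by simp
  also have "(\<Sum>x\<in>index_box N. w x * m x) + a * (\<Sum>x\<in>index_box N. laplacian_h N w x * m x) =
      (\<Sum>x\<in>index_box N. u x * m x) - \<delta> * (\<Sum>x\<in>index_box N. G x * m x)"
    by (simp add: 2 sum.distrib sum_subtractf sum_distrib_left algebra_simps)
  finally show ?thesis by (simp add: algebra_simps)
qed

text \<open>The energy estimate tests the equation with \<open>\<theta> m' + (1 - \<theta>) m\<close>; the remainder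
  \<open>(\<theta> - 1/2) |m' - m|\<^sup>2\<close>, positive because \<open>\<theta> > 1/2\<close>, absorbs the implicit part of the source.\<close>

lemma one_step_energy:
  fixes m m' \<eta> :: "int ^ 'd::finite \<Rightarrow> real" and q :: "int ^ 'd \<Rightarrow> real ^ 'd"
  assumes "N > 0" and per: "m \<in> grid_funs N" "m' \<in> grid_funs N" "q \<in> grid_funs N"
    and "\<sigma> > 0" "1 / 2 < \<theta>" "\<theta> < 1" "0 \<le> \<delta>" "\<delta> \<le> 1"
    and eq: "\<And>x. m' x - \<theta> * \<sigma> * \<delta> * laplacian_h N m' x =
        m x + (1 - \<theta>) * \<sigma> * \<delta> * laplacian_h N m x - \<delta> * div_h N q x + \<delta> * \<eta> x"
  shows "(\<Sum>x\<in>index_box N. (m' x)\<^sup>2) \<le> (1 + \<delta>) * (\<Sum>x\<in>index_box N. (m x)\<^sup>2)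
     + \<delta> * (1 / (2 * \<sigma>) * (\<Sum>x\<in>index_box N. (norm (q x))\<^sup>2)
       + (1 + 1 / (2 * \<theta> - 1)) * (\<Sum>x\<in>index_box N. (\<eta> x)\<^sup>2))"
proof -
  define z where "z x = \<theta> * m' x + (1 - \<theta>) * m x" for x
  have z: "z \<in> grid_funs N"
    unfolding z_def[abs_def] using per by (intro grid_funs_add grid_funs_mult grid_funs_const)
  have lz: "laplacian_h N z x = \<theta> * laplacian_h N m' x + (1 - \<theta>) * laplacian_h N m x" for x
    unfolding z_def[abs_def] by (simp only: laplacian_h_linear)
  have eq': "m' x - m x = \<delta> * (\<sigma> * laplacian_h N z x - div_h N q x + \<eta> x)" for x
    using eq[of x] unfolding lz by (simp add: algebra_simps)
  have A: "(\<Sum>x\<in>index_box N. (m' x - m x) * z x) =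
     \<delta> * (\<sigma> * (\<Sum>x\<in>index_box N. z x * laplacian_h N z x) + (\<Sum>x\<in>index_box N. nabla_h N z x \<bullet> q x)
       + (\<Sum>x\<in>index_box N. \<eta> x * z x))"
  proof -
    have "(\<Sum>x\<in>index_box N. (m' x - m x) * z x) =
     \<delta> * (\<sigma> * (\<Sum>x\<in>index_box N. z x * laplacian_h N z x) - (\<Sum>x\<in>index_box N. z x * div_h N q x)
       + (\<Sum>x\<in>index_box N. \<eta> x * z x))"
      by (simp add: eq' sum.distrib sum_subtractf sum_distrib_left algebra_simps)
    then show ?thesis using sum_grad_by_parts[OF z per(3) assms(1)] by simp
  qed
  have Q: "(\<Sum>x\<in>index_box N. nabla_h N z x \<bullet> q x) \<le>
      \<sigma> * (\<Sum>x\<in>index_box N. (norm (nabla_h N z x))\<^sup>2) + 1 / (4 * \<sigma>) * (\<Sum>x\<in>index_box N. (norm (q x))\<^sup>2)"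
    unfolding sum_distrib_left sum.distrib[symmetric]
  proof (rule sum_mono)
    fix x
    define s where "s = norm (nabla_h N z x)"
    define y where "y = norm (q x)"
    have "0 \<le> (2 * \<sigma> * s - y)\<^sup>2" by simp
    then have "4 * \<sigma> * (s * y) \<le> 4 * \<sigma>\<^sup>2 * s\<^sup>2 + y\<^sup>2"
      by (simp add: power2_eq_square algebra_simps)
    then have "4 * \<sigma> * (s * y) \<le> 4 * \<sigma> * (\<sigma> * s\<^sup>2 + 1 / (4 * \<sigma>) * y\<^sup>2)"
      using \<open>\<sigma> > 0\<close> by (simp add: power2_eq_square algebra_simps)
    then have "s * y \<le> \<sigma> * s\<^sup>2 + 1 / (4 * \<sigma>) * y\<^sup>2"
      using \<open>\<sigma> > 0\<close> by (metis mult_le_cancel_left_pos zero_less_mult_iff zero_less_numeral)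
    moreover have "nabla_h N z x \<bullet> q x \<le> s * y" unfolding s_def y_def by (rule norm_cauchy_schwarz)
    ultimately show "nabla_h N z x \<bullet> q x \<le> \<sigma> * (norm (nabla_h N z x))\<^sup>2 + 1 / (4 * \<sigma>) * (norm (q x))\<^sup>2"
      unfolding s_def y_def by linarith
  qed
  have "\<sigma> * (\<Sum>x\<in>index_box N. z x * laplacian_h N z x) \<le> \<sigma> * - (\<Sum>x\<in>index_box N. (norm (nabla_h N z x))\<^sup>2)"
    using sum_laplacian_self[OF z assms(1)] \<open>\<sigma> > 0\<close> by (intro mult_left_mono) auto
  with Q have B: "\<sigma> * (\<Sum>x\<in>index_box N. z x * laplacian_h N z x) + (\<Sum>x\<in>index_box N. nabla_h N z x \<bullet> q x)
     \<le> 1 / (4 * \<sigma>) * (\<Sum>x\<in>index_box N. (norm (q x))\<^sup>2)" by simp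
  define c where "c = \<theta> - 1 / 2"
  have c: "c > 0" using assms by (simp add: c_def)
  \<comment> \<open>Since \<open>z = m + \<theta> (m' - m)\<close>, the product with
    \<open>m\<close> is charged to the growth factor \<open>1 + \<delta>\<close> and the product
    with \<open>m' - m\<close> to the positive remainder with coefficient \<open>c\<close>.\<close>
  have E: "\<delta> * (\<Sum>x\<in>index_box N. \<eta> x * z x) \<le> (\<Sum>x\<in>index_box N. \<delta> / 2 * (m x)\<^sup>2 + c * (m' x - m x)\<^sup>2 +
       \<delta> * (1 / 2 + 1 / (4 * c)) * (\<eta> x)\<^sup>2)"
    unfolding sum_distrib_left
  proof (rule sum_mono)
    fix x
    define e where "e = m' x - m x"
    have "z x = m x + \<theta> * e" by (simp add: z_def e_def algebra_simps)
    have "0 \<le> (\<eta> x - m x)\<^sup>2" by simp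
    then have "2 * (\<eta> x * m x) \<le> (\<eta> x)\<^sup>2 + (m x)\<^sup>2" by (simp add: power2_eq_square algebra_simps)
    then have 1: "\<delta> * (2 * (\<eta> x * m x)) \<le> \<delta> * ((\<eta> x)\<^sup>2 + (m x)\<^sup>2)"
      using assms by (intro mult_left_mono) auto
    have "0 \<le> (2 * c * e - \<delta> * \<theta> * \<eta> x)\<^sup>2" by simp
    then have "4 * c * (\<delta> * \<theta> * \<eta> x * e) \<le> 4 * c\<^sup>2 * e\<^sup>2 + \<delta>\<^sup>2 * \<theta>\<^sup>2 * (\<eta> x)\<^sup>2"
      by (simp add: power2_eq_square algebra_simps)
    also have "\<delta>\<^sup>2 * \<theta>\<^sup>2 * (\<eta> x)\<^sup>2 \<le> \<delta> * 1 * (\<eta> x)\<^sup>2"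
    proof -
      have "\<delta>\<^sup>2 \<le> \<delta>" using assms by (simp add: power2_eq_square mult_left_le_one_le)
      moreover have "\<theta>\<^sup>2 \<le> 1" using assms by (simp add: power_le_one)
      ultimately show ?thesis using assms by (intro mult_mono) auto
    qed
    finally have "4 * c * (\<delta> * \<theta> * \<eta> x * e) \<le> 4 * c * (c * e\<^sup>2 + \<delta> * (1 / (4 * c)) * (\<eta> x)\<^sup>2)"
      using c by (simp add: power2_eq_square algebra_simps)
    then have 2: "\<delta> * \<theta> * \<eta> x * e \<le> c * e\<^sup>2 + \<delta> * (1 / (4 * c)) * (\<eta> x)\<^sup>2"
      using c by (metis mult_le_cancel_left_pos zero_less_mult_iff zero_less_numeral)
    have "\<delta> * (\<eta> x * z x) = \<delta> * (\<eta> x * m x) + \<delta> * \<theta> * \<eta> x * e"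
      unfolding \<open>z x = m x + \<theta> * e\<close> by (simp add: algebra_simps)
    also have "\<dots> \<le> \<delta> / 2 * (m x)\<^sup>2 + c * e\<^sup>2 + \<delta> * (1 / 2 + 1 / (4 * c)) * (\<eta> x)\<^sup>2"
      using 1 2 by (simp add: algebra_simps)
    finally show "\<delta> * (\<eta> x * z x) \<le> \<delta> / 2 * (m x)\<^sup>2 + c * (m' x - m x)\<^sup>2 + \<delta> * (1 / 2 + 1 / (4 * c)) * (\<eta> x)\<^sup>2"
      by (simp add: e_def)
  qed
  have id: "(m' x - m x) * z x = ((m' x)\<^sup>2 - (m x)\<^sup>2) / 2 + c * (m' x - m x)\<^sup>2" for x
    by (simp add: z_def c_def power2_eq_square field_simps)
  have "(\<Sum>x\<in>index_box N. (m' x - m x) * z x) = \<delta> * (\<sigma> * (\<Sum>x\<in>index_box N. z x * laplacian_h N z x) + (\<Sum>x\<in>index_box N. nabla_h N z x \<bullet> q x))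
       + \<delta> * (\<Sum>x\<in>index_box N. \<eta> x * z x)"
    unfolding A by (simp add: algebra_simps)
  also have "\<dots> \<le> \<delta> * (1 / (4 * \<sigma>) * (\<Sum>x\<in>index_box N. (norm (q x))\<^sup>2)) +
     (\<Sum>x\<in>index_box N. \<delta> / 2 * (m x)\<^sup>2 + c * (m' x - m x)\<^sup>2 + \<delta> * (1 / 2 + 1 / (4 * c)) * (\<eta> x)\<^sup>2)"
    using E B assms by (intro add_mono mult_left_mono) auto
  finally have F: "(\<Sum>x\<in>index_box N. (m' x - m x) * z x) - (\<Sum>x\<in>index_box N. c * (m' x - m x)\<^sup>2) \<le>
     \<delta> * (1 / (4 * \<sigma>) * (\<Sum>x\<in>index_box N. (norm (q x))\<^sup>2)) + \<delta> / 2 * (\<Sum>x\<in>index_box N. (m x)\<^sup>2)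
      + \<delta> * (1 / 2 + 1 / (4 * c)) * (\<Sum>x\<in>index_box N. (\<eta> x)\<^sup>2)"
    by (simp add: sum.distrib sum_distrib_left)
  have G: "(\<Sum>x\<in>index_box N. (m' x - m x) * z x) - (\<Sum>x\<in>index_box N. c * (m' x - m x)\<^sup>2) =
     ((\<Sum>x\<in>index_box N. (m' x)\<^sup>2) - (\<Sum>x\<in>index_box N. (m x)\<^sup>2)) / 2"
    unfolding id by (simp add: sum.distrib sum_subtractf sum_divide_distrib[symmetric])
  have cc: "1 / (2 * \<theta> - 1) = 2 * (1 / (4 * c))" unfolding c_def using assms by (simp add: field_simps)
  show ?thesis using F unfolding G cc by (simp add: algebra_simps)
qed

lemma discrete_gronwall:
  fixes a b :: "nat \<Rightarrow> real"
  assumes step: "\<And>s. s < T \<Longrightarrow> a (s + 1) \<le> (1 + \<delta> * K) * a s + \<delta> * b s"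
    and b: "\<And>s. 0 \<le> b s" and a0: "0 \<le> a 0"
    and K: "0 \<le> K" and \<delta>: "0 \<le> \<delta>" "\<delta> * real T \<le> 1" and t: "t \<le> T"
  shows "a t \<le> exp K * (a 0 + \<delta> * (\<Sum>s<t. b s))"
proof -
  have "a t \<le> (1 + \<delta> * K) ^ t * (a 0 + \<delta> * (\<Sum>s<t. b s))"
    using t
  proof (induction t)
    case 0
    then show ?case by simp
  next
    case (Suc t)
    have 1: "1 \<le> (1 + \<delta> * K) ^ Suc t" using K \<delta> by (intro one_le_power) auto
    have "a (Suc t) \<le> (1 + \<delta> * K) * a t + \<delta> * b t" using step[of t] Suc.prems by simp
    also have "\<dots> \<le> (1 + \<delta> * K) * ((1 + \<delta> * K) ^ t * (a 0 + \<delta> * (\<Sum>s<t. b s))) + (1 + \<delta> * K) ^ Suc t * (\<delta> * b t)"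
    proof (rule add_mono)
      show "\<delta> * b t \<le> (1 + \<delta> * K) ^ Suc t * (\<delta> * b t)"
        using mult_right_mono[OF 1, of "\<delta> * b t"] b[of t] \<delta> by simp
    qed (use Suc K \<delta> in \<open>auto intro!: mult_left_mono\<close>)
    also have "\<dots> = (1 + \<delta> * K) ^ Suc t * (a 0 + \<delta> * (\<Sum>s<Suc t. b s))"
      by (simp add: algebra_simps)
    finally show ?case .
  qed
  also have "\<dots> \<le> exp K * (a 0 + \<delta> * (\<Sum>s<t. b s))"
  proof (rule mult_right_mono)
    have "(1 + \<delta> * K) ^ t \<le> exp (\<delta> * K) ^ t"
      using K \<delta> by (intro power_mono) auto
    also have "\<dots> = exp (real t * \<delta> * K)" by (simp add: exp_of_nat_mult[symmetric] mult_ac)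
    also have "\<dots> \<le> exp K"
    proof -
      have "real t * \<delta> \<le> \<delta> * real T" using t \<delta> by (simp add: mult.commute mult_left_mono)
      then have "real t * \<delta> * K \<le> 1 * K" using \<delta> K by (intro mult_right_mono) auto
      then show ?thesis by simp
    qed
    finally show "(1 + \<delta> * K) ^ t \<le> exp K" .
    show "0 \<le> a 0 + \<delta> * (\<Sum>s<t. b s)" using a0 b \<delta> by (simp add: sum_nonneg)
  qed
  finally show ?thesis .
qed

section \<open>Gradients and periodic functions\<close>

lemma grad_eqI: "GDERIV \<phi> x :> D \<Longrightarrow> grad \<phi> x = D"
  unfolding grad_def
proof (rule the_equality)
  fix E assume "GDERIV \<phi> x :> E" "GDERIV \<phi> x :> D"
  then have "(\<lambda>h. h \<bullet> E) = (\<lambda>h. h \<bullet> D)"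
    unfolding gderiv_def by (rule has_derivative_unique)
  from fun_cong[OF this, of "E - D"] have "(E - D) \<bullet> E = (E - D) \<bullet> D" .
  then have "(E - D) \<bullet> (E - D) = 0" by (simp add: inner_diff_right)
  then show "E = D" by simp
qed

lemma has_derivative_grad:
  fixes \<phi> :: "real ^ 'd::finite \<Rightarrow> real"
  assumes "\<phi> differentiable (at x)"
  shows "(\<phi> has_derivative (\<lambda>h. h \<bullet> grad \<phi> x)) (at x)"
proof -
  obtain f' where f': "(\<phi> has_derivative f') (at x)" using assms by (auto simp: differentiable_def)
  \<comment> \<open>The Riesz representative of the derivative.\<close>
  define a where "a = adjoint f' 1"
  have "f' = (\<lambda>h. h \<bullet> a)"
    using adjoint_works[OF has_derivative_linear[OF f'], of _ 1] by (simp add: fun_eq_iff a_def)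
  with f' have "GDERIV \<phi> x :> a" by (simp add: gderiv_def)
  with grad_eqI[OF this] show ?thesis by (simp add: gderiv_def)
qed

lemma line_derivative:
  fixes \<phi> :: "real ^ 'd::finite \<Rightarrow> real"
  assumes "\<phi> differentiable (at (x + s *\<^sub>R e))"
  shows "((\<lambda>s. \<phi> (x + s *\<^sub>R e)) has_real_derivative (e \<bullet> grad \<phi> (x + s *\<^sub>R e))) (at s)"
proof -
  have "((\<lambda>s. x + s *\<^sub>R e) has_derivative (\<lambda>h. h *\<^sub>R e)) (at s)"
    by (auto intro!: derivative_eq_intros)
  from has_derivative_compose[OF this has_derivative_grad[OF assms]]
  show ?thesis unfolding has_field_derivative_def by (simp add: mult_commute_abs)
qed

lemma periodic_int_shift:
  fixes \<phi> :: "real ^ 'd::finite \<Rightarrow> 'b"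
  assumes "periodic \<phi>"
  shows "\<phi> (x + (\<chi> j. real_of_int (k $ j))) = \<phi> x"
proof -
  have per: "\<phi> (y + axis j 1) = \<phi> y" for y j using assms by (simp add: periodic_def)
  have step: "\<phi> (y + axis j (real_of_int k)) = \<phi> y" for y j k
  proof (induction k arbitrary: y rule: int_induct[where k = 0])
    case base
    have "y + axis j (real_of_int 0) = y" by (simp add: axis_def vec_eq_iff)
    then show ?case by (rule arg_cong)
  next
    case (step1 i)
    have "y + axis j (real_of_int (i + 1)) = (y + axis j (real_of_int i)) + axis j 1"
      by (simp add: axis_def vec_eq_iff algebra_simps)
    then show ?case by (simp only: per step1)
  next
    case (step2 i)
    have "y + axis j (real_of_int i) = (y + axis j (real_of_int (i - 1))) + axis j 1"
      by (simp add: axis_def vec_eq_iff algebra_simps)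
    then have "\<phi> (y + axis j (real_of_int i)) = \<phi> (y + axis j (real_of_int (i - 1)))"
      by (simp only: per)
    from this[symmetric] step2(2) show ?case by (rule trans)
  qed
  have "\<phi> (x + (\<chi> j. if j \<in> S then real_of_int (k $ j) else 0)) = \<phi> x" if "finite S" for S
    using that
  proof induction
    case empty
    have "x + (\<chi> j. if j \<in> {} then real_of_int (k $ j) else 0) = x" by (simp add: vec_eq_iff)
    then show ?case by (rule arg_cong)
  next
    case (insert i S)
    have "x + (\<chi> j. if j \<in> insert i S then real_of_int (k $ j) else 0) =
        (x + (\<chi> j. if j \<in> S then real_of_int (k $ j) else 0)) + axis i (real_of_int (k $ i))"
      using insert.hyps by (auto simp: vec_eq_iff axis_def)
    then have "\<phi> (x + (\<chi> j. if j \<in> insert i S then real_of_int (k $ j) else 0)) =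
        \<phi> (x + (\<chi> j. if j \<in> S then real_of_int (k $ j) else 0))"
      by (simp only: step)
    then show ?case by (simp only: insert.IH)
  qed
  from this[of UNIV] show ?thesis by simp
qed

lemma periodic_frac:
  fixes \<phi> :: "real ^ 'd::finite \<Rightarrow> 'b"
  assumes "periodic \<phi>"
  shows "\<phi> (\<chi> j. frac (x $ j)) = \<phi> x"
proof -
  have "x = (\<chi> j. frac (x $ j)) + (\<chi> j. real_of_int ((\<chi> j. \<lfloor>x $ j\<rfloor>) $ j))"
    by (simp add: vec_eq_iff frac_def)
  with periodic_int_shift[OF assms] show ?thesis by metis
qed

lemma frac_in_torus_cell: "(\<chi> j. frac (x $ j)) \<in> torus_cell"
  by (simp add: torus_cell_def frac_lt_1)

lemma norm_le_card:
  fixes x :: "real ^ 'd::finite"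
  assumes "\<And>j. \<bar>x $ j\<bar> \<le> c"
  shows "norm x \<le> real CARD('d) * c"
proof -
  have "norm x \<le> (\<Sum>j\<in>UNIV. \<bar>x $ j\<bar>)" by (rule norm_le_l1_cart)
  also have "\<dots> \<le> (\<Sum>j\<in>(UNIV::'d set). c)" by (intro sum_mono assms)
  finally show ?thesis by simp
qed

lemma norm_torus_cell: "x \<in> torus_cell \<Longrightarrow> norm (x :: real ^ 'd::finite) \<le> real CARD('d)"
  using norm_le_card[of x 1] by (simp add: torus_cell_def less_imp_le)

text \<open>Every value is already taken on the unit cell, where all points are within distance
  \<open>d\<close> of the origin. The bound on the oscillation is thus independent of the size of
  the function itself.\<close>

lemma periodic_lipschitz_osc:
  fixes \<phi> :: "real ^ 'd::finite \<Rightarrow> real"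
  assumes "periodic \<phi>" "L-lipschitz_on UNIV \<phi>"
  shows "\<bar>\<phi> x - \<phi> 0\<bar> \<le> L * real CARD('d)"
proof -
  have "\<bar>\<phi> (\<chi> j. frac (x $ j)) - \<phi> 0\<bar> \<le> L * dist (\<chi> j. frac (x $ j)) 0"
    using lipschitz_onD[OF assms(2), of "\<chi> j. frac (x $ j)" 0] by (simp add: dist_real_def)
  also have "\<dots> \<le> L * real CARD('d)"
    using norm_torus_cell[OF frac_in_torus_cell, of x] lipschitz_on_nonneg[OF assms(2)] by (intro mult_left_mono) (auto simp: dist_norm)
  finally show ?thesis using periodic_frac[OF assms(1)] by simp
qed

section \<open>Strongly convex Lagrangians\<close>

text \<open>The quadratic term is the gap at a maximizer that strong convexity of \<open>l\<close> gives.\<close>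

definition legendre_max :: "('a::euclidean_space \<Rightarrow> real) \<Rightarrow> real \<Rightarrow> 'a set \<Rightarrow> 'a \<Rightarrow> 'a \<Rightarrow> bool" where
  "legendre_max l \<alpha> K p v \<longleftrightarrow> v \<in> K \<and>
     (\<forall>v'\<in>K. - (p \<bullet> v') - l v' + \<alpha> / 2 * (norm (v' - v))\<^sup>2 \<le> - (p \<bullet> v) - l v)"

lemma legendre_maxD:
  "legendre_max l \<alpha> K p v \<Longrightarrow> v' \<in> K \<Longrightarrow>
     - (p \<bullet> v') - l v' + \<alpha> / 2 * (norm (v' - v))\<^sup>2 \<le> - (p \<bullet> v) - l v"
  "legendre_max l \<alpha> K p v \<Longrightarrow> v \<in> K"
  by (auto simp: legendre_max_def)

lemma legendre_max_le:
  assumes "legendre_max l \<alpha> K p v" "v' \<in> K" "\<alpha> > 0"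
  shows "- (p \<bullet> v') - l v' \<le> - (p \<bullet> v) - l v"
proof -
  have "0 \<le> \<alpha> / 2 * (norm (v' - v))\<^sup>2" using assms(3) by simp
  then show ?thesis using legendre_maxD(1)[OF assms(1,2)] by linarith
qed

text \<open>Each maximizer is tested in the problem of the other; adding the two gaps cancels
  \<open>l\<close> and leaves
  \<open>\<alpha> |w - v|^2 \<le> - (q - p) \<bullet> (w - v)\<close>.\<close>

lemma legendre_max_lipschitz:
  assumes "\<alpha> > 0" "legendre_max l \<alpha> K p v" "legendre_max l \<alpha> K q w"
  shows "norm (w - v) \<le> norm (q - p) / \<alpha>"
proof -
  have "- (p \<bullet> w) - l w + \<alpha> / 2 * (norm (w - v))\<^sup>2 \<le> - (p \<bullet> v) - l v"
    "- (q \<bullet> v) - l v + \<alpha> / 2 * (norm (w - v))\<^sup>2 \<le> - (q \<bullet> w) - l w"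
    using legendre_maxD(1)[OF assms(2) legendre_maxD(2)[OF assms(3)]]
      legendre_maxD(1)[OF assms(3) legendre_maxD(2)[OF assms(2)]] by (simp_all add: norm_minus_commute)
  then have "\<alpha> * (norm (w - v))\<^sup>2 \<le> - ((q - p) \<bullet> (w - v))"
    by (simp add: inner_diff_left inner_diff_right)
  also have "\<dots> \<le> norm (q - p) * norm (w - v)"
    using Cauchy_Schwarz_ineq2[of "q - p" "w - v"] by linarith
  finally have *: "(\<alpha> * norm (w - v)) * norm (w - v) \<le> norm (q - p) * norm (w - v)"
    by (simp add: power2_eq_square mult_ac)
  have "\<alpha> * norm (w - v) \<le> norm (q - p)"
  proof (cases "norm (w - v) = 0")
    case True
    then show ?thesis by simp
  next
    case False
    then have "norm (w - v) > 0" by simp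
    with * show ?thesis by (rule mult_right_le_imp_le)
  qed
  then show ?thesis using assms(1) by (simp add: field_simps)
qed

text \<open>Envelope argument: testing the maximizer at \<open>p\<close> in the problem at
  \<open>q\<close>, and conversely, sandwiches the increment of \<open>H\<close> between two linear
  expressions, and their distance is quadratic because the maximizer depends on \<open>q\<close> in
  a Lipschitz way. It serves the truncated Hamiltonian with \<open>K\<close> a ball and the
  continuous one with \<open>K = UNIV\<close>.\<close>

lemma legendre_gderiv:
  fixes H :: "'a::euclidean_space \<Rightarrow> real"
  assumes \<alpha>: "\<alpha> > 0" and max: "\<And>q. legendre_max l \<alpha> K q (W q)"
    and H: "\<And>q. H q = - (q \<bullet> W q) - l (W q)"
  shows "GDERIV H p :> - W p"
  unfolding gderiv_def
proof (rule has_derivativeI_sandwich[where e = 1 and H = "\<lambda>q. norm (q - p) / \<alpha>"])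
  show "bounded_linear (\<lambda>h. h \<bullet> - W p)" by (rule bounded_linear_inner_left)
  have "((\<lambda>q. norm (q - p) / \<alpha>) \<longlongrightarrow> norm (p - p) / \<alpha>) (at p)"
    using \<alpha> by (intro tendsto_intros) auto
  then show "((\<lambda>q. norm (q - p) / \<alpha>) \<longlongrightarrow> 0) (at p)" by simp
  fix q assume "q \<noteq> p"
  have 1: "- (p \<bullet> W q) - l (W q) \<le> H p"
    unfolding H by (rule legendre_max_le[OF max _ \<alpha>]) (use max in \<open>auto simp: legendre_max_def\<close>)
  have 2: "- (q \<bullet> W p) - l (W p) \<le> H q"
    unfolding H by (rule legendre_max_le[OF max _ \<alpha>]) (use max in \<open>auto simp: legendre_max_def\<close>)
  have "H q - H p + (q - p) \<bullet> W p \<ge> 0" using 2 H[of p] by (simp add: inner_diff_left)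
  moreover have "H q - H p + (q - p) \<bullet> W p \<le> (q - p) \<bullet> (W p - W q)"
    using 1 H[of q] by (simp add: inner_diff_left inner_diff_right)
  moreover have "(q - p) \<bullet> (W p - W q) \<le> norm (q - p) * norm (W p - W q)" by (rule norm_cauchy_schwarz)
  moreover have "norm (q - p) * norm (W p - W q) \<le> norm (q - p) * (norm (q - p) / \<alpha>)"
    using legendre_max_lipschitz[OF \<alpha> max max, of p q] by (intro mult_left_mono) (auto simp: norm_minus_commute)
  ultimately have "norm (H q - H p - (q - p) \<bullet> - W p) \<le> norm (q - p) * (norm (q - p) / \<alpha>)" by simp
  then show "norm (H q - H p - (q - p) \<bullet> - W p) / norm (q - p) \<le> norm (q - p) / \<alpha>"
    using \<open>q \<noteq> p\<close> by (simp add: field_simps)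
qed simp

locale strongly_convex_function =
  fixes l :: "real ^ 'd::finite \<Rightarrow> real" and G :: "real ^ 'd \<Rightarrow> real ^ 'd" and \<alpha> :: real
  assumes alpha_pos: "\<alpha> > 0"
    and lower: "\<And>v1 v2. l v2 \<ge> l v1 + G v1 \<bullet> (v2 - v1) + \<alpha> / 2 * (norm (v2 - v1))\<^sup>2"
    and cont: "continuous_on UNIV l" "continuous_on UNIV G"
begin

text \<open>First-order optimality from subgradients: the inequality at the intermediate point
  \<open>v + s (v' - v)\<close> gives the sign with \<open>G\<close> evaluated there, and continuity
  of \<open>G\<close> allows \<open>s\<close> to tend to 0 from the right.\<close>

lemma variational_inequality:
  assumes "convex K" "v \<in> K" "v' \<in> K" and max: "\<And>z. z \<in> K \<Longrightarrow> - (p \<bullet> z) - l z \<le> - (p \<bullet> v) - l v"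
  shows "(p + G v) \<bullet> (v' - v) \<ge> 0"
proof (rule tendsto_lowerbound)
  have "continuous_on UNIV (\<lambda>s. (p + G (v + s *\<^sub>R (v' - v))) \<bullet> (v' - v))"
    by (intro continuous_intros continuous_on_compose2[OF cont(2)]) auto
  then have "isCont (\<lambda>s. (p + G (v + s *\<^sub>R (v' - v))) \<bullet> (v' - v)) 0"
    by (simp add: continuous_on_eq_continuous_at)
  then have "((\<lambda>s. (p + G (v + s *\<^sub>R (v' - v))) \<bullet> (v' - v)) \<longlongrightarrow> (p + G v) \<bullet> (v' - v)) (at 0)"
    by (simp add: isCont_def)
  then show "((\<lambda>s. (p + G (v + s *\<^sub>R (v' - v))) \<bullet> (v' - v)) \<longlongrightarrow> (p + G v) \<bullet> (v' - v)) (at_right 0)"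
    by (rule tendsto_within_subset) simp
  have pos: "(p + G (v + s *\<^sub>R (v' - v))) \<bullet> (v' - v) \<ge> 0" if s: "0 < s" "s < 1" for s
  proof -
    define z where "z = v + s *\<^sub>R (v' - v)"
    have "(1 - s) *\<^sub>R v + s *\<^sub>R v' \<in> K" using s by (intro convexD_alt[OF assms(1) assms(2,3)]) auto
    also have "(1 - s) *\<^sub>R v + s *\<^sub>R v' = z" by (simp add: z_def algebra_simps)
    finally have "z \<in> K" .
    from max[OF this] have "p \<bullet> v + l v \<le> p \<bullet> z + l z" by simp
    moreover have "l v \<ge> l z + G z \<bullet> (v - z)"
    proof -
      have "0 \<le> \<alpha> / 2 * (norm (v - z))\<^sup>2" using alpha_pos by simp
      then show ?thesis using lower[of z v] by linarith
    qed
    ultimately have "(p + G z) \<bullet> (v - z) \<le> 0" by (simp add: inner_diff_right inner_add_left)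
    moreover have "v - z = - (s *\<^sub>R (v' - v))" by (simp add: z_def)
    ultimately have "s * ((p + G z) \<bullet> (v' - v)) \<ge> 0" by (simp only: inner_minus_right inner_scaleR_right)
    then show ?thesis using s by (simp add: z_def zero_le_mult_iff)
  qed
  show "\<forall>\<^sub>F s in at_right 0. 0 \<le> (p + G (v + s *\<^sub>R (v' - v))) \<bullet> (v' - v)"
    by (rule eventually_at_rightI[of 0 1]) (use pos in auto)
qed simp

lemma legendre_maxI:
  assumes "v \<in> K" "\<And>v'. v' \<in> K \<Longrightarrow> (p + G v) \<bullet> (v' - v) \<ge> 0"
  shows "legendre_max l \<alpha> K p v"
  unfolding legendre_max_def
proof (intro conjI ballI)
  fix v' assume "v' \<in> K"
  from assms(2)[OF this] lower[of v v']
  show "- (p \<bullet> v') - l v' + \<alpha> / 2 * (norm (v' - v))\<^sup>2 \<le> - (p \<bullet> v) - l v"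
    by (simp add: inner_add_left inner_diff_right)
qed fact

lemma exists_max_cball:
  assumes "R \<ge> 0"
  obtains v where "v \<in> cball 0 R" "\<And>v'. v' \<in> cball 0 R \<Longrightarrow> (p + G v) \<bullet> (v' - v) \<ge> 0"
proof -
  have "continuous_on (cball 0 R) l" by (rule continuous_on_subset[OF cont(1)]) simp
  then have "continuous_on (cball 0 R) (\<lambda>v. - (p \<bullet> v) - l v)" by (intro continuous_intros)
  then have "\<exists>v\<in>cball 0 R. \<forall>z\<in>cball 0 R. - (p \<bullet> z) - l z \<le> - (p \<bullet> v) - l v"
    using assms by (intro continuous_attains_sup) auto
  then obtain v where v: "v \<in> cball 0 R" "\<And>z. z \<in> cball 0 R \<Longrightarrow> - (p \<bullet> z) - l z \<le> - (p \<bullet> v) - l v"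
    by blast
  show ?thesis
    by (rule that[OF v(1)]) (rule variational_inequality[OF convex_cball v(1) _ v(2)])
qed

lemma legendre_max_cball:
  assumes "R \<ge> 0"
  shows "\<exists>v. legendre_max l \<alpha> (cball 0 R) p v"
proof -
  obtain v where "v \<in> cball 0 R" "\<And>v'. v' \<in> cball 0 R \<Longrightarrow> (p + G v) \<bullet> (v' - v) \<ge> 0"
    using exists_max_cball[OF assms, of p] by blast
  then show ?thesis using legendre_maxI by blast
qed

text \<open>Adding the strong convexity inequalities between 0 and \<open>v\<close> in both
  directions gives strong monotonicity of \<open>G\<close>, and the hypothesis removes
  \<open>G v\<close>. The quotient obtained here is the origin of the formula for
  \<open>radius_M\<close>.\<close>

lemma stationary_norm_le:
  assumes "(p + G v) \<bullet> (0 - v) \<ge> 0"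
  shows "norm v \<le> (norm p + norm (G 0)) / \<alpha>"
proof -
  have "l v \<ge> l 0 + G 0 \<bullet> (v - 0) + \<alpha> / 2 * (norm (v - 0))\<^sup>2"
    "l 0 \<ge> l v + G v \<bullet> (0 - v) + \<alpha> / 2 * (norm (0 - v))\<^sup>2" by (rule lower)+
  then have "\<alpha> * (norm v)\<^sup>2 \<le> - ((p + G 0) \<bullet> v)"
    using assms by (simp add: inner_add_left)
  also have "\<dots> \<le> norm (p + G 0) * norm v"
    using Cauchy_Schwarz_ineq2[of "p + G 0" v] by linarith
  also have "\<dots> \<le> (norm p + norm (G 0)) * norm v" by (intro mult_right_mono norm_triangle_ineq) simp
  finally have *: "(\<alpha> * norm v) * norm v \<le> (norm p + norm (G 0)) * norm v"
    by (simp add: power2_eq_square mult_ac)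
  have "\<alpha> * norm v \<le> norm p + norm (G 0)"
  proof (cases "v = 0")
    case False
    then have "norm v > 0" by simp
    with * show ?thesis by (rule mult_right_le_imp_le)
  qed simp
  then show ?thesis using alpha_pos by (simp add: field_simps)
qed

lemma legendre_max_UNIV:
  obtains v where "legendre_max l \<alpha> UNIV p v" "norm v \<le> (norm p + norm (G 0)) / \<alpha>"
proof -
  \<comment> \<open>One more than the a priori bound, so that the maximizer over the ball lies in
    its interior at distance at least 1 from the sphere.\<close>
  define R where "R = (norm p + norm (G 0)) / \<alpha> + 1"
  have R: "R \<ge> 0" unfolding R_def using alpha_pos by simp
  obtain v where v: "v \<in> cball 0 R" "\<And>v'. v' \<in> cball 0 R \<Longrightarrow> (p + G v) \<bullet> (v' - v) \<ge> 0"
    using exists_max_cball[OF R, of p] by blast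
  have nv: "norm v \<le> (norm p + norm (G 0)) / \<alpha>"
    by (rule stationary_norm_le, rule v(2)) (use R in simp)
  have "(p + G v) \<bullet> (z - v) \<ge> 0" for z
  proof -
    \<comment> \<open>Shortens the displacement towards \<open>z\<close> to length at most 1, which
      keeps it in the ball; the inequality is homogeneous in the displacement and so extends to
      \<open>z\<close>.\<close>
    define s where "s = 1 / (1 + norm (z - v))"
    have s: "s > 0" unfolding s_def by (simp add: add_pos_nonneg)
    have "s * norm (z - v) \<le> 1" unfolding s_def by (simp add: field_simps add_pos_nonneg)
    then have "norm (v + s *\<^sub>R (z - v)) \<le> R"
      using norm_triangle_ineq[of v "s *\<^sub>R (z - v)"] s nv by (simp add: R_def)
    then have "(p + G v) \<bullet> (v + s *\<^sub>R (z - v) - v) \<ge> 0" by (intro v(2)) simp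
    then show ?thesis using s by (simp add: zero_le_mult_iff)
  qed
  then show ?thesis using that[OF legendre_maxI nv] by blast
qed

end

section \<open>The data\<close>

locale data_A =
  fixes D :: "('d::finite) mfg_data"
  assumes torus: "torus_data D" and A: "assumption_A D"
begin

abbreviation "M \<equiv> radius_M D"

lemma consts_pos: "L_l D > 0" "L_f D > 0" "L_g D > 0" "alpha D > 0"
  using A by (auto simp: assumption_A_def)

lemma lc_strongly_convex:
  assumes "t \<in> {0..1}"
  shows "strongly_convex_function (lc D t x) (grad (lc D t x)) (alpha D)"
proof
  show "alpha D > 0" by (rule consts_pos)
  show "lc D t x v2 \<ge> lc D t x v1 + grad (lc D t x) v1 \<bullet> (v2 - v1) + alpha D / 2 * (norm (v2 - v1))\<^sup>2" for v1 v2
    using A assms by (auto simp: assumption_A_def)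
  have "\<forall>v. lc D t x differentiable (at v)" using A assms by (auto simp: assumption_A_def)
  then have "\<forall>v. isCont (lc D t x) v" using differentiable_imp_continuous_within by blast
  then show "continuous_on UNIV (lc D t x)"
    by (simp add: continuous_on_eq_continuous_at)
  show "continuous_on UNIV (grad (lc D t x))" using A assms by (auto simp: assumption_A_def)
qed

lemma lc_periodic: "t \<in> {0..1} \<Longrightarrow> lc D t (x + axis j 1) = lc D t x"
  using torus by (auto simp: torus_data_def periodic_def fun_eq_iff)

lemma lc_lipschitz_x: "t \<in> {0..1} \<Longrightarrow> \<bar>lc D t x v - lc D t y v\<bar> \<le> L_l D * norm (x - y)"
  using A lipschitz_onD[of "L_l D" UNIV "\<lambda>x. lc D t x v" x y]
  by (auto simp: assumption_A_def dist_norm)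

lemma lc_lipschitz_t: "s \<in> {0..1} \<Longrightarrow> t \<in> {0..1} \<Longrightarrow> \<bar>lc D t x v - lc D s x v\<bar> \<le> L_l D * \<bar>t - s\<bar>"
  using A lipschitz_onD[of "L_l D" "{0..1}" "\<lambda>t. lc D t x v" t s]
  by (auto simp: assumption_A_def dist_norm)

text \<open>This makes the supremum in \<open>radius_M\<close> a genuine upper bound. The gradient
  is Lipschitz in time only, so its size over space is taken from convexity: the slope at 0 in a
  unit direction \<open>e\<close> is at most \<open>l e - l 0\<close>, and the values of the
  Lagrangian on the unit ball stay within a bounded distance of those at time 0 and position
  0.\<close>

lemma grad_lc_0_bounded: "bdd_above ((\<lambda>(t, x). norm (grad (lc D t x) 0)) ` ({0..1} \<times> UNIV))"
proof -
  interpret l0: strongly_convex_function "lc D 0 0" "grad (lc D 0 0)" "alpha D"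
    by (rule lc_strongly_convex) simp
  have "compact (lc D 0 0 ` cball 0 1)"
    by (intro compact_continuous_image continuous_on_subset[OF l0.cont(1)]) auto
  then obtain B where B: "\<And>e. norm e \<le> 1 \<Longrightarrow> \<bar>lc D 0 0 e\<bar> \<le> B"
    using compact_imp_bounded by (force simp: bounded_iff)
  have bound: "norm (grad (lc D t x) 0) \<le> 2 * B + 2 * (L_l D + L_l D * real CARD('d))" if t: "t \<in> {0..1}" for t x
  proof -
    have near: "\<bar>lc D t x e - lc D 0 0 e\<bar> \<le> L_l D + L_l D * real CARD('d)" for e
    proof -
      have "\<bar>lc D t x e - lc D t 0 e\<bar> \<le> L_l D * real CARD('d)"
        by (rule periodic_lipschitz_osc) (use torus A t in \<open>auto simp: torus_data_def assumption_A_def\<close>)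
      moreover have "\<bar>lc D t 0 e - lc D 0 0 e\<bar> \<le> L_l D * \<bar>t - 0\<bar>"
        by (rule lc_lipschitz_t) (use t in auto)
      moreover have "L_l D * \<bar>t - 0\<bar> \<le> L_l D * 1"
        using t consts_pos by (intro mult_left_mono) auto
      ultimately show ?thesis by linarith
    qed
    interpret l: strongly_convex_function "lc D t x" "grad (lc D t x)" "alpha D"
      by (rule lc_strongly_convex[OF t])
    define g where "g = grad (lc D t x) 0"
    define e where "e = sgn g"
    have "lc D t x e \<ge> lc D t x 0 + g \<bullet> e + alpha D / 2 * (norm (e - 0))\<^sup>2"
      using l.lower[of 0 e] by (simp add: g_def)
    moreover have "alpha D / 2 * (norm (e - 0))\<^sup>2 \<ge> 0" using consts_pos by simp
    moreover have "g \<bullet> e = norm g"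
      by (cases "g = 0") (simp_all add: e_def sgn_div_norm power2_norm_eq_inner[symmetric] power2_eq_square)
    ultimately have "norm g \<le> lc D t x e - lc D t x 0" by linarith
    moreover have "norm e \<le> 1" by (simp add: e_def norm_sgn)
    ultimately show ?thesis using near[of e] near[of 0] B[of e] B[of 0] unfolding g_def by simp
  qed
  then show ?thesis
    by (intro bdd_aboveI2[where M = "2 * B + 2 * (L_l D + L_l D * real CARD('d))"]) auto
qed

lemma grad_lc_0_le:
  assumes "t \<in> {0..1}"
  shows "norm (grad (lc D t x) 0) \<le> (SUP (t, x)\<in>{0..1} \<times> UNIV. norm (grad (lc D t x) 0))"
  using cSUP_upper[OF _ grad_lc_0_bounded, of "(t, x)"] assms by auto

text \<open>Meant for \<open>p\<close> the gradient of the continuous value function, which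
  satisfies the hypothesis by \<open>grad_us_bound\<close>: the unconstrained optimal velocity then
  lies in the ball to which the discrete Lagrangian is truncated.\<close>

lemma radius_bound:
  assumes "t \<in> {0..1}" "norm p \<le> L_l D + L_f D + L_g D"
  shows "(norm p + norm (grad (lc D t x) 0)) / alpha D \<le> M"
proof -
  let ?S = "(SUP (t, x)\<in>{0..1} \<times> UNIV. norm (grad (lc D t x) 0))"
  have S: "norm (grad (lc D t x) 0) \<le> ?S" by (rule grad_lc_0_le[OF assms(1)])
  then have S0: "0 \<le> ?S" using norm_ge_zero order_trans by blast
  have "sqrt (real CARD('d)) \<ge> 1" using zero_less_card_finite[where ?'a='d] by (simp add: Suc_leI)
  then have "sqrt (real CARD('d)) * (L_l D + L_f D + L_g D) \<ge> 1 * (L_l D + L_f D + L_g D)"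
    using consts_pos by (intro mult_right_mono) auto
  with S0 S assms(2) have "norm p + norm (grad (lc D t x) 0) \<le> 2 * ?S + sqrt (real CARD('d)) * (L_l D + L_f D + L_g D)"
    by (smt (verit))
  then have "1 / alpha D * (norm p + norm (grad (lc D t x) 0)) \<le> M"
    unfolding radius_M_def using consts_pos by (intro mult_left_mono) auto
  then show ?thesis by simp
qed

lemma radius_pos: "M > 0"
proof -
  have "norm (grad (lc D 0 0) 0) \<ge> 0" by simp
  then have S: "0 \<le> (SUP (t, x)\<in>{0..1} \<times> UNIV. norm (grad (lc D t x) 0))"
    using grad_lc_0_le[of 0 0] by (meson atLeastAtMost_iff order.refl order_trans zero_le_one)
  have "sqrt (real CARD('d)) * (L_l D + L_f D + L_g D) > 0" using consts_pos by simp
  with S show ?thesis unfolding radius_M_def using consts_pos by (intro mult_pos_pos add_nonneg_pos) auto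
qed

definition opt_vel :: "real \<Rightarrow> real ^ 'd \<Rightarrow> real ^ 'd \<Rightarrow> real ^ 'd" where
  "opt_vel t x p = (SOME v. legendre_max (lc D t x) (alpha D) (cball 0 M) p v)"

lemma opt_vel: "t \<in> {0..1} \<Longrightarrow> legendre_max (lc D t x) (alpha D) (cball 0 M) p (opt_vel t x p)"
  unfolding opt_vel_def
  by (rule someI_ex, rule strongly_convex_function.legendre_max_cball[OF lc_strongly_convex])
    (use radius_pos in auto)

lemma H_h_eq:
  fixes p :: "real ^ 'd"
  assumes "n \<le> T" "T > 0"
  shows "H_h D T N n x p = - (p \<bullet> opt_vel (real n / real T) (gpoint N x) p)
           - lc D (real n / real T) (gpoint N x) (opt_vel (real n / real T) (gpoint N x) p)"
proof -
  define t where "t = real n / real T"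
  define y where "y = gpoint N x"
  define v where "v = opt_vel t y p"
  have t: "t \<in> {0..1}" using assms by (auto simp: t_def)
  have v: "legendre_max (lc D t y) (alpha D) (cball 0 M) p v" unfolding v_def by (rule opt_vel[OF t])
  have "(SUP v. ereal (- p \<bullet> v) - l_h D T N n x v) = ereal (- (p \<bullet> v) - lc D t y v)"
  proof (rule SUP_eqI)
    fix v' show "ereal (- p \<bullet> v') - l_h D T N n x v' \<le> ereal (- (p \<bullet> v) - lc D t y v)"
      using legendre_max_le[OF v _ consts_pos(4), of v'] by (auto simp: l_h_def t_def y_def)
  next
    fix c assume c: "\<And>i. i \<in> UNIV \<Longrightarrow> ereal (- p \<bullet> i) - l_h D T N n x i \<le> c"
    have "norm v \<le> M" using v by (simp add: legendre_max_def)
    then show "ereal (- (p \<bullet> v) - lc D t y v) \<le> c"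
      using c[of v] by (simp add: l_h_def t_def y_def)
  qed
  then show ?thesis unfolding H_h_def v_def t_def y_def by simp
qed

lemma grad_H_h:
  assumes "n \<le> T" "T > 0"
  shows "grad (H_h D T N n x) p = - opt_vel (real n / real T) (gpoint N x) p"
proof (rule grad_eqI, rule legendre_gderiv)
  show "legendre_max (lc D (real n / real T) (gpoint N x)) (alpha D) (cball 0 M) q (opt_vel (real n / real T) (gpoint N x) q)" for q
    by (rule opt_vel) (use assms in auto)
qed (use H_h_eq[OF assms] consts_pos in auto)

lemma opt_vel_periodic: "t \<in> {0..1} \<Longrightarrow> opt_vel t (x + axis j 1) p = opt_vel t x p"
  unfolding opt_vel_def by (simp add: lc_periodic)

end

section \<open>Grid cells and averages\<close>

text \<open>Squeezed between the open and the closed box, whose measures agree.\<close>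

lemma half_open_box:
  fixes a b :: "real ^ 'd::finite"
  assumes "\<And>j. a $ j \<le> b $ j"
  shows "{y. \<forall>j. a $ j \<le> y $ j \<and> y $ j < b $ j} \<in> sets lborel" (is "?B \<in> _")
    and "emeasure lborel {y. \<forall>j. a $ j \<le> y $ j \<and> y $ j < b $ j} = ennreal (\<Prod>j\<in>UNIV. b $ j - a $ j)"
proof -
  have "?B = (\<Inter>j. {y. a $ j \<le> y $ j} \<inter> {y. y $ j < b $ j})" by auto
  also have "\<dots> \<in> sets borel"
    by (intro sets.countable_INT'' sets.Int borel_closed borel_open closed_Collect_le open_Collect_less
        continuous_intros) auto
  finally show B: "?B \<in> sets lborel" by simp
  have c: "emeasure lborel (cbox a b) = ennreal (\<Prod>j\<in>UNIV. b $ j - a $ j)"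
  proof -
    have "emeasure lborel (cbox a b) = ennreal (measure lborel (cbox a b))"
      using emeasure_lborel_cbox_finite[of a b] by (intro emeasure_eq_ennreal_measure) (metis infinity_ennreal_def less_irrefl)
    moreover have "cbox a b \<noteq> {}" using assms by (simp add: interval_ne_empty_cart)
    ultimately show ?thesis by (simp add: content_cbox_cart)
  qed
  have o: "emeasure lborel (box a b) = ennreal (\<Prod>j\<in>UNIV. b $ j - a $ j)"
  proof -
    have "emeasure lborel (box a b) = emeasure lborel (cbox a b)"
      by (simp add: emeasure_lborel_box_eq emeasure_lborel_cbox_eq)
    then show ?thesis by (simp only: c)
  qed
  have "emeasure lborel ?B \<le> emeasure lborel (cbox a b)"
    by (rule emeasure_mono) (auto simp: mem_box_cart less_imp_le)
  moreover have "emeasure lborel (box a b) \<le> emeasure lborel ?B"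
    using B by (intro emeasure_mono) (auto simp: mem_box_cart less_imp_le)
  ultimately show "emeasure lborel ?B = ennreal (\<Prod>j\<in>UNIV. b $ j - a $ j)"
    unfolding c o by (rule antisym)
qed

lemma torus_cell_measurable: "torus_cell \<in> sets lborel"
  and emeasure_torus_cell: "emeasure lborel (torus_cell :: (real ^ 'd::finite) set) = 1"
  using half_open_box[of "0 :: real ^ 'd" 1] half_open_box[of "0 :: real ^ 'a" 1] by (simp_all add: torus_cell_def)

lemma B_h_measurable: "B_h N x \<in> sets lborel"
  and emeasure_B_h: "emeasure lborel (B_h N x :: (real ^ 'd::finite) set) = ennreal ((1 / real N) ^ CARD('d))"
proof -
  have *: "B_h N x = {y. \<forall>j. (\<chi> j. gpoint N x $ j - 1 / (2 * real N)) $ j \<le> y $ j \<and>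
      y $ j < (\<chi> j. gpoint N x $ j + 1 / (2 * real N)) $ j}" for x :: "int ^ 'e::finite"
    by (simp add: B_h_def)
  show "B_h N x \<in> sets lborel" unfolding * by (rule half_open_box) simp
  have "emeasure lborel (B_h N x) = ennreal (\<Prod>j\<in>(UNIV :: 'd set). 1 / real N)"
    unfolding * by (subst half_open_box) (auto intro!: prod.cong arg_cong[where f = ennreal])
  then show "emeasure lborel (B_h N x :: (real ^ 'd) set) = ennreal ((1 / real N) ^ CARD('d))" by simp
qed

text \<open>Rounding to the nearest index, with ties upwards to match the half-open cells; it
  replaces the description operator in \<open>R_h\<close>.\<close>

definition cell_index :: "nat \<Rightarrow> real ^ 'd::finite \<Rightarrow> int ^ 'd" where
  "cell_index N y = (\<chi> j. \<lfloor>real N * y $ j + 1 / 2\<rfloor>)"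

lemma B_h_iff:
  assumes "N > 0"
  shows "y \<in> B_h N x \<longleftrightarrow> cell_index N y = x"
proof -
  have "(gpoint N x $ j - 1 / (2 * real N) \<le> y $ j \<and> y $ j < gpoint N x $ j + 1 / (2 * real N)) \<longleftrightarrow>
     \<lfloor>real N * y $ j + 1 / 2\<rfloor> = x $ j" for j
  proof -
    have "gpoint N x $ j - 1 / (2 * real N) \<le> y $ j \<longleftrightarrow> real_of_int (x $ j) \<le> real N * y $ j + 1 / 2"
      using assms by (simp add: gpoint_def field_simps)
    moreover have "y $ j < gpoint N x $ j + 1 / (2 * real N) \<longleftrightarrow> real N * y $ j + 1 / 2 < real_of_int (x $ j) + 1"
      using assms by (simp add: gpoint_def field_simps)
    ultimately show ?thesis by (simp only: floor_eq_iff)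
  qed
  then show ?thesis by (simp add: B_h_def cell_index_def vec_eq_iff)
qed

lemma R_h_eq:
  assumes "N > 0"
  shows "R_h N m (y :: real ^ 'd::finite) = real N ^ CARD('d) * m (cell_index N y)"
  unfolding R_h_def B_h_iff[OF assms] by (simp add: power_one_over field_simps)

lemma cell_index_shift:
  "N > 0 \<Longrightarrow> cell_index N (y + (\<chi> j. real_of_int (k $ j))) = cell_index N y + (\<chi> j. int N * k $ j)"
proof -
  have "real N * (y $ j + real_of_int (k $ j)) + 1 / 2 = (real N * y $ j + 1 / 2) + real_of_int (int N * k $ j)" for j
    by (simp add: algebra_simps)
  then have "\<lfloor>real N * (y $ j + real_of_int (k $ j)) + 1 / 2\<rfloor> = \<lfloor>real N * y $ j + 1 / 2\<rfloor> + int N * k $ j" for j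
    by (simp only: floor_add_int)
  then show ?thesis by (simp add: cell_index_def vec_eq_iff)
qed

lemma cell_index_measurable: "N > 0 \<Longrightarrow> cell_index N \<in> lborel \<rightarrow>\<^sub>M count_space UNIV"
proof -
  assume N: "N > 0"
  have "cell_index N -` {x} = B_h N x" for x :: "int ^ 'a" using N by (auto simp: B_h_iff)
  then have "cell_index N -` {x} \<inter> space lborel \<in> sets lborel" for x :: "int ^ 'a"
    using B_h_measurable[of N x] by simp
  moreover have "countable (UNIV :: (int ^ 'a) set)"
    by (rule countableI_type)
  ultimately show ?thesis by (subst measurable_count_space_eq2_countable) (simp_all add: Pi_def)
qed

lemma R_h_measurable: "N > 0 \<Longrightarrow> R_h N m \<in> borel_measurable lborel"
proof -
  assume N: "N > 0"
  have "(\<lambda>y. real N ^ CARD('a) * m (cell_index N y)) \<in> borel_measurable lborel"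
    by (rule measurable_compose[OF cell_index_measurable[OF N]]) simp
  also have "(\<lambda>y. real N ^ CARD('a) * m (cell_index N y)) = R_h N m" by (simp add: fun_eq_iff R_h_eq[OF N])
  finally show ?thesis .
qed

lemma R_h_periodic: "m \<in> grid_funs N \<Longrightarrow> N > 0 \<Longrightarrow> periodic (R_h N m)"
proof -
  assume m: "m \<in> grid_funs N" and N: "N > 0"
  have "cell_index N (x + axis j 1) = cell_index N x + axis j (int N)" for x :: "real ^ 'a" and j
  proof -
    have "axis j (1::real) = (\<chi> i. real_of_int (axis j 1 $ i))" by (simp add: axis_def vec_eq_iff)
    moreover have "axis j (int N) = (\<chi> i. int N * axis j 1 $ i)" by (simp add: axis_def vec_eq_iff)
    ultimately show ?thesis using cell_index_shift[OF N, of x "axis j 1"] by simp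
  qed
  then show ?thesis unfolding periodic_def R_h_eq[OF N] by (simp add: grid_funsD[OF m])
qed

lemma R_h_linear:
  "N > 0 \<Longrightarrow> R_h N (\<lambda>x. m x + m' x) y = R_h N m y + R_h N m' y"
  "N > 0 \<Longrightarrow> R_h N (\<lambda>x. m x - m' x) y = R_h N m y - R_h N m' y"
  "N > 0 \<Longrightarrow> R_h N (\<lambda>x. c * m x) y = c * R_h N m y"
  by (simp_all add: R_h_eq algebra_simps)

lemma lborel_translate:
  fixes f :: "'a::euclidean_space \<Rightarrow> real"
  assumes "f \<in> borel_measurable borel"
  shows "integral\<^sup>L lborel (\<lambda>x. f (x + c)) = integral\<^sup>L lborel f"
    and "integrable lborel (\<lambda>x. f (x + c)) \<longleftrightarrow> integrable lborel f"
proof -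
  have d: "distr lborel borel (\<lambda>x. x + c) = (lborel :: 'a measure)"
    using lborel_distr_plus[of c] unfolding add.commute[of c, abs_def] .
  show "integral\<^sup>L lborel (\<lambda>x. f (x + c)) = integral\<^sup>L lborel f"
    using integral_distr[of "\<lambda>x. x + c" lborel borel f] assms unfolding d by simp
  show "integrable lborel (\<lambda>x. f (x + c)) \<longleftrightarrow> integrable lborel f"
    using integrable_distr_eq[of "\<lambda>x. x + c" lborel borel f] assms unfolding d by simp
qed

text \<open>A point of the unit cell lies in exactly one cell \<open>B_h N x\<close>, \<open>x \<in> index_box N\<close>, after a shift by
  a vector with coordinates in \<open>{0, 1}\<close>, because the cells are centred at the grid points.\<close>

lemma torus_integral_tiles:
  fixes \<phi> :: "real ^ 'd::finite \<Rightarrow> real"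
  assumes per: "periodic \<phi>" and int: "set_integrable lborel torus_cell \<phi>"
    and meas: "\<phi> \<in> borel_measurable lborel" and N: "N > 0"
  shows "x \<in> index_box N \<Longrightarrow> set_integrable lborel (B_h N x) \<phi>"
    and "torus_integral \<phi> = (\<Sum>x\<in>index_box N. LINT y:B_h N x|lborel. \<phi> y)"
proof -
  define K where "K = (index_box 2 :: (int ^ 'd) set)"
  define s where "s k = (\<chi> j. real_of_int (k $ j))" for k :: "int ^ 'd"
  have K: "finite K" unfolding K_def by simp
  have Kiff: "k \<in> K \<longleftrightarrow> (\<forall>j. k $ j = 0 \<or> k $ j = 1)" for k
    unfolding K_def index_box_def by (auto simp: order_le_less) (smt (verit))+
  define g where "g x k y = indicator torus_cell y * indicator (B_h N x) (y - s k) * \<phi> y" for x k y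
  have [measurable]: "\<phi> \<in> borel_measurable borel" "torus_cell \<in> sets (borel :: (real ^ 'd) measure)" "\<And>x. B_h N x \<in> sets (borel :: (real ^ 'd) measure)"
    using meas torus_cell_measurable B_h_measurable by auto
  have g_int: "integrable lborel (g x k)" for x k
  proof -
    have "{y. y - s k \<in> B_h N x} \<in> sets (borel :: (real ^ 'd) measure)" by measurable
    then have "integrable lborel (\<lambda>y. indicator {y. y - s k \<in> B_h N x} y *\<^sub>R (indicator torus_cell y *\<^sub>R \<phi> y))"
      using int unfolding set_integrable_def by (rule_tac integrable_mult_indicator) simp_all
    moreover have "g x k = (\<lambda>y. indicator {y. y - s k \<in> B_h N x} y *\<^sub>R (indicator torus_cell y *\<^sub>R \<phi> y))"
      by (simp add: g_def fun_eq_iff indicator_def)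
    ultimately show ?thesis by (simp only:)
  qed
  have g_shift: "g x k (y + s k) = indicator torus_cell (y + s k) * indicator (B_h N x) y * \<phi> y" for x k y
    using periodic_int_shift[OF per, of y k] unfolding g_def s_def by simp
  have g_meas: "g x k \<in> borel_measurable borel" for x k unfolding g_def by measurable
  have cell: "indicator torus_cell y * \<phi> y = (\<Sum>x\<in>index_box N. \<Sum>k\<in>K. g x k y)" for y
  proof (cases "y \<in> torus_cell")
    case True
    define z where "z = cell_index N y"
    have z: "0 \<le> z $ j \<and> z $ j \<le> int N" for j
    proof -
      have "0 \<le> real N * y $ j" "real N * y $ j < real N"
        using True N by (auto simp: torus_cell_def)
      then show ?thesis unfolding z_def cell_index_def by (simp add: le_floor_iff floor_le_iff)
    qed
    define k0 where "k0 = (\<chi> j. if z $ j = int N then 1 else (0 :: int))"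
    define x0 where "x0 = z - (\<chi> j. int N * k0 $ j)"
    have k0: "k0 \<in> K" by (simp add: Kiff k0_def)
    have x0: "x0 \<in> index_box N" using z N
      by (auto simp: x0_def k0_def index_box_def order_le_less)
    have ind: "y - s k \<in> B_h N x \<longleftrightarrow> x = x0 \<and> k = k0" if "x \<in> index_box N" "k \<in> K" for x k
    proof -
      have "y - s k = y + (\<chi> j. real_of_int ((- k) $ j))" by (simp add: s_def vec_eq_iff)
      then have "y - s k \<in> B_h N x \<longleftrightarrow> z - (\<chi> j. int N * k $ j) = x"
        unfolding B_h_iff[OF N] z_def by (simp only: cell_index_shift[OF N]) (auto simp: vec_eq_iff)
      also have "\<dots> \<longleftrightarrow> x = x0 \<and> k = k0"
      proof
        assume *: "z - (\<chi> j. int N * k $ j) = x"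
        have "k $ j = k0 $ j" for j
        proof -
          have "z $ j - int N * k $ j = x $ j" using * by (metis vector_minus_component vec_lambda_beta)
          moreover have "0 \<le> x $ j" "x $ j < int N" using that(1) by (auto simp: index_box_def)
          moreover have "k $ j = 0 \<or> k $ j = 1" using that(2) by (simp add: Kiff)
          ultimately show ?thesis using z[of j] by (auto simp: k0_def)
        qed
        then have "k = k0" by (simp add: vec_eq_iff)
        then show "x = x0 \<and> k = k0" using * by (simp add: x0_def)
      qed (simp add: x0_def)
      finally show ?thesis .
    qed
    have "(\<Sum>x\<in>index_box N. \<Sum>k\<in>K. g x k y) = (\<Sum>x\<in>index_box N. \<Sum>k\<in>K. if x = x0 then if k = k0 then \<phi> y else 0 else 0)"
      using True ind by (intro sum.cong refl) (auto simp: g_def indicator_def)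
    also have "\<dots> = (\<Sum>x\<in>index_box N. if x = x0 then \<phi> y else 0)"
      using k0 K by (intro sum.cong refl) simp
    also have "\<dots> = \<phi> y" using x0 by simp
    finally show ?thesis using True by simp
  qed (simp add: g_def)
  \<comment> \<open>The opposite reading of the same decomposition: summing over \<open>k\<close>
    reassembles a whole cell, whose pieces with negative coordinates had been moved into the unit
    cell by a period.\<close>
  have tile: "indicator (B_h N x) y * \<phi> y = (\<Sum>k\<in>K. g x k (y + s k))" if x: "x \<in> index_box N" for x y
  proof (cases "y \<in> B_h N x")
    case True
    have y: "- 1 < y $ j \<and> y $ j < 1" for j
    proof -
      define c where "c = 1 / (2 * real N)"
      have c: "0 < c" "2 * c = 1 / real N" "c \<le> 1 / 2" using N by (auto simp: c_def field_simps)
      have "0 \<le> x $ j" "x $ j \<le> int N - 1" using x by (auto simp: index_box_def)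
      then have "0 \<le> real_of_int (x $ j)" "real_of_int (x $ j) \<le> real_of_int (int N - 1)" by linarith+
      then have "0 \<le> gpoint N x $ j" "gpoint N x $ j \<le> 1 - 2 * c"
        unfolding c(2) using N by (auto simp: gpoint_def field_simps)
      moreover have "gpoint N x $ j - c \<le> y $ j" "y $ j < gpoint N x $ j + c"
        using True by (auto simp: B_h_def c_def)
      ultimately show ?thesis using c by linarith
    qed
    define k0 where "k0 = (\<chi> j. if y $ j < 0 then 1 else (0 :: int))"
    have k0: "k0 \<in> K" by (simp add: Kiff k0_def)
    have ind: "y + s k \<in> torus_cell \<longleftrightarrow> k = k0" if "k \<in> K" for k
    proof -
      have "0 \<le> (y + s k) $ j \<and> (y + s k) $ j < 1 \<longleftrightarrow> k $ j = k0 $ j" for j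
        using y[of j] that[unfolded Kiff, rule_format, of j] by (auto simp: k0_def s_def)
      then show ?thesis by (simp add: torus_cell_def vec_eq_iff)
    qed
    have "(\<Sum>k\<in>K. g x k (y + s k)) = (\<Sum>k\<in>K. if k = k0 then \<phi> y else 0)"
      unfolding g_shift using ind True by (intro sum.cong refl) (auto simp: indicator_def)
    then show ?thesis using K k0 True by simp
  qed (simp add: g_shift)
  have shift_int: "integrable lborel (\<lambda>y. g x k (y + s k))" "integral\<^sup>L lborel (\<lambda>y. g x k (y + s k)) = integral\<^sup>L lborel (g x k)" for x k
    using lborel_translate[OF g_meas, of x k "s k"] g_int by auto
  show "set_integrable lborel (B_h N x) \<phi>" if "x \<in> index_box N"
    unfolding set_integrable_def using tile[OF that] shift_int by (simp add: K)
  have "torus_integral \<phi> = integral\<^sup>L lborel (\<lambda>y. \<Sum>x\<in>index_box N. \<Sum>k\<in>K. g x k y)"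
    unfolding torus_integral_def set_lebesgue_integral_def by (simp add: cell)
  also have "\<dots> = (\<Sum>x\<in>index_box N. \<Sum>k\<in>K. integral\<^sup>L lborel (g x k))"
    using g_int by (simp add: Bochner_Integration.integral_sum)
  also have "\<dots> = (\<Sum>x\<in>index_box N. integral\<^sup>L lborel (\<lambda>y. \<Sum>k\<in>K. g x k (y + s k)))"
    using shift_int by (simp add: Bochner_Integration.integral_sum)
  also have "\<dots> = (\<Sum>x\<in>index_box N. LINT y:B_h N x|lborel. \<phi> y)"
    unfolding set_lebesgue_integral_def by (intro sum.cong refl) (simp add: tile)
  finally show "torus_integral \<phi> = (\<Sum>x\<in>index_box N. LINT y:B_h N x|lborel. \<phi> y)" .
qed

lemma bounded_set_integrable:
  fixes \<phi> :: "real ^ 'd::finite \<Rightarrow> real"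
  assumes "A \<in> sets lborel" "emeasure lborel A < \<infinity>" "\<phi> \<in> borel_measurable lborel" "\<And>x. x \<in> A \<Longrightarrow> \<bar>\<phi> x\<bar> \<le> B"
  shows "set_integrable lborel A \<phi>"
  unfolding set_integrable_def
proof (rule Bochner_Integration.integrable_bound)
  show "integrable lborel (\<lambda>x. indicator A x * B)" using assms by (simp add: integrable_real_mult_indicator)
  have [measurable]: "A \<in> sets borel" "\<phi> \<in> borel_measurable borel" using assms by auto
  show "(\<lambda>x. indicator A x *\<^sub>R \<phi> x) \<in> borel_measurable lborel" by measurable
  show "AE x in lborel. norm (indicator A x *\<^sub>R \<phi> x) \<le> norm (indicator A x * B)"
    using assms(4) by (intro AE_I2) (force simp: indicator_def)
qed

lemma set_integral_const_bounds:
  fixes \<phi> :: "real ^ 'd::finite \<Rightarrow> real"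
  assumes A: "A \<in> sets lborel" "emeasure lborel A = ennreal a" "0 \<le> a" and int: "set_integrable lborel A \<phi>"
    and B: "\<And>x. x \<in> A \<Longrightarrow> \<bar>\<phi> x - c\<bar> \<le> B"
  shows "\<bar>(LINT x:A|lborel. \<phi> x) - c * a\<bar> \<le> B * a"
proof -
  have m: "measure lborel A = a" using A by (simp add: measure_def)
  have fin: "emeasure lborel A < \<infinity>" using A by simp
  have cint: "set_integrable lborel A (\<lambda>_. k)" for k :: real
    using A fin by (intro bounded_set_integrable[where B = "\<bar>k\<bar>"]) auto
  have ci: "(LINT x:A|lborel. k) = k * a" for k :: real
    using A fin m by (simp add: set_lebesgue_integral_def)
  have "(LINT x:A|lborel. c - B) \<le> (LINT x:A|lborel. \<phi> x)" "(LINT x:A|lborel. \<phi> x) \<le> (LINT x:A|lborel. c + B)"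
    using B by (intro set_integral_mono int cint, force simp: abs_le_iff)+
  then show ?thesis unfolding ci by (simp add: abs_le_iff algebra_simps)
qed

lemma torus_cell_integrable:
  fixes \<phi> :: "real ^ 'd::finite \<Rightarrow> real"
  assumes "\<phi> \<in> borel_measurable lborel" "\<And>x. \<bar>\<phi> x\<bar> \<le> B"
  shows "set_integrable lborel torus_cell \<phi>"
  using assms by (intro bounded_set_integrable[where B = B] torus_cell_measurable) (auto simp: emeasure_torus_cell)

lemma B_h_integrable:
  fixes \<phi> :: "real ^ 'd::finite \<Rightarrow> real"
  assumes "\<phi> \<in> borel_measurable lborel" "\<And>x. \<bar>\<phi> x\<bar> \<le> B"
  shows "set_integrable lborel (B_h N x) \<phi>"
  using assms by (intro bounded_set_integrable[where B = B] B_h_measurable) (auto simp: emeasure_B_h)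

lemma set_integral_B_h_const:
  fixes x :: "int ^ 'd::finite"
  shows "(LINT y:B_h N x|lborel. (c::real)) = c * (1 / real N) ^ CARD('d)"
proof -
  have "\<bar>(LINT y:B_h N x|lborel. c) - c * (1 / real N) ^ CARD('d)\<bar> \<le> 0 * (1 / real N) ^ CARD('d)"
    by (rule set_integral_const_bounds[OF B_h_measurable emeasure_B_h _ B_h_integrable[where B = "\<bar>c\<bar>"]]) auto
  then show ?thesis by simp
qed

lemma R_h_bounded:
  assumes "\<mu> \<in> grid_funs N" "N > 0"
  obtains B where "\<And>y :: real ^ 'd::finite. \<bar>R_h N \<mu> y\<bar> \<le> B"
proof -
  obtain x0 where "\<And>x. \<bar>\<mu> x\<bar> \<le> \<bar>\<mu> x0\<bar>"
    using grid_funs_max[OF grid_funs_comp[OF assms(1), of abs] assms(2)] by blast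
  then have "\<bar>R_h N \<mu> y\<bar> \<le> real N ^ CARD('d) * \<bar>\<mu> x0\<bar>" for y
    by (simp add: R_h_eq[OF assms(2)] abs_mult mult_left_mono)
  then show ?thesis by (rule that)
qed

lemma torus_integral_mult_R_h:
  fixes \<psi> :: "real ^ 'd::finite \<Rightarrow> real"
  assumes per: "periodic \<psi>" and meas: "\<psi> \<in> borel_measurable lborel" and bd: "\<And>x. \<bar>\<psi> x\<bar> \<le> B"
    and \<mu>: "\<mu> \<in> grid_funs N" and N: "N > 0"
  shows "set_integrable lborel torus_cell (\<lambda>y. \<psi> y * R_h N \<mu> y)"
    and "torus_integral (\<lambda>y. \<psi> y * R_h N \<mu> y) =
      (\<Sum>x\<in>index_box N. real N ^ CARD('d) * (LINT y:B_h N x|lborel. \<psi> y) * \<mu> x)"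
proof -
  obtain C where C: "\<And>y. \<bar>R_h N \<mu> y\<bar> \<le> C" using R_h_bounded[OF \<mu> N] by blast
  have m: "(\<lambda>y. \<psi> y * R_h N \<mu> y) \<in> borel_measurable lborel"
    using meas R_h_measurable[OF N, of \<mu>] by (rule borel_measurable_times)
  have "\<bar>\<psi> y * R_h N \<mu> y\<bar> \<le> B * C" for y
    unfolding abs_mult using bd C by (intro mult_mono) (auto intro: order_trans[OF abs_ge_zero])
  from torus_cell_integrable[OF m this] show int: "set_integrable lborel torus_cell (\<lambda>y. \<psi> y * R_h N \<mu> y)" .
  have p: "periodic (\<lambda>y. \<psi> y * R_h N \<mu> y)"
    using per R_h_periodic[OF \<mu> N] by (simp add: periodic_def)
  have "(LINT y:B_h N x|lborel. \<psi> y * R_h N \<mu> y) = real N ^ CARD('d) * (LINT y:B_h N x|lborel. \<psi> y) * \<mu> x" for x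
  proof -
    have "(LINT y:B_h N x|lborel. \<psi> y * R_h N \<mu> y) = (LINT y:B_h N x|lborel. (real N ^ CARD('d) * \<mu> x) * \<psi> y)"
      by (rule set_lebesgue_integral_cong[OF B_h_measurable]) (auto simp: R_h_eq[OF N] B_h_iff[OF N])
    then show ?thesis by (simp add: mult_ac)
  qed
  then show "torus_integral (\<lambda>y. \<psi> y * R_h N \<mu> y) =
      (\<Sum>x\<in>index_box N. real N ^ CARD('d) * (LINT y:B_h N x|lborel. \<psi> y) * \<mu> x)"
    using torus_integral_tiles(2)[OF p int m N] by simp
qed

lemma set_integral_R_h:
  fixes x :: "int ^ 'd::finite"
  assumes "N > 0"
  shows "(LINT y:B_h N x|lborel. R_h N \<mu> y) = \<mu> x"
proof -
  have "(LINT y:B_h N x|lborel. R_h N \<mu> y) = (LINT y:B_h N x|lborel. real N ^ CARD('d) * \<mu> x)"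
    by (rule set_lebesgue_integral_cong[OF B_h_measurable]) (auto simp: R_h_eq[OF assms] B_h_iff[OF assms])
  then show ?thesis unfolding set_integral_B_h_const using assms by (simp add: power_one_over)
qed

lemma torus_integral_R_h:
  fixes \<mu> :: "int ^ 'd::finite \<Rightarrow> real"
  assumes \<mu>: "\<mu> \<in> grid_funs N" and N: "N > 0"
  shows "torus_integral (R_h N \<mu>) = (\<Sum>x\<in>index_box N. \<mu> x)"
    and "torus_integral (\<lambda>y. (R_h N \<mu> y)\<^sup>2) = real N ^ CARD('d) * (\<Sum>x\<in>index_box N. (\<mu> x)\<^sup>2)"
    and "set_integrable lborel torus_cell (\<lambda>y. (R_h N \<mu> y)\<^sup>2)"
proof -
  have "periodic (\<lambda>y :: real ^ 'd. 1 :: real)" by (simp add: periodic_def)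
  from torus_integral_mult_R_h(2)[OF this _ _ \<mu> N, of 1]
  show "torus_integral (R_h N \<mu>) = (\<Sum>x\<in>index_box N. \<mu> x)"
    unfolding set_integral_B_h_const using N by (simp add: power_one_over)
  obtain C where C: "\<And>y :: real ^ 'd. \<bar>R_h N \<mu> y\<bar> \<le> C" using R_h_bounded[OF \<mu> N] by blast
  note T = torus_integral_mult_R_h[OF R_h_periodic[OF \<mu> N] R_h_measurable[OF N] C \<mu> N]
  show "torus_integral (\<lambda>y. (R_h N \<mu> y)\<^sup>2) = real N ^ CARD('d) * (\<Sum>x\<in>index_box N. (\<mu> x)\<^sup>2)"
    using T(2) unfolding set_integral_R_h[OF N] by (simp add: power2_eq_square sum_distrib_left mult.assoc)
  show "set_integrable lborel torus_cell (\<lambda>y. (R_h N \<mu> y)\<^sup>2)"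
    using T(1) by (simp add: power2_eq_square)
qed

lemma L2_norm_R_h_diff:
  fixes \<mu> :: "int ^ 'd::finite \<Rightarrow> real"
  assumes "\<mu> \<in> grid_funs N" "\<nu> \<in> grid_funs N" "N > 0"
  shows "L2_norm_torus (\<lambda>y. R_h N \<mu> y - R_h N \<nu> y) = sqrt (real N ^ CARD('d) * (\<Sum>x\<in>index_box N. (\<mu> x - \<nu> x)\<^sup>2))"
  using torus_integral_R_h(2)[OF grid_funs_diff[OF assms(1,2)] assms(3)]
  by (simp add: L2_norm_torus_def R_h_linear(2)[OF assms(3)])

lemma R_h_density:
  assumes "m \<in> prob_grid N" "N > 0"
  shows "R_h N m \<in> densities"
  using assms torus_integral_R_h[of m N] R_h_periodic[of m N] R_h_measurable[of N m]
  by (auto simp: densities_def prob_grid_def R_h_eq)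

lemma densitiesD:
  assumes "\<mu> \<in> densities"
  shows "periodic \<mu>" "\<mu> \<in> borel_measurable lborel" "set_integrable lborel torus_cell (\<lambda>x. (\<mu> x)\<^sup>2)"
    "AE x in lborel. 0 \<le> \<mu> x" "torus_integral \<mu> = 1" "set_integrable lborel torus_cell \<mu>"
proof -
  show *: "periodic \<mu>" "\<mu> \<in> borel_measurable lborel" "set_integrable lborel torus_cell (\<lambda>x. (\<mu> x)\<^sup>2)"
    "AE x in lborel. 0 \<le> \<mu> x" "torus_integral \<mu> = 1" using assms by (auto simp: densities_def)
  have [measurable]: "\<mu> \<in> borel_measurable borel" "torus_cell \<in> sets (borel :: (real ^ 'a) measure)"
    using * torus_cell_measurable by auto
  show "set_integrable lborel torus_cell \<mu>"
    unfolding set_integrable_def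
  proof (rule Bochner_Integration.integrable_bound)
    have "set_integrable lborel torus_cell (\<lambda>x :: real ^ 'a. 1 :: real)"
      by (rule torus_cell_integrable[where B = 1]) auto
    from set_integral_add(1)[OF this *(3)] show "integrable lborel (\<lambda>x. indicat_real torus_cell x *\<^sub>R (1 + (\<mu> x)\<^sup>2))"
      by (simp add: set_integrable_def)
    have "\<bar>\<mu> x\<bar> \<le> 1 + (\<mu> x)\<^sup>2" for x
    proof -
      have "0 \<le> (\<bar>\<mu> x\<bar> - 1)\<^sup>2" by simp
      then have "2 * \<bar>\<mu> x\<bar> \<le> 1 + (\<mu> x)\<^sup>2" by (simp add: power2_diff)
      then show ?thesis by linarith
    qed
    then show "AE x in lborel. norm (indicat_real torus_cell x *\<^sub>R \<mu> x) \<le> norm (indicat_real torus_cell x *\<^sub>R (1 + (\<mu> x)\<^sup>2))"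
      by (intro AE_I2) (simp add: indicator_def)
    show "(\<lambda>x. indicat_real torus_cell x *\<^sub>R \<mu> x) \<in> borel_measurable lborel" by measurable
  qed
qed

section \<open>Cell averages of densities\<close>

lemma I_h_periodic:
  fixes \<mu> :: "real ^ 'd::finite \<Rightarrow> real"
  assumes "periodic \<mu>" "\<mu> \<in> borel_measurable lborel" "N > 0"
  shows "I_h N \<mu> \<in> grid_funs N"
  unfolding grid_funs_def
proof safe
  fix x :: "int ^ 'd" and j
  have [measurable]: "\<mu> \<in> borel_measurable borel" "\<And>x. B_h N x \<in> sets (borel :: (real ^ 'd) measure)"
    using assms B_h_measurable by auto
  have gp: "gpoint N (x + axis j (int N)) = gpoint N x + axis j 1"
    using assms(3) by (simp add: gpoint_def vec_eq_iff axis_def add_divide_distrib)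
  have shift: "(gpoint N x + axis j 1) $ i - c \<le> (y + axis j 1) $ i \<longleftrightarrow> gpoint N x $ i - c \<le> y $ i"
    "(y + axis j 1) $ i < (gpoint N x + axis j 1) $ i + c \<longleftrightarrow> y $ i < gpoint N x $ i + c" for i c and y :: "real ^ 'd"
    unfolding vector_add_component by linarith+
  have "y + axis j 1 \<in> B_h N (x + axis j (int N)) \<longleftrightarrow> y \<in> B_h N x" for y
    unfolding B_h_def gp mem_Collect_eq shift ..
  then have "indicator (B_h N (x + axis j (int N))) (y + axis j 1) = (indicator (B_h N x) y :: real)" for y
    by (simp add: indicator_def)
  moreover have "\<mu> (y + axis j 1) = \<mu> y" for y using assms(1) by (simp add: periodic_def)
  ultimately have "(\<lambda>y. indicator (B_h N x) y *\<^sub>R \<mu> y) =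
      (\<lambda>y. indicator (B_h N (x + axis j (int N))) (y + axis j 1) *\<^sub>R \<mu> (y + axis j 1))"
    by simp
  then have "integral\<^sup>L lborel (\<lambda>y. indicator (B_h N x) y *\<^sub>R \<mu> y) =
      integral\<^sup>L lborel (\<lambda>y. indicator (B_h N (x + axis j (int N))) (y + axis j 1) *\<^sub>R \<mu> (y + axis j 1))"
    by (rule arg_cong)
  also have "\<dots> = integral\<^sup>L lborel (\<lambda>y. indicator (B_h N (x + axis j (int N))) y *\<^sub>R \<mu> y)"
    by (rule lborel_translate(1)[of "\<lambda>y. indicator (B_h N (x + axis j (int N))) y *\<^sub>R \<mu> y"]) measurable
  finally show "I_h N \<mu> (x + axis j (int N)) = I_h N \<mu> x"
    unfolding I_h_def set_lebesgue_integral_def by (rule sym)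
qed

lemma I_h_prob:
  assumes "\<mu> \<in> densities" "N > 0"
  shows "I_h N \<mu> \<in> prob_grid N"
proof -
  note d = densitiesD[OF assms(1)]
  have "0 \<le> I_h N \<mu> x" for x
    unfolding I_h_def set_lebesgue_integral_def using d(4)
    by (intro Bochner_Integration.integral_nonneg_AE) (auto simp: indicator_def)
  moreover have "(\<Sum>x\<in>index_box N. I_h N \<mu> x) = 1"
    using torus_integral_tiles(2)[OF d(1,6,2) assms(2)] d(5) by (simp add: I_h_def)
  ultimately show ?thesis using I_h_periodic[OF d(1,2) assms(2)] by (simp add: prob_grid_def)
qed

lemma I_h_square_sum:
  fixes \<mu> :: "real ^ 'd::finite \<Rightarrow> real"
  assumes "\<mu> \<in> densities" "N > 0"
  shows "(\<Sum>x\<in>index_box N. (I_h N \<mu> x)\<^sup>2) \<le> (1 / real N) ^ CARD('d) * torus_integral (\<lambda>x. (\<mu> x)\<^sup>2)"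
proof -
  note d = densitiesD[OF assms(1)]
  let ?a = "(1 / real N) ^ CARD('d)"
  have a: "?a > 0" using assms by simp
  have p2: "periodic (\<lambda>x. (\<mu> x)\<^sup>2)" "(\<lambda>x. (\<mu> x)\<^sup>2) \<in> borel_measurable lborel"
    using d by (auto simp: periodic_def)
  have one: "(I_h N \<mu> x)\<^sup>2 \<le> ?a * (LINT y:B_h N x|lborel. (\<mu> y)\<^sup>2)" if x: "x \<in> index_box N" for x
  proof -
    \<comment> \<open>\<open>c\<close> is the mean of \<open>\<mu>\<close> over the cell. Expanding
      the nonnegative integral of \<open>(\<mu> - c)\<^sup>2\<close> gives the Cauchy-Schwarz
      inequality on the cell.\<close>
    define c where "c = I_h N \<mu> x / ?a"
    have i1: "set_integrable lborel (B_h N x) \<mu>" by (rule torus_integral_tiles(1)[OF d(1,6,2) assms(2) x])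
    have i2: "set_integrable lborel (B_h N x) (\<lambda>y. (\<mu> y)\<^sup>2)"
      by (rule torus_integral_tiles(1)[OF p2(1) d(3) p2(2) assms(2) x])
    have i3: "set_integrable lborel (B_h N x) (\<lambda>y. 2 * c * \<mu> y)" using i1 by simp
    have i4: "set_integrable lborel (B_h N x) (\<lambda>y. c\<^sup>2)" by (rule B_h_integrable[where B = "\<bar>c\<^sup>2\<bar>"]) auto
    have "0 \<le> (LINT y:B_h N x|lborel. ((\<mu> y)\<^sup>2 - 2 * c * \<mu> y) + c\<^sup>2)"
    proof -
      have "((\<mu> y)\<^sup>2 - 2 * c * \<mu> y) + c\<^sup>2 = (\<mu> y - c)\<^sup>2" for y by (simp add: power2_diff)
      then show ?thesis unfolding set_lebesgue_integral_def by (intro Bochner_Integration.integral_nonneg) simp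
    qed
    also have "\<dots> = (LINT y:B_h N x|lborel. (\<mu> y)\<^sup>2) - 2 * c * I_h N \<mu> x + c\<^sup>2 * ?a"
      using set_integral_add(2)[OF set_integral_diff(1)[OF i2 i3] i4] set_integral_diff(2)[OF i2 i3]
      unfolding set_integral_B_h_const by (simp add: I_h_def)
    also have "\<dots> = (LINT y:B_h N x|lborel. (\<mu> y)\<^sup>2) - (I_h N \<mu> x)\<^sup>2 / ?a"
      using a by (simp add: c_def power2_eq_square field_simps)
    finally have "(I_h N \<mu> x)\<^sup>2 / ?a \<le> (LINT y:B_h N x|lborel. (\<mu> y)\<^sup>2)" by simp
    then show ?thesis using a by (simp add: pos_divide_le_eq mult.commute)
  qed
  have "(\<Sum>x\<in>index_box N. (I_h N \<mu> x)\<^sup>2) \<le> (\<Sum>x\<in>index_box N. ?a * (LINT y:B_h N x|lborel. (\<mu> y)\<^sup>2))"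
    by (intro sum_mono one)
  also have "\<dots> = ?a * torus_integral (\<lambda>x. (\<mu> x)\<^sup>2)"
    unfolding torus_integral_tiles(2)[OF p2(1) d(3) p2(2) assms(2)] by (simp add: sum_distrib_left)
  finally show ?thesis .
qed

lemma L2_norm_le_sup:
  fixes \<phi> :: "real ^ 'd::finite \<Rightarrow> real"
  assumes "\<phi> \<in> borel_measurable lborel" "\<And>x. \<bar>\<phi> x\<bar> \<le> B"
  shows "L2_norm_torus \<phi> \<le> B"
proof -
  have B: "0 \<le> B" using assms(2)[of 0] by linarith
  have sq: "(\<phi> x)\<^sup>2 \<le> B\<^sup>2" for x using assms(2)[of x] B by (simp add: abs_le_square_iff[symmetric])
  have [measurable]: "(\<lambda>x. (\<phi> x)\<^sup>2) \<in> borel_measurable lborel" using assms(1) by simp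
  have "\<bar>(LINT x:torus_cell|lborel. (\<phi> x)\<^sup>2) - 0 * 1\<bar> \<le> B\<^sup>2 * 1"
    using sq by (intro set_integral_const_bounds torus_cell_measurable torus_cell_integrable[where B = "B\<^sup>2"])
      (auto simp: emeasure_torus_cell)
  then have "torus_integral (\<lambda>x. (\<phi> x)\<^sup>2) \<le> B\<^sup>2" unfolding torus_integral_def by simp
  then show ?thesis unfolding L2_norm_torus_def using B real_sqrt_le_mono by fastforce
qed

section \<open>The discrete coupling term and its potential\<close>

context data_A
begin

lemma fc_lipschitz_x:
  assumes "t \<in> {0..1}" "m \<in> densities"
  shows "\<bar>fc D t x m - fc D t y m\<bar> \<le> L_f D * norm (x - y)"
  using A lipschitz_onD[of "L_f D" UNIV "\<lambda>x. fc D t x m" x y] assms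
  by (auto simp: assumption_A_def dist_norm)

lemma fc_osc:
  assumes "t \<in> {0..1}" "m \<in> densities"
  shows "\<bar>fc D t x m - fc D t 0 m\<bar> \<le> L_f D * real CARD('d)"
  by (rule periodic_lipschitz_osc) (use torus A assms in \<open>auto simp: torus_data_def assumption_A_def\<close>)

lemma fc_bounded:
  assumes "t \<in> {0..1}" "m \<in> densities"
  shows "\<bar>fc D t x m\<bar> \<le> \<bar>fc D t 0 m\<bar> + L_f D * real CARD('d)"
  using fc_osc[OF assms, of x] by linarith

lemma fc_measurable:
  assumes "t \<in> {0..1}" "m \<in> densities"
  shows "(\<lambda>x. fc D t x m) \<in> borel_measurable lborel"
proof -
  have "(L_f D)-lipschitz_on UNIV (\<lambda>x. fc D t x m)"
    using A assms by (auto simp: assumption_A_def)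
  then have "continuous_on UNIV (\<lambda>x. fc D t x m)" by (rule lipschitz_on_continuous_on)
  then show ?thesis by (simp add: borel_measurable_continuous_onI)
qed

lemma fc_L2:
  assumes "t \<in> {0..1}" "m1 \<in> densities" "m2 \<in> densities"
  shows "\<bar>fc D t x m1 - fc D t x m2\<bar> \<le> L_f D * L2_norm_torus (\<lambda>y. m1 y - m2 y)"
  using A assms by (auto simp: assumption_A_def)

context
  fixes T N n :: nat
  assumes N: "N > 0" and T: "T > 0" and n: "n \<le> T"
begin

private abbreviation "\<tau> \<equiv> real n / real T"

private lemma \<tau>: "\<tau> \<in> {0..1}"
  using n T by simp

lemma f_h_near:
  fixes x :: "int ^ 'd"
  assumes m: "m \<in> prob_grid N" and B: "\<And>y. y \<in> B_h N x \<Longrightarrow> \<bar>fc D \<tau> y (R_h N m) - c\<bar> \<le> B"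
  shows "\<bar>f_h D T N n x m - c\<bar> \<le> B"
proof -
  let ?a = "(1 / real N) ^ CARD('d)"
  have a: "?a > 0" using N by simp
  have "\<bar>(LINT y:B_h N x|lborel. fc D \<tau> y (R_h N m)) - c * ?a\<bar> \<le> B * ?a"
    using fc_bounded[OF \<tau> R_h_density[OF m N]] fc_measurable[OF \<tau> R_h_density[OF m N]]
    by (intro set_integral_const_bounds[OF B_h_measurable emeasure_B_h _ B_h_integrable B]) auto
  then have "\<bar>(LINT y:B_h N x|lborel. fc D \<tau> y (R_h N m)) / ?a - c\<bar> * ?a \<le> B * ?a"
    using a by (simp add: abs_le_iff field_simps)
  then show ?thesis unfolding f_h_def using a by (rule mult_right_le_imp_le)
qed

lemma f_h_osc:
  assumes m: "m \<in> prob_grid N"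
  shows "\<bar>f_h D T N n x m - fc D \<tau> 0 (R_h N m)\<bar> \<le> L_f D * real CARD('d)"
  by (rule f_h_near[OF m]) (rule fc_osc[OF \<tau> R_h_density[OF m N]])

lemma B_h_norm:
  fixes y :: "real ^ 'd"
  assumes "y \<in> B_h N x"
  shows "norm (y - gpoint N x) \<le> real CARD('d) / real N"
proof -
  have "\<bar>(y - gpoint N x) $ j\<bar> \<le> 1 / real N" for j
  proof -
    have "gpoint N x $ j - 1 / (2 * real N) \<le> y $ j \<and> y $ j < gpoint N x $ j + 1 / (2 * real N)"
      using assms by (simp add: B_h_def)
    moreover have "1 / (2 * real N) \<le> 1 / real N" using N by (simp add: field_simps)
    ultimately show ?thesis unfolding vector_minus_component by linarith
  qed
  from norm_le_card[OF this] show ?thesis by simp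
qed

lemma f_h_consistent:
  assumes m: "m \<in> prob_grid N" and \<mu>: "\<mu> \<in> densities"
  shows "\<bar>f_h D T N n x m - fc D \<tau> (gpoint N x) \<mu>\<bar> \<le>
     L_f D * (real CARD('d) / real N) + L_f D * L2_norm_torus (\<lambda>y. R_h N m y - \<mu> y)"
proof (rule f_h_near[OF m])
  fix y assume "y \<in> B_h N x"
  then have "L_f D * norm (y - gpoint N x) \<le> L_f D * (real CARD('d) / real N)"
    using consts_pos by (intro mult_left_mono B_h_norm) auto
  moreover note fc_lipschitz_x[OF \<tau> R_h_density[OF m N], of y "gpoint N x"]
    fc_L2[OF \<tau> R_h_density[OF m N] \<mu>, of "gpoint N x"]
  ultimately show "\<bar>fc D \<tau> y (R_h N m) - fc D \<tau> (gpoint N x) \<mu>\<bar> \<le>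
     L_f D * (real CARD('d) / real N) + L_f D * L2_norm_torus (\<lambda>y. R_h N m y - \<mu> y)"
    by linarith
qed

text \<open>\<open>R_h N \<mu>\<close> is constant on cells, so the averaging inside
  \<open>f_h\<close> can be transferred to it without error. Monotonicity and the potential
  therefore pass from the continuous coupling to the discrete one exactly, not up to a consistency
  error.\<close>

lemma f_h_pairing:
  assumes m: "m \<in> prob_grid N" and \<mu>: "\<mu> \<in> grid_funs N"
  shows "(\<Sum>x\<in>index_box N. f_h D T N n x m * \<mu> x) = torus_integral (\<lambda>y. fc D \<tau> y (R_h N m) * R_h N \<mu> y)"
    and "set_integrable lborel torus_cell (\<lambda>y. fc D \<tau> y (R_h N m) * R_h N \<mu> y)"
proof -
  have "periodic (\<lambda>y. fc D \<tau> y (R_h N m))"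
    using torus \<tau> R_h_density[OF m N] by (auto simp: torus_data_def)
  note P = torus_integral_mult_R_h[OF this fc_measurable[OF \<tau> R_h_density[OF m N]]
      fc_bounded[OF \<tau> R_h_density[OF m N]] \<mu> N]
  show "(\<Sum>x\<in>index_box N. f_h D T N n x m * \<mu> x) = torus_integral (\<lambda>y. fc D \<tau> y (R_h N m) * R_h N \<mu> y)"
    unfolding P(2) f_h_def by (simp add: power_one_over mult_ac)
  show "set_integrable lborel torus_cell (\<lambda>y. fc D \<tau> y (R_h N m) * R_h N \<mu> y)" by (rule P(1))
qed

lemma f_h_lipschitz:
  fixes m1 :: "int ^ 'd \<Rightarrow> real"
  assumes m1: "m1 \<in> prob_grid N" and m2: "m2 \<in> prob_grid N"
  shows "\<bar>f_h D T N n x m1 - f_h D T N n x m2\<bar> \<le>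
    L_f D * sqrt (real N ^ CARD('d) * (\<Sum>x\<in>index_box N. (m1 x - m2 x)\<^sup>2))"
proof -
  have g: "m1 \<in> grid_funs N" "m2 \<in> grid_funs N" using m1 m2 by (auto simp: prob_grid_def)
  let ?a = "(1 / real N) ^ CARD('d)" and ?L = "L_f D * L2_norm_torus (\<lambda>y. R_h N m1 y - R_h N m2 y)"
  have a: "?a > 0" using N by simp
  have int: "set_integrable lborel (B_h N x) (\<lambda>y. fc D \<tau> y (R_h N m))" if "m \<in> prob_grid N" for m
    using fc_bounded[OF \<tau> R_h_density[OF that N]] fc_measurable[OF \<tau> R_h_density[OF that N]]
    by (intro B_h_integrable)
  have "\<bar>(LINT y:B_h N x|lborel. fc D \<tau> y (R_h N m1) - fc D \<tau> y (R_h N m2)) - 0 * ?a\<bar> \<le> ?L * ?a"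
    using fc_L2[OF \<tau> R_h_density[OF m1 N] R_h_density[OF m2 N]]
    by (intro set_integral_const_bounds[OF B_h_measurable emeasure_B_h _ set_integral_diff(1)[OF int[OF m1] int[OF m2]]]) auto
  then have "\<bar>f_h D T N n x m1 - f_h D T N n x m2\<bar> * ?a \<le> ?L * ?a"
    unfolding f_h_def set_integral_diff(2)[OF int[OF m1] int[OF m2]] using N
    by (simp add: diff_divide_distrib[symmetric] abs_divide)
  then have "\<bar>f_h D T N n x m1 - f_h D T N n x m2\<bar> \<le> ?L" using a by (rule mult_right_le_imp_le)
  then show ?thesis unfolding L2_norm_R_h_diff[OF g N] .
qed

lemma f_h_monotone:
  assumes m1: "m1 \<in> prob_grid N" and m2: "m2 \<in> prob_grid N"
  shows "0 \<le> (\<Sum>x\<in>index_box N. (f_h D T N n x m1 - f_h D T N n x m2) * (m1 x - m2 x))"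
proof -
  have g: "(\<lambda>x. m1 x - m2 x) \<in> grid_funs N" using m1 m2 by (auto simp: prob_grid_def intro: grid_funs_diff)
  let ?\<mu> = "R_h N (\<lambda>x. m1 x - m2 x)"
  have "(\<Sum>x\<in>index_box N. (f_h D T N n x m1 - f_h D T N n x m2) * (m1 x - m2 x)) =
     torus_integral (\<lambda>y. fc D \<tau> y (R_h N m1) * ?\<mu> y) - torus_integral (\<lambda>y. fc D \<tau> y (R_h N m2) * ?\<mu> y)"
    unfolding f_h_pairing(1)[OF m1 g, symmetric] f_h_pairing(1)[OF m2 g, symmetric]
    by (simp add: sum_subtractf left_diff_distrib)
  also have "\<dots> = torus_integral (\<lambda>y. (fc D \<tau> y (R_h N m1) - fc D \<tau> y (R_h N m2)) * (R_h N m1 y - R_h N m2 y))"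
    using set_integral_diff(2)[OF f_h_pairing(2)[OF m1 g] f_h_pairing(2)[OF m2 g]]
    by (simp add: torus_integral_def R_h_linear(2)[OF N] left_diff_distrib)
  also have "\<dots> \<ge> 0"
    using A \<tau> R_h_density[OF m1 N] R_h_density[OF m2 N] by (auto simp: assumption_A_def)
  finally show ?thesis .
qed

lemma prob_grid_convex:
  assumes "m1 \<in> prob_grid N" "m2 \<in> prob_grid N" "s \<in> {0..1::real}"
  shows "(\<lambda>x. m1 x + s * (m2 x - m1 x)) \<in> prob_grid N"
proof -
  have "0 \<le> m1 x + s * (m2 x - m1 x)" for x
  proof -
    have "0 \<le> (1 - s) * m1 x + s * m2 x" using assms by (auto simp: prob_grid_def)
    then show ?thesis by (simp add: algebra_simps)
  qed
  moreover have "(\<lambda>x. m1 x + s * (m2 x - m1 x)) \<in> grid_funs N"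
    using assms by (auto simp: prob_grid_def grid_funs_def)
  moreover have "(\<Sum>x\<in>index_box N. m1 x + s * (m2 x - m1 x)) = 1"
    using assms by (simp add: prob_grid_def sum.distrib sum_distrib_left[symmetric] sum_subtractf)
  ultimately show ?thesis by (simp add: prob_grid_def)
qed

text \<open>Along a segment, the derivative of the potential is nondecreasing by monotonicity and
  Lipschitz continuous by assumption (A).\<close>

lemma F_h_bounds:
  fixes m1 m2 :: "int ^ 'd \<Rightarrow> real"
  assumes C: "assumption_C D" and m1: "m1 \<in> prob_grid N" and m2: "m2 \<in> prob_grid N"
  shows "(\<Sum>x\<in>index_box N. f_h D T N n x m1 * (m2 x - m1 x)) \<le> F_h D T N n m2 - F_h D T N n m1" (is "?A \<le> ?F")
    and "F_h D T N n m2 - F_h D T N n m1 \<le> (\<Sum>x\<in>index_box N. f_h D T N n x m1 * (m2 x - m1 x)) +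
      L_f D * sqrt (real N ^ CARD('d) * (\<Sum>x\<in>index_box N. (m2 x - m1 x)\<^sup>2)) * (\<Sum>x\<in>index_box N. \<bar>m2 x - m1 x\<bar>)"
proof -
  define c where "c s x = m1 x + s * (m2 x - m1 x)" for s x
  define \<phi> where "\<phi> s = (\<Sum>x\<in>index_box N. f_h D T N n x (c s) * (m2 x - m1 x))" for s
  define S where "S = sqrt (real N ^ CARD('d) * (\<Sum>x\<in>index_box N. (m2 x - m1 x)\<^sup>2))"
  define W where "W = (\<Sum>x\<in>index_box N. \<bar>m2 x - m1 x\<bar>)"
  have c: "c s \<in> prob_grid N" if "s \<in> {0..1}" for s
    unfolding c_def[abs_def] by (rule prob_grid_convex[OF m1 m2 that])
  have g: "(\<lambda>x. m2 x - m1 x) \<in> grid_funs N" using m1 m2 by (auto simp: prob_grid_def intro: grid_funs_diff)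
  have nonneg: "0 \<le> S" "0 \<le> W" unfolding S_def W_def by (auto intro!: sum_nonneg mult_nonneg_nonneg)
  have lip: "\<bar>\<phi> s - \<phi> s'\<bar> \<le> (L_f D * S * W) * \<bar>s - s'\<bar>" if "s \<in> {0..1}" "s' \<in> {0..1}" for s s'
  proof -
    have "\<bar>f_h D T N n x (c s) - f_h D T N n x (c s')\<bar> \<le> L_f D * (S * \<bar>s - s'\<bar>)" for x
    proof -
      have "c s x - c s' x = (s - s') * (m2 x - m1 x)" for x by (simp add: c_def algebra_simps)
      then have "sqrt (real N ^ CARD('d) * (\<Sum>x\<in>index_box N. (c s x - c s' x)\<^sup>2)) = S * \<bar>s - s'\<bar>"
        by (simp add: power_mult_distrib sum_distrib_left[symmetric] real_sqrt_mult S_def)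
      then show ?thesis using f_h_lipschitz[OF c[OF that(1)] c[OF that(2)], of x] by simp
    qed
    then have "\<bar>\<phi> s - \<phi> s'\<bar> \<le> (\<Sum>x\<in>index_box N. L_f D * (S * \<bar>s - s'\<bar>) * \<bar>m2 x - m1 x\<bar>)"
      unfolding \<phi>_def sum_subtractf[symmetric] left_diff_distrib[symmetric]
      by (intro order_trans[OF sum_abs] sum_mono) (simp add: abs_mult mult_right_mono)
    then show ?thesis unfolding sum_distrib_left[symmetric] W_def by (simp add: mult_ac)
  qed
  have cont: "continuous_on {0..1} \<phi>"
  proof -
    have "(L_f D * S * W)-lipschitz_on {0..1} \<phi>"
      using lip nonneg consts_pos by (intro lipschitz_onI) (auto simp: dist_real_def)
    then show ?thesis by (rule lipschitz_on_continuous_on)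
  qed
  have int: "set_integrable lborel {0..1} \<phi>" by (rule borel_integrable_atLeastAtMost'[OF cont])
  \<comment> \<open>Monotonicity is applied to \<open>c s\<close> and \<open>c 0\<close>, whose
    difference is \<open>s\<close> times the direction of the segment.\<close>
  have mono: "\<phi> 0 \<le> \<phi> s" if s: "s \<in> {0..1}" for s
  proof (cases "s = 0")
    case False
    have "0 \<le> (\<Sum>x\<in>index_box N. (f_h D T N n x (c s) - f_h D T N n x (c 0)) * (c s x - c 0 x))"
      by (rule f_h_monotone[OF c[OF s] c]) simp
    also have "\<dots> = s * (\<phi> s - \<phi> 0)"
      by (simp add: \<phi>_def c_def[of _ _] sum_distrib_left sum_subtractf sum.distrib right_diff_distrib left_diff_distrib algebra_simps)
    finally show ?thesis using False s by (simp add: zero_le_mult_iff)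
  qed simp
  have up: "\<phi> s \<le> \<phi> 0 + L_f D * S * W" if s: "s \<in> {0..1}" for s
  proof -
    have "(L_f D * S * W) * \<bar>s - 0\<bar> \<le> (L_f D * S * W) * 1"
      using s nonneg consts_pos by (intro mult_left_mono) auto
    then show ?thesis using lip[OF s, of 0] by auto
  qed
  have const: "(LINT s:{0..1::real}|lborel. k) = k" "set_integrable lborel {0..1::real} (\<lambda>_. k)" for k :: real
    by (simp_all add: set_lebesgue_integral_def set_integrable_def)
  have F: "?F = (LINT s:{0..1}|lborel. \<phi> s)"
  proof -
    have "?F = (LINT s:{0..1}|lborel.
          torus_integral (\<lambda>x. fc D \<tau> x (\<lambda>y. R_h N m1 y + s * (R_h N m2 y - R_h N m1 y)) * (R_h N m2 x - R_h N m1 x)))"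
      using C \<tau> R_h_density[OF m1 N] R_h_density[OF m2 N] unfolding assumption_C_def F_h_def by blast
    also have "\<dots> = (LINT s:{0..1}|lborel. \<phi> s)"
    proof (rule set_lebesgue_integral_cong; safe?)
      fix s :: real assume s: "s \<in> {0..1}"
      have "(\<lambda>y. R_h N m1 y + s * (R_h N m2 y - R_h N m1 y)) = R_h N (c s)"
        unfolding c_def[abs_def] by (simp add: fun_eq_iff R_h_eq[OF N] algebra_simps)
      then show "torus_integral (\<lambda>x. fc D \<tau> x (\<lambda>y. R_h N m1 y + s * (R_h N m2 y - R_h N m1 y)) * (R_h N m2 x - R_h N m1 x)) = \<phi> s"
        using f_h_pairing(1)[OF c[OF s] g] by (simp add: \<phi>_def R_h_linear(2)[OF N])
    qed simp
    finally show ?thesis .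
  qed
  have "(LINT s:{0..1::real}|lborel. \<phi> 0) \<le> (LINT s:{0..1}|lborel. \<phi> s)"
    by (rule set_integral_mono[OF const(2) int]) (use mono in simp)
  moreover have "(LINT s:{0..1}|lborel. \<phi> s) \<le> (LINT s:{0..1::real}|lborel. \<phi> 0 + L_f D * S * W)"
    by (rule set_integral_mono[OF int const(2)]) (use up in simp)
  moreover have "\<phi> 0 = ?A" by (simp add: \<phi>_def c_def[abs_def])
  ultimately show "?A \<le> ?F" "?F \<le> ?A + L_f D * sqrt (real N ^ CARD('d) * (\<Sum>x\<in>index_box N. (m2 x - m1 x)\<^sup>2)) * (\<Sum>x\<in>index_box N. \<bar>m2 x - m1 x\<bar>)"
    unfolding const F S_def W_def by simp_all
qed

text \<open>A difference of two probability vectors has total mass zero, so a constant may be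
  subtracted from the coupling and only its oscillation counts. The bound is thus uniform in
  \<open>m\<close>, even for an initialization whose L2-norm is not controlled on fine
  grids.\<close>

lemma f_h_prob_diff:
  fixes \<mu> \<nu> :: "int ^ 'd \<Rightarrow> real"
  assumes m: "m \<in> prob_grid N" and \<mu>: "\<mu> \<in> prob_grid N" and \<nu>: "\<nu> \<in> prob_grid N"
  shows "(\<Sum>x\<in>index_box N. f_h D T N n x m * (\<mu> x - \<nu> x)) \<le> 2 * L_f D * real CARD('d)"
proof -
  let ?c = "fc D \<tau> 0 (R_h N m)" and ?L = "L_f D * real CARD('d)"
  have "(\<Sum>x\<in>index_box N. f_h D T N n x m * (\<mu> x - \<nu> x)) = (\<Sum>x\<in>index_box N. (f_h D T N n x m - ?c) * (\<mu> x - \<nu> x))"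
    using \<mu> \<nu> by (simp add: prob_grid_def left_diff_distrib sum_subtractf right_diff_distrib sum_distrib_left[symmetric])
  also have "\<dots> \<le> (\<Sum>x\<in>index_box N. ?L * (\<mu> x + \<nu> x))"
  proof (rule sum_mono)
    fix x
    have "(f_h D T N n x m - ?c) * (\<mu> x - \<nu> x) \<le> \<bar>f_h D T N n x m - ?c\<bar> * \<bar>\<mu> x - \<nu> x\<bar>"
      unfolding abs_mult[symmetric] by (rule abs_ge_self)
    also have "\<dots> \<le> ?L * (\<mu> x + \<nu> x)"
      using f_h_osc[OF m, of x] \<mu> \<nu> by (intro mult_mono) (auto simp: prob_grid_def abs_le_iff add_increasing add_increasing2)
    finally show "(f_h D T N n x m - ?c) * (\<mu> x - \<nu> x) \<le> ?L * (\<mu> x + \<nu> x)" .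
  qed
  also have "\<dots> = 2 * L_f D * real CARD('d)"
    using \<mu> \<nu> by (simp add: prob_grid_def sum_distrib_left[symmetric] sum.distrib)
  finally show ?thesis .
qed

end

end

section \<open>The theta-scheme\<close>

locale theta_data = data_A D for D :: "('d::finite) mfg_data" +
  fixes \<sigma> \<theta> :: real
  assumes sigma: "\<sigma> > 0" and theta: "1 / 2 < \<theta>" "\<theta> < 1"
begin

text \<open>For a flux bounded by \<open>M |m| + |q'|\<close>, the coefficient
  \<open>1 / (2 \<sigma>)\<close> of \<open>one_step_energy\<close> produces
  \<open>M\<^sup>2 / \<sigma>\<close> in front of the density and \<open>1 / \<sigma>\<close> in
  front of the source; the summand 1 is the factor \<open>1 + \<delta>\<close> of that estimate.
  \<open>K_source\<close> dominates the coefficients of both sources, and \<open>K_L2\<close> is the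
  resulting squared L2 bound for admissible densities.\<close>

definition "K_growth = 1 + M\<^sup>2 / \<sigma>"

definition "K_source = 1 / \<sigma> + (1 + 1 / (2 * \<theta> - 1))"

definition "K_L2 = exp K_growth * torus_integral (\<lambda>x. (m0c D x)\<^sup>2)"

lemma K_pos: "K_growth > 0" "K_source > 0" "K_L2 \<ge> 0"
proof -
  show "K_growth > 0" unfolding K_growth_def using sigma by (intro add_pos_nonneg) auto
  show "K_source > 0" unfolding K_source_def using sigma theta by (intro add_pos_pos) auto
  show "K_L2 \<ge> 0" unfolding K_L2_def torus_integral_def set_lebesgue_integral_def
    by (intro mult_nonneg_nonneg Bochner_Integration.integral_nonneg) auto
qed

end

locale scheme = theta_data D \<sigma> \<theta> for D :: "('d::finite) mfg_data" and \<sigma> \<theta> +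
  fixes T N :: nat
  assumes T: "T > 0" and N: "N > 0"
    and step_t: "1 / real T \<le> (1 / real N)\<^sup>2 / (2 * real CARD('d) * (1 - \<theta>) * \<sigma>)"
    and step_x: "1 / real N \<le> 2 * (1 - \<theta>) * \<sigma> / M"
begin

definition \<delta> :: real where "\<delta> = 1 / real T"

abbreviation "lap \<equiv> laplacian_h N"
abbreviation "nab \<equiv> nabla_h N"
abbreviation "ibox \<equiv> (index_box N :: (int ^ 'd) set)"
abbreviation "tau t \<equiv> real t / real T"

lemma delta: "0 < \<delta>" "\<delta> \<le> 1" "\<delta> * real T = 1"
  using T by (auto simp: \<delta>_def)

lemma cfl: "2 * real CARD('d) * ((1 - \<theta>) * \<sigma>) * \<delta> * (real N)\<^sup>2 \<le> 1"
  and drift_cfl: "M / real N \<le> 2 * ((1 - \<theta>) * \<sigma>)"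
proof -
  have c: "0 < 2 * real CARD('d) * (1 - \<theta>) * \<sigma>" using sigma theta by simp
  have "\<delta> * (2 * real CARD('d) * (1 - \<theta>) * \<sigma>) \<le> (1 / real N)\<^sup>2"
    using step_t c by (simp only: pos_le_divide_eq \<delta>_def)
  then have "(\<delta> * (2 * real CARD('d) * (1 - \<theta>) * \<sigma>)) * (real N)\<^sup>2 \<le> (1 / real N)\<^sup>2 * (real N)\<^sup>2"
    by (rule mult_right_mono) simp
  also have "\<dots> = 1" using N by (simp add: power_one_over)
  finally show "2 * real CARD('d) * ((1 - \<theta>) * \<sigma>) * \<delta> * (real N)\<^sup>2 \<le> 1" by (simp only: mult_ac)
  have "1 / real N * M \<le> 2 * (1 - \<theta>) * \<sigma>"
    using step_x radius_pos by (simp only: pos_le_divide_eq)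
  then show "M / real N \<le> 2 * ((1 - \<theta>) * \<sigma>)" by (simp add: mult_ac)
qed

lemma tau: "t \<le> T \<Longrightarrow> tau t \<in> {0..1}"
  using T by simp

text \<open>The squared L2-norm of the reconstruction \<open>R_h N \<mu>\<close>. With this weight,
  the number of grid points, it controls the l1-norm with constant one, so no power of the grid size
  is lost in passing to the norm of the statement.\<close>

definition l2 :: "(int ^ 'd \<Rightarrow> real) \<Rightarrow> real" where
  "l2 \<mu> = real N ^ CARD('d) * (\<Sum>x\<in>ibox. (\<mu> x)\<^sup>2)"

lemma l2_nonneg: "l2 \<mu> \<ge> 0"
  unfolding l2_def by (intro mult_nonneg_nonneg sum_nonneg) auto

lemma l1_le_l2: "(\<Sum>x\<in>ibox. \<bar>\<mu> x\<bar>) \<le> sqrt (l2 \<mu>)"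
proof -
  have "(\<Sum>x\<in>ibox. \<bar>\<mu> x\<bar> * 1)\<^sup>2 \<le> (\<Sum>x\<in>ibox. \<bar>\<mu> x\<bar>\<^sup>2) * (\<Sum>x\<in>ibox. 1\<^sup>2)"
    by (rule Cauchy_Schwarz_ineq_sum)
  then have "(\<Sum>x\<in>ibox. \<bar>\<mu> x\<bar>)\<^sup>2 \<le> l2 \<mu>"
    by (simp add: l2_def card_index_box mult.commute)
  then show ?thesis by (rule real_le_rsqrt)
qed

text \<open>The part of the flux that is proportional to the density feeds the Gronwall factor only;
  \<open>q'\<close> and \<open>\<eta>\<close> are the true sources. With both zero it gives the a
  priori bound, with \<open>q'\<close> a velocity discrepancy the distance to the equilibrium, and
  with a consistency residual in addition the distance to the trace.\<close>

lemma energy_bound: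
  fixes m \<eta> :: "nat \<Rightarrow> int ^ 'd \<Rightarrow> real" and q q' :: "nat \<Rightarrow> int ^ 'd \<Rightarrow> real ^ 'd"
  assumes per: "\<And>t. t \<le> T \<Longrightarrow> m t \<in> grid_funs N" "\<And>t. t < T \<Longrightarrow> q t \<in> grid_funs N"
    and q: "\<And>t x. t < T \<Longrightarrow> norm (q t x) \<le> M * \<bar>m t x\<bar> + norm (q' t x)"
    and eq: "\<And>t x. t < T \<Longrightarrow> m (t + 1) x - \<theta> * \<sigma> * \<delta> * lap (m (t + 1)) x =
        m t x + (1 - \<theta>) * \<sigma> * \<delta> * lap (m t) x - \<delta> * div_h N (q t) x + \<delta> * \<eta> t x"
    and t: "t \<le> T"
  shows "(\<Sum>x\<in>ibox. (m t x)\<^sup>2) \<le> exp K_growth * ((\<Sum>x\<in>ibox. (m 0 x)\<^sup>2) +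
     \<delta> * (\<Sum>s<t. K_source * ((\<Sum>x\<in>ibox. (norm (q' s x))\<^sup>2) + (\<Sum>x\<in>ibox. (\<eta> s x)\<^sup>2))))"
proof (rule discrete_gronwall[where T = T and K = K_growth and a = "\<lambda>t. \<Sum>x\<in>ibox. (m t x)\<^sup>2"])
  fix s assume s: "s < T"
  have "(\<Sum>x\<in>ibox. (m (s + 1) x)\<^sup>2) \<le> (1 + \<delta>) * (\<Sum>x\<in>ibox. (m s x)\<^sup>2)
     + \<delta> * (1 / (2 * \<sigma>) * (\<Sum>x\<in>ibox. (norm (q s x))\<^sup>2) + (1 + 1 / (2 * \<theta> - 1)) * (\<Sum>x\<in>ibox. (\<eta> s x)\<^sup>2))"
    using s per delta sigma theta N eq[OF s] by (intro one_step_energy) auto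
  also have "(\<Sum>x\<in>ibox. (norm (q s x))\<^sup>2) \<le> 2 * M\<^sup>2 * (\<Sum>x\<in>ibox. (m s x)\<^sup>2) + 2 * (\<Sum>x\<in>ibox. (norm (q' s x))\<^sup>2)"
    unfolding sum_distrib_left sum.distrib[symmetric]
  proof (rule sum_mono)
    fix x
    have "(norm (q s x))\<^sup>2 \<le> (M * \<bar>m s x\<bar> + norm (q' s x))\<^sup>2"
      using q[OF s, of x] by (intro power_mono) auto
    also have "\<dots> \<le> 2 * (M * \<bar>m s x\<bar>)\<^sup>2 + 2 * (norm (q' s x))\<^sup>2"
      using sum_squares_bound[of "M * \<bar>m s x\<bar>" "norm (q' s x)"] by (simp add: power2_sum)
    finally show "(norm (q s x))\<^sup>2 \<le> 2 * M\<^sup>2 * (m s x)\<^sup>2 + 2 * (norm (q' s x))\<^sup>2"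
      by (simp add: power_mult_distrib)
  qed
  also have "(1 + \<delta>) * (\<Sum>x\<in>ibox. (m s x)\<^sup>2)
     + \<delta> * (1 / (2 * \<sigma>) * (2 * M\<^sup>2 * (\<Sum>x\<in>ibox. (m s x)\<^sup>2) + 2 * (\<Sum>x\<in>ibox. (norm (q' s x))\<^sup>2)) + (1 + 1 / (2 * \<theta> - 1)) * (\<Sum>x\<in>ibox. (\<eta> s x)\<^sup>2))
    = (1 + \<delta> * K_growth) * (\<Sum>x\<in>ibox. (m s x)\<^sup>2) + \<delta> * (1 / \<sigma> * (\<Sum>x\<in>ibox. (norm (q' s x))\<^sup>2) + (1 + 1 / (2 * \<theta> - 1)) * (\<Sum>x\<in>ibox. (\<eta> s x)\<^sup>2))"
    using sigma by (simp add: K_growth_def field_simps)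
  also have "\<dots> \<le> (1 + \<delta> * K_growth) * (\<Sum>x\<in>ibox. (m s x)\<^sup>2) + \<delta> * (K_source * ((\<Sum>x\<in>ibox. (norm (q' s x))\<^sup>2) + (\<Sum>x\<in>ibox. (\<eta> s x)\<^sup>2)))"
  proof (intro add_left_mono mult_left_mono)
    have "1 / \<sigma> * (\<Sum>x\<in>ibox. (norm (q' s x))\<^sup>2) \<le> K_source * (\<Sum>x\<in>ibox. (norm (q' s x))\<^sup>2)"
      "(1 + 1 / (2 * \<theta> - 1)) * (\<Sum>x\<in>ibox. (\<eta> s x)\<^sup>2) \<le> K_source * (\<Sum>x\<in>ibox. (\<eta> s x)\<^sup>2)"
      using sigma theta by (intro mult_right_mono sum_nonneg; simp add: K_source_def)+
    then show "1 / \<sigma> * (\<Sum>x\<in>ibox. (norm (q' s x))\<^sup>2) + (1 + 1 / (2 * \<theta> - 1)) * (\<Sum>x\<in>ibox. (\<eta> s x)\<^sup>2)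
      \<le> K_source * ((\<Sum>x\<in>ibox. (norm (q' s x))\<^sup>2) + (\<Sum>x\<in>ibox. (\<eta> s x)\<^sup>2))"
      by (simp add: algebra_simps)
  qed (use delta in simp)
  finally show "(\<Sum>x\<in>ibox. (m (s + 1) x)\<^sup>2) \<le> (1 + \<delta> * K_growth) * (\<Sum>x\<in>ibox. (m s x)\<^sup>2) +
     \<delta> * (K_source * ((\<Sum>x\<in>ibox. (norm (q' s x))\<^sup>2) + (\<Sum>x\<in>ibox. (\<eta> s x)\<^sup>2)))"
    using delta sigma by (simp add: add_left_mono mult_left_mono divide_right_mono)
qed (use delta K_pos t in \<open>auto intro!: sum_nonneg mult_nonneg_nonneg add_nonneg_nonneg\<close>)

text \<open>Backward induction in which each of the two half steps costs at most
  \<open>\<delta> * e\<close>, over \<open>T\<close> steps with \<open>\<delta> T = 1\<close>. In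
  the applications \<open>v\<close> is a velocity that is optimal for one of the two compared
  problems and linearizes the difference of the Hamiltonians from one side, so every two-sided
  estimate takes two comparisons with different \<open>v\<close>.\<close>

lemma comparison:
  fixes \<phi> \<omega> :: "nat \<Rightarrow> int ^ 'd \<Rightarrow> real" and v :: "nat \<Rightarrow> int ^ 'd \<Rightarrow> real ^ 'd"
  assumes per: "\<And>t. t < T \<Longrightarrow> \<omega> t \<in> grid_funs N" and v: "\<And>t x. t < T \<Longrightarrow> norm (v t x) \<le> M"
    and fin: "\<And>x. \<phi> T x \<le> 0"
    and half: "\<And>t x. t < T \<Longrightarrow> \<omega> t x - \<theta> * \<sigma> * \<delta> * lap (\<omega> t) x \<le> \<phi> (t + 1) x + \<delta> * e"
    and expl: "\<And>t x. t < T \<Longrightarrow> \<phi> t x \<le> \<omega> t x + (1 - \<theta>) * \<sigma> * \<delta> * lap (\<omega> t) x + \<delta> * (v t x \<bullet> nab (\<omega> t) x) + \<delta> * e"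
    and e: "0 \<le> e" and t: "t \<le> T"
  shows "\<phi> t x \<le> 2 * e" and "t < T \<Longrightarrow> \<omega> t x \<le> 2 * e"
proof -
  have *: "\<forall>x. \<phi> t x \<le> 2 * e * (\<delta> * real (T - t))" if "t \<le> T" for t
    using that
  proof (induction "T - t" arbitrary: t)
    case 0
    then show ?case using fin by auto
  next
    case (Suc k)
    then have tT: "t < T" by simp
    have IH: "\<phi> (t + 1) x \<le> 2 * e * (\<delta> * real (T - (t + 1)))" for x
      using Suc.hyps(1)[of "t + 1"] Suc.hyps(2) tT by simp
    have w: "\<omega> t x \<le> 2 * e * (\<delta> * real (T - (t + 1))) + \<delta> * e" for x
    proof (rule half_step_le[OF per[OF tT] N, of "\<theta> * \<sigma> * \<delta>"])
      show "0 \<le> \<theta> * \<sigma> * \<delta>" using theta sigma delta by (intro mult_nonneg_nonneg) auto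
      show "\<omega> t x - \<theta> * \<sigma> * \<delta> * lap (\<omega> t) x \<le> 2 * e * (\<delta> * real (T - (t + 1))) + \<delta> * e" for x
        using half[OF tT, of x] IH[of x] by linarith
    qed
    show ?case
    proof
      fix x
      have "\<omega> t x + ((1 - \<theta>) * \<sigma>) * \<delta> * lap (\<omega> t) x + \<delta> * (v t x \<bullet> nab (\<omega> t) x) \<le> 2 * e * (\<delta> * real (T - (t + 1))) + \<delta> * e"
        using N delta v[OF tT] drift_cfl cfl w by (intro explicit_step_le) auto
      with expl[OF tT, of x] have "\<phi> t x \<le> 2 * e * (\<delta> * real (T - (t + 1))) + \<delta> * e + \<delta> * e" by linarith
      also have "\<dots> = 2 * e * (\<delta> * real (T - t))"
      proof -
        have "real (T - t) = real (T - (t + 1)) + 1" using tT by (simp add: of_nat_diff)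
        then show ?thesis by (simp add: algebra_simps)
      qed
      finally show "\<phi> t x \<le> 2 * e * (\<delta> * real (T - t))" .
    qed
  qed
  have le: "2 * e * (\<delta> * real (T - t)) \<le> 2 * e" for t
  proof -
    have "\<delta> * real (T - t) \<le> 1" using T by (simp add: \<delta>_def field_simps)
    then show ?thesis using mult_left_mono[of "\<delta> * real (T - t)" 1 "2 * e"] e by simp
  qed
  show "\<phi> t x \<le> 2 * e" using *[OF t] le[of t] order_trans by blast
  assume tT: "t < T"
  show "\<omega> t x \<le> 2 * e"
  proof (rule half_step_le[OF per[OF tT] N, of "\<theta> * \<sigma> * \<delta>"])
    show "0 \<le> \<theta> * \<sigma> * \<delta>" using theta sigma delta by (intro mult_nonneg_nonneg) auto
    fix x
    have "\<phi> (t + 1) x \<le> 2 * e * (\<delta> * real (T - (t + 1)))" using *[of "t + 1"] tT by simp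
    with half[OF tT, of x] have "\<omega> t x - \<theta> * \<sigma> * \<delta> * lap (\<omega> t) x \<le> 2 * e * (\<delta> * real (T - (t + 1))) + \<delta> * e" by linarith
    also have "\<delta> * e \<le> 2 * e * \<delta>" using e delta by simp
    also have "2 * e * (\<delta> * real (T - (t + 1))) + 2 * e * \<delta> = 2 * e * (\<delta> * real (T - t))"
    proof -
      have "real (T - t) = real (T - (t + 1)) + 1" using tT by (simp add: of_nat_diff)
      then show ?thesis by (simp add: algebra_simps)
    qed
    also note le
    finally show "\<omega> t x - \<theta> * \<sigma> * \<delta> * lap (\<omega> t) x \<le> 2 * e" by simp
  qed
qed

text \<open>Pairs of a density and a flux \<open>w = m v\<close> with \<open>|v| \<le> M\<close> that satisfy the discrete
  Fokker-Planck equation; unlike the velocities, the fluxes may be averaged.\<close>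

definition adm :: "(nat \<Rightarrow> int ^ 'd \<Rightarrow> real) \<Rightarrow> (nat \<Rightarrow> int ^ 'd \<Rightarrow> real ^ 'd) \<Rightarrow> bool" where
  "adm m w \<longleftrightarrow> (\<forall>t\<le>T. m t \<in> prob_grid N) \<and> (\<forall>x. m 0 x = I_h N (m0c D) x) \<and>
     (\<forall>t<T. w t \<in> grid_funs N \<and> (\<forall>x. norm (w t x) \<le> M * m t x) \<and>
       (\<forall>x. m (t + 1) x - \<theta> * \<sigma> * \<delta> * lap (m (t + 1)) x =
          m t x + (1 - \<theta>) * \<sigma> * \<delta> * lap (m t) x - \<delta> * div_h N (w t) x))"

lemma admD:
  assumes "adm m w"
  shows "t \<le> T \<Longrightarrow> m t \<in> prob_grid N" "t \<le> T \<Longrightarrow> m t \<in> grid_funs N" "t \<le> T \<Longrightarrow> 0 \<le> m t x"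
    "t \<le> T \<Longrightarrow> (\<Sum>x\<in>ibox. m t x) = 1" "m 0 = I_h N (m0c D)" "t < T \<Longrightarrow> w t \<in> grid_funs N"
    "t < T \<Longrightarrow> norm (w t x) \<le> M * m t x"
    "t < T \<Longrightarrow> m (t + 1) x - \<theta> * \<sigma> * \<delta> * lap (m (t + 1)) x =
          m t x + (1 - \<theta>) * \<sigma> * \<delta> * lap (m t) x - \<delta> * div_h N (w t) x"
  using assms by (auto simp: adm_def prob_grid_def)

lemma adm_l2:
  assumes "adm m w" "t \<le> T"
  shows "l2 (m t) \<le> K_L2"
proof -
  have "(\<Sum>x\<in>ibox. (m t x)\<^sup>2) \<le> exp K_growth * ((\<Sum>x\<in>ibox. (m 0 x)\<^sup>2) +
     \<delta> * (\<Sum>s<t. K_source * ((\<Sum>x\<in>ibox. (norm (0 :: real ^ 'd))\<^sup>2) + (\<Sum>x\<in>ibox. 0\<^sup>2))))"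
    using admD[OF assms(1)] assms(2) by (intro energy_bound[where q = w]) auto
  also have "\<dots> = exp K_growth * (\<Sum>x\<in>ibox. (I_h N (m0c D) x)\<^sup>2)" using admD(5)[OF assms(1)] by simp
  also have "\<dots> \<le> exp K_growth * ((1 / real N) ^ CARD('d) * torus_integral (\<lambda>x. (m0c D x)\<^sup>2))"
    using torus N by (intro mult_left_mono I_h_square_sum) (auto simp: torus_data_def)
  finally have "real N ^ CARD('d) * (\<Sum>x\<in>ibox. (m t x)\<^sup>2) \<le>
      real N ^ CARD('d) * (exp K_growth * ((1 / real N) ^ CARD('d) * torus_integral (\<lambda>x. (m0c D x)\<^sup>2)))"
    by (rule mult_left_mono) simp
  also have "\<dots> = K_L2" using N by (simp add: K_L2_def power_one_over)
  finally show ?thesis unfolding l2_def .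
qed

lemma adm_le:
  assumes "adm m w" "t \<le> T" "x \<in> ibox"
  shows "m t x \<le> sqrt (K_L2 / real N ^ CARD('d))"
proof (rule real_le_rsqrt)
  have "(m t x)\<^sup>2 \<le> (\<Sum>x\<in>ibox. (m t x)\<^sup>2)" using assms(3) by (intro member_le_sum) auto
  also have "\<dots> \<le> K_L2 / real N ^ CARD('d)"
    using adm_l2[OF assms(1,2)] N unfolding l2_def by (simp add: field_simps)
  finally show "(m t x)\<^sup>2 \<le> K_L2 / real N ^ CARD('d)" .
qed

lemma adm_convex:
  assumes 1: "adm m1 w1" and 2: "adm m2 w2" and s: "s \<in> {0..1}"
    and m: "\<And>t x. t \<le> T \<Longrightarrow> m t x = (1 - s) * m1 t x + s * m2 t x"
    and w: "\<And>t x. t < T \<Longrightarrow> w t x = (1 - s) *\<^sub>R w1 t x + s *\<^sub>R w2 t x"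
  shows "adm m w"
proof -
  have m': "m t = (\<lambda>x. (1 - s) * m1 t x + s * m2 t x)" if "t \<le> T" for t using m[OF that] by auto
  have w': "w t = (\<lambda>x. (1 - s) *\<^sub>R w1 t x + s *\<^sub>R w2 t x)" if "t < T" for t using w[OF that] by auto
  have "m t \<in> prob_grid N" if "t \<le> T" for t
  proof -
    have "m t = (\<lambda>x. m1 t x + s * (m2 t x - m1 t x))" unfolding m'[OF that] by (simp add: algebra_simps)
    then show ?thesis using prob_grid_convex[OF N T le_refl admD(1)[OF 1 that] admD(1)[OF 2 that] s] by simp
  qed
  moreover have "m 0 x = I_h N (m0c D) x" for x
    using m[of 0 x] admD(5)[OF 1] admD(5)[OF 2] by (simp add: algebra_simps)
  moreover have "w t \<in> grid_funs N" if "t < T" for t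
    using admD(6)[OF 1 that] admD(6)[OF 2 that] unfolding w'[OF that] grid_funs_def by simp
  moreover have "norm (w t x) \<le> M * m t x" if "t < T" for t x
  proof -
    have "norm (w t x) \<le> norm ((1 - s) *\<^sub>R w1 t x) + norm (s *\<^sub>R w2 t x)"
      unfolding w[OF that] by (rule norm_triangle_ineq)
    also have "\<dots> \<le> (1 - s) * (M * m1 t x) + s * (M * m2 t x)"
      using s admD(7)[OF 1 that] admD(7)[OF 2 that] by (auto intro!: add_mono mult_left_mono)
    also have "\<dots> = M * m t x" using that by (simp add: m algebra_simps)
    finally show ?thesis .
  qed
  moreover have "m (t + 1) x - \<theta> * \<sigma> * \<delta> * lap (m (t + 1)) x =
          m t x + (1 - \<theta>) * \<sigma> * \<delta> * lap (m t) x - \<delta> * div_h N (w t) x" if t: "t < T" for t x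
  proof -
    have le: "t \<le> T" "t + 1 \<le> T" using t by auto
    have "m (t + 1) x - \<theta> * \<sigma> * \<delta> * lap (m (t + 1)) x =
      (1 - s) * (m1 (t + 1) x - \<theta> * \<sigma> * \<delta> * lap (m1 (t + 1)) x) + s * (m2 (t + 1) x - \<theta> * \<sigma> * \<delta> * lap (m2 (t + 1)) x)"
      unfolding m'[OF le(2)] laplacian_h_linear by (simp only: algebra_simps)
    also have "\<dots> = m t x + (1 - \<theta>) * \<sigma> * \<delta> * lap (m t) x - \<delta> * div_h N (w t) x"
      unfolding m'[OF le(1)] w'[OF t] laplacian_h_linear div_h_linear admD(8)[OF 1 t] admD(8)[OF 2 t]
      by (simp only: algebra_simps)
    finally show ?thesis .
  qed
  ultimately show ?thesis unfolding adm_def by blast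
qed

text \<open>Positivity passes through the explicit half by the step size conditions and through the
  implicit half by the maximum principle. Mass is conserved because Laplacian and divergence sum to
  zero over the torus.\<close>

lemma adm_FP:
  assumes FP: "FP D \<sigma> \<theta> T N v m" and v: "\<And>t x. t < T \<Longrightarrow> norm (v t x) \<le> M" "\<And>t. t < T \<Longrightarrow> v t \<in> grid_funs N"
    and w: "\<And>t x. t < T \<Longrightarrow> w t x = m t x *\<^sub>R v t x"
  shows "adm m w"
proof -
  have per: "m t \<in> grid_funs N" if "t \<le> T" for t using FP that by (auto simp: FP_def)
  have w': "w t = (\<lambda>x. m t x *\<^sub>R v t x)" if "t < T" for t using w[OF that] by auto
  have eq: "m (t + 1) x - \<theta> * \<sigma> * \<delta> * lap (m (t + 1)) x =
          m t x + (1 - \<theta>) * \<sigma> * \<delta> * lap (m t) x - \<delta> * div_h N (\<lambda>y. m t y *\<^sub>R v t y) x" if "t < T" for t x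
  proof -
    have "(m (t + 1) x - m t x) / \<delta>
          - \<theta> * \<sigma> * lap (m (t + 1)) x - (1 - \<theta>) * \<sigma> * lap (m t) x
          + div_h N (\<lambda>y. m t y *\<^sub>R v t y) x = 0"
      using FP that by (auto simp: FP_def \<delta>_def)
    then have "(m (t + 1) x - m t x) / \<delta> = 
          \<theta> * \<sigma> * lap (m (t + 1)) x + (1 - \<theta>) * \<sigma> * lap (m t) x - div_h N (\<lambda>y. m t y *\<^sub>R v t y) x" by linarith
    then have "m (t + 1) x - m t x = \<delta> * (\<theta> * \<sigma> * lap (m (t + 1)) x + (1 - \<theta>) * \<sigma> * lap (m t) x - div_h N (\<lambda>y. m t y *\<^sub>R v t y) x)"
      using delta by (simp add: divide_eq_eq mult.commute)
    then show ?thesis by (simp only: algebra_simps)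
  qed
  have init: "m 0 = I_h N (m0c D)" using FP by (auto simp: FP_def)
  have prob: "m t \<in> prob_grid N" if "t \<le> T" for t
    using that
  proof (induction t)
    case 0
    show ?case unfolding init using torus N by (intro I_h_prob) (auto simp: torus_data_def)
  next
    case (Suc t)
    then have t: "t < T" and IH: "m t \<in> prob_grid N" by auto
    have pq: "(\<lambda>y. m t y *\<^sub>R v t y) \<in> grid_funs N" using t per v by (intro grid_funs_scaleR) auto
    have "0 \<le> m (t + 1) x" for x
    proof (rule half_step_ge[OF per N, of _ "\<theta> * \<sigma> * \<delta>"])
      show "0 \<le> \<theta> * \<sigma> * \<delta>" using theta sigma delta by (intro mult_nonneg_nonneg) auto
      fix x
      have "0 \<le> m t x + ((1 - \<theta>) * \<sigma>) * \<delta> * lap (m t) x - \<delta> * div_h N (\<lambda>y. m t y *\<^sub>R v t y) x"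
        using N delta v(1)[OF t] drift_cfl cfl IH by (intro explicit_transport_nonneg) (auto simp: prob_grid_def)
      then show "0 \<le> m (t + 1) x - \<theta> * \<sigma> * \<delta> * lap (m (t + 1)) x" unfolding eq[OF t] .
    qed (use t in simp)
    moreover have "(\<Sum>x\<in>ibox. m (t + 1) x) = 1"
    proof -
      have "(\<Sum>x\<in>ibox. m (t + 1) x) = (\<Sum>x\<in>ibox. m (t + 1) x - \<theta> * \<sigma> * \<delta> * lap (m (t + 1)) x)"
        using sum_laplacian_zero[OF per[of "t + 1"] N] t by (simp add: sum_subtractf sum_distrib_left[symmetric])
      also have "\<dots> = (\<Sum>x\<in>ibox. m t x)"
        unfolding eq[OF t] using sum_laplacian_zero[OF per[of t] N] sum_div_zero[OF pq N] t
        by (simp add: sum_subtractf sum.distrib sum_distrib_left[symmetric] del: sum_divide_distrib)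
      finally show ?thesis using IH by (simp add: prob_grid_def)
    qed
    ultimately show ?case using per[of "t + 1"] t by (simp add: prob_grid_def)
  qed
  show ?thesis unfolding adm_def
  proof (intro conjI allI impI)
    fix t x assume t: "t < T"
    show "w t \<in> grid_funs N" unfolding w'[OF t] using t per v by (intro grid_funs_scaleR) auto
    have "\<bar>m t x\<bar> * norm (v t x) \<le> m t x * M"
      using prob[of t] t v(1)[OF t, of x] by (auto simp: prob_grid_def intro!: mult_left_mono)
    then show "norm (w t x) \<le> M * m t x" by (simp add: w[OF t] mult.commute)
    show "m (t + 1) x - \<theta> * \<sigma> * \<delta> * lap (m (t + 1)) x =
          m t x + (1 - \<theta>) * \<sigma> * \<delta> * lap (m t) x - \<delta> * div_h N (w t) x"
      unfolding w'[OF t] by (rule eq[OF t])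
  qed (use prob init in auto)
qed

text \<open>The backward scheme solved for \<open>u t\<close>, with the half-step values
  \<open>\<omega>\<close> named; \<open>HJB\<close> only asserts that they exist.\<close>

definition backward :: "(nat \<Rightarrow> int ^ 'd \<Rightarrow> real) \<Rightarrow> (nat \<Rightarrow> int ^ 'd \<Rightarrow> real) \<Rightarrow> (nat \<Rightarrow> int ^ 'd \<Rightarrow> real) \<Rightarrow> bool" where
  "backward \<mu> u \<omega> \<longleftrightarrow> (\<forall>x. u T x = gc D (gpoint N x)) \<and>
     (\<forall>t<T. \<omega> t \<in> grid_funs N \<and> (\<forall>x. \<omega> t x - \<theta> * \<sigma> * \<delta> * lap (\<omega> t) x = u (t + 1) x) \<and>
       (\<forall>x. u t x = \<omega> t x + (1 - \<theta>) * \<sigma> * \<delta> * lap (\<omega> t) x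
          + \<delta> * (f_h D T N t x (\<mu> t) - H_h D T N t x (nab (\<omega> t) x))))"

definition vel :: "(nat \<Rightarrow> int ^ 'd \<Rightarrow> real) \<Rightarrow> nat \<Rightarrow> int ^ 'd \<Rightarrow> real ^ 'd" where
  "vel \<omega> t x = opt_vel (tau t) (gpoint N x) (nab (\<omega> t) x)"

lemma HJB_backward:
  assumes HJB: "HJB D \<sigma> \<theta> T N \<mu> u"
  obtains \<omega> where "backward \<mu> u \<omega>" "\<And>v t x. V D \<sigma> \<theta> T N u v \<Longrightarrow> t < T \<Longrightarrow> v t x = vel \<omega> t x"
proof -
  have "\<forall>t\<in>{..<T}. \<exists>w. half_step \<sigma> \<theta> T N (u (t + 1)) w \<and>
        (\<forall>x. - (w x - u t x) / \<delta> - (1 - \<theta>) * \<sigma> * lap w x + H_h D T N t x (nab w x) = f_h D T N t x (\<mu> t))"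
    using HJB by (auto simp: HJB_def \<delta>_def)
  from bchoice[OF this] obtain \<omega> where \<omega>: "\<And>t. t < T \<Longrightarrow> half_step \<sigma> \<theta> T N (u (t + 1)) (\<omega> t)"
    and eq: "\<And>t x. t < T \<Longrightarrow> - (\<omega> t x - u t x) / \<delta> - (1 - \<theta>) * \<sigma> * lap (\<omega> t) x + H_h D T N t x (nab (\<omega> t) x) = f_h D T N t x (\<mu> t)"
    by auto
  have "u t x = \<omega> t x + (1 - \<theta>) * \<sigma> * \<delta> * lap (\<omega> t) x
          + \<delta> * (f_h D T N t x (\<mu> t) - H_h D T N t x (nab (\<omega> t) x))" if t: "t < T" for t x
  proof -
    have "- (\<omega> t x - u t x) / \<delta> = (u t x - \<omega> t x) / \<delta>" by simp
    then have "(u t x - \<omega> t x) / \<delta> = (1 - \<theta>) * \<sigma> * lap (\<omega> t) x + f_h D T N t x (\<mu> t) - H_h D T N t x (nab (\<omega> t) x)"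
      using eq[OF t, of x] by linarith
    then have "u t x - \<omega> t x = \<delta> * ((1 - \<theta>) * \<sigma> * lap (\<omega> t) x + f_h D T N t x (\<mu> t) - H_h D T N t x (nab (\<omega> t) x))"
      using delta by (simp add: divide_eq_eq mult.commute)
    then show ?thesis by (simp only: algebra_simps)
  qed
  then have "backward \<mu> u \<omega>"
    using HJB \<omega> by (auto simp: backward_def half_step_def HJB_def \<delta>_def)
  moreover have "v t x = vel \<omega> t x" if v: "V D \<sigma> \<theta> T N u v" and t: "t < T" for v t x
  proof -
    obtain w where w: "half_step \<sigma> \<theta> T N (u (t + 1)) w" and vx: "\<And>x. v t x = - grad (H_h D T N t x) (nab w x)"
      using v t by (auto simp: V_def)
    \<comment> \<open>\<open>V\<close> asserts a half-step value of its own. Uniqueness for the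
      implicit equation, from the maximum principle, identifies it with
      \<open>\<omega> t\<close>.\<close>
    have "w y - \<omega> t y = 0" for y
    proof (rule antisym)
      have g: "(\<lambda>y. w y - \<omega> t y) \<in> grid_funs N"
        using w \<omega>[OF t] by (intro grid_funs_diff) (auto simp: half_step_def)
      have z: "(w y - \<omega> t y) - \<theta> * \<sigma> * \<delta> * lap (\<lambda>y. w y - \<omega> t y) y = 0" for y
      proof -
        have "w y - \<theta> * \<sigma> * \<delta> * lap w y = u (t + 1) y" "\<omega> t y - \<theta> * \<sigma> * \<delta> * lap (\<omega> t) y = u (t + 1) y"
          using w \<omega>[OF t] by (auto simp: half_step_def \<delta>_def)
        then show ?thesis unfolding laplacian_h_linear right_diff_distrib by linarith
      qed
      have k: "0 \<le> \<theta> * \<sigma> * \<delta>" using theta sigma delta by (intro mult_nonneg_nonneg) auto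
      show "w y - \<omega> t y \<le> 0" by (rule half_step_le[OF g N k]) (simp add: z)
      show "0 \<le> w y - \<omega> t y" by (rule half_step_ge[OF g N k]) (simp add: z)
    qed
    then have "w = \<omega> t" by (simp add: fun_eq_iff)
    then show ?thesis unfolding vx vel_def using grad_H_h[of t T N x] t T by simp
  qed
  ultimately show ?thesis by (rule that)
qed

lemma vel_max: "t \<le> T \<Longrightarrow> legendre_max (lc D (tau t) (gpoint N x)) (alpha D) (cball 0 M) (nab (\<omega> t) x) (vel \<omega> t x)"
  unfolding vel_def by (rule opt_vel[OF tau])

lemma vel_norm: "t \<le> T \<Longrightarrow> norm (vel \<omega> t x) \<le> M"
  using legendre_maxD(2)[OF vel_max, of t] by simp

lemma vel_periodic:
  assumes "t \<le> T" "\<omega> t \<in> grid_funs N"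
  shows "vel \<omega> t \<in> grid_funs N"
  unfolding grid_funs_def vel_def
proof safe
  fix x :: "int ^ 'd" and j
  have gp: "gpoint N (x + axis j (int N)) = gpoint N x + axis j 1"
    using N by (simp add: gpoint_def vec_eq_iff axis_def add_divide_distrib)
  show "opt_vel (tau t) (gpoint N (x + axis j (int N))) (nab (\<omega> t) (x + axis j (int N))) =
      opt_vel (tau t) (gpoint N x) (nab (\<omega> t) x)"
    unfolding gp opt_vel_periodic[OF tau[OF assms(1)]] grid_funsD[OF grid_funs_nabla[OF assms(2)]] ..
qed

lemma H_h_vel:
  "t \<le> T \<Longrightarrow> H_h D T N t x (nab (\<omega> t) x) = - (nab (\<omega> t) x \<bullet> vel \<omega> t x) - lc D (tau t) (gpoint N x) (vel \<omega> t x)"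
  unfolding vel_def by (rule H_h_eq[OF _ T])

end

section \<open>The discrete control problem\<close>

context theta_data
begin

definition "fw_const = 8 * L_f D * sqrt K_L2"

text \<open>The first entry bounds the gap after the first best response; the second, four times the
  curvature constant, is what the induction on \<open>gap_const / k\<close> consumes.\<close>

definition "gap_const = max (4 * L_f D * real CARD('d)) (4 * fw_const)"

lemma gap_const_pos: "gap_const > 0"
  using consts_pos by (simp add: gap_const_def less_max_iff_disj)

end

context scheme
begin

text \<open>The perspective function of the Lagrangian. The constraint on the velocity, infinite
  cost in \<open>l_tilde\<close>, is carried by \<open>adm\<close>, so that real numbers suffice
  here.\<close>

definition run_cost :: "nat \<Rightarrow> int ^ 'd \<Rightarrow> real \<Rightarrow> real ^ 'd \<Rightarrow> real" where
  "run_cost t x m w = (if m = 0 then 0 else m * lc D (tau t) (gpoint N x) ((1 / m) *\<^sub>R w))"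

definition total_cost :: "(nat \<Rightarrow> int ^ 'd \<Rightarrow> real) \<Rightarrow> (nat \<Rightarrow> int ^ 'd \<Rightarrow> real ^ 'd) \<Rightarrow> real" where
  "total_cost m w = \<delta> * (\<Sum>t<T. \<Sum>x\<in>ibox. run_cost t x (m t x) (w t x)) +
     \<delta> * (\<Sum>t<T. F_h D T N t (m t)) + (\<Sum>x\<in>ibox. gc D (gpoint N x) * m T x)"

lemma J_tilde_eq:
  assumes "adm m w"
  shows "J_tilde D T N m w = ereal (total_cost m w)"
proof -
  have "l_tilde D T N m w t x = ereal (run_cost t x (m t x) (w t x))" if t: "t < T" for t x
  proof (cases "m t x = 0")
    case True
    then have "w t x = 0" using admD(7)[OF assms t, of x] by simp
    then show ?thesis using True by (simp add: l_tilde_def run_cost_def zero_ereal_def)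
  next
    case False
    then have pos: "m t x > 0" using admD(3)[OF assms, of t x] t by simp
    have "norm ((1 / m t x) *\<^sub>R w t x) \<le> M"
      using admD(7)[OF assms t, of x] pos by (simp add: pos_divide_le_eq)
    then show ?thesis using False by (simp add: l_tilde_def run_cost_def l_h_def mult.commute)
  qed
  then have "(\<Sum>t<T. \<Sum>x\<in>ibox. l_tilde D T N m w t x) = (\<Sum>t<T. \<Sum>x\<in>ibox. ereal (run_cost t x (m t x) (w t x)))"
    by (intro sum.cong refl) auto
  also have "\<dots> = ereal (\<Sum>t<T. \<Sum>x\<in>ibox. run_cost t x (m t x) (w t x))" by simp
  finally show ?thesis by (simp add: J_tilde_def total_cost_def \<delta>_def)
qed

text \<open>\<open>m |v - z|\<^sup>2\<close> in terms of the flux \<open>w = m v\<close>.\<close>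

definition quad :: "real \<Rightarrow> real ^ 'd \<Rightarrow> real ^ 'd \<Rightarrow> real" where
  "quad m w z = (if m = 0 then 0 else (norm (w - m *\<^sub>R z))\<^sup>2 / m)"

text \<open>The Fenchel-Young gap between Lagrangian and Hamiltonian in perspective form. For a flux
  within the velocity constraint it is nonnegative, and it vanishes when the velocity is the optimal
  one for \<open>nab (\<omega> t)\<close>.\<close>

definition defect :: "(nat \<Rightarrow> int ^ 'd \<Rightarrow> real) \<Rightarrow> nat \<Rightarrow> int ^ 'd \<Rightarrow> real \<Rightarrow> real ^ 'd \<Rightarrow> real" where
  "defect \<omega> t x m w = run_cost t x m w + H_h D T N t x (nab (\<omega> t) x) * m + nab (\<omega> t) x \<bullet> w"

lemma quad_nonneg: "0 \<le> m \<Longrightarrow> 0 \<le> quad m w z"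
  by (simp add: quad_def)

lemma quad_eq: "norm w \<le> M * m \<Longrightarrow> (norm (w - m *\<^sub>R z))\<^sup>2 = m * quad m w z"
  by (auto simp: quad_def)

lemma defect_ge:
  assumes t: "t < T" and m: "0 \<le> m" and w: "norm w \<le> M * m"
  shows "alpha D / 2 * quad m w (vel \<omega> t x) \<le> defect \<omega> t x m w"
proof (cases "m = 0")
  case True
  then show ?thesis using w by (simp add: quad_def defect_def run_cost_def)
next
  case False
  then have pos: "m > 0" using m by simp
  let ?v = "(1 / m) *\<^sub>R w" and ?V = "vel \<omega> t x" and ?p = "nab (\<omega> t) x" and ?l = "lc D (tau t) (gpoint N x)"
  have "norm ?v \<le> M" using w pos by (simp add: pos_divide_le_eq)
  then have "- (?p \<bullet> ?v) - ?l ?v + alpha D / 2 * (norm (?v - ?V))\<^sup>2 \<le> - (?p \<bullet> ?V) - ?l ?V"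
    using legendre_maxD(1)[OF vel_max[of t x \<omega>], of ?v] t by simp
  also have "\<dots> = H_h D T N t x ?p" using H_h_vel[of t x \<omega>] t by simp
  finally have "alpha D / 2 * (norm (?v - ?V))\<^sup>2 \<le> ?l ?v + H_h D T N t x ?p + ?p \<bullet> ?v" by linarith
  then have *: "m * (alpha D / 2 * (norm (?v - ?V))\<^sup>2) \<le> m * (?l ?v + H_h D T N t x ?p + ?p \<bullet> ?v)"
    using m by (rule mult_left_mono)
  have "w - m *\<^sub>R ?V = m *\<^sub>R (?v - ?V)" using pos by (simp add: scaleR_diff_right)
  then have "(norm (w - m *\<^sub>R ?V))\<^sup>2 = m\<^sup>2 * (norm (?v - ?V))\<^sup>2" by (simp add: power_mult_distrib)
  then have "quad m w ?V = m * (norm (?v - ?V))\<^sup>2" using pos by (simp add: quad_def power2_eq_square)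
  moreover have "m * (?p \<bullet> ?v) = ?p \<bullet> w" using pos by simp
  ultimately show ?thesis using * False by (simp add: defect_def run_cost_def algebra_simps)
qed

lemma defect_nonneg: "t < T \<Longrightarrow> 0 \<le> m \<Longrightarrow> norm w \<le> M * m \<Longrightarrow> 0 \<le> defect \<omega> t x m w"
  using defect_ge[of t m w \<omega> x] quad_nonneg[of m w "vel \<omega> t x"] consts_pos
  by (metis order_trans half_gt_zero less_imp_le mult_nonneg_nonneg)

lemma defect_vel:
  assumes t: "t < T"
  shows "defect \<omega> t x m (m *\<^sub>R vel \<omega> t x) = 0"
  using t by (simp add: defect_def run_cost_def H_h_vel algebra_simps)

section \<open>The linearized cost and its minimization by best responses\<close>

definition lin_cost :: "(nat \<Rightarrow> int ^ 'd \<Rightarrow> real) \<Rightarrow> (nat \<Rightarrow> int ^ 'd \<Rightarrow> real) \<Rightarrow> (nat \<Rightarrow> int ^ 'd \<Rightarrow> real ^ 'd) \<Rightarrow> real" where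
  "lin_cost \<mu> m w = \<delta> * (\<Sum>t<T. \<Sum>x\<in>ibox. run_cost t x (m t x) (w t x)) +
     \<delta> * (\<Sum>t<T. \<Sum>x\<in>ibox. f_h D T N t x (\<mu> t) * m t x) + (\<Sum>x\<in>ibox. gc D (gpoint N x) * m T x)"

text \<open>Telescoping the one-step duality turns the cost into a term fixed by the initial datum
  plus the accumulated defects. Competing pairs therefore differ by their defects alone, and a best
  response has none.\<close>

lemma lin_cost_duality:
  assumes "adm m w" "backward \<mu> u \<omega>"
  shows "lin_cost \<mu> m w = (\<Sum>x\<in>ibox. u 0 x * I_h N (m0c D) x) +
     \<delta> * (\<Sum>t<T. \<Sum>x\<in>ibox. defect \<omega> t x (m t x) (w t x))"
proof -
  define a where "a t = (\<Sum>x\<in>ibox. u t x * m t x)" for t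
  have step: "a (Suc t) - a t = \<delta> * (\<Sum>x\<in>ibox. nab (\<omega> t) x \<bullet> w t x
      - (f_h D T N t x (\<mu> t) - H_h D T N t x (nab (\<omega> t) x)) * m t x)" if t: "t < T" for t
  proof -
    have "a (t + 1) - a t = \<delta> * ((\<Sum>x\<in>ibox. nab (\<omega> t) x \<bullet> w t x) -
      (\<Sum>x\<in>ibox. (f_h D T N t x (\<mu> t) - H_h D T N t x (nab (\<omega> t) x)) * m t x)
       + (\<Sum>x\<in>ibox. \<omega> t x * 0) - (\<Sum>x\<in>ibox. 0 * m (t + 1) x))"
      unfolding a_def
      by (rule one_step_duality[where b = "\<theta> * \<sigma> * \<delta>" and a = "(1 - \<theta>) * \<sigma> * \<delta>"])
        (use assms t N admD[OF assms(1)] in \<open>auto simp: backward_def\<close>)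
    then show ?thesis by (simp add: sum_subtractf)
  qed
  have "a T - a 0 = (\<Sum>t<T. a (Suc t) - a t)" by (rule sum_lessThan_telescope[symmetric])
  also have "\<dots> = \<delta> * (\<Sum>t<T. \<Sum>x\<in>ibox. nab (\<omega> t) x \<bullet> w t x
      - (f_h D T N t x (\<mu> t) - H_h D T N t x (nab (\<omega> t) x)) * m t x)"
    unfolding sum_distrib_left by (intro sum.cong refl) (simp add: step sum_distrib_left)
  finally have *: "a T - a 0 = \<dots>" .
  have "a T = (\<Sum>x\<in>ibox. gc D (gpoint N x) * m T x)" using assms(2) by (simp add: a_def backward_def)
  moreover have "a 0 = (\<Sum>x\<in>ibox. u 0 x * I_h N (m0c D) x)" using admD(5)[OF assms(1)] by (simp add: a_def)
  moreover have "(\<Sum>t<T. \<Sum>x\<in>ibox. defect \<omega> t x (m t x) (w t x)) =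
     (\<Sum>t<T. \<Sum>x\<in>ibox. run_cost t x (m t x) (w t x)) + (\<Sum>t<T. \<Sum>x\<in>ibox. f_h D T N t x (\<mu> t) * m t x)
     + (\<Sum>t<T. \<Sum>x\<in>ibox. nab (\<omega> t) x \<bullet> w t x - (f_h D T N t x (\<mu> t) - H_h D T N t x (nab (\<omega> t) x)) * m t x)"
    unfolding sum.distrib[symmetric] by (intro sum.cong refl) (simp add: defect_def algebra_simps)
  ultimately show ?thesis using * by (simp add: lin_cost_def algebra_simps)
qed

lemma lin_cost_le:
  assumes m: "adm m w" and b: "backward \<mu> u \<omega>" and m': "adm m' w'"
    and w: "\<And>t x. t < T \<Longrightarrow> w t x = m t x *\<^sub>R vel \<omega> t x"
  shows "lin_cost \<mu> m w \<le> lin_cost \<mu> m' w'"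
    and "\<delta> * (\<Sum>t<T. \<Sum>x\<in>ibox. alpha D / 2 * quad (m' t x) (w' t x) (vel \<omega> t x)) \<le> lin_cost \<mu> m' w' - lin_cost \<mu> m w"
proof -
  have "(\<Sum>t<T. \<Sum>x\<in>ibox. defect \<omega> t x (m t x) (w t x)) = 0"
    by (intro sum.neutral ballI) (simp add: w defect_vel)
  then have 1: "lin_cost \<mu> m' w' - lin_cost \<mu> m w = \<delta> * (\<Sum>t<T. \<Sum>x\<in>ibox. defect \<omega> t x (m' t x) (w' t x))"
    unfolding lin_cost_duality[OF m b] lin_cost_duality[OF m' b] by simp
  have "(\<Sum>t<T. \<Sum>x\<in>ibox. alpha D / 2 * quad (m' t x) (w' t x) (vel \<omega> t x)) \<le> (\<Sum>t<T. \<Sum>x\<in>ibox. defect \<omega> t x (m' t x) (w' t x))"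
    using admD(3,7)[OF m'] by (intro sum_mono defect_ge) auto
  then show 2: "\<delta> * (\<Sum>t<T. \<Sum>x\<in>ibox. alpha D / 2 * quad (m' t x) (w' t x) (vel \<omega> t x)) \<le> lin_cost \<mu> m' w' - lin_cost \<mu> m w"
    unfolding 1 using delta by (intro mult_left_mono) auto
  have "0 \<le> (\<Sum>t<T. \<Sum>x\<in>ibox. defect \<omega> t x (m' t x) (w' t x))"
    using admD(3,7)[OF m'] by (intro sum_nonneg defect_nonneg) auto
  then show "lin_cost \<mu> m w \<le> lin_cost \<mu> m' w'" using 1 delta by (simp add: algebra_simps)
qed

text \<open>The tangent of the Lagrangian at the averaged velocity \<open>v0\<close> gives a
  minorant of the perspective that is linear in \<open>(m, w)\<close> and touches at the averaged
  point; averaging the minorant is the claim. At zero density the flux bound forces zero flux, which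
  settles the degenerate case.\<close>

lemma run_cost_convex:
  assumes t: "t \<le> T" and s: "s \<in> {0..1}" and m: "0 \<le> m1" "0 \<le> m2" and w: "norm w1 \<le> M * m1" "norm w2 \<le> M * m2"
  shows "run_cost t x ((1 - s) * m1 + s * m2) ((1 - s) *\<^sub>R w1 + s *\<^sub>R w2) \<le>
    (1 - s) * run_cost t x m1 w1 + s * run_cost t x m2 w2"
proof -
  let ?l = "lc D (tau t) (gpoint N x)"
  define m0 where "m0 = (1 - s) * m1 + s * m2"
  define w0 where "w0 = (1 - s) *\<^sub>R w1 + s *\<^sub>R w2"
  interpret l: strongly_convex_function ?l "grad ?l" "alpha D" by (rule lc_strongly_convex[OF tau[OF t]])
  define v0 where "v0 = (1 / m0) *\<^sub>R w0"
  define G where "G = grad ?l v0"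
  have tangent: "m * (?l v0 - G \<bullet> v0) + G \<bullet> w \<le> run_cost t x m w" if "0 \<le> m" "norm w \<le> M * m" for m w
  proof (cases "m = 0")
    case True
    then show ?thesis using that by (simp add: run_cost_def)
  next
    case False
    then have pos: "m > 0" using that by simp
    have "0 \<le> alpha D / 2 * (norm ((1 / m) *\<^sub>R w - v0))\<^sup>2" using consts_pos by simp
    then have "?l v0 + G \<bullet> ((1 / m) *\<^sub>R w - v0) \<le> ?l ((1 / m) *\<^sub>R w)"
      using l.lower[of v0 "(1 / m) *\<^sub>R w"] unfolding G_def by linarith
    then have "m * (?l v0 + G \<bullet> ((1 / m) *\<^sub>R w - v0)) \<le> m * ?l ((1 / m) *\<^sub>R w)" using pos by simp
    moreover have "m * (?l v0 + G \<bullet> ((1 / m) *\<^sub>R w - v0)) = m * (?l v0 - G \<bullet> v0) + G \<bullet> w"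
      using pos by (simp add: inner_diff_right algebra_simps)
    ultimately show ?thesis using False by (simp add: run_cost_def)
  qed
  have "run_cost t x m0 w0 = m0 * (?l v0 - G \<bullet> v0) + G \<bullet> w0"
  proof (cases "m0 = 0")
    case True
    have "norm w0 \<le> (1 - s) * norm w1 + s * norm w2"
      unfolding w0_def using norm_triangle_ineq[of "(1 - s) *\<^sub>R w1" "s *\<^sub>R w2"] s by simp
    also have "\<dots> \<le> (1 - s) * (M * m1) + s * (M * m2)" using w s by (intro add_mono mult_left_mono) auto
    also have "\<dots> = M * m0" by (simp add: m0_def algebra_simps)
    finally have "w0 = 0" using True by simp
    then show ?thesis using True by (simp add: run_cost_def)
  next
    case False
    then show ?thesis by (simp add: run_cost_def v0_def algebra_simps)
  qed
  also have "\<dots> = (1 - s) * (m1 * (?l v0 - G \<bullet> v0) + G \<bullet> w1) + s * (m2 * (?l v0 - G \<bullet> v0) + G \<bullet> w2)"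
    by (simp add: m0_def w0_def inner_add_right algebra_simps)
  also have "\<dots> \<le> (1 - s) * run_cost t x m1 w1 + s * run_cost t x m2 w2"
    using tangent[OF m(1) w(1)] tangent[OF m(2) w(2)] s by (intro add_mono mult_left_mono) auto
  finally show ?thesis by (simp add: m0_def w0_def)
qed

section \<open>The optimality gap along the Frank-Wolfe iteration\<close>

definition equilibrium :: "(nat \<Rightarrow> int ^ 'd \<Rightarrow> real) \<Rightarrow> (nat \<Rightarrow> int ^ 'd \<Rightarrow> real ^ 'd) \<Rightarrow>
    (nat \<Rightarrow> int ^ 'd \<Rightarrow> real) \<Rightarrow> (nat \<Rightarrow> int ^ 'd \<Rightarrow> real) \<Rightarrow> bool" where
  "equilibrium m w u \<omega> \<longleftrightarrow> adm m w \<and> backward m u \<omega> \<and> (\<forall>t<T. \<forall>x. w t x = m t x *\<^sub>R vel \<omega> t x)"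

lemma F_h_diff:
  assumes C: "assumption_C D" and m: "adm m w" and m': "adm m' w'"
  shows "\<delta> * (\<Sum>t<T. \<Sum>x\<in>ibox. f_h D T N t x (m t) * (m' t x - m t x)) \<le> \<delta> * (\<Sum>t<T. F_h D T N t (m' t)) - \<delta> * (\<Sum>t<T. F_h D T N t (m t))"
proof -
  have "(\<Sum>t<T. \<Sum>x\<in>ibox. f_h D T N t x (m t) * (m' t x - m t x)) \<le> (\<Sum>t<T. F_h D T N t (m' t) - F_h D T N t (m t))"
    using admD(1)[OF m] admD(1)[OF m'] by (intro sum_mono F_h_bounds(1)[OF N T _ C]) auto
  then show ?thesis using delta mult_left_mono[of _ _ \<delta>] by (fastforce simp: sum_subtractf right_diff_distrib)
qed

text \<open>The equilibrium is a best response to itself, so the linearized excess over it controls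
  \<open>quad\<close>; convexity of the potential turns this into an excess of the true cost. The
  second part is the Frank-Wolfe certificate: linearizing at the current iterate bounds the gap from
  above.\<close>

lemma cost_gap_ge:
  assumes C: "assumption_C D" and e: "equilibrium mh wh uh \<omega>h" and m: "adm m w"
  shows "\<delta> * (\<Sum>t<T. \<Sum>x\<in>ibox. alpha D / 2 * quad (m t x) (w t x) (vel \<omega>h t x)) \<le> total_cost m w - total_cost mh wh"
    and "lin_cost m mh wh - lin_cost m m w \<le> total_cost mh wh - total_cost m w"
proof -
  have mh: "adm mh wh" using e by (simp add: equilibrium_def)
  have "\<delta> * (\<Sum>t<T. \<Sum>x\<in>ibox. alpha D / 2 * quad (m t x) (w t x) (vel \<omega>h t x)) \<le> lin_cost mh m w - lin_cost mh mh wh"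
    using e by (intro lin_cost_le(2)[OF _ _ m]) (auto simp: equilibrium_def)
  also have "\<dots> \<le> total_cost m w - total_cost mh wh"
    using F_h_diff[OF C mh m]
    by (simp add: lin_cost_def total_cost_def right_diff_distrib sum_subtractf)
  finally show "\<delta> * (\<Sum>t<T. \<Sum>x\<in>ibox. alpha D / 2 * quad (m t x) (w t x) (vel \<omega>h t x)) \<le> total_cost m w - total_cost mh wh" .
  show "lin_cost m mh wh - lin_cost m m w \<le> total_cost mh wh - total_cost m w"
    using F_h_diff[OF C m mh]
    by (simp add: lin_cost_def total_cost_def right_diff_distrib sum_subtractf)
qed

text \<open>Curvature of the potential: the second-order term is a product of an L2-distance, at
  most \<open>2 * sqrt K_L2\<close>, and an l1-distance, at most 2, both scaled by \<open>s\<close>.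
  Only the L2 bound for admissible densities enters, so the constant does not depend on the
  grid.\<close>

lemma F_h_upper:
  assumes C: "assumption_C D" and m: "adm m w" and mb: "adm mb wb" and s: "s \<in> {0..1}" and t: "t \<le> T"
    and m': "m' t = (\<lambda>x. (1 - s) * m t x + s * mb t x)" 
  shows "F_h D T N t (m' t) - F_h D T N t (m t) \<le> s * (\<Sum>x\<in>ibox. f_h D T N t x (m t) * (mb t x - m t x)) + s\<^sup>2 * fw_const"
proof -
  have d: "m' t x - m t x = s * (mb t x - m t x)" for x by (simp add: m' algebra_simps)
  have pm': "m' t \<in> prob_grid N"
  proof -
    have "m' t = (\<lambda>x. m t x + s * (mb t x - m t x))" unfolding m' by (simp add: algebra_simps)
    then show ?thesis using prob_grid_convex[OF N T t admD(1)[OF m t] admD(1)[OF mb t] s] by simp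
  qed
  have l2d: "real N ^ CARD('d) * (\<Sum>x\<in>ibox. (mb t x - m t x)\<^sup>2) \<le> 4 * K_L2"
  proof -
    have "(\<Sum>x\<in>ibox. (mb t x - m t x)\<^sup>2) \<le> (\<Sum>x\<in>ibox. 2 * (mb t x)\<^sup>2 + 2 * (m t x)\<^sup>2)"
    proof (rule sum_mono)
      fix x have "0 \<le> (mb t x + m t x)\<^sup>2" by simp
      then show "(mb t x - m t x)\<^sup>2 \<le> 2 * (mb t x)\<^sup>2 + 2 * (m t x)\<^sup>2" by (simp add: power2_eq_square algebra_simps)
    qed
    then have "real N ^ CARD('d) * (\<Sum>x\<in>ibox. (mb t x - m t x)\<^sup>2) \<le> real N ^ CARD('d) * (\<Sum>x\<in>ibox. 2 * (mb t x)\<^sup>2 + 2 * (m t x)\<^sup>2)"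
      by (rule mult_left_mono) simp
    also have "\<dots> = 2 * l2 (mb t) + 2 * l2 (m t)" by (simp add: l2_def sum.distrib sum_distrib_left[symmetric] algebra_simps)
    also have "\<dots> \<le> 4 * K_L2" using adm_l2[OF m t] adm_l2[OF mb t] by simp
    finally show ?thesis .
  qed
  have l1d: "(\<Sum>x\<in>ibox. \<bar>mb t x - m t x\<bar>) \<le> 2"
  proof -
    have "(\<Sum>x\<in>ibox. \<bar>mb t x - m t x\<bar>) \<le> (\<Sum>x\<in>ibox. mb t x + m t x)"
      using admD(3)[OF m t] admD(3)[OF mb t] by (intro sum_mono) (simp add: abs_le_iff add_increasing add_increasing2)
    then show ?thesis using admD(4)[OF m t] admD(4)[OF mb t] by (simp add: sum.distrib)
  qed
  have "F_h D T N t (m' t) - F_h D T N t (m t) \<le> (\<Sum>x\<in>ibox. f_h D T N t x (m t) * (m' t x - m t x)) +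
      L_f D * sqrt (real N ^ CARD('d) * (\<Sum>x\<in>ibox. (m' t x - m t x)\<^sup>2)) * (\<Sum>x\<in>ibox. \<bar>m' t x - m t x\<bar>)"
    by (rule F_h_bounds(2)[OF N T t C admD(1)[OF m t] pm'])
  also have "(\<Sum>x\<in>ibox. f_h D T N t x (m t) * (m' t x - m t x)) = s * (\<Sum>x\<in>ibox. f_h D T N t x (m t) * (mb t x - m t x))"
    unfolding d sum_distrib_left by (intro sum.cong refl) simp
  also have "sqrt (real N ^ CARD('d) * (\<Sum>x\<in>ibox. (m' t x - m t x)\<^sup>2)) = s * sqrt (real N ^ CARD('d) * (\<Sum>x\<in>ibox. (mb t x - m t x)\<^sup>2))"
    unfolding d power_mult_distrib sum_distrib_left[symmetric] using s by (simp add: real_sqrt_mult mult.left_commute)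
  also have "(\<Sum>x\<in>ibox. \<bar>m' t x - m t x\<bar>) = s * (\<Sum>x\<in>ibox. \<bar>mb t x - m t x\<bar>)"
    unfolding d abs_mult sum_distrib_left[symmetric] using s by simp
  also have "L_f D * (s * sqrt (real N ^ CARD('d) * (\<Sum>x\<in>ibox. (mb t x - m t x)\<^sup>2))) * (s * (\<Sum>x\<in>ibox. \<bar>mb t x - m t x\<bar>))
     \<le> L_f D * (s * sqrt (4 * K_L2)) * (s * 2)"
  proof -
    have "L_f D * (s * sqrt (real N ^ CARD('d) * (\<Sum>x\<in>ibox. (mb t x - m t x)\<^sup>2))) \<le> L_f D * (s * sqrt (4 * K_L2))"
      using s consts_pos by (intro mult_left_mono real_sqrt_le_mono l2d) auto
    moreover have "s * (\<Sum>x\<in>ibox. \<bar>mb t x - m t x\<bar>) \<le> s * 2" using s l1d by (intro mult_left_mono) auto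
    moreover have "0 \<le> L_f D * (s * sqrt (4 * K_L2))" using s K_pos consts_pos by simp
    moreover have "0 \<le> s * (\<Sum>x\<in>ibox. \<bar>mb t x - m t x\<bar>)" using s by (auto intro!: mult_nonneg_nonneg sum_nonneg)
    ultimately show ?thesis by (rule mult_mono)
  qed
  also have "\<dots> \<le> s\<^sup>2 * fw_const"
  proof -
    have "L_f D * (s * sqrt (4 * K_L2)) * (s * 2) = s\<^sup>2 * (4 * L_f D * sqrt K_L2)"
      by (simp add: real_sqrt_mult power2_eq_square)
    also have "\<dots> \<le> s\<^sup>2 * fw_const" unfolding fw_const_def using consts_pos K_pos by (intro mult_left_mono mult_right_mono) auto
    finally show ?thesis .
  qed
  finally show ?thesis by simp
qed

text \<open>Only the potential is linearized. The running cost, which has no grid-independent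
  smoothness, is kept and handled by its convexity alone; the quadratic error comes from the
  potential.\<close>

lemma fw_step:
  assumes C: "assumption_C D" and e: "equilibrium mh wh uh \<omega>h" and m: "adm m w"
    and b: "backward m u \<omega>" and mb: "adm mb wb" and wb: "\<And>t x. t < T \<Longrightarrow> wb t x = mb t x *\<^sub>R vel \<omega> t x"
    and s: "s \<in> {0..1}"
    and m': "\<And>t x. t \<le> T \<Longrightarrow> m' t x = (1 - s) * m t x + s * mb t x"
    and w': "\<And>t x. t < T \<Longrightarrow> w' t x = (1 - s) *\<^sub>R w t x + s *\<^sub>R wb t x"
  shows "total_cost m' w' - total_cost mh wh \<le> (1 - s) * (total_cost m w - total_cost mh wh) + s\<^sup>2 * fw_const"
proof -
  define R where "R m w = (\<Sum>t<T. \<Sum>x\<in>ibox. run_cost t x (m t x) (w t x))" for m w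
  define Gt where "Gt m = (\<Sum>x\<in>ibox. gc D (gpoint N x) * m T x)" for m :: "nat \<Rightarrow> int ^ 'd \<Rightarrow> real"
  define Fs where "Fs m = (\<Sum>t<T. F_h D T N t (m t))" for m
  define f where "f n = (\<Sum>t<T. \<Sum>x\<in>ibox. f_h D T N t x (m t) * n t x)" for n
  have mh: "adm mh wh" using e by (simp add: equilibrium_def)
  have R: "R m' w' \<le> (1 - s) * R m w + s * R mb wb"
    unfolding R_def sum_distrib_left sum.distrib[symmetric]
  proof (intro sum_mono)
    fix t x assume "t \<in> {..<T}"
    then have t: "t < T" "t \<le> T" by auto
    show "run_cost t x (m' t x) (w' t x) \<le> (1 - s) * run_cost t x (m t x) (w t x) + s * run_cost t x (mb t x) (wb t x)"
      unfolding m'[OF t(2)] w'[OF t(1)]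
      by (rule run_cost_convex[OF t(2) s admD(3)[OF m t(2)] admD(3)[OF mb t(2)] admD(7)[OF m t(1)] admD(7)[OF mb t(1)]])
  qed
  have Gt: "Gt m' = (1 - s) * Gt m + s * Gt mb"
    unfolding Gt_def sum_distrib_left sum.distrib[symmetric] by (intro sum.cong refl) (simp add: m' algebra_simps)
  have F: "Fs m' - Fs m \<le> s * (f mb - f m) + real T * (s\<^sup>2 * fw_const)"
  proof -
    have "Fs m' - Fs m \<le> (\<Sum>t<T. s * (\<Sum>x\<in>ibox. f_h D T N t x (m t) * (mb t x - m t x)) + s\<^sup>2 * fw_const)"
      unfolding Fs_def sum_subtractf[symmetric] using m'
      by (intro sum_mono F_h_upper[OF C m mb s]) auto
    also have "\<dots> = s * (f mb - f m) + real T * (s\<^sup>2 * fw_const)"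
      by (simp add: f_def sum.distrib sum_distrib_left sum_subtractf right_diff_distrib)
    finally show ?thesis .
  qed
  have "\<delta> * (Fs m' - Fs m) \<le> \<delta> * (s * (f mb - f m) + real T * (s\<^sup>2 * fw_const))"
    using F delta by (intro mult_left_mono) auto
  also have "\<dots> = s * (\<delta> * f mb - \<delta> * f m) + s\<^sup>2 * fw_const"
  proof -
    have "\<delta> * (s * (f mb - f m) + real T * (s\<^sup>2 * fw_const)) = s * (\<delta> * f mb - \<delta> * f m) + (\<delta> * real T) * (s\<^sup>2 * fw_const)"
      by (simp add: algebra_simps)
    then show ?thesis unfolding delta(3) by simp
  qed
  finally have F': "\<delta> * Fs m' - \<delta> * Fs m \<le> s * (\<delta> * f mb - \<delta> * f m) + s\<^sup>2 * fw_const" by (simp add: right_diff_distrib)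
  have R': "\<delta> * R m' w' \<le> (1 - s) * (\<delta> * R m w) + s * (\<delta> * R mb wb)"
    using mult_left_mono[OF R, of \<delta>] delta by (simp add: algebra_simps)
  have lin: "lin_cost m mb wb \<le> lin_cost m mh wh" by (rule lin_cost_le(1)[OF mb b mh wb])
  have tot: "total_cost n z = \<delta> * R n z + \<delta> * Fs n + Gt n" and ln: "lin_cost m n z = \<delta> * R n z + \<delta> * f n + Gt n" for n z
    by (simp_all add: total_cost_def lin_cost_def R_def Fs_def Gt_def f_def)
  have gap: "lin_cost m mh wh - lin_cost m m w \<le> total_cost mh wh - total_cost m w"
    by (rule cost_gap_ge(2)[OF C e m])
  have "total_cost m' w' - total_cost m w \<le> s * (lin_cost m mb wb - lin_cost m m w) + s\<^sup>2 * fw_const"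
    using F' R' unfolding tot ln Gt by (simp add: algebra_simps)
  also have "\<dots> \<le> s * (total_cost mh wh - total_cost m w) + s\<^sup>2 * fw_const"
    using lin gap s by (intro add_right_mono mult_left_mono) auto
  finally show ?thesis by (simp add: algebra_simps)
qed

text \<open>The initialization is an arbitrary curve of probabilities, neither admissible nor
  bounded in L2, so \<open>fw_step\<close> does not start from it. Instead two linearizations, at
  \<open>m0\<close> where \<open>m\<close> is optimal and at \<open>m\<close> where convexity
  applies, each cost one oscillation of the coupling.\<close>

lemma fw_first:
  assumes C: "assumption_C D" and e: "equilibrium mh wh uh \<omega>h" and m0: "\<And>t. t \<le> T \<Longrightarrow> m0 t \<in> prob_grid N"
    and b: "backward m0 u \<omega>" and m: "adm m w" and w: "\<And>t x. t < T \<Longrightarrow> w t x = m t x *\<^sub>R vel \<omega> t x"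
  shows "total_cost m w - total_cost mh wh \<le> 4 * L_f D * real CARD('d)"
proof -
  have mh: "adm mh wh" using e by (simp add: equilibrium_def)
  let ?K = "2 * L_f D * real CARD('d)"
  have lin: "lin_cost m0 m w \<le> lin_cost m0 mh wh" by (rule lin_cost_le(1)[OF m b mh w])
  have sum_le: "\<delta> * (\<Sum>t<T. g t) \<le> ?K" if "\<And>t. t < T \<Longrightarrow> g t \<le> ?K" for g :: "nat \<Rightarrow> real"
  proof -
    have "\<delta> * (\<Sum>t<T. g t) \<le> \<delta> * (\<Sum>t<T. ?K)" using that delta by (intro mult_left_mono sum_mono) auto
    also have "\<dots> = (\<delta> * real T) * ?K" by simp
    finally show ?thesis unfolding delta(3) by simp
  qed
  have 1: "\<delta> * (\<Sum>t<T. \<Sum>x\<in>ibox. f_h D T N t x (m0 t) * (mh t x - m t x)) \<le> ?K"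
    using m0 admD(1)[OF m] admD(1)[OF mh] by (intro sum_le f_h_prob_diff[OF N T]) auto
  have 2: "\<delta> * (\<Sum>t<T. \<Sum>x\<in>ibox. f_h D T N t x (m t) * (m t x - mh t x)) \<le> ?K"
    using m0 admD(1)[OF m] admD(1)[OF mh] by (intro sum_le f_h_prob_diff[OF N T]) auto
  have 3: "\<delta> * (\<Sum>t<T. \<Sum>x\<in>ibox. f_h D T N t x (m t) * (mh t x - m t x)) = - (\<delta> * (\<Sum>t<T. \<Sum>x\<in>ibox. f_h D T N t x (m t) * (m t x - mh t x)))"
    by (simp add: right_diff_distrib sum_subtractf)
  show ?thesis using lin 1 2 F_h_diff[OF C m mh] unfolding 3
    by (simp add: lin_cost_def total_cost_def right_diff_distrib sum_subtractf)
qed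

lemma BR_adm:
  assumes "BR D \<sigma> \<theta> T N \<mu> m w"
  obtains u \<omega> where "backward \<mu> u \<omega>" "adm m w" "\<And>t x. t < T \<Longrightarrow> w t x = m t x *\<^sub>R vel \<omega> t x"
proof -
  obtain u v where uv: "HJB D \<sigma> \<theta> T N \<mu> u" "V D \<sigma> \<theta> T N u v" "FP D \<sigma> \<theta> T N v m" "\<And>t x. t < T \<Longrightarrow> w t x = m t x *\<^sub>R v t x"
    using assms by (auto simp: BR_def)
  obtain \<omega> where \<omega>: "backward \<mu> u \<omega>" "\<And>v t x. V D \<sigma> \<theta> T N u v \<Longrightarrow> t < T \<Longrightarrow> v t x = vel \<omega> t x"
    using HJB_backward[OF uv(1)] by metis
  have v: "v t = vel \<omega> t" if "t < T" for t using \<omega>(2)[OF uv(2) that] by auto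
  have "adm m w"
  proof (rule adm_FP[OF uv(3) _ _ uv(4)])
    show "norm (v t x) \<le> M" "v t \<in> grid_funs N" if "t < T" for t x
      using that vel_norm vel_periodic \<omega>(1) by (auto simp: v backward_def)
  qed
  then show ?thesis using that[OF \<omega>(1)] uv(4) v by auto
qed

lemma discrete_mfg_equilibrium:
  assumes "discrete_mfg D \<sigma> \<theta> T N u v m"
  obtains \<omega> where "equilibrium m (\<lambda>t x. m t x *\<^sub>R v t x) u \<omega>"
proof -
  have uv: "HJB D \<sigma> \<theta> T N m u" "V D \<sigma> \<theta> T N u v" "FP D \<sigma> \<theta> T N v m" using assms by (auto simp: discrete_mfg_def)
  obtain \<omega> where \<omega>: "backward m u \<omega>" "\<And>v t x. V D \<sigma> \<theta> T N u v \<Longrightarrow> t < T \<Longrightarrow> v t x = vel \<omega> t x"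
    using HJB_backward[OF uv(1)] by metis
  have v: "v t = vel \<omega> t" if "t < T" for t using \<omega>(2)[OF uv(2) that] by auto
  have "adm m (\<lambda>t x. m t x *\<^sub>R v t x)"
  proof (rule adm_FP[OF uv(3)])
    show "norm (v t x) \<le> M" "v t \<in> grid_funs N" if "t < T" for t x
      using that vel_norm vel_periodic \<omega>(1) by (auto simp: v backward_def)
  qed simp
  then show ?thesis using that \<omega>(1) v by (auto simp: equilibrium_def)
qed

lemma frank_wolfe_rate:
  assumes C: "assumption_C D" and e: "equilibrium mh wh uh \<omega>h"
    and fw: "frank_wolfe D \<sigma> \<theta> T N (\<lambda>k. 2 / (real k + 2)) m w" and k: "k \<ge> 1"
  shows "adm (m k) (w k)" and "total_cost (m k) (w k) - total_cost mh wh \<le> gap_const / real k"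
proof -
  have "adm (m k) (w k) \<and> total_cost (m k) (w k) - total_cost mh wh \<le> gap_const / real k"
    using k
  proof (induction k rule: nat_induct_at_least)
    case base
    have "BR D \<sigma> \<theta> T N (m 0) (m 1) (w 1)" using fw by (simp add: frank_wolfe_def)
    then obtain u \<omega> where "backward (m 0) u \<omega>" "adm (m 1) (w 1)" "\<And>t x. t < T \<Longrightarrow> w 1 t x = m 1 t x *\<^sub>R vel \<omega> t x"
      using BR_adm by metis
    moreover have "m 0 t \<in> prob_grid N" if "t \<le> T" for t
      using fw that by (simp add: frank_wolfe_def prob_curves_def)
    ultimately show ?case using fw_first[OF C e, of "m 0" u \<omega> "m 1" "w 1"] by (simp add: gap_const_def)
  next
    case (Suc k)
    define s where "s = 2 / (real k + 2)"
    have s: "s \<in> {0..1}" by (simp add: s_def)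
    obtain mb wb where BR: "BR D \<sigma> \<theta> T N (m k) mb wb"
      and mw: "\<And>t x. t \<le> T \<Longrightarrow> m (Suc k) t x = (1 - s) * m k t x + s * mb t x"
        "\<And>t x. t < T \<Longrightarrow> w (Suc k) t x = (1 - s) *\<^sub>R w k t x + s *\<^sub>R wb t x"
      using fw Suc.hyps by (auto simp: frank_wolfe_def s_def)
    obtain u \<omega> where b: "backward (m k) u \<omega>" "adm mb wb" "\<And>t x. t < T \<Longrightarrow> wb t x = mb t x *\<^sub>R vel \<omega> t x"
      using BR_adm[OF BR] by metis
    have a: "adm (m k) (w k)" and g: "total_cost (m k) (w k) - total_cost mh wh \<le> gap_const / real k"
      using Suc.IH by auto
    have "total_cost (m (Suc k)) (w (Suc k)) - total_cost mh wh \<le>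
        (1 - s) * (total_cost (m k) (w k) - total_cost mh wh) + s\<^sup>2 * fw_const"
      by (rule fw_step[OF C e a b s mw])
    also have "\<dots> \<le> (1 - s) * (gap_const / real k) + s\<^sup>2 * (gap_const / 4)"
      using g s by (intro add_mono mult_left_mono) (auto simp: gap_const_def)
    \<comment> \<open>\<open>1 - s = k / (k + 2)\<close> cancels the \<open>k\<close> of the
      induction hypothesis; what then remains is
      \<open>(k + 1) (k + 3) \<le> (k + 2)^2\<close>.\<close>
    also have "\<dots> = gap_const * ((real k + 3) / (real k + 2)\<^sup>2)"
    proof -
      define y where "y = real k + 2"
      have y: "y > 0" "real k > 0" using Suc.hyps by (auto simp: y_def)
      have "1 - s = real k / y" using y by (simp add: s_def y_def field_simps)
      then have "(1 - s) * (gap_const / real k) = gap_const / y" using y by simp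
      moreover have "s\<^sup>2 * (gap_const / 4) = gap_const / y\<^sup>2"
        by (simp add: s_def y_def[symmetric] power_divide)
      moreover have "gap_const / y + gap_const / y\<^sup>2 = gap_const * ((y + 1) / y\<^sup>2)"
        using y by (simp add: field_simps power2_eq_square)
      ultimately show ?thesis by (simp add: y_def algebra_simps)
    qed
    also have "\<dots> \<le> gap_const * (1 / real (Suc k))"
    proof (rule mult_left_mono)
      show "(real k + 3) / (real k + 2)\<^sup>2 \<le> 1 / real (Suc k)"
        by (simp add: divide_simps power2_eq_square) (simp add: algebra_simps)
      show "0 \<le> gap_const" using gap_const_pos by simp
    qed
    finally show ?case using adm_convex[OF a b(2) s mw] by simp
  qed
  then show "adm (m k) (w k)" "total_cost (m k) (w k) - total_cost mh wh \<le> gap_const / real k" by auto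
qed

text \<open>The difference of the densities solves the forward equation with source
  \<open>m (v - v_h)\<close>, whose square is \<open>m\<close> times a term that the gap controls.
  Bounding the weight \<open>m\<close> by \<open>sqrt (K_L2 / N^d)\<close> against the factor
  \<open>N^d\<close> in \<open>l2\<close> leaves \<open>N^(d/2)\<close>, the price of having no sup
  bound of order \<open>h^d\<close> for the iterates.\<close>

lemma adm_distance:
  assumes C: "assumption_C D" and e: "equilibrium mh wh uh \<omega>h" and m: "adm m w" and t: "t \<le> T"
  shows "l2 (\<lambda>x. m t x - mh t x) \<le> exp K_growth * K_source * (2 / alpha D) * sqrt (K_L2 * real N ^ CARD('d)) *
     (total_cost m w - total_cost mh wh)"
proof -
  let ?A = "sqrt (K_L2 / real N ^ CARD('d))"
  define Q where "Q s = (\<Sum>x\<in>ibox. quad (m s x) (w s x) (vel \<omega>h s x))" for s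
  have mh: "adm mh wh" and wh: "\<And>t x. t < T \<Longrightarrow> wh t x = mh t x *\<^sub>R vel \<omega>h t x" using e by (auto simp: equilibrium_def)
  have Q0: "0 \<le> Q s" if "s < T" for s unfolding Q_def using admD(3)[OF m] that by (intro sum_nonneg quad_nonneg) auto
  have src: "(\<Sum>x\<in>ibox. (norm (w s x - m s x *\<^sub>R vel \<omega>h s x))\<^sup>2) \<le> ?A * Q s" if s: "s < T" for s
    unfolding Q_def sum_distrib_left
  proof (rule sum_mono)
    fix x assume x: "x \<in> ibox"
    have "(norm (w s x - m s x *\<^sub>R vel \<omega>h s x))\<^sup>2 = m s x * quad (m s x) (w s x) (vel \<omega>h s x)"
      by (rule quad_eq[OF admD(7)[OF m s]])
    also have "\<dots> \<le> ?A * quad (m s x) (w s x) (vel \<omega>h s x)"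
      using adm_le[OF m, of s x] x s quad_nonneg admD(3)[OF m, of s x] by (intro mult_right_mono) auto
    finally show "(norm (w s x - m s x *\<^sub>R vel \<omega>h s x))\<^sup>2 \<le> ?A * quad (m s x) (w s x) (vel \<omega>h s x)" .
  qed
  have "(\<Sum>x\<in>ibox. (m t x - mh t x)\<^sup>2) \<le> exp K_growth * ((\<Sum>x\<in>ibox. (m 0 x - mh 0 x)\<^sup>2) +
     \<delta> * (\<Sum>s<t. K_source * ((\<Sum>x\<in>ibox. (norm (w s x - m s x *\<^sub>R vel \<omega>h s x))\<^sup>2) + (\<Sum>x\<in>ibox. (0::real)\<^sup>2))))"
  proof (rule energy_bound[where q = "\<lambda>s x. w s x - wh s x" and \<eta> = "\<lambda>s x. 0"])
    fix s assume "s \<le> T"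
    then show "(\<lambda>x. m s x - mh s x) \<in> grid_funs N" using admD(2)[OF m] admD(2)[OF mh] by (intro grid_funs_diff) auto
  next
    fix s assume s: "s < T"
    show "(\<lambda>x. w s x - wh s x) \<in> grid_funs N"
      using admD(6)[OF m s] admD(6)[OF mh s] by (rule grid_funs_diff)
    fix x
    have "w s x - wh s x = (m s x - mh s x) *\<^sub>R vel \<omega>h s x + (w s x - m s x *\<^sub>R vel \<omega>h s x)"
      using wh[OF s, of x] by (simp add: algebra_simps)
    then have "norm (w s x - wh s x) \<le> \<bar>m s x - mh s x\<bar> * norm (vel \<omega>h s x) + norm (w s x - m s x *\<^sub>R vel \<omega>h s x)"
      by (metis norm_scaleR norm_triangle_ineq)
    also have "\<bar>m s x - mh s x\<bar> * norm (vel \<omega>h s x) \<le> \<bar>m s x - mh s x\<bar> * M"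
      using s vel_norm[of s \<omega>h x] by (intro mult_left_mono) auto
    finally show "norm (w s x - wh s x) \<le> M * \<bar>m s x - mh s x\<bar> + norm (w s x - m s x *\<^sub>R vel \<omega>h s x)"
      by (simp add: mult.commute)
    show "m (s + 1) x - mh (s + 1) x - \<theta> * \<sigma> * \<delta> * lap (\<lambda>x. m (s + 1) x - mh (s + 1) x) x =
      m s x - mh s x + (1 - \<theta>) * \<sigma> * \<delta> * lap (\<lambda>x. m s x - mh s x) x - \<delta> * div_h N (\<lambda>x. w s x - wh s x) x + \<delta> * 0"
      using admD(8)[OF m s, of x] admD(8)[OF mh s, of x] unfolding laplacian_h_linear div_h_linear
      by (simp add: algebra_simps)
  qed (use t in auto)
  also have "\<dots> = exp K_growth * (\<delta> * (\<Sum>s<t. K_source * (\<Sum>x\<in>ibox. (norm (w s x - m s x *\<^sub>R vel \<omega>h s x))\<^sup>2)))"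
    using admD(5)[OF m] admD(5)[OF mh] by simp
  also have "\<dots> \<le> exp K_growth * (\<delta> * (\<Sum>s<t. K_source * (?A * Q s)))"
    using src t delta K_pos by (intro mult_left_mono sum_mono) auto
  also have "\<dots> \<le> exp K_growth * (\<delta> * (\<Sum>s<T. K_source * (?A * Q s)))"
    using t delta K_pos Q0 by (intro mult_left_mono sum_mono2 mult_nonneg_nonneg) auto
  also have "\<dots> = exp K_growth * K_source * (2 / alpha D) * ?A * (\<delta> * (\<Sum>s<T. alpha D / 2 * Q s))"
  proof -
    have *: "(\<Sum>s<T. K_source * (?A * Q s)) = K_source * (?A * (\<Sum>s<T. Q s))"
      "(\<Sum>s<T. alpha D / 2 * Q s) = alpha D / 2 * (\<Sum>s<T. Q s)"
      by (simp_all only: sum_distrib_left)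
    show ?thesis unfolding * using consts_pos by simp
  qed
  also have "\<dots> \<le> exp K_growth * K_source * (2 / alpha D) * ?A * (total_cost m w - total_cost mh wh)"
    using cost_gap_ge(1)[OF C e m] K_pos consts_pos
    by (intro mult_left_mono) (auto simp: Q_def sum_distrib_left intro!: mult_nonneg_nonneg)
  finally have "l2 (\<lambda>x. m t x - mh t x) \<le> real N ^ CARD('d) * (exp K_growth * K_source * (2 / alpha D) * ?A * (total_cost m w - total_cost mh wh))"
    unfolding l2_def by (rule mult_left_mono) simp
  also have "\<dots> = exp K_growth * K_source * (2 / alpha D) * (real N ^ CARD('d) * ?A) * (total_cost m w - total_cost mh wh)"
    by (simp add: mult_ac)
  also have "real N ^ CARD('d) * ?A = sqrt (K_L2 * real N ^ CARD('d))"
  proof -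
    define y where "y = sqrt (real N ^ CARD('d))"
    have y: "y > 0" "real N ^ CARD('d) = y * y" using N by (auto simp: y_def)
    then show ?thesis by (simp add: real_sqrt_mult real_sqrt_divide)
  qed
  finally show ?thesis .
qed

text \<open>The optimal velocity of one problem is admissible in the other, so the difference of the
  Hamiltonians is bounded on one side by a transport term with that velocity. Exchanging the roles
  gives the other side.\<close>

lemma backward_distance:
  assumes b1: "backward \<mu>1 u1 \<omega>1" and b2: "backward \<mu>2 u2 \<omega>2" and t: "t \<le> T"
    and \<mu>: "\<And>t. t \<le> T \<Longrightarrow> \<mu>1 t \<in> prob_grid N" "\<And>t. t \<le> T \<Longrightarrow> \<mu>2 t \<in> prob_grid N"
    and e: "0 \<le> e" "\<And>t. t \<le> T \<Longrightarrow> sqrt (l2 (\<lambda>x. \<mu>1 t x - \<mu>2 t x)) \<le> e"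
  shows "\<bar>u1 t x - u2 t x\<bar> \<le> 2 * (L_f D * e)"
proof -
  have one: "u t x - u' t x \<le> 2 * (L_f D * e)" if b: "backward \<mu> u \<omega>" and b': "backward \<mu>' u' \<omega>'"
    and \<mu>: "\<And>t. t \<le> T \<Longrightarrow> \<mu> t \<in> prob_grid N" "\<And>t. t \<le> T \<Longrightarrow> \<mu>' t \<in> prob_grid N"
    and l: "\<And>t. t \<le> T \<Longrightarrow> sqrt (l2 (\<lambda>x. \<mu> t x - \<mu>' t x)) \<le> e" for \<mu> \<mu>' u u' \<omega> \<omega>'
  proof (rule comparison(1)[where \<phi> = "\<lambda>t x. u t x - u' t x" and \<omega> = "\<lambda>t x. \<omega> t x - \<omega>' t x" and v = "vel \<omega>'"])
    fix s x assume s: "s < T"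
    show "(\<lambda>x. \<omega> s x - \<omega>' s x) \<in> grid_funs N" using b b' s by (intro grid_funs_diff) (auto simp: backward_def)
    show "norm (vel \<omega>' s x) \<le> M" using vel_norm s by simp
    have Le: "0 \<le> \<delta> * (L_f D * e)" using e consts_pos delta by simp
    have "\<omega> s x - \<theta> * \<sigma> * \<delta> * lap (\<omega> s) x = u (s + 1) x" "\<omega>' s x - \<theta> * \<sigma> * \<delta> * lap (\<omega>' s) x = u' (s + 1) x"
      using b b' s by (auto simp: backward_def)
    then show "\<omega> s x - \<omega>' s x - \<theta> * \<sigma> * \<delta> * lap (\<lambda>x. \<omega> s x - \<omega>' s x) x \<le> u (s + 1) x - u' (s + 1) x + \<delta> * (L_f D * e)"
      using Le unfolding laplacian_h_linear right_diff_distrib by linarith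
    have "f_h D T N s x (\<mu> s) - f_h D T N s x (\<mu>' s) \<le> L_f D * sqrt (l2 (\<lambda>x. \<mu> s x - \<mu>' s x))"
      using f_h_lipschitz[OF N T, of s "\<mu> s" "\<mu>' s" x] \<mu> s by (simp add: l2_def)
    also have "\<dots> \<le> L_f D * e" using l s consts_pos by (intro mult_left_mono) auto
    finally have f: "f_h D T N s x (\<mu> s) - f_h D T N s x (\<mu>' s) \<le> L_f D * e" .
    have "H_h D T N s x (nab (\<omega>' s) x) - H_h D T N s x (nab (\<omega> s) x) \<le> vel \<omega>' s x \<bullet> (nab (\<omega> s) x - nab (\<omega>' s) x)"
    proof -
      have "- (nab (\<omega> s) x \<bullet> vel \<omega>' s x) - lc D (tau s) (gpoint N x) (vel \<omega>' s x) \<le> H_h D T N s x (nab (\<omega> s) x)"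
        unfolding H_h_vel[OF less_imp_le[OF s]]
        using vel_norm[of s \<omega>' x] s by (intro legendre_max_le[OF vel_max _ consts_pos(4)]) auto
      then show ?thesis using H_h_vel[of s x \<omega>'] s by (simp add: inner_diff_right inner_commute)
    qed
    with f have "(f_h D T N s x (\<mu> s) - H_h D T N s x (nab (\<omega> s) x)) - (f_h D T N s x (\<mu>' s) - H_h D T N s x (nab (\<omega>' s) x))
       \<le> vel \<omega>' s x \<bullet> (nab (\<omega> s) x - nab (\<omega>' s) x) + L_f D * e" by linarith
    then have "\<delta> * ((f_h D T N s x (\<mu> s) - H_h D T N s x (nab (\<omega> s) x)) - (f_h D T N s x (\<mu>' s) - H_h D T N s x (nab (\<omega>' s) x)))
       \<le> \<delta> * (vel \<omega>' s x \<bullet> (nab (\<omega> s) x - nab (\<omega>' s) x) + L_f D * e)" using delta by (intro mult_left_mono) auto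
    moreover have "u s x = \<omega> s x + (1 - \<theta>) * \<sigma> * \<delta> * lap (\<omega> s) x + \<delta> * (f_h D T N s x (\<mu> s) - H_h D T N s x (nab (\<omega> s) x))"
      "u' s x = \<omega>' s x + (1 - \<theta>) * \<sigma> * \<delta> * lap (\<omega>' s) x + \<delta> * (f_h D T N s x (\<mu>' s) - H_h D T N s x (nab (\<omega>' s) x))"
      using b b' s by (auto simp: backward_def)
    ultimately show "u s x - u' s x \<le> \<omega> s x - \<omega>' s x + (1 - \<theta>) * \<sigma> * \<delta> * lap (\<lambda>x. \<omega> s x - \<omega>' s x) x
        + \<delta> * (vel \<omega>' s x \<bullet> nab (\<lambda>x. \<omega> s x - \<omega>' s x) x) + \<delta> * (L_f D * e)"
      unfolding laplacian_h_linear nabla_h_linear by (simp add: algebra_simps)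
  next
    show "u T x - u' T x \<le> 0" for x using b b' by (simp add: backward_def)
  qed (use t e consts_pos in auto)
  have sym: "l2 (\<lambda>x. \<mu>2 t x - \<mu>1 t x) = l2 (\<lambda>x. \<mu>1 t x - \<mu>2 t x)" for t
    by (simp add: l2_def power2_commute)
  show ?thesis using one[OF b1 b2 \<mu> e(2)] one[OF b2 b1 \<mu>(2,1)] e(2) by (simp add: sym abs_le_iff)
qed

end

section \<open>Regularity of the continuous solution\<close>

text \<open>\<open>holder_Q\<close> with its constant exposed, so that a single constant can be
  chosen for the finitely many functions involved.\<close>

definition holder_const :: "real \<Rightarrow> real \<Rightarrow> real \<Rightarrow> (real \<Rightarrow> real ^ 'd::finite \<Rightarrow> 'b::metric_space) \<Rightarrow> bool" where
  "holder_const a b K w \<longleftrightarrow> (\<forall>t\<in>{0..1}. \<forall>s\<in>{0..1}. \<forall>x y.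
     dist (w t x) (w s y) \<le> K * (\<bar>t - s\<bar> powr a + dist x y powr b))"

lemma holder_const_mono: "holder_const a b K w \<Longrightarrow> K \<le> K' \<Longrightarrow> holder_const a b K' w"
  unfolding holder_const_def
  by (meson add_nonneg_nonneg mult_right_mono order_trans powr_ge_zero)

lemma holder_Q_iff: "holder_Q a b w \<longleftrightarrow> (\<exists>K. holder_const a b K w)"
  by (simp add: holder_Q_def holder_const_def)

lemma holder_constD:
  "holder_const a b K w \<Longrightarrow> t \<in> {0..1} \<Longrightarrow> s \<in> {0..1} \<Longrightarrow>
     dist (w t x) (w s y) \<le> K * (\<bar>t - s\<bar> powr a + dist x y powr b)"
  unfolding holder_const_def by blast

lemma holder_const_space:
  "holder_const a b K w \<Longrightarrow> t \<in> {0..1} \<Longrightarrow> dist (w t x) (w t y) \<le> K * dist x y powr b"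
  using holder_constD[of a b K w t t x y] by simp

lemma holder_const_time:
  "holder_const a b K w \<Longrightarrow> t \<in> {0..1} \<Longrightarrow> s \<in> {0..1} \<Longrightarrow> dist (w t x) (w s x) \<le> K * \<bar>t - s\<bar> powr a"
  using holder_constD[of a b K w t s x x] by simp

lemma holder_const_nonneg:
  assumes "holder_const a b K (w :: real \<Rightarrow> real ^ 'd::finite \<Rightarrow> 'b::metric_space)"
  shows "0 \<le> K"
proof -
  have "dist (w 0 0) (w 1 0) \<le> K * \<bar>0 - 1\<bar> powr a" using assms by (intro holder_const_time) auto
  then have "dist (w 0 0) (w 1 0) \<le> K" by simp
  with zero_le_dist show ?thesis by (rule order_trans)
qed

lemma finite_uniform_const:
  fixes P :: "'i::finite \<Rightarrow> real \<Rightarrow> bool"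
  assumes "\<And>i. \<exists>K. P i K" and mono: "\<And>i K K'. P i K \<Longrightarrow> K \<le> K' \<Longrightarrow> P i K'"
  shows "\<exists>K. \<forall>i. P i K"
proof -
  obtain k where k: "\<And>i. P i (k i)" using assms(1) by metis
  have "P i (\<Sum>i\<in>UNIV. \<bar>k i\<bar>)" for i
  proof (rule mono[OF k])
    have "\<bar>k i\<bar> \<le> (\<Sum>i\<in>UNIV. \<bar>k i\<bar>)" by (rule member_le_sum) auto
    then show "k i \<le> (\<Sum>i\<in>UNIV. \<bar>k i\<bar>)" by linarith
  qed
  then show ?thesis by blast
qed

lemma holder_periodic_bounded:
  fixes w :: "real \<Rightarrow> real ^ 'd::finite \<Rightarrow> 'b::real_normed_vector"
  assumes h: "holder_const a b K w" and per: "\<And>t. t \<in> {0..1} \<Longrightarrow> periodic (w t)" and t: "t \<in> {0..1}" and "0 \<le> a" "0 \<le> b"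
  shows "norm (w t x) \<le> norm (w 0 0) + K * (1 + real CARD('d) powr b)"
proof -
  define y where "y = (\<chi> j. frac (x $ j))"
  have "dist (w t y) (w 0 0) \<le> K * (\<bar>t - 0\<bar> powr a + dist y 0 powr b)"
    by (rule holder_constD[OF h t]) simp
  also have "\<dots> \<le> K * (1 + real CARD('d) powr b)"
  proof (intro mult_left_mono add_mono)
    show "\<bar>t - 0\<bar> powr a \<le> 1" using t assms powr_mono2[of a "\<bar>t\<bar>" 1] by auto
    show "dist y 0 powr b \<le> real CARD('d) powr b"
      using norm_torus_cell[OF frac_in_torus_cell, of x] assms by (intro powr_mono2) (auto simp: y_def dist_norm)
  qed (rule holder_const_nonneg[OF h])
  finally have "norm (w t y) \<le> norm (w 0 0) + K * (1 + real CARD('d) powr b)"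
    using norm_triangle_sub[of "w t y" "w 0 0"] by (simp add: dist_norm)
  then show ?thesis using periodic_frac[OF per[OF t], of x] by (simp add: y_def)
qed

lemma axis_inner: "axis i c \<bullet> x = c * x $ i"
  for x :: "real ^ 'd::finite"
  by (simp add: inner_axis' )

lemma pd_line:
  fixes \<phi> :: "real ^ 'd::finite \<Rightarrow> real"
  assumes "\<And>x. \<phi> differentiable (at x)"
  shows "((\<lambda>s. \<phi> (x + s *\<^sub>R axis i 1)) has_real_derivative pd i \<phi> (x + s *\<^sub>R axis i 1)) (at s)"
  using line_derivative[of \<phi> x s "axis i 1"] assms by (simp add: axis_inner pd_def)

lemma mvt_line:
  fixes \<phi> :: "real ^ 'd::finite \<Rightarrow> real"
  assumes "\<And>x. \<phi> differentiable (at x)" "a < b"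
  obtains s where "a < s" "s < b" "\<phi> (x + b *\<^sub>R e) - \<phi> (x + a *\<^sub>R e) = (b - a) * (e \<bullet> grad \<phi> (x + s *\<^sub>R e))"
proof -
  have "\<exists>s. a < s \<and> s < b \<and> \<phi> (x + b *\<^sub>R e) - \<phi> (x + a *\<^sub>R e) = (b - a) * (e \<bullet> grad \<phi> (x + s *\<^sub>R e))"
    by (rule MVT2[OF assms(2)]) (rule line_derivative[OF assms(1)])
  then show ?thesis using that by blast
qed

section \<open>Difference quotients of functions with Hoelder continuous derivatives\<close>

lemma central_difference:
  fixes \<phi> :: "real ^ 'd::finite \<Rightarrow> real"
  assumes diff: "\<And>x. \<phi> differentiable (at x)" and N: "N > 0" and r: "0 \<le> r"
    and h: "\<And>x y. \<bar>pd i \<phi> x - pd i \<phi> y\<bar> \<le> K * dist x y powr r" and K: "0 \<le> K"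
  shows "\<bar>real N / 2 * (\<phi> (x + axis i (1 / real N)) - \<phi> (x - axis i (1 / real N))) - pd i \<phi> x\<bar> \<le> K * (1 / real N) powr r"
proof -
  define a where "a = 1 / real N"
  have a: "a > 0" using N by (simp add: a_def)
  obtain s where s: "- a < s" "s < a" and eq: "\<phi> (x + a *\<^sub>R axis i 1) - \<phi> (x + (- a) *\<^sub>R axis i 1) = (a - - a) * (axis i 1 \<bullet> grad \<phi> (x + s *\<^sub>R axis i 1))"
    using mvt_line[OF diff, of "- a" a x "axis i 1"] a by auto
  have ax: "a *\<^sub>R axis i 1 = (axis i a :: real ^ 'd)" "x + (- a) *\<^sub>R axis i 1 = x - axis i a"
    by (simp_all add: axis_def vec_eq_iff)
  have "\<phi> (x + axis i a) - \<phi> (x - axis i a) = 2 * a * pd i \<phi> (x + s *\<^sub>R axis i 1)"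
    using eq unfolding ax by (simp add: axis_inner pd_def)
  then have "real N / 2 * (\<phi> (x + axis i a) - \<phi> (x - axis i a)) = pd i \<phi> (x + s *\<^sub>R axis i 1)"
    using N by (simp add: a_def)
  moreover have "\<bar>pd i \<phi> (x + s *\<^sub>R axis i 1) - pd i \<phi> x\<bar> \<le> K * dist (x + s *\<^sub>R axis i 1) x powr r" by (rule h)
  moreover have "dist (x + s *\<^sub>R axis i 1) x powr r \<le> a powr r"
    using s r by (intro powr_mono2) (auto simp: dist_norm)
  ultimately show ?thesis using K mult_left_mono[of "dist (x + s *\<^sub>R axis i 1) x powr r" "a powr r" K] by (simp add: a_def)
qed

lemma second_difference:
  fixes \<phi> :: "real ^ 'd::finite \<Rightarrow> real"
  assumes diff: "\<And>x. \<phi> differentiable (at x)" "\<And>x. pd i \<phi> differentiable (at x)" and N: "N > 0" and r: "0 \<le> r"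
    and h: "\<And>x y. \<bar>pd i (pd i \<phi>) x - pd i (pd i \<phi>) y\<bar> \<le> K * dist x y powr r" and K: "0 \<le> K"
  shows "\<bar>(real N)\<^sup>2 * (\<phi> (x + axis i (1 / real N)) + \<phi> (x - axis i (1 / real N)) - 2 * \<phi> x) - pd i (pd i \<phi>) x\<bar> \<le> K * (1 / real N) powr r"
proof -
  define a where "a = 1 / real N"
  have a: "a > 0" using N by (simp add: a_def)
  define e where "e = (axis i 1 :: real ^ 'd)"
  define f where "f s = \<phi> (x + s *\<^sub>R e)" for s
  define f1 where "f1 s = pd i \<phi> (x + s *\<^sub>R e)" for s
  define f2 where "f2 s = pd i (pd i \<phi>) (x + s *\<^sub>R e)" for s
  have d1: "(f has_real_derivative f1 s) (at s)" for s unfolding f_def[abs_def] f1_def e_def by (rule pd_line[OF diff(1)])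
  have d2: "(f1 has_real_derivative f2 s) (at s)" for s unfolding f1_def[abs_def] f2_def e_def by (rule pd_line[OF diff(2)])
  \<comment> \<open>Symmetrizing about \<open>x\<close> makes the first derivative vanish at 0. The
    Taylor remainder of order two is then a mean of two second derivatives near \<open>x\<close>,
    and Hoelder continuity of these is all that is available.\<close>
  define G where "G k = (if k = 0 then (\<lambda>s. f s + f (- s)) else if k = 1 then (\<lambda>s. f1 s - f1 (- s)) else (\<lambda>s. f2 s + f2 (- s)))" for k :: nat
  have "(G m has_real_derivative G (Suc m) s) (at s)" if "m < 2" for m s
  proof -
    have "((\<lambda>s. f s + f (- s)) has_real_derivative f1 s - f1 (- s)) (at s)"
      by (auto intro!: derivative_eq_intros DERIV_chain2[OF d1] d1)
    moreover have "((\<lambda>s. f1 s - f1 (- s)) has_real_derivative f2 s + f2 (- s)) (at s)"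
      by (auto intro!: derivative_eq_intros DERIV_chain2[OF d2] d2)
    moreover have "m = 0 \<or> m = 1" using that by auto
    ultimately show ?thesis by (auto simp: G_def)
  qed
  then have "\<exists>s>0. s \<le> a \<and> (\<lambda>s. f s + f (- s)) a = (\<Sum>m<2. G m 0 / fact m * a ^ m) + G 2 s / fact 2 * a ^ 2"
    using a by (intro Maclaurin2) (auto simp: G_def)
  then obtain s where s: "0 < s" "s \<le> a" and eq: "f a + f (- a) = (\<Sum>m<2. G m 0 / fact m * a ^ m) + G 2 s / fact 2 * a ^ 2" by blast
  have "f a + f (- a) - 2 * f 0 = (f2 s + f2 (- s)) / 2 * a\<^sup>2"
    using eq by (simp add: G_def numeral_2_eq_2)
  moreover have "f a = \<phi> (x + axis i a)" "f (- a) = \<phi> (x - axis i a)" "f 0 = \<phi> x"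
    by (auto simp: f_def e_def intro!: arg_cong[where f = \<phi>]) (simp_all add: vec_eq_iff axis_def)
  ultimately have main: "(real N)\<^sup>2 * (\<phi> (x + axis i a) + \<phi> (x - axis i a) - 2 * \<phi> x) = (f2 s + f2 (- s)) / 2"
    using N by (simp add: a_def power_one_over)
  have "\<bar>f2 s' - f2 0\<bar> \<le> K * a powr r" if "\<bar>s'\<bar> \<le> a" for s'
  proof -
    have "\<bar>f2 s' - f2 0\<bar> \<le> K * dist (x + s' *\<^sub>R e) (x + 0 *\<^sub>R e) powr r" unfolding f2_def by (rule h)
    also have "\<dots> \<le> K * a powr r" using that r K by (intro mult_left_mono powr_mono2) (auto simp: dist_norm e_def)
    finally show ?thesis .
  qed
  from this[of s] this[of "- s"] s have "\<bar>f2 s - f2 0\<bar> \<le> K * a powr r" "\<bar>f2 (- s) - f2 0\<bar> \<le> K * a powr r" by auto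
  then have est: "\<bar>(f2 s + f2 (- s)) / 2 - f2 0\<bar> \<le> K * a powr r" by (simp add: abs_le_iff field_simps)
  have f20: "f2 0 = pd i (pd i \<phi>) x" by (simp add: f2_def)
  show ?thesis unfolding a_def[symmetric] main f20[symmetric] by (rule est)
qed

text \<open>The derivative is allowed at any time \<open>s\<close> of the step, because the forward
  equation will be evaluated at a time chosen inside the step.\<close>

lemma time_difference:
  fixes u :: "real \<Rightarrow> real ^ 'd::finite \<Rightarrow> real"
  assumes diff: "\<And>t. t \<in> {0..1} \<Longrightarrow> (\<lambda>s. u s x) differentiable (at t within {0..1})"
    and h: "holder_const a b K (dt u)" and "0 \<le> a" and t: "0 \<le> t" "t < t'" "t' \<le> 1" and s: "t \<le> s" "s \<le> t'"
  shows "\<bar>(u t' x - u t x) / (t' - t) - dt u s x\<bar> \<le> K * (t' - t) powr a"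
proof -
  have d: "((\<lambda>s. u s x) has_real_derivative dt u s x) (at s within {t..t'})" if "s \<in> {t..t'}" for s
  proof -
    have "((\<lambda>s. u s x) has_vector_derivative dt u s x) (at s within {0..1})"
      unfolding dt_def vector_derivative_works[symmetric] using diff that t by auto
    then show ?thesis using t
      by (auto simp: has_real_derivative_iff_has_vector_derivative intro: has_vector_derivative_within_subset)
  qed
  have "\<exists>s\<in>{t<..<t'}. u t' x - u t x = (\<lambda>h. h * dt u s x) (t' - t)"
    by (rule mvt_simple[OF t(2)])
      (use d in \<open>auto simp: has_field_derivative_def mult_commute_abs\<close>)
  then obtain q where q: "t < q" "q < t'" "u t' x - u t x = (t' - t) * dt u q x" by auto
  then have "(u t' x - u t x) / (t' - t) = dt u q x" by simp
  moreover have "dist (dt u q x) (dt u s x) \<le> K * \<bar>q - s\<bar> powr a"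
    using q t s by (intro holder_const_time[OF h]) auto
  moreover have "K * \<bar>q - s\<bar> powr a \<le> K * (t' - t) powr a"
    using q s assms(3) holder_const_nonneg[OF h] by (intro mult_left_mono powr_mono2) auto
  ultimately show ?thesis by (simp add: dist_real_def)
qed

lemma holder_continuous:
  fixes w :: "real \<Rightarrow> real ^ 'd::finite \<Rightarrow> 'b::metric_space"
  assumes h: "holder_const a b K w" and "0 < a" "0 < b"
  shows "continuous_on ({0..1} \<times> UNIV) (\<lambda>(t, x). w t x)"
  unfolding continuous_on_def
proof
  fix p :: "real \<times> (real ^ 'd)" assume p: "p \<in> {0..1} \<times> UNIV"
  obtain t x where tx: "p = (t, x)" by (cases p)
  let ?F = "at p within ({0..1} \<times> UNIV)"
  have "((\<lambda>q. K * (\<bar>fst q - t\<bar> powr a + dist (snd q) x powr b)) \<longlongrightarrow> K * (\<bar>fst p - t\<bar> powr a + dist (snd p) x powr b)) ?F"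
    using assms by (intro tendsto_intros tendsto_powr') (auto simp: always_eventually)
  then have lim: "((\<lambda>q. K * (\<bar>fst q - t\<bar> powr a + dist (snd q) x powr b)) \<longlongrightarrow> 0) ?F" using tx by simp
  show "((\<lambda>(t, x). w t x) \<longlongrightarrow> (case p of (t, x) \<Rightarrow> w t x)) ?F"
  proof (rule tendsto_dist_iff[THEN iffD2], rule tendsto_sandwich[OF _ _ tendsto_const lim])
    show "\<forall>\<^sub>F q in ?F. dist (case q of (t, x) \<Rightarrow> w t x) (case p of (t, x) \<Rightarrow> w t x) \<le> K * (\<bar>fst q - t\<bar> powr a + dist (snd q) x powr b)"
      unfolding eventually_at_filter using h p by (auto simp: tx holder_const_def intro!: always_eventually)
  qed (simp add: always_eventually)
qed

lemma legendre_max_Hc: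
  assumes "legendre_max (lc D t x) \<alpha> UNIV p v" "\<alpha> > 0"
  shows "Hc D t x p = - (p \<bullet> v) - lc D t x v"
proof -
  have "- p \<bullet> v' - lc D t x v' \<le> - (p \<bullet> v) - lc D t x v" for v'
    using legendre_max_le[OF assms(1) _ assms(2), of v'] by simp
  then show ?thesis unfolding Hc_def by (intro cSup_eq_maximum) auto
qed

lemma C1r_bounded_mono:
  assumes "C1r_bounded r C \<phi>" "C \<le> C'"
  shows "C1r_bounded r C' \<phi>"
  unfolding C1r_bounded_def
proof (intro conjI allI)
  fix x z i j
  show "norm (\<phi> x) \<le> C'" using assms order_trans unfolding C1r_bounded_def by blast
  show "(\<lambda>y. \<phi> y $ i) differentiable (at x)" using assms unfolding C1r_bounded_def by blast
  show "\<bar>pd j (\<lambda>y. \<phi> y $ i) x\<bar> \<le> C'" using assms order_trans unfolding C1r_bounded_def by blast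
  have "\<bar>pd j (\<lambda>y. \<phi> y $ i) x - pd j (\<lambda>y. \<phi> y $ i) z\<bar> \<le> C * dist x z powr r"
    using assms unfolding C1r_bounded_def by blast
  also have "\<dots> \<le> C' * dist x z powr r" using assms(2) by (rule mult_right_mono) simp
  finally show "\<bar>pd j (\<lambda>y. \<phi> y $ i) x - pd j (\<lambda>y. \<phi> y $ i) z\<bar> \<le> C' * dist x z powr r" .
qed

lemma C_parabolicD:
  assumes "u \<in> C_parabolic r"
  shows "t \<in> {0..1} \<Longrightarrow> periodic (u t)" "t \<in> {0..1} \<Longrightarrow> (\<lambda>s. u s x) differentiable (at t within {0..1})"
    "t \<in> {0..1} \<Longrightarrow> u t differentiable (at x)" "t \<in> {0..1} \<Longrightarrow> pd i (u t) differentiable (at x)"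
    "holder_Q (r / 2) r u" "holder_Q (r / 2) r (dt u)" "holder_Q (r / 2) r (\<lambda>t. pd i (u t))"
    "holder_Q (r / 2) r (\<lambda>t. pd j (pd i (u t)))"
  using assms by (simp_all add: C_parabolic_def)

section \<open>Uniform bounds and optimality for the continuous solution\<close>

locale mfg_regular = theta_data D \<sigma> \<theta> for D :: "('d::finite) mfg_data" and \<sigma> \<theta> +
  fixes r :: real and us ms :: "real \<Rightarrow> real ^ 'd \<Rightarrow> real" and vs :: "real \<Rightarrow> real ^ 'd \<Rightarrow> real ^ 'd"
  assumes r: "0 < r" "r < 1" and sol: "mfg_solution D \<sigma> r us vs ms"
begin

lemma us_reg:
  "t \<in> {0..1} \<Longrightarrow> periodic (us t)" "t \<in> {0..1} \<Longrightarrow> (\<lambda>s. us s x) differentiable (at t within {0..1})"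
  "t \<in> {0..1} \<Longrightarrow> us t differentiable (at x)" "t \<in> {0..1} \<Longrightarrow> pd i (us t) differentiable (at x)"
  and ms_reg:
  "t \<in> {0..1} \<Longrightarrow> periodic (ms t)" "t \<in> {0..1} \<Longrightarrow> (\<lambda>s. ms s x) differentiable (at t within {0..1})"
  "t \<in> {0..1} \<Longrightarrow> ms t differentiable (at x)" "t \<in> {0..1} \<Longrightarrow> pd i (ms t) differentiable (at x)"
  "t \<in> {0..1} \<Longrightarrow> ms t \<in> densities"
  and vs_per: "t \<in> {0..1} \<Longrightarrow> periodic (vs t)"
  and equations: "t \<in> {0..1} \<Longrightarrow> - dt us t x - \<sigma> * laplacian (us t) x + Hc D t x (grad (us t) x) = fc D t x (ms t)"
    "t \<in> {0..1} \<Longrightarrow> vs t x = - grad (Hc D t x) (grad (us t) x)"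
    "t \<in> {0..1} \<Longrightarrow> dt ms t x - \<sigma> * laplacian (ms t) x + divergence (\<lambda>y. ms t y *\<^sub>R vs t y) x = 0"
    "AE x in lborel. ms 0 x = m0c D x" "us 1 x = gc D x"
proof -
  have u: "us \<in> C_parabolic r" and m: "ms \<in> C_parabolic r" and v: "vs \<in> C_holder r"
    using sol by (simp_all add: mfg_solution_def)
  note C_parabolicD[OF u] C_parabolicD[OF m]
  then show "t \<in> {0..1} \<Longrightarrow> periodic (us t)" "t \<in> {0..1} \<Longrightarrow> (\<lambda>s. us s x) differentiable (at t within {0..1})"
    "t \<in> {0..1} \<Longrightarrow> us t differentiable (at x)" "t \<in> {0..1} \<Longrightarrow> pd i (us t) differentiable (at x)"
    "t \<in> {0..1} \<Longrightarrow> periodic (ms t)" "t \<in> {0..1} \<Longrightarrow> (\<lambda>s. ms s x) differentiable (at t within {0..1})"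
    "t \<in> {0..1} \<Longrightarrow> ms t differentiable (at x)" "t \<in> {0..1} \<Longrightarrow> pd i (ms t) differentiable (at x)"
    by blast+
  show "t \<in> {0..1} \<Longrightarrow> periodic (vs t)" using v by (simp add: C_holder_def)
  show "t \<in> {0..1} \<Longrightarrow> ms t \<in> densities" "AE x in lborel. ms 0 x = m0c D x" "us 1 x = gc D x"
    "t \<in> {0..1} \<Longrightarrow> - dt us t x - \<sigma> * laplacian (us t) x + Hc D t x (grad (us t) x) = fc D t x (ms t)"
    "t \<in> {0..1} \<Longrightarrow> vs t x = - grad (Hc D t x) (grad (us t) x)"
    "t \<in> {0..1} \<Longrightarrow> dt ms t x - \<sigma> * laplacian (ms t) x + divergence (\<lambda>y. ms t y *\<^sub>R vs t y) x = 0"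
    using sol unfolding mfg_solution_def by blast+
qed

lemma uniform_constant:
  obtains K where "K \<ge> 1"
    "holder_const (r / 2) r K us" "holder_const (r / 2) r K (dt us)"
    "\<And>i. holder_const (r / 2) r K (\<lambda>t. pd i (us t))" "\<And>i. holder_const (r / 2) r K (\<lambda>t. pd i (pd i (us t)))"
    "holder_const (r / 2) r K ms" "holder_const (r / 2) r K (dt ms)"
    "\<And>i. holder_const (r / 2) r K (\<lambda>t. pd i (ms t))" "\<And>i. holder_const (r / 2) r K (\<lambda>t. pd i (pd i (ms t)))"
    "holder_const r r K vs" "AE t in lborel. t \<in> {0..1} \<longrightarrow> C1r_bounded r K (vs t)"
    "\<And>t x. t \<in> {0..1} \<Longrightarrow> \<bar>ms t x\<bar> \<le> K" "\<And>t x. t \<in> {0..1} \<Longrightarrow> norm (vs t x) \<le> K"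
    "\<And>t x i. t \<in> {0..1} \<Longrightarrow> \<bar>pd i (ms t) x\<bar> \<le> K"
proof -
  have hol: "\<exists>K. holder_const (r / 2) r K us" "\<exists>K. holder_const (r / 2) r K (dt us)"
    "\<exists>K. holder_const (r / 2) r K (\<lambda>t. pd i (us t))" "\<exists>K. holder_const (r / 2) r K (\<lambda>t. pd i (pd i (us t)))"
    "\<exists>K. holder_const (r / 2) r K ms" "\<exists>K. holder_const (r / 2) r K (dt ms)"
    "\<exists>K. holder_const (r / 2) r K (\<lambda>t. pd i (ms t))" "\<exists>K. holder_const (r / 2) r K (\<lambda>t. pd i (pd i (ms t)))"
    "\<exists>K. holder_const r r K vs" "\<exists>K. AE t in lborel. t \<in> {0..1} \<longrightarrow> C1r_bounded r K (vs t)" for i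
    using sol C_parabolicD(5-8)[of us r] C_parabolicD(5-8)[of ms r]
    unfolding mfg_solution_def C_holder_def Linf_C1r_def holder_Q_iff by auto
  have uni: "\<exists>K. \<forall>i. holder_const (r / 2) r K (\<lambda>t. pd i (us t))" "\<exists>K. \<forall>i. holder_const (r / 2) r K (\<lambda>t. pd i (pd i (us t)))"
    "\<exists>K. \<forall>i. holder_const (r / 2) r K (\<lambda>t. pd i (ms t))" "\<exists>K. \<forall>i. holder_const (r / 2) r K (\<lambda>t. pd i (pd i (ms t)))"
    using finite_uniform_const[of "\<lambda>i K. holder_const (r / 2) r K (\<lambda>t. pd i (us t))", OF hol(3) holder_const_mono]
      finite_uniform_const[of "\<lambda>i K. holder_const (r / 2) r K (\<lambda>t. pd i (pd i (us t)))", OF hol(4) holder_const_mono]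
      finite_uniform_const[of "\<lambda>i K. holder_const (r / 2) r K (\<lambda>t. pd i (ms t))", OF hol(7) holder_const_mono]
      finite_uniform_const[of "\<lambda>i K. holder_const (r / 2) r K (\<lambda>t. pd i (pd i (ms t)))", OF hol(8) holder_const_mono]
    by simp_all
  obtain k1 where k1: "holder_const (r / 2) r k1 us" using hol(1) by blast
  obtain k2 where k2: "holder_const (r / 2) r k2 (dt us)" using hol(2) by blast
  obtain k3 where k3: "\<And>i. holder_const (r / 2) r k3 (\<lambda>t. pd i (us t))" using uni(1) by blast
  obtain k4 where k4: "\<And>i. holder_const (r / 2) r k4 (\<lambda>t. pd i (pd i (us t)))" using uni(2) by blast
  obtain k5 where k5: "holder_const (r / 2) r k5 ms" using hol(5) by blast
  obtain k6 where k6: "holder_const (r / 2) r k6 (dt ms)" using hol(6) by blast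
  obtain k7 where k7: "\<And>i. holder_const (r / 2) r k7 (\<lambda>t. pd i (ms t))" using uni(3) by blast
  obtain k8 where k8: "\<And>i. holder_const (r / 2) r k8 (\<lambda>t. pd i (pd i (ms t)))" using uni(4) by blast
  obtain k9 where k9: "holder_const r r k9 vs" using hol(9) by blast
  obtain k10 where k10: "AE t in lborel. t \<in> {0..1} \<longrightarrow> C1r_bounded r k10 (vs t)" using hol(10) by blast
  define B where "B = \<bar>ms 0 0\<bar> + k5 * (1 + real CARD('d) powr r)"
  define B' where "B' = norm (vs 0 0) + k9 * (1 + real CARD('d) powr r)"
  have B: "\<bar>ms t x\<bar> \<le> B" if "t \<in> {0..1}" for t x
    using holder_periodic_bounded[OF k5 ms_reg(1) that, of x] r unfolding B_def by simp
  have B': "norm (vs t x) \<le> B'" if "t \<in> {0..1}" for t x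
    using holder_periodic_bounded[OF k9 vs_per that, of x] r unfolding B'_def by simp
  \<comment> \<open>By periodicity the derivative vanishes somewhere on every segment of one period,
    so its Hoelder constant also bounds its size.\<close>
  have B'': "\<bar>pd i (ms t) x\<bar> \<le> k7" if t: "t \<in> {0..1}" for t x i
  proof -
    obtain s where s: "0 < s" "s < 1" and eq: "ms t (x + 1 *\<^sub>R axis i 1) - ms t (x + 0 *\<^sub>R axis i 1) = (1 - 0) * (axis i 1 \<bullet> grad (ms t) (x + s *\<^sub>R axis i 1))"
      using mvt_line[OF ms_reg(3)[OF t], of 0 1 x "axis i 1"] by auto
    have "ms t (x + axis i 1) = ms t x" using ms_reg(1)[OF t] by (simp add: periodic_def)
    then have "pd i (ms t) (x + s *\<^sub>R axis i 1) = 0" using eq by (simp add: axis_inner pd_def)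
    then have "\<bar>pd i (ms t) x\<bar> \<le> k7 * dist x (x + s *\<^sub>R axis i 1) powr r"
      using holder_const_space[OF k7 t, of i x "x + s *\<^sub>R axis i 1"] by (simp add: dist_real_def)
    also have "\<dots> \<le> k7 * 1"
      using s r holder_const_nonneg[OF k7] powr_mono2[of r s 1] by (intro mult_left_mono) (auto simp: dist_norm)
    finally show ?thesis by simp
  qed
  define K where "K = Max {1, k1, k2, k3, k4, k5, k6, k7, k8, k9, k10, B, B'}"
  have le: "k1 \<le> K" "k2 \<le> K" "k3 \<le> K" "k4 \<le> K" "k5 \<le> K" "k6 \<le> K" "k7 \<le> K" "k8 \<le> K" "k9 \<le> K" "k10 \<le> K" "B \<le> K" "B' \<le> K" "1 \<le> K"
    unfolding K_def by (rule Max_ge; simp)+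
  have C1r: "C1r_bounded r K \<phi>" if "C1r_bounded r k10 \<phi>" for \<phi> :: "real ^ 'd \<Rightarrow> real ^ 'd"
    by (rule C1r_bounded_mono[OF that le(10)])
  show ?thesis
  proof (rule that)
    show "AE t in lborel. t \<in> {0..1} \<longrightarrow> C1r_bounded r K (vs t)" using k10 by eventually_elim (use C1r in blast)
    show "\<bar>ms t x\<bar> \<le> K" "norm (vs t x) \<le> K" "\<bar>pd i (ms t) x\<bar> \<le> K" if "t \<in> {0..1}" for t x i
      using B[OF that, of x] B'[OF that, of x] B''[OF that, of i x] le by linarith+
  qed (rule holder_const_mono[OF k1 le(1)] holder_const_mono[OF k2 le(2)] holder_const_mono[OF k3 le(3)]
      holder_const_mono[OF k4 le(4)] holder_const_mono[OF k5 le(5)] holder_const_mono[OF k6 le(6)]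
      holder_const_mono[OF k7 le(7)] holder_const_mono[OF k8 le(8)] holder_const_mono[OF k9 le(9)] le(13))+
qed

text \<open>The maximum principle for the increment \<open>us t (x + z) - us t x\<close>: at a spatial maximum both
  points have the same gradient, so that the Hamiltonians differ by at most \<open>L_l |z|\<close>.\<close>

lemma us_increment:
  assumes t: "t \<in> {0..1}"
  shows "us t (x + z) - us t x \<le> (L_l D + L_f D + L_g D) * norm z"
proof (rule field_le_epsilon)
  fix \<epsilon> :: real assume \<epsilon>: "\<epsilon> > 0"
  \<comment> \<open>The slope exceeds by \<open>\<epsilon>\<close> the growth that the equation
    permits. A maximum of \<open>\<Psi>\<close> before the terminal time would contradict the
    equation, and at the terminal time the Lipschitz constant of \<open>gc\<close> applies.\<close>
  define k where "k = (L_l D + L_f D) * norm z + \<epsilon>"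
  define \<Psi> where "\<Psi> t x = us t (x + z) - us t x - k * (1 - t)" for t x
  obtain K where K: "holder_const (r / 2) r K us" using uniform_constant by metis
  have per: "periodic (\<Psi> t)" if "t \<in> {0..1}" for t
    using us_reg(1)[OF that] unfolding periodic_def \<Psi>_def by (metis (no_types, lifting) add.assoc add.commute)
  have c1: "continuous_on ({0..1} \<times> UNIV) (\<lambda>(t, x). us t x)" using r by (intro holder_continuous[OF K]) auto
  have c2: "continuous_on ({0..1} \<times> UNIV) (\<lambda>p. us (fst p) (snd p + z))"
  proof -
    have "continuous_on ({0..1} \<times> UNIV) (\<lambda>p :: real \<times> (real ^ 'd). (fst p, snd p + z))" by (intro continuous_intros)
    from continuous_on_compose2[OF c1 this] show ?thesis by (simp add: image_subset_iff mem_Times_iff)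
  qed
  have "continuous_on ({0..1} \<times> cbox 0 (1 :: real ^ 'd)) (\<lambda>p. \<Psi> (fst p) (snd p))"
    unfolding \<Psi>_def using c1 c2
    by (intro continuous_intros continuous_on_subset[OF c2]) (auto simp: case_prod_beta intro: continuous_on_subset)
  moreover have "compact ({0..1 :: real} \<times> cbox 0 (1 :: real ^ 'd))" by (intro compact_Times) auto
  moreover have "{0..1 :: real} \<times> cbox 0 (1 :: real ^ 'd) \<noteq> {}" by (auto simp: interval_ne_empty_cart)
  ultimately have "\<exists>p\<in>{0..1} \<times> cbox 0 1. \<forall>q\<in>{0..1} \<times> cbox 0 1. \<Psi> (fst q) (snd q) \<le> \<Psi> (fst p) (snd p)"
    by (intro continuous_attains_sup)
  then obtain p where p: "p \<in> {0..1} \<times> cbox 0 1" "\<forall>q\<in>{0..1} \<times> cbox 0 1. \<Psi> (fst q) (snd q) \<le> \<Psi> (fst p) (snd p)"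
    by (rule bexE)
  define t1 x1 where "t1 = fst p" and "x1 = snd p"
  have t1: "t1 \<in> {0..1}" using p(1) unfolding t1_def by (simp only: mem_Times_iff)
  have mx0: "\<Psi> s y \<le> \<Psi> t1 x1" if "s \<in> {0..1}" "y \<in> cbox 0 1" for s y
    using bspec[OF p(2), of "(s, y)"] that by (simp only: mem_Times_iff fst_conv snd_conv t1_def x1_def simp_thms)
  have mx: "\<Psi> s y \<le> \<Psi> t1 x1" if s: "s \<in> {0..1}" for s y
  proof -
    have "(\<chi> j. frac (y $ j)) \<in> cbox 0 (1 :: real ^ 'd)"
      by (simp add: mem_box_cart less_imp_le[OF frac_lt_1])
    from mx0[OF s this] show ?thesis using periodic_frac[OF per[OF s], of y] by simp
  qed
  have "t1 = 1"
  proof (rule ccontr)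
    assume "t1 \<noteq> 1"
    then have t1': "t1 < 1" using t1 by simp
    have dtu: "((\<lambda>s. us s y) has_real_derivative dt us t1 y) (at t1 within {0..1})" for y
      unfolding has_real_derivative_iff_has_vector_derivative dt_def vector_derivative_works[symmetric]
      by (rule us_reg(2)[OF t1])
    have "((\<lambda>s. \<Psi> s x1) has_real_derivative dt us t1 (x1 + z) - dt us t1 x1 + k) (at t1 within {0..1})"
      unfolding \<Psi>_def[abs_def] by (rule derivative_eq_intros dtu refl | simp)+
    \<comment> \<open>The maximum may sit at time 0, where only increments to the right exist. For a
      backward equation this is the side that yields the contradiction.\<close>
    moreover have False if d: "((\<lambda>s. \<Psi> s x1) has_real_derivative l) (at t1 within {0..1})" "0 < l" for l
    proof -
      obtain d where d: "d > 0" "\<And>h. h > 0 \<Longrightarrow> t1 + h \<in> {0..1} \<Longrightarrow> h < d \<Longrightarrow> \<Psi> t1 x1 < \<Psi> (t1 + h) x1"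
        using has_real_derivative_pos_inc_right[OF d] by blast
      define h where "h = min (d / 2) (1 - t1)"
      have "h > 0" "t1 + h \<in> {0..1}" "h < d" using d(1) t1 t1' by (auto simp: h_def min_def)
      then show False using d(2)[of h] mx[of "t1 + h" x1] by auto
    qed
    ultimately have dt_le: "dt us t1 (x1 + z) - dt us t1 x1 + k \<le> 0" by (meson not_le)
    have line: "((\<lambda>s. us t1 (y + s *\<^sub>R axis i 1)) has_real_derivative pd i (us t1) (y + s *\<^sub>R axis i 1)) (at s)"
      "((\<lambda>s. pd i (us t1) (y + s *\<^sub>R axis i 1)) has_real_derivative pd i (pd i (us t1)) (y + s *\<^sub>R axis i 1)) (at s)" for y i s
      using us_reg(3,4)[OF t1] by (intro pd_line; blast)+
    define F where "F i s = us t1 (x1 + z + s *\<^sub>R axis i 1) - us t1 (x1 + s *\<^sub>R axis i 1)" for i s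
    define F1 where "F1 i s = pd i (us t1) (x1 + z + s *\<^sub>R axis i 1) - pd i (us t1) (x1 + s *\<^sub>R axis i 1)" for i s
    define F2 where "F2 i s = pd i (pd i (us t1)) (x1 + z + s *\<^sub>R axis i 1) - pd i (pd i (us t1)) (x1 + s *\<^sub>R axis i 1)" for i s
    have dF: "(F i has_real_derivative F1 i s) (at s)" "(F1 i has_real_derivative F2 i s) (at s)" for i s
      unfolding F_def[abs_def] F1_def[abs_def] F2_def by (intro DERIV_diff line)+
    have Fmax: "F i s \<le> F i 0" for i s
      using mx[OF t1, of "x1 + s *\<^sub>R axis i 1"] by (simp add: \<Psi>_def F_def add_ac)
    have F1: "F1 i 0 = 0" for i
      by (rule DERIV_local_max[OF dF(1), where d = 1]) (use Fmax in auto)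
    have F2: "F2 i 0 \<le> 0" for i
    proof (rule ccontr)
      assume "\<not> F2 i 0 \<le> 0"
      then have "0 < F2 i 0" by simp
      from DERIV_pos_inc_right[OF dF(2) this] obtain d where d: "d > 0" "\<And>h. h > 0 \<Longrightarrow> h < d \<Longrightarrow> F1 i 0 < F1 i (0 + h)" by auto
      obtain s where s: "0 < s" "s < d / 2" "F i (d / 2) - F i 0 = (d / 2 - 0) * F1 i s"
        using MVT2[of 0 "d / 2" "F i" "F1 i"] dF(1) d(1) by auto
      have "F1 i s > 0" using d(2)[of s] s d(1) F1[of i] by simp
      then have "(d / 2 - 0) * F1 i s > 0" using d(1) by simp
      then have "F i (d / 2) - F i 0 > 0" by (simp only: s(3))
      then show False using Fmax[of i "d / 2"] by simp
    qed
    define p where "p = grad (us t1) x1"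
    have p: "grad (us t1) (x1 + z) = p"
      using F1 by (simp add: p_def vec_eq_iff F1_def pd_def)
    have lap: "laplacian (us t1) (x1 + z) - laplacian (us t1) x1 \<le> 0"
      unfolding laplacian_def sum_subtractf[symmetric] using F2 by (intro sum_nonpos) (simp add: F2_def)
    obtain v where v: "legendre_max (lc D t1 x1) (alpha D) UNIV p v"
      using strongly_convex_function.legendre_max_UNIV[OF lc_strongly_convex[OF t1]] by metis
    obtain v' where v': "legendre_max (lc D t1 (x1 + z)) (alpha D) UNIV p v'"
      using strongly_convex_function.legendre_max_UNIV[OF lc_strongly_convex[OF t1]] by metis
    have "Hc D t1 (x1 + z) p \<ge> - (p \<bullet> v) - lc D t1 (x1 + z) v"
      unfolding legendre_max_Hc[OF v' consts_pos(4)] using v' by (intro legendre_max_le) (auto simp: consts_pos)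
    moreover have "\<bar>lc D t1 (x1 + z) v - lc D t1 x1 v\<bar> \<le> L_l D * norm z"
      using lc_lipschitz_x[OF t1, of "x1 + z" v x1] by simp
    ultimately have H: "Hc D t1 (x1 + z) p - Hc D t1 x1 p \<ge> - (L_l D * norm z)"
      unfolding legendre_max_Hc[OF v consts_pos(4)] by linarith
    have f: "fc D t1 (x1 + z) (ms t1) - fc D t1 x1 (ms t1) \<le> L_f D * norm z"
      using fc_lipschitz_x[OF t1 ms_reg(5)[OF t1], of "x1 + z" x1] by simp
    have "\<sigma> * (laplacian (us t1) (x1 + z) - laplacian (us t1) x1) \<le> 0"
      using lap sigma by (simp add: mult_nonneg_nonpos)
    moreover note equations(1)[OF t1, of "x1 + z"] equations(1)[OF t1, of x1]
    ultimately have "- (dt us t1 (x1 + z) - dt us t1 x1) \<le> (L_l D + L_f D) * norm z"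
      using H f unfolding p p_def[symmetric] by (simp add: algebra_simps)
    then show False using dt_le \<epsilon> by (simp add: k_def)
  qed
  have "\<Psi> 1 x1 = gc D (x1 + z) - gc D x1" using equations(5) by (simp add: \<Psi>_def)
  also have "\<dots> \<le> L_g D * norm z"
  proof -
    have "(L_g D)-lipschitz_on UNIV (gc D)" using A by (simp add: assumption_A_def)
    from lipschitz_onD[OF this, of "x1 + z" x1] show ?thesis by (simp add: dist_real_def dist_norm)
  qed
  finally have "\<Psi> t x \<le> L_g D * norm z" using mx[OF t, of x] \<open>t1 = 1\<close> by simp
  then have "us t (x + z) - us t x \<le> L_g D * norm z + k * (1 - t)" by (simp add: \<Psi>_def)
  also have "k * (1 - t) \<le> k * 1" using t \<epsilon> consts_pos by (intro mult_left_mono) (auto simp: k_def)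
  finally show "us t (x + z) - us t x \<le> (L_l D + L_f D + L_g D) * norm z + \<epsilon>"
    by (simp add: k_def algebra_simps)
qed

lemma grad_us_bound:
  assumes t: "t \<in> {0..1}"
  shows "norm (grad (us t) x) \<le> L_l D + L_f D + L_g D"
proof (rule ccontr)
  define L where "L = L_l D + L_f D + L_g D"
  define g where "g = grad (us t) x"
  define e where "e = sgn g"
  assume "\<not> norm (grad (us t) x) \<le> L_l D + L_f D + L_g D"
  then have gL: "norm g > L" by (simp add: g_def L_def)
  have "L > 0" unfolding L_def using consts_pos by simp
  then have "g \<noteq> 0" using gL by auto
  then have e: "norm e = 1" "e \<bullet> g = norm g"
    by (simp_all add: e_def norm_sgn sgn_div_norm power2_norm_eq_inner[symmetric] power2_eq_square)
  have "((\<lambda>s. us t (x + s *\<^sub>R e) - L * s) has_real_derivative e \<bullet> grad (us t) (x + 0 *\<^sub>R e) - L * 1) (at 0)"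
    by (intro DERIV_diff line_derivative us_reg(3)[OF t] DERIV_cmult DERIV_ident)
  moreover have "e \<bullet> grad (us t) (x + 0 *\<^sub>R e) - L * 1 > 0" using gL e(2) by (simp add: g_def)
  ultimately obtain d where d: "d > 0" "\<And>h. h > 0 \<Longrightarrow> h < d \<Longrightarrow> us t (x + 0 *\<^sub>R e) - L * 0 < us t (x + (0 + h) *\<^sub>R e) - L * (0 + h)"
    using DERIV_pos_inc_right by blast
  have "us t (x + (d / 2) *\<^sub>R e) - us t x \<le> L * norm ((d / 2) *\<^sub>R e)" unfolding L_def by (rule us_increment[OF t])
  then show False using d(2)[of "d / 2"] d(1) e(1) by simp
qed

text \<open>The gradient of the Hamiltonian is minus the maximizer, so the feedback is optimal among
  all velocities; the gradient bound for the value function then places it in the ball of radius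
  \<open>M\<close>. Along the trace the truncation is therefore inactive.\<close>

lemma vs_optimal:
  assumes t: "t \<in> {0..1}"
  shows "legendre_max (lc D t x) (alpha D) UNIV (grad (us t) x) (vs t x)" and "norm (vs t x) \<le> M"
    and "Hc D t x (grad (us t) x) = - (grad (us t) x \<bullet> vs t x) - lc D t x (vs t x)"
proof -
  interpret l: strongly_convex_function "lc D t x" "grad (lc D t x)" "alpha D" by (rule lc_strongly_convex[OF t])
  have "\<forall>p. \<exists>v. legendre_max (lc D t x) (alpha D) UNIV p v \<and> norm v \<le> (norm p + norm (grad (lc D t x) 0)) / alpha D"
    using l.legendre_max_UNIV by metis
  then obtain W where W: "\<And>p. legendre_max (lc D t x) (alpha D) UNIV p (W p)"
    "\<And>p. norm (W p) \<le> (norm p + norm (grad (lc D t x) 0)) / alpha D" by metis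
  have "grad (Hc D t x) p = - W p" for p
    by (rule grad_eqI, rule legendre_gderiv[OF consts_pos(4) W(1)]) (rule legendre_max_Hc[OF W(1) consts_pos(4)])
  then have v: "vs t x = W (grad (us t) x)" using equations(2)[OF t, of x] by simp
  show "legendre_max (lc D t x) (alpha D) UNIV (grad (us t) x) (vs t x)" unfolding v by (rule W)
  then show "Hc D t x (grad (us t) x) = - (grad (us t) x \<bullet> vs t x) - lc D t x (vs t x)"
    by (rule legendre_max_Hc[OF _ consts_pos(4)])
  show "norm (vs t x) \<le> M" unfolding v
    using W(2) radius_bound[OF t grad_us_bound[OF t]] by (rule order_trans)
qed

end

section \<open>Consistency\<close>

locale regular_bounds = mfg_regular D \<sigma> \<theta> r us ms vs
  for D :: "('d::finite) mfg_data" and \<sigma> \<theta> r us ms vs +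
  fixes K :: real
  assumes K1: "K \<ge> 1"
    and u_h: "holder_const (r / 2) r K us" "holder_const (r / 2) r K (dt us)"
      "\<And>i. holder_const (r / 2) r K (\<lambda>t. pd i (us t))" "\<And>i. holder_const (r / 2) r K (\<lambda>t. pd i (pd i (us t)))"
    and m_h: "holder_const (r / 2) r K ms" "holder_const (r / 2) r K (dt ms)"
      "\<And>i. holder_const (r / 2) r K (\<lambda>t. pd i (ms t))" "\<And>i. holder_const (r / 2) r K (\<lambda>t. pd i (pd i (ms t)))"
    and v_h: "holder_const r r K vs" "AE t in lborel. t \<in> {0..1} \<longrightarrow> C1r_bounded r K (vs t)"
    and m_bd: "\<And>t x. t \<in> {0..1} \<Longrightarrow> \<bar>ms t x\<bar> \<le> K" and v_bd: "\<And>t x. t \<in> {0..1} \<Longrightarrow> norm (vs t x) \<le> K"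
    and dm_bd: "\<And>t x i. t \<in> {0..1} \<Longrightarrow> \<bar>pd i (ms t) x\<bar> \<le> K"
begin

text \<open>The step size condition in the form \<open>\<delta> N\<^sup>2 \<le> c0\<close>.
  \<open>Kt\<close> converts Hoelder continuity in time into the spatial rate:
  \<open>\<delta>^(r/2) \<le> Kt h^r\<close>.\<close>

definition "c0 = 1 / (2 * real CARD('d) * (1 - \<theta>) * \<sigma>)"

definition "Kt = c0 powr (r / 2)"

lemma c0_pos: "c0 > 0" unfolding c0_def using sigma theta by simp

lemma Kt_pos: "Kt > 0" unfolding Kt_def using c0_pos by simp

lemma cd_ge_1: "real CARD('d) \<ge> 1"
  using zero_less_card_finite[where ?'a = 'd] by (simp add: Suc_leI)

definition "E_grad = real CARD('d) * (K * (1 + Kt + 3 * \<sigma> * c0 * real CARD('d)))"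
definition "E_half = \<sigma>\<^sup>2 * (6 * c0 * (real CARD('d))\<^sup>2 * K)"
definition "E_f = L_f D * real CARD('d) + L_f D * (2 * real CARD('d) * K)"
definition "E_HJB = K * Kt + \<sigma> * (real CARD('d) * K * (1 + Kt)) + E_half + E_grad * K + E_f"
definition "E_div = 2 * K + 2 * K\<^sup>2 * (real CARD('d))\<^sup>2 + 4 * K\<^sup>2"
definition "E_FP = K * Kt + 2 * (\<sigma> * (real CARD('d) * K * (1 + Kt))) + real CARD('d) * E_div"

lemma E_nonneg: "E_grad \<ge> 0" "E_half \<ge> 0" "E_f \<ge> 0" "E_HJB \<ge> 0" "E_div \<ge> 0" "E_FP \<ge> 0"
proof -
  show *: "E_grad \<ge> 0" "E_half \<ge> 0" "E_f \<ge> 0" "E_div \<ge> 0"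
    unfolding E_grad_def E_half_def E_f_def E_div_def using K1 sigma c0_pos Kt_pos consts_pos by auto
  show "E_HJB \<ge> 0" "E_FP \<ge> 0"
    unfolding E_HJB_def E_FP_def using * K1 sigma Kt_pos by auto
qed

end

lemma gpoint_shift:
  "gpoint N (x + axis i 1) = gpoint N x + axis i (1 / real N)"
  "gpoint N (x - axis i 1) = gpoint N x - axis i (1 / real N)"
  by (simp_all add: gpoint_def vec_eq_iff axis_def add_divide_distrib diff_divide_distrib)

lemma trace_periodic:
  fixes \<phi> :: "real ^ 'd::finite \<Rightarrow> 'b"
  assumes "periodic \<phi>" "N > 0"
  shows "(\<lambda>x. \<phi> (gpoint N x)) \<in> grid_funs N"
  unfolding grid_funs_def
proof safe
  fix x :: "int ^ 'd" and j
  have "gpoint N (x + axis j (int N)) = gpoint N x + axis j 1"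
    using assms(2) by (simp add: gpoint_def vec_eq_iff axis_def add_divide_distrib)
  then show "\<phi> (gpoint N (x + axis j (int N))) = \<phi> (gpoint N x)"
    using assms(1) by (simp add: periodic_def)
qed

locale convergence = regular_bounds D \<sigma> \<theta> r us ms vs K + scheme D \<sigma> \<theta> T N
  for D :: "('d::finite) mfg_data" and \<sigma> \<theta> r us ms vs K T N
begin

abbreviation "h \<equiv> 1 / real N"
definition hr :: real where "hr = h powr r"

lemma h: "0 < h" "h \<le> 1" "real N * h = 1" using N by auto

lemma hr: "0 < hr" "h \<le> hr"
proof -
  show "0 < hr" unfolding hr_def using N by simp
  have "h powr 1 \<le> h powr r" using h r by (intro powr_mono') auto
  then show "h \<le> hr" unfolding hr_def using N by simp
qed

lemma delta_N: "\<delta> * (real N)\<^sup>2 \<le> c0" "\<delta> * real N \<le> c0" "\<delta> powr (r / 2) \<le> Kt * hr"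
proof -
  have c: "0 < 2 * real CARD('d) * (1 - \<theta>) * \<sigma>" using sigma theta by simp
  have "(\<delta> * (real N)\<^sup>2) * (2 * real CARD('d) * (1 - \<theta>) * \<sigma>) \<le> 1" using cfl by (simp only: mult_ac)
  then show 1: "\<delta> * (real N)\<^sup>2 \<le> c0" unfolding c0_def using c by (simp only: pos_le_divide_eq)
  have "\<delta> * real N \<le> \<delta> * (real N)\<^sup>2" using N delta by (intro mult_left_mono) (auto simp: power2_eq_square)
  then show "\<delta> * real N \<le> c0" using 1 by simp
  have "\<delta> \<le> c0 * h\<^sup>2" using 1 N by (simp add: power_one_over field_simps)
  then have "\<delta> powr (r / 2) \<le> (c0 * h\<^sup>2) powr (r / 2)" using delta r by (intro powr_mono2) auto
  also have "\<dots> = Kt * (h\<^sup>2) powr (r / 2)" unfolding Kt_def by (rule powr_mult)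
  also have "(h\<^sup>2) powr (r / 2) = hr"
  proof -
    have "h\<^sup>2 = h powr 2" using h by simp
    then show ?thesis unfolding hr_def by (simp add: powr_powr del: powr_numeral)
  qed
  finally show "\<delta> powr (r / 2) \<le> Kt * hr" .
qed

definition "uh t x = us (tau t) (gpoint N x)"
text \<open>An explicit half step: it solves the implicit equation of the scheme only up to the residual
  \<open>rho\<close> below, but it needs no estimates for the resolvent of the discrete Laplacian.\<close>

definition "wh t x = uh (t + 1) x + \<theta> * \<sigma> * \<delta> * lap (uh (t + 1)) x"
definition "vh t x = vs (tau t) (gpoint N x)"
definition "mhat t = I_h N (ms (tau t))"
definition "ph t x = grad (us (tau t)) (gpoint N x)"

lemma uh_periodic: "t \<le> T \<Longrightarrow> uh t \<in> grid_funs N"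
  unfolding uh_def[abs_def] by (intro trace_periodic us_reg tau N)

lemma wh_periodic: "t < T \<Longrightarrow> wh t \<in> grid_funs N"
  unfolding wh_def[abs_def]
  by (intro grid_funs_add grid_funs_mult grid_funs_const grid_funs_laplacian uh_periodic) auto

lemma vh_periodic: "t \<le> T \<Longrightarrow> vh t \<in> grid_funs N"
  unfolding vh_def[abs_def] by (intro trace_periodic vs_per tau N)

lemma mhat_prob: "t \<le> T \<Longrightarrow> mhat t \<in> prob_grid N"
  unfolding mhat_def by (intro I_h_prob ms_reg tau N)

lemma tau_succ: "tau (t + 1) = tau t + \<delta>"
  by (simp add: \<delta>_def add_divide_distrib)

lemma tau_mono: "tau t < tau (t + 1)" "tau t \<le> tau (t + 1)"
  unfolding tau_succ using delta by simp_all

lemma tau_mem: "tau t \<in> {tau t..tau (t + 1)}" "tau (t + 1) \<in> {tau t..tau (t + 1)}"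
  using tau_mono(2)[of t] by (simp_all only: atLeastAtMost_iff order_refl simp_thms)

lemma norm_axis_real: "norm (axis i c :: real ^ 'd) = \<bar>c\<bar>"
proof -
  have "axis i c = c *\<^sub>R (axis i 1 :: real ^ 'd)" by (simp add: axis_def vec_eq_iff)
  then show ?thesis by simp
qed

lemma space_holder:
  assumes "holder_const a r K (w :: real \<Rightarrow> real ^ 'd \<Rightarrow> real)" "t \<in> {0..1}"
  shows "\<bar>w t x - w t y\<bar> \<le> K * dist x y powr r"
  using holder_const_space[OF assms] by (simp add: dist_real_def)

lemma time_step:
  assumes "holder_const (r / 2) r K (w :: real \<Rightarrow> real ^ 'd \<Rightarrow> real)" "t < T" "s \<in> {tau t..tau (t + 1)}" "s' \<in> {tau t..tau (t + 1)}"
  shows "\<bar>w s x - w s' x\<bar> \<le> K * Kt * hr"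
proof -
  have "{tau t..tau (t + 1)} \<subseteq> {0..1}" using tau[of t] tau[of "t + 1"] assms(2) by auto
  then have "s \<in> {0..1}" "s' \<in> {0..1}" using assms(3,4) by blast+
  from holder_const_time[OF assms(1) this, of x] have "\<bar>w s x - w s' x\<bar> \<le> K * \<bar>s - s'\<bar> powr (r / 2)"
    by (simp only: dist_real_def)
  also have "\<dots> \<le> K * \<delta> powr (r / 2)"
    using assms(3,4) K1 r unfolding tau_succ by (intro mult_left_mono powr_mono2) auto
  also have "\<dots> \<le> K * (Kt * hr)" using delta_N K1 by (intro mult_left_mono) auto
  finally show ?thesis by (simp add: mult_ac)
qed

lemma time_quotient:
  assumes diff: "\<And>t. t \<in> {0..1} \<Longrightarrow> (\<lambda>s. w s x) differentiable (at t within {0..1})"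
    and w: "holder_const (r / 2) r K (dt w)" and t: "t < T" and s: "s \<in> {tau t..tau (t + 1)}"
  shows "\<bar>(w (tau (t + 1)) x - w (tau t) x) / \<delta> - dt w s x\<bar> \<le> K * Kt * hr"
proof -
  define a b where "a = tau t" and "b = tau (t + 1)"
  have ab: "a < b" "b - a = \<delta>" using tau_mono(1)[of t] tau_succ[of t] by (simp_all only: a_def b_def)
  have "a \<in> {0..1}" "b \<in> {0..1}" using tau[of t] tau[of "t + 1"] t by (simp_all only: a_def b_def)
  then have "0 \<le> a" "b \<le> 1" by auto
  moreover have "a \<le> s" "s \<le> b" using s by (simp_all only: a_def b_def atLeastAtMost_iff)
  ultimately have "\<bar>(w b x - w a x) / (b - a) - dt w s x\<bar> \<le> K * (b - a) powr (r / 2)"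
    using ab(1) r by (intro time_difference[OF diff w]) auto
  also have "\<dots> \<le> K * (Kt * hr)" unfolding ab using delta_N K1 by (intro mult_left_mono) auto
  finally show ?thesis unfolding ab unfolding a_def b_def by (simp only: mult.assoc)
qed

text \<open>The discrete Laplacian at points off the grid. The trace of the density is a cell
  average, and its discrete Laplacian is the integral of \<open>clap\<close> over a cell.\<close>

definition clap :: "(real ^ 'd \<Rightarrow> real) \<Rightarrow> real ^ 'd \<Rightarrow> real" where
  "clap \<phi> z = (\<Sum>i\<in>UNIV. (real N)\<^sup>2 * (\<phi> (z + axis i h) + \<phi> (z - axis i h) - 2 * \<phi> z))"

lemma lap_trace: "lap (\<lambda>x. \<phi> (gpoint N x)) x = clap \<phi> (gpoint N x)"
  unfolding laplacian_h_eq clap_def gpoint_shift ..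

lemma clap_consistent:
  assumes diff: "\<And>x. \<phi> differentiable (at x)" "\<And>i x. pd i \<phi> differentiable (at x)"
    and h2: "\<And>i x y. \<bar>pd i (pd i \<phi>) x - pd i (pd i \<phi>) y\<bar> \<le> K * dist x y powr r"
  shows "\<bar>clap \<phi> z - laplacian \<phi> z\<bar> \<le> real CARD('d) * K * hr"
proof -
  have "\<bar>clap \<phi> z - laplacian \<phi> z\<bar> \<le> (\<Sum>i\<in>(UNIV :: 'd set). K * hr)"
    unfolding clap_def laplacian_def sum_subtractf[symmetric] hr_def
    using r N K1 by (intro order_trans[OF sum_abs] sum_mono second_difference diff h2) auto
  then show ?thesis by simp
qed

lemma laplacian_time:
  fixes w :: "real \<Rightarrow> real ^ 'd \<Rightarrow> real"
  assumes "\<And>i. holder_const (r / 2) r K (\<lambda>t. pd i (pd i (w t)))" "t < T" "s \<in> {tau t..tau (t + 1)}" "s' \<in> {tau t..tau (t + 1)}"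
  shows "\<bar>laplacian (w s) x - laplacian (w s') x\<bar> \<le> real CARD('d) * K * Kt * hr"
proof -
  have "\<bar>laplacian (w s) x - laplacian (w s') x\<bar> \<le> (\<Sum>i\<in>(UNIV :: 'd set). K * Kt * hr)"
    unfolding laplacian_def sum_subtractf[symmetric]
    by (intro order_trans[OF sum_abs] sum_mono time_step[OF assms(1) assms(2-4)])
  then show ?thesis by simp
qed

section \<open>Residuals of the backward scheme\<close>

lemma uh_laplacian:
  assumes "t \<le> T"
  shows "\<bar>lap (uh t) x - laplacian (us (tau t)) (gpoint N x)\<bar> \<le> real CARD('d) * K * hr"
  unfolding uh_def[abs_def] lap_trace using tau[OF assms] us_reg(3,4) space_holder[OF u_h(4)]
  by (intro clap_consistent) auto

lemma laplacian_us_holder: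
  assumes "t \<in> {0..1}"
  shows "\<bar>laplacian (us t) (x + axis i h) - laplacian (us t) x\<bar> \<le> real CARD('d) * K * hr"
    "\<bar>laplacian (us t) (x - axis i h) - laplacian (us t) x\<bar> \<le> real CARD('d) * K * hr"
proof -
  have *: "\<bar>laplacian (us t) y - laplacian (us t) x\<bar> \<le> real CARD('d) * K * hr" if "dist y x = h" for y
  proof -
    have "\<bar>laplacian (us t) y - laplacian (us t) x\<bar> \<le> (\<Sum>i\<in>(UNIV :: 'd set). K * dist y x powr r)"
      unfolding laplacian_def sum_subtractf[symmetric]
      by (intro order_trans[OF sum_abs] sum_mono space_holder[OF u_h(4) assms])
    then show ?thesis using that by (simp add: hr_def)
  qed
  show "\<bar>laplacian (us t) (x + axis i h) - laplacian (us t) x\<bar> \<le> real CARD('d) * K * hr"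
    "\<bar>laplacian (us t) (x - axis i h) - laplacian (us t) x\<bar> \<le> real CARD('d) * K * hr"
    using h by (intro *; simp add: dist_norm norm_axis_real)+
qed

lemma lap_uh_increment:
  assumes "t \<le> T"
  shows "\<bar>lap (uh t) (x + axis i 1) - lap (uh t) x\<bar> \<le> 3 * (real CARD('d) * K * hr)"
    "\<bar>lap (uh t) (x - axis i 1) - lap (uh t) x\<bar> \<le> 3 * (real CARD('d) * K * hr)"
  using uh_laplacian[OF assms, of x] uh_laplacian[OF assms, of "x + axis i 1"] uh_laplacian[OF assms, of "x - axis i 1"]
    laplacian_us_holder[OF tau[OF assms], of "gpoint N x" i] unfolding gpoint_shift by linarith+

lemma lap_lap_uh:
  assumes "t \<le> T"
  shows "\<delta> * \<bar>lap (lap (uh t)) x\<bar> \<le> 6 * c0 * (real CARD('d))\<^sup>2 * K * hr"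
proof -
  have "\<bar>lap (lap (uh t)) x\<bar> \<le> (\<Sum>i\<in>(UNIV :: 'd set). (real N)\<^sup>2 * (6 * (real CARD('d) * K * hr)))"
    unfolding laplacian_h_eq[of N "lap (uh t)"]
  proof (intro order_trans[OF sum_abs] sum_mono)
    fix i :: 'd
    have "\<bar>lap (uh t) (x + axis i 1) + lap (uh t) (x - axis i 1) - 2 * lap (uh t) x\<bar> \<le> 6 * (real CARD('d) * K * hr)"
      using lap_uh_increment[OF assms, of x i] by linarith
    then show "\<bar>(real N)\<^sup>2 * (lap (uh t) (x + axis i 1) + lap (uh t) (x - axis i 1) - 2 * lap (uh t) x)\<bar> \<le> (real N)\<^sup>2 * (6 * (real CARD('d) * K * hr))"
      by (simp add: abs_mult mult_left_mono)
  qed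
  then have "\<delta> * \<bar>lap (lap (uh t)) x\<bar> \<le> \<delta> * (real CARD('d) * ((real N)\<^sup>2 * (6 * (real CARD('d) * K * hr))))"
    using delta by (intro mult_left_mono) auto
  also have "\<dots> = (\<delta> * (real N)\<^sup>2) * (6 * (real CARD('d))\<^sup>2 * K * hr)" by (simp add: power2_eq_square mult_ac)
  also have "\<dots> \<le> c0 * (6 * (real CARD('d))\<^sup>2 * K * hr)" using delta_N K1 hr by (intro mult_right_mono) auto
  finally show ?thesis by (simp add: mult_ac)
qed

definition "rho t x = - ((\<theta> * \<sigma>)\<^sup>2 * (\<delta> * lap (lap (uh (t + 1))) x))"

lemma lap_wh: "lap (wh t) x = lap (uh (t + 1)) x + \<theta> * \<sigma> * \<delta> * lap (lap (uh (t + 1))) x"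
  unfolding wh_def[abs_def] laplacian_h_linear ..

lemma wh_eq: "wh t x - \<theta> * \<sigma> * \<delta> * lap (wh t) x = uh (t + 1) x + \<delta> * rho t x"
  unfolding lap_wh wh_def rho_def by (simp add: power2_eq_square algebra_simps)

lemma theta_sigma_le: "(\<theta> * \<sigma>)\<^sup>2 \<le> \<sigma>\<^sup>2" "(1 - \<theta>) * \<theta> * \<sigma>\<^sup>2 \<le> \<sigma>\<^sup>2"
proof -
  have "\<theta> * \<sigma> \<le> 1 * \<sigma>" using theta sigma by (intro mult_right_mono) auto
  then show "(\<theta> * \<sigma>)\<^sup>2 \<le> \<sigma>\<^sup>2" using theta sigma by (intro power_mono) auto
  have "(1 - \<theta>) * \<theta> \<le> 1 * 1" using theta by (intro mult_mono) auto
  then have "(1 - \<theta>) * \<theta> * \<sigma>\<^sup>2 \<le> 1 * \<sigma>\<^sup>2" by (intro mult_right_mono) auto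
  then show "(1 - \<theta>) * \<theta> * \<sigma>\<^sup>2 \<le> \<sigma>\<^sup>2" by simp
qed

lemma rho_bound: "t < T \<Longrightarrow> \<bar>rho t x\<bar> \<le> E_half * hr"
proof -
  assume t: "t < T"
  have "\<bar>rho t x\<bar> = (\<theta> * \<sigma>)\<^sup>2 * (\<delta> * \<bar>lap (lap (uh (t + 1))) x\<bar>)"
    unfolding rho_def using delta by (simp add: abs_mult)
  also have "\<dots> \<le> \<sigma>\<^sup>2 * (6 * c0 * (real CARD('d))\<^sup>2 * K * hr)"
    using t delta by (intro mult_mono[OF theta_sigma_le(1) lap_lap_uh]) auto
  finally show ?thesis by (simp add: E_half_def mult_ac)
qed

text \<open>Three errors add up: the central difference, the passage from time \<open>t + 1\<close>
  to time \<open>t\<close>, and the correction contained in \<open>wh\<close>, in which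
  \<open>\<delta>\<close> pays for the factor \<open>N\<close> of the difference quotient.\<close>

lemma grad_wh:
  assumes t: "t < T"
  shows "norm (nab (wh t) x - ph t x) \<le> E_grad * hr"
proof -
  have t': "t + 1 \<le> T" "t \<le> T" using t by auto
  have "\<bar>(nab (wh t) x - ph t x) $ i\<bar> \<le> K * (1 + Kt + 3 * \<sigma> * c0 * real CARD('d)) * hr" for i
  proof -
    define X where "X = real N / 2 * (us (tau (t + 1)) (gpoint N x + axis i h) - us (tau (t + 1)) (gpoint N x - axis i h))"
    define Y where "Y = real N / 2 * (lap (uh (t + 1)) (x + axis i 1) - lap (uh (t + 1)) (x - axis i 1))"
    have nab: "nab (wh t) x $ i = X + \<theta> * \<sigma> * (\<delta> * Y)"
      unfolding nabla_h_eq wh_def X_def Y_def uh_def gpoint_shift by (simp add: algebra_simps)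
    have "\<bar>X - pd i (us (tau (t + 1))) (gpoint N x)\<bar> \<le> K * hr"
      unfolding X_def hr_def using r N K1 us_reg(3)[OF tau[OF t'(1)]] space_holder[OF u_h(3) tau[OF t'(1)]]
      by (intro central_difference) auto
    moreover have "\<bar>pd i (us (tau (t + 1))) (gpoint N x) - pd i (us (tau t)) (gpoint N x)\<bar> \<le> K * Kt * hr"
      by (rule time_step[OF u_h(3) t tau_mem(2,1)])
    moreover have "\<bar>\<theta> * \<sigma> * (\<delta> * Y)\<bar> \<le> \<sigma> * (c0 * (3 * (real CARD('d) * K * hr)))"
    proof -
      have "\<bar>lap (uh (t + 1)) (x + axis i 1) - lap (uh (t + 1)) (x - axis i 1)\<bar> \<le> 6 * (real CARD('d) * K * hr)"
        using lap_uh_increment[OF t'(1), of x i] by linarith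
      then have "\<bar>Y\<bar> \<le> real N / 2 * (6 * (real CARD('d) * K * hr))"
        unfolding Y_def abs_mult by (intro mult_mono) auto
      then have "\<delta> * \<bar>Y\<bar> \<le> \<delta> * (real N / 2 * (6 * (real CARD('d) * K * hr)))" using delta by (intro mult_left_mono) auto
      also have "\<dots> = (\<delta> * real N) * (3 * (real CARD('d) * K * hr))" by simp
      also have "\<dots> \<le> c0 * (3 * (real CARD('d) * K * hr))" using delta_N K1 hr by (intro mult_right_mono) auto
      finally have 1: "\<delta> * \<bar>Y\<bar> \<le> c0 * (3 * (real CARD('d) * K * hr))" .
      have "\<bar>\<theta> * \<sigma> * (\<delta> * Y)\<bar> = (\<theta> * \<sigma>) * (\<delta> * \<bar>Y\<bar>)" using theta sigma delta by (simp add: abs_mult)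
      also have "\<dots> \<le> (1 * \<sigma>) * (c0 * (3 * (real CARD('d) * K * hr)))"
        using theta sigma delta by (intro mult_mono[OF _ 1]) auto
      finally show ?thesis by simp
    qed
    moreover have "ph t x $ i = pd i (us (tau t)) (gpoint N x)" by (simp add: ph_def pd_def)
    ultimately have "\<bar>(nab (wh t) x - ph t x) $ i\<bar> \<le> K * hr + K * Kt * hr + \<sigma> * (c0 * (3 * (real CARD('d) * K * hr)))"
      unfolding vector_minus_component nab by linarith
    then show ?thesis by (simp add: algebra_simps)
  qed
  from norm_le_card[OF this] show ?thesis by (simp add: E_grad_def mult_ac)
qed

lemma cell_dist:
  fixes y z :: "real ^ 'd"
  assumes "y \<in> B_h N x" "z \<in> B_h N x"
  shows "dist y z powr r \<le> 2 * real CARD('d) * hr"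
proof -
  have "norm (y - gpoint N x) \<le> real CARD('d) / real N" "norm (z - gpoint N x) \<le> real CARD('d) / real N"
    using B_h_norm[OF N T le_refl] assms by auto
  then have "dist y z \<le> 2 * real CARD('d) * h" using norm_triangle_ineq4[of "y - gpoint N x" "z - gpoint N x"] by (simp add: dist_norm)
  then have "dist y z powr r \<le> (2 * real CARD('d) * h) powr r" using r by (intro powr_mono2) auto
  also have "\<dots> = (2 * real CARD('d)) powr r * hr" unfolding hr_def by (rule powr_mult)
  also have "\<dots> \<le> (2 * real CARD('d)) powr 1 * hr"
  proof (intro mult_right_mono powr_mono)
    show "1 \<le> 2 * real CARD('d)" using cd_ge_1 by linarith
  qed (use r hr in auto)
  finally show ?thesis by simp
qed

lemma ms_measurable: "t \<in> {0..1} \<Longrightarrow> ms t \<in> borel_measurable lborel"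
  using densitiesD(2)[OF ms_reg(5)] .

lemma mhat_average:
  assumes t: "t \<le> T"
  shows "\<bar>R_h N (mhat t) y - ms (tau t) y\<bar> \<le> 2 * real CARD('d) * K * hr"
proof -
  define x where "x = cell_index N y"
  have y: "y \<in> B_h N x" using B_h_iff[OF N, of y x] by (simp add: x_def)
  have "\<bar>(LINT z:B_h N x|lborel. ms (tau t) z) - ms (tau t) y * h ^ CARD('d)\<bar> \<le> (2 * real CARD('d) * K * hr) * h ^ CARD('d)"
  proof (rule set_integral_const_bounds[OF B_h_measurable emeasure_B_h])
    show "set_integrable lborel (B_h N x) (ms (tau t))"
      using ms_measurable[OF tau[OF t]] m_bd[OF tau[OF t]] by (rule B_h_integrable)
    fix z assume z: "z \<in> B_h N x"
    have "\<bar>ms (tau t) z - ms (tau t) y\<bar> \<le> K * dist z y powr r" by (rule space_holder[OF m_h(1) tau[OF t]])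
    also have "\<dots> \<le> K * (2 * real CARD('d) * hr)" using cell_dist[OF z y] K1 by (intro mult_left_mono) auto
    finally show "\<bar>ms (tau t) z - ms (tau t) y\<bar> \<le> 2 * real CARD('d) * K * hr" by (simp add: mult_ac)
  qed simp
  then have "real N ^ CARD('d) * \<bar>mhat t x - ms (tau t) y * h ^ CARD('d)\<bar> \<le> real N ^ CARD('d) * ((2 * real CARD('d) * K * hr) * h ^ CARD('d))"
    unfolding mhat_def I_h_def by (intro mult_left_mono) auto
  then have "\<bar>real N ^ CARD('d) * (mhat t x - ms (tau t) y * h ^ CARD('d))\<bar> \<le> real N ^ CARD('d) * ((2 * real CARD('d) * K * hr) * h ^ CARD('d))"
    by (simp add: abs_mult)
  moreover have one: "real N ^ CARD('d) * h ^ CARD('d) = 1" using N by (simp add: power_one_over)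
  have "real N ^ CARD('d) * (mhat t x - ms (tau t) y * h ^ CARD('d)) = real N ^ CARD('d) * mhat t x - ms (tau t) y"
    using one by (simp add: algebra_simps)
  moreover have "real N ^ CARD('d) * ((2 * real CARD('d) * K * hr) * h ^ CARD('d)) = 2 * real CARD('d) * K * hr"
    using one by (simp add: mult.left_commute)
  ultimately show ?thesis unfolding R_h_eq[OF N] x_def[symmetric] by (simp only:)
qed

lemma mhat_le:
  assumes t: "t \<le> T"
  shows "mhat t x \<le> K * h ^ CARD('d)"
proof -
  have "\<bar>(LINT z:B_h N x|lborel. ms (tau t) z) - 0 * h ^ CARD('d)\<bar> \<le> K * h ^ CARD('d)"
    using m_bd[OF tau[OF t]] ms_measurable[OF tau[OF t]]
    by (intro set_integral_const_bounds[OF B_h_measurable emeasure_B_h _ B_h_integrable]) auto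
  then show ?thesis unfolding mhat_def I_h_def by simp
qed

lemma f_consistent:
  assumes t: "t \<le> T"
  shows "\<bar>f_h D T N t x (mhat t) - fc D (tau t) (gpoint N x) (ms (tau t))\<bar> \<le> E_f * hr"
proof -
  have "L2_norm_torus (\<lambda>y. R_h N (mhat t) y - ms (tau t) y) \<le> 2 * real CARD('d) * K * hr"
    using R_h_measurable[OF N] ms_measurable[OF tau[OF t]] mhat_average[OF t]
    by (intro L2_norm_le_sup borel_measurable_diff) auto
  then have "L_f D * L2_norm_torus (\<lambda>y. R_h N (mhat t) y - ms (tau t) y) \<le> L_f D * (2 * real CARD('d) * K * hr)"
    using consts_pos by (intro mult_left_mono) auto
  moreover have "L_f D * (real CARD('d) / real N) \<le> L_f D * (real CARD('d) * hr)"
    using hr consts_pos mult_left_mono[OF hr(2), of "real CARD('d)"] by (intro mult_left_mono) auto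
  moreover note f_h_consistent[OF N T t mhat_prob[OF t] ms_reg(5)[OF tau[OF t]], of x]
  ultimately show ?thesis by (simp add: E_f_def algebra_simps)
qed

text \<open>The residual is measured with the velocity trace \<open>vh\<close> inserted, not with
  the discrete Hamiltonian at \<open>nab (wh t)\<close>. The duality needs this affine expression in
  the gradient, and its distance to the Hamiltonian is treated separately in
  \<open>gradient_gap\<close>.\<close>

definition "eta_HJB t x = (uh t x - wh t x - (1 - \<theta>) * \<sigma> * \<delta> * lap (wh t) x) / \<delta>
   - (nab (wh t) x \<bullet> vh t x + lc D (tau t) (gpoint N x) (vh t x) + f_h D T N t x (mhat t))"

lemma uh_eq: "uh t x = wh t x + (1 - \<theta>) * \<sigma> * \<delta> * lap (wh t) x
    + \<delta> * (nab (wh t) x \<bullet> vh t x + lc D (tau t) (gpoint N x) (vh t x) + f_h D T N t x (mhat t) + eta_HJB t x)"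
  unfolding eta_HJB_def using delta by simp

lemma eta_HJB_bound:
  assumes t: "t < T"
  shows "\<bar>eta_HJB t x\<bar> \<le> E_HJB * hr"
proof -
  have t': "t \<le> T" "t + 1 \<le> T" using t by auto
  let ?z = "gpoint N x" and ?s = "tau t"
  define L2 where "L2 = lap (lap (uh (t + 1))) x"
  define l where "l = lc D ?s ?z (vh t x)"
  define P where "P = ph t x \<bullet> vh t x"
  define P' where "P' = nab (wh t) x \<bullet> vh t x"
  define f where "f = f_h D T N t x (mhat t)"
  define f' where "f' = fc D ?s ?z (ms ?s)"
  define Lh where "Lh = lap (uh (t + 1)) x"
  define Lc where "Lc = laplacian (us ?s) ?z"
  define dq where "dq = (uh (t + 1) x - uh t x) / \<delta>"
  have "uh t x - wh t x - (1 - \<theta>) * \<sigma> * \<delta> * lap (wh t) x = \<delta> * (- dq - \<sigma> * Lh - (1 - \<theta>) * \<theta> * \<sigma>\<^sup>2 * (\<delta> * L2))"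
    unfolding lap_wh wh_def dq_def Lh_def[symmetric] L2_def[symmetric] using delta by (simp add: field_simps power2_eq_square)
  then have 1: "eta_HJB t x = - dq - \<sigma> * Lh - (1 - \<theta>) * \<theta> * \<sigma>\<^sup>2 * (\<delta> * L2) - (P' + l + f)"
    unfolding eta_HJB_def P'_def[symmetric] l_def[symmetric] f_def[symmetric] using delta by simp
  have pde: "- dt us ?s ?z - \<sigma> * Lc + (- P - l) = f'"
    using equations(1)[OF tau[OF t'(1)], of ?z] vs_optimal(3)[OF tau[OF t'(1)], of ?z]
    unfolding Lc_def f'_def P_def ph_def vh_def l_def by simp
  have e1: "\<bar>dq - dt us ?s ?z\<bar> \<le> K * Kt * hr"
    unfolding dq_def uh_def by (rule time_quotient[OF us_reg(2) u_h(2) t tau_mem(1)])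
  have e2: "\<bar>\<sigma> * Lh - \<sigma> * Lc\<bar> \<le> \<sigma> * (real CARD('d) * K * (1 + Kt)) * hr"
  proof -
    have "\<bar>laplacian (us (tau (t + 1))) ?z - Lc\<bar> \<le> real CARD('d) * K * Kt * hr"
      unfolding Lc_def by (rule laplacian_time[OF u_h(4) t tau_mem(2,1)])
    with uh_laplacian[OF t'(2), of x] have "\<bar>Lh - Lc\<bar> \<le> real CARD('d) * K * hr + real CARD('d) * K * Kt * hr"
      unfolding Lh_def by linarith
    then have "\<sigma> * \<bar>Lh - Lc\<bar> \<le> \<sigma> * (real CARD('d) * K * hr + real CARD('d) * K * Kt * hr)" using sigma by (intro mult_left_mono) auto
    moreover have "\<sigma> * \<bar>Lh - Lc\<bar> = \<bar>\<sigma> * Lh - \<sigma> * Lc\<bar>" using sigma by (simp add: abs_mult right_diff_distrib[symmetric])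
    ultimately show ?thesis by (simp add: algebra_simps)
  qed
  have e3: "\<bar>(1 - \<theta>) * \<theta> * \<sigma>\<^sup>2 * (\<delta> * L2)\<bar> \<le> E_half * hr"
  proof -
    have "\<bar>(1 - \<theta>) * \<theta> * \<sigma>\<^sup>2 * (\<delta> * L2)\<bar> = (1 - \<theta>) * \<theta> * \<sigma>\<^sup>2 * (\<delta> * \<bar>L2\<bar>)"
      using theta delta by (simp add: abs_mult)
    also have "\<dots> \<le> \<sigma>\<^sup>2 * (6 * c0 * (real CARD('d))\<^sup>2 * K * hr)"
      using delta unfolding L2_def by (intro mult_mono[OF theta_sigma_le(2) lap_lap_uh[OF t'(2)]]) auto
    finally show ?thesis by (simp add: E_half_def mult_ac)
  qed
  have e4: "\<bar>P' - P\<bar> \<le> E_grad * K * hr"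
  proof -
    have "\<bar>P' - P\<bar> \<le> norm (nab (wh t) x - ph t x) * norm (vh t x)"
      unfolding P'_def P_def inner_diff_left[symmetric] by (rule Cauchy_Schwarz_ineq2)
    also have "\<dots> \<le> (E_grad * hr) * K"
      using grad_wh[OF t, of x] v_bd[OF tau[OF t'(1)], of ?z] E_nonneg hr unfolding vh_def by (intro mult_mono) auto
    finally show ?thesis by (simp add: mult_ac)
  qed
  have e5: "\<bar>f - f'\<bar> \<le> E_f * hr" unfolding f_def f'_def by (rule f_consistent[OF t'(1)])
  have "\<bar>eta_HJB t x\<bar> \<le> K * Kt * hr + \<sigma> * (real CARD('d) * K * (1 + Kt)) * hr + E_half * hr + E_grad * K * hr + E_f * hr"
    unfolding 1 using pde e1 e2 e3 e4 e5 by linarith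
  then show ?thesis by (simp add: E_HJB_def algebra_simps)
qed

end

lemma AE_lborel_dense:
  assumes "AE x in lborel. P x" "a < (b :: real)"
  shows "\<exists>x. a < x \<and> x < b \<and> P x"
proof (rule ccontr)
  assume "\<not> ?thesis"
  then have "AE x in lborel. x \<notin> {a<..<b}"
    using assms(1) by (auto elim: eventually_mono)
  then have "{a<..<b} \<in> null_sets lborel" by (subst AE_iff_null_sets) auto
  then have "emeasure lborel {a<..<b} = 0" by (rule null_setsD1)
  then show False using assms(2) by simp
qed

lemma gradient_norm_le:
  fixes \<phi> :: "real ^ 'd::finite \<Rightarrow> real"
  assumes "\<And>j. \<bar>pd j \<phi> x\<bar> \<le> c"
  shows "norm (grad \<phi> x) \<le> real CARD('d) * c"
  by (rule norm_le_card) (use assms in \<open>simp add: pd_def\<close>)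

lemma gradient_diff_norm_le:
  fixes \<phi> :: "real ^ 'd::finite \<Rightarrow> real"
  assumes "\<And>j. \<bar>pd j \<phi> x - pd j \<phi> z\<bar> \<le> c"
  shows "norm (grad \<phi> x - grad \<phi> z) \<le> real CARD('d) * c"
  by (rule norm_le_card) (use assms in \<open>simp add: pd_def\<close>)

lemma abs_mult_diff_le:
  fixes a b a' b' :: real
  assumes "\<bar>a - a'\<bar> \<le> e" "\<bar>b - b'\<bar> \<le> e'" "\<bar>b\<bar> \<le> B" "\<bar>a'\<bar> \<le> A"
  shows "\<bar>a * b - a' * b'\<bar> \<le> e * B + A * e'"
proof -
  have "a * b - a' * b' = (a - a') * b + a' * (b - b')" by (simp add: algebra_simps)
  then have "\<bar>a * b - a' * b'\<bar> \<le> \<bar>a - a'\<bar> * \<bar>b\<bar> + \<bar>a'\<bar> * \<bar>b - b'\<bar>"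
    using abs_triangle_ineq[of "(a - a') * b" "a' * (b - b')"] by (simp add: abs_mult)
  also have "\<dots> \<le> e * B + A * e'"
    using assms by (intro add_mono mult_mono) (auto intro: order_trans[OF abs_ge_zero])
  finally show ?thesis .
qed

lemma pd_mult:
  fixes \<phi> \<psi> :: "real ^ 'd::finite \<Rightarrow> real"
  assumes "\<phi> differentiable (at x)" "\<psi> differentiable (at x)"
  shows "pd i (\<lambda>y. \<phi> y * \<psi> y) x = \<phi> x * pd i \<psi> x + pd i \<phi> x * \<psi> x"
proof -
  have "GDERIV \<phi> x :> grad \<phi> x" "GDERIV \<psi> x :> grad \<psi> x"
    using assms unfolding gderiv_def by (auto intro: has_derivative_grad)
  from grad_eqI[OF GDERIV_mult[OF this]] show ?thesis by (simp add: pd_def mult.commute)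
qed

text \<open>The flux \<open>m b\<close> with \<open>b\<close> evaluated at points shifted by \<open>y\<close>: the cell average of \<open>m\<close>
  is multiplied by the velocity at the centre of the cell.\<close>

lemma flux_consistent:
  fixes m b :: "real ^ 'd::finite \<Rightarrow> real"
  assumes N: "N > 0" and r: "0 < r" "r < 1" and K: "K \<ge> 0"
    and diff: "\<And>x. m differentiable (at x)" "\<And>x. b differentiable (at x)"
    and bd: "\<And>x. \<bar>m x\<bar> \<le> K" "\<And>x. \<bar>b x\<bar> \<le> K" "\<And>x j. \<bar>pd j m x\<bar> \<le> K" "\<And>x j. \<bar>pd j b x\<bar> \<le> K"
    and hol: "\<And>x y. \<bar>m x - m y\<bar> \<le> K * dist x y powr r" "\<And>x y. \<bar>b x - b y\<bar> \<le> K * dist x y powr r"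
      "\<And>x y j. \<bar>pd j m x - pd j m y\<bar> \<le> K * dist x y powr r" "\<And>x y j. \<bar>pd j b x - pd j b y\<bar> \<le> K * dist x y powr r"
    and y: "norm y \<le> real CARD('d) * (1 / real N)"
  defines "h \<equiv> 1 / real N"
  shows "\<bar>real N / 2 * (m (z + axis i h) * b (z + axis i h - y) - m (z - axis i h) * b (z - axis i h - y))
     - pd i (\<lambda>x. m x * b x) z\<bar> \<le> (2 * K\<^sup>2 * (real CARD('d))\<^sup>2 + 4 * K\<^sup>2) * h powr r"
proof -
  let ?cd = "real CARD('d)"
  have h: "h > 0" "real N * h = 1" "h \<le> 1" "h \<le> h powr r"
  proof -
    show *: "h > 0" "real N * h = 1" "h \<le> 1" using N by (auto simp: h_def)
    have "h powr 1 \<le> h powr r" using * r by (intro powr_mono') auto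
    then show "h \<le> h powr r" using * by simp
  qed
  have nax: "norm (axis i c :: real ^ 'd) = \<bar>c\<bar>" for c
  proof -
    have "axis i c = c *\<^sub>R (axis i 1 :: real ^ 'd)" by (simp add: axis_def vec_eq_iff)
    then show ?thesis by simp
  qed
  define zp where "zp = z + axis i h"
  define zm where "zm = z - axis i h"
  have dz: "dist zp zm powr r \<le> 2 * h powr r"
  proof -
    have "dist zp zm = norm (axis i (2 * h) :: real ^ 'd)"
      unfolding dist_norm zp_def zm_def by (rule arg_cong[where f = norm]) (simp add: vec_eq_iff axis_def)
    then have "dist zp zm powr r = 2 powr r * h powr r" using h by (simp add: nax powr_mult)
    also have "\<dots> \<le> 2 powr 1 * h powr r" using r by (intro mult_right_mono powr_mono) auto
    finally show ?thesis by simp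
  qed
  have dm: "\<bar>m zp - m zm\<bar> \<le> 2 * h * K"
  proof -
    obtain s where "m (z + h *\<^sub>R axis i 1) - m (z + (- h) *\<^sub>R axis i 1) = (h - - h) * (axis i 1 \<bullet> grad m (z + s *\<^sub>R axis i 1))"
      using mvt_line[OF diff(1), of "- h" h z "axis i 1"] h by auto
    moreover have "z + h *\<^sub>R axis i 1 = zp" "z + (- h) *\<^sub>R axis i 1 = zm"
      by (simp_all add: zp_def zm_def axis_def vec_eq_iff)
    ultimately have "m zp - m zm = 2 * h * pd i m (z + s *\<^sub>R axis i 1)" by (simp add: axis_inner pd_def)
    then show ?thesis using h bd(3)[of i "z + s *\<^sub>R axis i 1"] by (simp add: abs_mult mult_left_mono)
  qed
  define G where "G w s = b (w - y + s *\<^sub>R y)" for w s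
  have dG: "(G w has_real_derivative y \<bullet> grad b (w - y + s *\<^sub>R y)) (at s)" for w s
    unfolding G_def[abs_def] by (rule line_derivative[OF diff(2)])
  have db: "\<bar>b w - b (w - y)\<bar> \<le> ?cd * h * (?cd * K)" for w
  proof -
    have "\<exists>s>0. s < 1 \<and> G w 1 - G w 0 = (1 - 0) * (y \<bullet> grad b (w - y + s *\<^sub>R y))"
      by (rule MVT2[OF zero_less_one dG])
    then obtain s where "G w 1 - G w 0 = (1 - 0) * (y \<bullet> grad b (w - y + s *\<^sub>R y))" by blast
    then have "b w - b (w - y) = y \<bullet> grad b (w - y + s *\<^sub>R y)" by (simp add: G_def)
    then have "\<bar>b w - b (w - y)\<bar> \<le> norm y * norm (grad b (w - y + s *\<^sub>R y))" using Cauchy_Schwarz_ineq2 by metis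
    also have "\<dots> \<le> ?cd * h * (?cd * K)"
      using y gradient_norm_le[OF bd(4)] K h unfolding h_def by (intro mult_mono) auto
    finally show ?thesis .
  qed
  \<comment> \<open>One mean value theorem for the difference of both increments, so that the same
    \<open>s\<close> occurs in the two gradients. Their difference is of order \<open>h^r\<close>,
    and with \<open>|y|\<close> of order \<open>h\<close> the factor \<open>N / 2\<close> is
    compensated.\<close>
  have ddb: "\<bar>(b zp - b (zp - y)) - (b zm - b (zm - y))\<bar> \<le> ?cd * h * (?cd * (K * (2 * h powr r)))"
  proof -
    have dd: "((\<lambda>s. G zp s - G zm s) has_real_derivative y \<bullet> grad b (zp - y + s *\<^sub>R y) - y \<bullet> grad b (zm - y + s *\<^sub>R y)) (at s)" for s
      by (intro DERIV_diff dG)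
    have "\<exists>s>0. s < 1 \<and> (G zp 1 - G zm 1) - (G zp 0 - G zm 0) = (1 - 0) * (y \<bullet> grad b (zp - y + s *\<^sub>R y) - y \<bullet> grad b (zm - y + s *\<^sub>R y))"
      by (rule MVT2[OF zero_less_one dd])
    then obtain s where "(G zp 1 - G zm 1) - (G zp 0 - G zm 0) = (1 - 0) * (y \<bullet> grad b (zp - y + s *\<^sub>R y) - y \<bullet> grad b (zm - y + s *\<^sub>R y))"
      by blast
    then have "(b zp - b (zp - y)) - (b zm - b (zm - y)) = y \<bullet> (grad b (zp - y + s *\<^sub>R y) - grad b (zm - y + s *\<^sub>R y))"
      by (simp add: G_def inner_diff_right)
    then have "\<bar>(b zp - b (zp - y)) - (b zm - b (zm - y))\<bar> \<le> norm y * norm (grad b (zp - y + s *\<^sub>R y) - grad b (zm - y + s *\<^sub>R y))"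
      using Cauchy_Schwarz_ineq2 by metis
    also have "\<dots> \<le> ?cd * h * (?cd * (K * (2 * h powr r)))"
    proof (intro mult_mono gradient_diff_norm_le)
      fix j
      have "dist (zp - y + s *\<^sub>R y) (zm - y + s *\<^sub>R y) = dist zp zm" by (simp add: dist_norm)
      then have "\<bar>pd j b (zp - y + s *\<^sub>R y) - pd j b (zm - y + s *\<^sub>R y)\<bar> \<le> K * dist zp zm powr r"
        using hol(4)[of j "zp - y + s *\<^sub>R y" "zm - y + s *\<^sub>R y"] by simp
      also have "\<dots> \<le> K * (2 * h powr r)" using dz K by (intro mult_left_mono) auto
      finally show "\<bar>pd j b (zp - y + s *\<^sub>R y) - pd j b (zm - y + s *\<^sub>R y)\<bar> \<le> K * (2 * h powr r)" .
    qed (use y h in \<open>auto simp: h_def\<close>)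
    finally show ?thesis .
  qed
  have "\<bar>(m zp * b (zp - y) - m zm * b (zm - y)) - (m zp * b zp - m zm * b zm)\<bar> =
      \<bar>m zp * (b zp - b (zp - y)) - m zm * (b zm - b (zm - y))\<bar>"
    by (simp add: algebra_simps abs_minus_commute)
  also have "\<dots> \<le> (2 * h * K) * (?cd * h * (?cd * K)) + K * (?cd * h * (?cd * (K * (2 * h powr r))))"
    by (rule abs_mult_diff_le[OF dm ddb db bd(1)])
  finally have "real N / 2 * \<bar>(m zp * b (zp - y) - m zm * b (zm - y)) - (m zp * b zp - m zm * b zm)\<bar> \<le>
      real N / 2 * ((2 * h * K) * (?cd * h * (?cd * K)) + K * (?cd * h * (?cd * (K * (2 * h powr r)))))"
    by (rule mult_left_mono) simp
  also have "\<dots> = (real N * h) * (K\<^sup>2 * ?cd\<^sup>2 * h + K\<^sup>2 * ?cd\<^sup>2 * h powr r)"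
    by (simp add: power2_eq_square algebra_simps)
  also have "\<dots> \<le> 2 * K\<^sup>2 * ?cd\<^sup>2 * h powr r"
  proof -
    have "K\<^sup>2 * ?cd\<^sup>2 * h \<le> K\<^sup>2 * ?cd\<^sup>2 * h powr r" using h by (intro mult_left_mono) auto
    then show ?thesis unfolding h(2) by (simp add: algebra_simps)
  qed
  finally have 1: "\<bar>real N / 2 * (m zp * b (zp - y) - m zm * b (zm - y)) - real N / 2 * (m zp * b zp - m zm * b zm)\<bar> \<le> 2 * K\<^sup>2 * ?cd\<^sup>2 * h powr r"
    unfolding right_diff_distrib[symmetric] abs_mult by simp
  have "\<bar>real N / 2 * ((\<lambda>x. m x * b x) (z + axis i (1 / real N)) - (\<lambda>x. m x * b x) (z - axis i (1 / real N))) - pd i (\<lambda>x. m x * b x) z\<bar>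
      \<le> (4 * K\<^sup>2) * (1 / real N) powr r"
  proof (rule central_difference)
    show "(\<lambda>x. m x * b x) differentiable (at x)" for x using diff by (intro differentiable_mult) auto
    fix x x'
    have "\<bar>m x * pd i b x - m x' * pd i b x'\<bar> \<le> (K * dist x x' powr r) * K + K * (K * dist x x' powr r)"
      by (rule abs_mult_diff_le[OF hol(1) hol(4) bd(4) bd(1)])
    moreover have "\<bar>pd i m x * b x - pd i m x' * b x'\<bar> \<le> (K * dist x x' powr r) * K + K * (K * dist x x' powr r)"
      by (rule abs_mult_diff_le[OF hol(3) hol(2) bd(2) bd(3)])
    ultimately show "\<bar>pd i (\<lambda>x. m x * b x) x - pd i (\<lambda>x. m x * b x) x'\<bar> \<le> 4 * K\<^sup>2 * dist x x' powr r"
      unfolding pd_mult[OF diff] by (simp add: power2_eq_square abs_le_iff algebra_simps)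
  qed (use N r in auto)
  then have 2: "\<bar>real N / 2 * (m zp * b zp - m zm * b zm) - pd i (\<lambda>x. m x * b x) z\<bar> \<le> 4 * K\<^sup>2 * h powr r"
    by (simp only: zp_def zm_def h_def)
  have "\<bar>real N / 2 * (m zp * b (zp - y) - m zm * b (zm - y)) - pd i (\<lambda>x. m x * b x) z\<bar> \<le> 2 * K\<^sup>2 * ?cd\<^sup>2 * h powr r + 4 * K\<^sup>2 * h powr r"
    using 1 2 by linarith
  then show ?thesis unfolding zp_def[symmetric] zm_def[symmetric] by (simp only: distrib_right)
qed

section \<open>Residual of the forward scheme\<close>

context convergence
begin

definition "eta_FP t x = (mhat (t + 1) x - mhat t x) / \<delta> - \<theta> * \<sigma> * lap (mhat (t + 1)) x
   - (1 - \<theta>) * \<sigma> * lap (mhat t) x + div_h N (\<lambda>y. mhat t y *\<^sub>R vh t y) x"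

lemma mhat_eq:
  "mhat (t + 1) x - \<theta> * \<sigma> * \<delta> * lap (mhat (t + 1)) x =
    mhat t x + (1 - \<theta>) * \<sigma> * \<delta> * lap (mhat t) x - \<delta> * div_h N (\<lambda>y. mhat t y *\<^sub>R vh t y) x + \<delta> * eta_FP t x"
proof -
  have "\<delta> * ((mhat (t + 1) x - mhat t x) / \<delta>) = mhat (t + 1) x - mhat t x" using delta by simp
  then show ?thesis unfolding eta_FP_def by (simp add: algebra_simps)
qed

text \<open>All cells are translated to the one at the origin. Averages at neighbouring grid points
  become integrals over the same set, and the residual becomes the integral of a single local
  residual that can be estimated pointwise.\<close>

definition has_cell_integral :: "(real ^ 'd \<Rightarrow> real) \<Rightarrow> real \<Rightarrow> bool" where
  "has_cell_integral \<phi> c \<longleftrightarrow> set_integrable lborel (B_h N 0) \<phi> \<and> (LINT y:B_h N 0|lborel. \<phi> y) = c"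

lemma has_cell_integral_intros:
  "has_cell_integral \<phi> a \<Longrightarrow> has_cell_integral \<psi> b \<Longrightarrow> has_cell_integral (\<lambda>y. \<phi> y + \<psi> y) (a + b)"
  "has_cell_integral \<phi> a \<Longrightarrow> has_cell_integral \<psi> b \<Longrightarrow> has_cell_integral (\<lambda>y. \<phi> y - \<psi> y) (a - b)"
  "has_cell_integral \<phi> a \<Longrightarrow> has_cell_integral (\<lambda>y. c * \<phi> y) (c * a)"
  unfolding has_cell_integral_def by (auto simp: set_integral_add set_integral_diff)

lemma has_cell_integral_sum:
  assumes "\<And>i. i \<in> I \<Longrightarrow> has_cell_integral (\<phi> i) (a i)" "finite I"
  shows "has_cell_integral (\<lambda>y. \<Sum>i\<in>I. \<phi> i y) (\<Sum>i\<in>I. a i)"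
  using assms(2,1)
proof (induction I)
  case empty
  show ?case by (simp add: has_cell_integral_def set_integrable_def set_lebesgue_integral_def)
next
  case (insert i I)
  then show ?case by (simp add: has_cell_integral_intros(1))
qed

lemma has_cell_integral_bound:
  assumes "has_cell_integral \<phi> c" "\<And>y. y \<in> B_h N 0 \<Longrightarrow> \<bar>\<phi> y\<bar> \<le> B"
  shows "\<bar>c\<bar> \<le> B * h ^ CARD('d)"
  using set_integral_const_bounds[OF B_h_measurable emeasure_B_h _, of N 0 \<phi> 0 B] assms
  by (simp add: has_cell_integral_def)

lemma has_cell_integral_ms:
  assumes t: "t \<in> {0..1}"
  shows "has_cell_integral (\<lambda>y. ms t (gpoint N x + y)) (I_h N (ms t) x)"
proof -
  have [measurable]: "ms t \<in> borel_measurable borel" "\<And>x. B_h N x \<in> sets (borel :: (real ^ 'd) measure)"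
    using ms_measurable[OF t] B_h_measurable by auto
  have "set_integrable lborel (B_h N 0) (\<lambda>y. ms t (gpoint N x + y))"
    using m_bd[OF t] by (intro B_h_integrable[where B = K]) auto
  moreover have "(LINT y:B_h N 0|lborel. ms t (gpoint N x + y)) = I_h N (ms t) x"
  proof -
    have shift: "gpoint N x $ j - c \<le> (y + gpoint N x) $ j \<longleftrightarrow> gpoint N 0 $ j - c \<le> y $ j"
      "(y + gpoint N x) $ j < gpoint N x $ j + c \<longleftrightarrow> y $ j < gpoint N 0 $ j + c" for j c and y :: "real ^ 'd"
      by (auto simp: gpoint_def)
    have "y + gpoint N x \<in> B_h N x \<longleftrightarrow> y \<in> B_h N 0" for y
      unfolding B_h_def mem_Collect_eq shift ..
    then have "(\<lambda>y. indicator (B_h N 0) y *\<^sub>R ms t (gpoint N x + y)) = (\<lambda>y. indicator (B_h N x) (y + gpoint N x) *\<^sub>R ms t (y + gpoint N x))"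
      by (simp add: fun_eq_iff indicator_def add.commute)
    moreover have "integral\<^sup>L lborel (\<lambda>y. indicator (B_h N x) (y + gpoint N x) *\<^sub>R ms t (y + gpoint N x)) = integral\<^sup>L lborel (\<lambda>y. indicator (B_h N x) y *\<^sub>R ms t y)"
      by (rule lborel_translate(1)[of "\<lambda>y. indicator (B_h N x) y *\<^sub>R ms t y"]) measurable
    ultimately show ?thesis unfolding I_h_def set_lebesgue_integral_def by simp
  qed
  ultimately show ?thesis by (simp add: has_cell_integral_def)
qed

lemma has_cell_integral_shift:
  assumes t: "t \<in> {0..1}"
  shows "has_cell_integral (\<lambda>y. ms t (gpoint N x + y + axis i h)) (I_h N (ms t) (x + axis i 1))"
    "has_cell_integral (\<lambda>y. ms t (gpoint N x + y - axis i h)) (I_h N (ms t) (x - axis i 1))"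
proof -
  have eqs: "gpoint N x + y + axis i h = gpoint N (x + axis i 1) + y" "gpoint N x + y - axis i h = gpoint N (x - axis i 1) + y" for y
    unfolding gpoint_shift by (simp_all add: algebra_simps)
  show "has_cell_integral (\<lambda>y. ms t (gpoint N x + y + axis i h)) (I_h N (ms t) (x + axis i 1))"
    "has_cell_integral (\<lambda>y. ms t (gpoint N x + y - axis i h)) (I_h N (ms t) (x - axis i 1))"
    unfolding eqs by (rule has_cell_integral_ms[OF t])+
qed

lemma has_cell_integral_clap:
  assumes t: "t \<in> {0..1}"
  shows "has_cell_integral (\<lambda>y. clap (ms t) (gpoint N x + y)) (lap (I_h N (ms t)) x)"
  unfolding clap_def laplacian_h_eq
  by (intro has_cell_integral_sum has_cell_integral_intros has_cell_integral_ms has_cell_integral_shift t) simp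

definition "flux t x y i = real N / 2 * (vh t (x + axis i 1) $ i * ms (tau t) (gpoint N x + y + axis i h)
    - vh t (x - axis i 1) $ i * ms (tau t) (gpoint N x + y - axis i h))"

definition "local_eta t x y = 1 / \<delta> * (ms (tau (t + 1)) (gpoint N x + y) - ms (tau t) (gpoint N x + y))
   - \<theta> * \<sigma> * clap (ms (tau (t + 1))) (gpoint N x + y) - (1 - \<theta>) * \<sigma> * clap (ms (tau t)) (gpoint N x + y)
   + (\<Sum>i\<in>UNIV. flux t x y i)"

lemma eta_FP_integral:
  assumes t: "t < T"
  shows "has_cell_integral (local_eta t x) (eta_FP t x)"
proof -
  have t': "tau t \<in> {0..1}" "tau (t + 1) \<in> {0..1}" using t by (intro tau; simp)+
  have "has_cell_integral (local_eta t x) (1 / \<delta> * (mhat (t + 1) x - mhat t x)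
     - \<theta> * \<sigma> * lap (mhat (t + 1)) x - (1 - \<theta>) * \<sigma> * lap (mhat t) x
     + (\<Sum>i\<in>UNIV. real N / 2 * (vh t (x + axis i 1) $ i * mhat t (x + axis i 1) - vh t (x - axis i 1) $ i * mhat t (x - axis i 1))))"
    unfolding local_eta_def[abs_def] flux_def mhat_def
    by (intro has_cell_integral_sum has_cell_integral_intros has_cell_integral_ms has_cell_integral_shift has_cell_integral_clap t') simp
  also have "(\<Sum>i\<in>UNIV. real N / 2 * (vh t (x + axis i 1) $ i * mhat t (x + axis i 1) - vh t (x - axis i 1) $ i * mhat t (x - axis i 1)))
     = div_h N (\<lambda>y. mhat t y *\<^sub>R vh t y) x"
    by (simp add: div_h_eq mult.commute)
  finally show ?thesis by (simp add: eta_FP_def)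
qed

lemma good_time:
  assumes t: "t < T" and e: "e > 0"
  obtains s where "s \<in> {tau t..tau (t + 1)}" "\<bar>s - tau t\<bar> \<le> e" "C1r_bounded r K (vs s)"
proof -
  define a b where "a = tau t" and "b = min (tau (t + 1)) (tau t + e)"
  have "a < b" unfolding a_def b_def using tau_mono(1)[of t] e by (simp only: min_less_iff_conj less_add_same_cancel1 simp_thms)
  from AE_lborel_dense[OF v_h(2) this] obtain s where s: "a < s" "s < b" "s \<in> {0..1} \<longrightarrow> C1r_bounded r K (vs s)" by blast
  then have mem: "s \<in> {tau t..tau (t + 1)}" "\<bar>s - tau t\<bar> \<le> e" unfolding a_def b_def by auto
  moreover have "s \<in> {0..1}" 
  proof -
    have "tau t \<in> {0..1}" "tau (t + 1) \<in> {0..1}" using t by (intro tau; simp)+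
    then show ?thesis using mem(1) unfolding atLeastAtMost_iff by linarith
  qed
  ultimately show ?thesis using s(3) by (intro that) auto
qed

text \<open>The bounds on the derivatives of \<open>vs\<close> hold only at almost every time. They are used at such a
  time \<open>s\<close>, chosen so close to \<open>tau t\<close> that replacing \<open>vs (tau t)\<close> by \<open>vs s\<close> in the difference
  quotients costs less than the consistency error despite the factor \<open>N\<close>.\<close>

lemma local_eta_bound:
  assumes t: "t < T" and y: "y \<in> B_h N 0"
  shows "\<bar>local_eta t x y\<bar> \<le> E_FP * hr"
proof -
  define z where "z = gpoint N x + y"
  define a b where "a = tau t" and "b = tau (t + 1)"
  have a: "a \<in> {0..1}" and b: "b \<in> {0..1}" unfolding a_def b_def using t by (intro tau; simp)+
  \<comment> \<open>The distance \<open>e\<close> in time is chosen with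
    \<open>K e^(r/2) = h * hr\<close>, so that the factor \<open>N\<close> of the flux quotient
    leaves \<open>hr\<close>. Since \<open>q \<le> 1\<close>, the exponent \<open>r\<close> for
    \<open>vs\<close> in place of \<open>r / 2\<close> does no harm.\<close>
  define q where "q = h * hr / K"
  have q: "q > 0" unfolding q_def using h hr K1 by simp
  define e where "e = q powr (2 / r)"
  have "e powr (r / 2) = q" using q r by (simp add: e_def powr_powr)
  then have e: "e > 0" "e powr (r / 2) = h * hr / K" using q by (simp_all only: q_def e_def powr_gt_zero)
  obtain s where s: "s \<in> {tau t..tau (t + 1)}" "\<bar>s - tau t\<bar> \<le> e" and C1r: "C1r_bounded r K (vs s)"
    by (rule good_time[OF t e(1)])
  have s01: "s \<in> {0..1}" using s(1) a b unfolding a_def b_def atLeastAtMost_iff by linarith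
  have e_le: "h * hr / K \<le> 1"
  proof -
    have "hr \<le> 1" unfolding hr_def using h r powr_mono2[of r h 1] by auto
    then have "h * hr \<le> 1 * 1" using h hr by (intro mult_mono) auto
    then have "h * hr \<le> K" using K1 by linarith
    then show ?thesis by (intro divide_le_eq_1_pos[THEN iffD2]) (use K1 in auto)
  qed
  have scale: "p \<le> h * hr / K \<Longrightarrow> K * p \<le> h * hr" for p
    using K1 mult_left_mono[of p "h * hr / K" K] by simp
  have near: "K * \<bar>s - a\<bar> powr (r / 2) \<le> h * hr" "K * \<bar>s - a\<bar> powr r \<le> h * hr"
  proof -
    have "\<bar>s - a\<bar> powr (r / 2) \<le> e powr (r / 2)" using s(2) r unfolding a_def by (intro powr_mono2) auto
    then have 1: "\<bar>s - a\<bar> powr (r / 2) \<le> h * hr / K" unfolding e(2) .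
    then show "K * \<bar>s - a\<bar> powr (r / 2) \<le> h * hr" by (rule scale)
    have "\<bar>s - a\<bar> powr r = \<bar>s - a\<bar> powr (r / 2) * \<bar>s - a\<bar> powr (r / 2)" by (simp add: powr_add[symmetric])
    also have "\<dots> \<le> 1 * (h * hr / K)" using 1 e_le by (intro mult_mono) auto
    finally show "K * \<bar>s - a\<bar> powr r \<le> h * hr" by (intro scale) simp
  qed
  have m_near: "\<bar>ms a w - ms s w\<bar> \<le> h * hr" for w
    using holder_const_time[OF m_h(1) s01 a, of w] near(1) by (simp add: dist_real_def abs_minus_commute)
  have v_near: "\<bar>vs a w $ i - vs s w $ i\<bar> \<le> h * hr" for w i
  proof -
    have "\<bar>(vs s w - vs a w) $ i\<bar> \<le> norm (vs s w - vs a w)" by (rule component_le_norm_cart)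
    then show ?thesis using holder_const_time[OF v_h(1) s01 a, of w] near(2) by (simp add: dist_norm)
  qed
  have T1: "\<bar>(ms b z - ms a z) / \<delta> - dt ms s z\<bar> \<le> K * Kt * hr"
    unfolding a_def b_def by (rule time_quotient[OF ms_reg(2) m_h(2) t s(1)])
  have T2: "\<bar>\<sigma> * clap (ms c) z - \<sigma> * laplacian (ms s) z\<bar> \<le> \<sigma> * (real CARD('d) * K * (1 + Kt)) * hr" if "c = a \<or> c = b" for c
  proof -
    have c: "c \<in> {0..1}" using that a b by auto
    have "\<bar>clap (ms c) z - laplacian (ms c) z\<bar> \<le> real CARD('d) * K * hr"
      using ms_reg(3,4)[OF c] space_holder[OF m_h(4) c] by (intro clap_consistent) auto
    moreover have "\<bar>laplacian (ms c) z - laplacian (ms s) z\<bar> \<le> real CARD('d) * K * Kt * hr"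
      using that tau_mem[of t] unfolding a_def b_def by (intro laplacian_time[OF m_h(4) t _ s(1)]) blast
    ultimately have "\<bar>clap (ms c) z - laplacian (ms s) z\<bar> \<le> real CARD('d) * K * (1 + Kt) * hr"
      by (simp add: algebra_simps)
    then have "\<sigma> * \<bar>clap (ms c) z - laplacian (ms s) z\<bar> \<le> \<sigma> * (real CARD('d) * K * (1 + Kt) * hr)"
      using sigma by (intro mult_left_mono) auto
    then show ?thesis using sigma by (simp add: abs_mult right_diff_distrib[symmetric] mult.assoc)
  qed
  have T3: "\<bar>flux t x y i - pd i (\<lambda>w. ms s w * vs s w $ i) z\<bar> \<le> E_div * hr" for i
  proof -
    let ?zp = "z + axis i h" and ?zm = "z - axis i h"
    \<comment> \<open>The velocities sit at cell centres: \<open>y\<close> is the offset of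
      \<open>z\<close> from the centre, and the same offset applies at both neighbours.\<close>
    have vh: "vh t (x + axis i 1) = vs a (?zp - y)" "vh t (x - axis i 1) = vs a (?zm - y)"
      by (simp_all add: vh_def gpoint_shift z_def a_def algebra_simps)
    have comp: "\<bar>vs c w $ i\<bar> \<le> K" if "c \<in> {0..1}" for c w
      using component_le_norm_cart[of "vs c w" i] v_bd[OF that, of w] by linarith
    have prod: "\<bar>vs a (w - y) $ i * ms a w - ms s w * vs s (w - y) $ i\<bar> \<le> 2 * (K * (h * hr))" for w
      using abs_mult_diff_le[OF m_near[of w] v_near[of "w - y" i] comp[OF a] m_bd[OF s01]]
      by (simp add: mult.commute)
    have "\<bar>(vs a (?zp - y) $ i * ms a ?zp - vs a (?zm - y) $ i * ms a ?zm) - (ms s ?zp * vs s (?zp - y) $ i - ms s ?zm * vs s (?zm - y) $ i)\<bar> \<le> 4 * (K * (h * hr))"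
      using prod[of ?zp] prod[of ?zm] by linarith
    then have "real N / 2 * \<bar>(vs a (?zp - y) $ i * ms a ?zp - vs a (?zm - y) $ i * ms a ?zm) - (ms s ?zp * vs s (?zp - y) $ i - ms s ?zm * vs s (?zm - y) $ i)\<bar> \<le> real N / 2 * (4 * (K * (h * hr)))"
      by (rule mult_left_mono) simp
    also have "\<dots> = (real N * h) * (2 * K * hr)" by simp
    also have "\<dots> = 2 * K * hr" unfolding h(3) by simp
    finally have 1: "\<bar>flux t x y i - real N / 2 * (ms s ?zp * vs s (?zp - y) $ i - ms s ?zm * vs s (?zm - y) $ i)\<bar> \<le> 2 * K * hr"
      unfolding flux_def vh z_def[symmetric] a_def[symmetric] right_diff_distrib[symmetric, of "real N / 2"] abs_mult by simp
    have "norm (y - gpoint N 0) \<le> real CARD('d) / real N" by (rule B_h_norm[OF N T le_refl y])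
    then have ny: "norm y \<le> real CARD('d) * h" by (simp add: gpoint_def zero_vec_def[symmetric])
    have C1: "(\<lambda>w. vs s w $ i) differentiable (at w)" "\<bar>pd j (\<lambda>w. vs s w $ i) w\<bar> \<le> K"
      "\<bar>pd j (\<lambda>w. vs s w $ i) w - pd j (\<lambda>w. vs s w $ i) w'\<bar> \<le> K * dist w w' powr r" for w w' j
      using C1r unfolding C1r_bounded_def by blast+
    have v_space: "\<bar>vs s w $ i - vs s w' $ i\<bar> \<le> K * dist w w' powr r" for w w'
    proof -
      have "\<bar>(vs s w - vs s w') $ i\<bar> \<le> norm (vs s w - vs s w')" by (rule component_le_norm_cart)
      then show ?thesis using holder_const_space[OF v_h(1) s01, of w w'] by (simp add: dist_norm)
    qed
    have 2: "\<bar>real N / 2 * (ms s ?zp * vs s (?zp - y) $ i - ms s ?zm * vs s (?zm - y) $ i) - pd i (\<lambda>w. ms s w * vs s w $ i) z\<bar>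
       \<le> (2 * K\<^sup>2 * (real CARD('d))\<^sup>2 + 4 * K\<^sup>2) * h powr r"
      by (rule flux_consistent[where b = "\<lambda>w. vs s w $ i", OF N r _ ms_reg(3)[OF s01] C1(1) m_bd[OF s01] comp[OF s01] dm_bd[OF s01] C1(2)
          space_holder[OF m_h(1) s01] v_space space_holder[OF m_h(3) s01] C1(3) ny]) (use K1 in simp)
    have "\<bar>flux t x y i - pd i (\<lambda>w. ms s w * vs s w $ i) z\<bar> \<le> 2 * K * hr + (2 * K\<^sup>2 * (real CARD('d))\<^sup>2 + 4 * K\<^sup>2) * hr"
      using 1 2 unfolding hr_def[symmetric] by linarith
    then show ?thesis by (simp add: E_div_def algebra_simps)
  qed
  have T3': "\<bar>(\<Sum>i\<in>UNIV. flux t x y i) - divergence (\<lambda>w. ms s w *\<^sub>R vs s w) z\<bar> \<le> real CARD('d) * E_div * hr"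
  proof -
    have "\<bar>(\<Sum>i\<in>UNIV. flux t x y i) - divergence (\<lambda>w. ms s w *\<^sub>R vs s w) z\<bar> \<le> (\<Sum>i\<in>(UNIV :: 'd set). E_div * hr)"
      unfolding divergence_def sum_subtractf[symmetric] using T3 by (intro order_trans[OF sum_abs] sum_mono) simp
    then show ?thesis by simp
  qed
  define A where "A = (ms b z - ms a z) / \<delta>"
  define S where "S = (\<Sum>i\<in>UNIV. flux t x y i)"
  define Lb where "Lb = \<sigma> * clap (ms b) z - \<sigma> * laplacian (ms s) z"
  define La where "La = \<sigma> * clap (ms a) z - \<sigma> * laplacian (ms s) z"
  have "local_eta t x y = A - \<theta> * \<sigma> * clap (ms b) z - (1 - \<theta>) * \<sigma> * clap (ms a) z + S"
    unfolding local_eta_def A_def S_def z_def a_def b_def by simp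
  also have "\<dots> = (A - dt ms s z) - \<theta> * Lb - (1 - \<theta>) * La + (S - divergence (\<lambda>w. ms s w *\<^sub>R vs s w) z)"
    using equations(3)[OF s01, of z] unfolding Lb_def La_def by (simp add: algebra_simps)
  finally have eq: "local_eta t x y = (A - dt ms s z) - \<theta> * Lb - (1 - \<theta>) * La + (S - divergence (\<lambda>w. ms s w *\<^sub>R vs s w) z)" .
  let ?X = "\<sigma> * (real CARD('d) * K * (1 + Kt)) * hr"
  have "\<bar>\<theta> * Lb\<bar> \<le> 1 * ?X" unfolding abs_mult using T2[of b] theta unfolding Lb_def by (intro mult_mono) auto
  moreover have "\<bar>(1 - \<theta>) * La\<bar> \<le> 1 * ?X" unfolding abs_mult using T2[of a] theta unfolding La_def by (intro mult_mono) auto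
  ultimately have "\<bar>local_eta t x y\<bar> \<le> K * Kt * hr + ?X + ?X + real CARD('d) * E_div * hr"
    unfolding eq using T1 T3' unfolding A_def S_def by linarith
  then show ?thesis by (simp add: E_FP_def algebra_simps)
qed

lemma eta_FP_bound: "t < T \<Longrightarrow> \<bar>eta_FP t x\<bar> \<le> E_FP * hr * h ^ CARD('d)"
  by (rule has_cell_integral_bound[OF eta_FP_integral local_eta_bound])

lemma mhat_initial: "mhat 0 x = I_h N (m0c D) x"
proof -
  have [measurable]: "ms 0 \<in> borel_measurable borel" "m0c D \<in> borel_measurable borel" "B_h N x \<in> sets (borel :: (real ^ 'd) measure)"
    using ms_measurable[of 0] densitiesD(2)[of "m0c D"] torus B_h_measurable by (auto simp: torus_data_def)
  have "AE y in lborel. indicat_real (B_h N x) y *\<^sub>R ms 0 y = indicat_real (B_h N x) y *\<^sub>R m0c D y"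
    using equations(4) by eventually_elim simp
  then have "integral\<^sup>L lborel (\<lambda>y. indicat_real (B_h N x) y *\<^sub>R ms 0 y) = integral\<^sup>L lborel (\<lambda>y. indicat_real (B_h N x) y *\<^sub>R m0c D y)"
    by (intro integral_cong_AE) measurable
  then show ?thesis by (simp add: mhat_def I_h_def set_lebesgue_integral_def)
qed

end

section \<open>Stability and convergence\<close>

context regular_bounds
begin

definition "E_all = E_grad + E_half + E_HJB + E_FP"
text \<open>Coefficients of \<open>\<epsilon>\<^sup>2\<close> and \<open>\<epsilon> Y\<close> in the
  estimate for \<open>Y\<^sup>2\<close>, where \<open>Y\<close> is the distance of the densities. In
  \<open>c_1\<close>, \<open>1 / (2 alpha)\<close> is the quadratic gradient gap,
  \<open>2 (1 + 2 M)\<close> the value error met by the forward residual, and the last 1 that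
  residual as a source. In \<open>c_2\<close>, 2 counts the two backward residuals paired with the
  densities, and \<open>2 L_f\<close> comes from the coupling in the value error.\<close>

definition "c_1 = exp K_growth * K_source * (K * (2 / alpha D * (1 / (2 * alpha D) + 2 * (1 + 2 * M))) + 1)"
definition "c_2 = exp K_growth * K_source * (K * (2 / alpha D * (2 + 2 * L_f D)))"
definition "C_m = (1 + c_1 + c_2) * E_all"
definition "C_u = 2 * (L_f D * C_m + (1 + 2 * M) * E_all)"

lemma c_nonneg: "0 \<le> c_1" "0 \<le> c_2" "0 \<le> E_all" "0 \<le> C_m" "0 \<le> C_u"
proof -
  show *: "0 \<le> c_1" "0 \<le> c_2" "0 \<le> E_all"
    unfolding c_1_def c_2_def E_all_def using K_pos consts_pos K1 radius_pos E_nonneg by auto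
  show "0 \<le> C_m" unfolding C_m_def using * by simp
  then show "0 \<le> C_u" unfolding C_u_def using * consts_pos radius_pos by simp
qed

end

context convergence
begin

definition \<epsilon> :: real where "\<epsilon> = E_all * hr"

lemma eps: "0 \<le> \<epsilon>" "E_grad * hr \<le> \<epsilon>" "E_half * hr \<le> \<epsilon>" "E_HJB * hr \<le> \<epsilon>" "E_FP * hr \<le> \<epsilon>"
proof -
  show "0 \<le> \<epsilon>" unfolding \<epsilon>_def using c_nonneg hr by simp
  show "E_grad * hr \<le> \<epsilon>" "E_half * hr \<le> \<epsilon>" "E_HJB * hr \<le> \<epsilon>" "E_FP * hr \<le> \<epsilon>"
    unfolding \<epsilon>_def E_all_def using E_nonneg hr by (intro mult_right_mono; simp)+
qed

lemma residuals:
  assumes "t < T"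
  shows "\<bar>rho t x\<bar> \<le> \<epsilon>" "norm (nab (wh t) x - ph t x) \<le> \<epsilon>" "\<bar>eta_HJB t x\<bar> \<le> \<epsilon>" "\<bar>eta_FP t x\<bar> \<le> \<epsilon> * h ^ CARD('d)"
proof -
  show "\<bar>rho t x\<bar> \<le> \<epsilon>" using rho_bound[OF assms] eps(3) by (rule order_trans)
  show "norm (nab (wh t) x - ph t x) \<le> \<epsilon>" using grad_wh[OF assms] eps(2) by (rule order_trans)
  show "\<bar>eta_HJB t x\<bar> \<le> \<epsilon>" using eta_HJB_bound[OF assms] eps(4) by (rule order_trans)
  have "E_FP * hr * h ^ CARD('d) \<le> \<epsilon> * h ^ CARD('d)" using eps(5) h by (intro mult_right_mono) auto
  with eta_FP_bound[OF assms] show "\<bar>eta_FP t x\<bar> \<le> \<epsilon> * h ^ CARD('d)" by (rule order_trans)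
qed

lemma trace_optimal:
  assumes t: "t < T"
  shows "ph t x \<bullet> vh t x + lc D (tau t) (gpoint N x) (vh t x) + alpha D / 2 * (norm (v - vh t x))\<^sup>2
     \<le> ph t x \<bullet> v + lc D (tau t) (gpoint N x) v" and "norm (vh t x) \<le> M"
proof -
  have t': "tau t \<in> {0..1}" using t by (intro tau) simp
  show "ph t x \<bullet> vh t x + lc D (tau t) (gpoint N x) (vh t x) + alpha D / 2 * (norm (v - vh t x))\<^sup>2
     \<le> ph t x \<bullet> v + lc D (tau t) (gpoint N x) v"
    using legendre_maxD(1)[OF vs_optimal(1)[OF t', of "gpoint N x"], of v] by (simp add: ph_def vh_def)
  show "norm (vh t x) \<le> M" unfolding vh_def by (rule vs_optimal(2)[OF t'])
qed

text \<open>\<open>vh\<close> is optimal for the exact gradient \<open>ph\<close>, not for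
  \<open>nab (wh t)\<close>. The mismatch costs \<open>\<epsilon> d\<close> with \<open>d\<close>
  the distance of the velocities, while strong convexity returns
  \<open>alpha / 2 * d\<^sup>2\<close>; maximizing over \<open>d\<close> leaves order
  \<open>\<epsilon>\<^sup>2\<close>. This quadratic bound is used under a density of mass one; the
  linear one suffices in the maximum principle.\<close>

lemma gradient_gap:
  fixes x :: "int ^ 'd"
  assumes t: "t < T" and v: "norm v \<le> M"
  defines "g \<equiv> (nab (wh t) x \<bullet> vh t x + lc D (tau t) (gpoint N x) (vh t x)) - (nab (wh t) x \<bullet> v + lc D (tau t) (gpoint N x) v)"
  shows "g \<le> \<epsilon>\<^sup>2 / (2 * alpha D)" and "g \<le> 2 * M * \<epsilon>"
proof -
  define d where "d = norm (v - vh t x)"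
  have g: "g \<le> \<epsilon> * d - alpha D / 2 * d\<^sup>2"
  proof -
    have "g \<le> (nab (wh t) x - ph t x) \<bullet> (vh t x - v) - alpha D / 2 * d\<^sup>2"
      using trace_optimal(1)[OF t, of x v] by (simp add: g_def d_def inner_diff_left inner_diff_right)
    also have "(nab (wh t) x - ph t x) \<bullet> (vh t x - v) \<le> norm (nab (wh t) x - ph t x) * norm (vh t x - v)"
      by (rule norm_cauchy_schwarz)
    also have "\<dots> \<le> \<epsilon> * d"
      unfolding d_def using residuals(2)[OF t, of x] by (simp add: norm_minus_commute mult_right_mono)
    finally show ?thesis by simp
  qed
  have a: "alpha D > 0" by (rule consts_pos)
  have "0 \<le> (alpha D * d - \<epsilon>)\<^sup>2" by simp
  then have "2 * alpha D * (\<epsilon> * d - alpha D / 2 * d\<^sup>2) \<le> \<epsilon>\<^sup>2"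
    by (simp add: power2_eq_square algebra_simps)
  then have "\<epsilon> * d - alpha D / 2 * d\<^sup>2 \<le> \<epsilon>\<^sup>2 / (2 * alpha D)"
    using a by (simp add: pos_le_divide_eq mult.commute)
  then show "g \<le> \<epsilon>\<^sup>2 / (2 * alpha D)" using g by linarith
  have "d \<le> 2 * M" unfolding d_def using norm_triangle_ineq4[of v "vh t x"] v trace_optimal(2)[OF t, of x] by linarith
  then have "\<epsilon> * d \<le> \<epsilon> * (2 * M)" using eps by (intro mult_left_mono) auto
  moreover have "0 \<le> alpha D / 2 * d\<^sup>2" using a by simp
  ultimately show "g \<le> 2 * M * \<epsilon>" using g by (simp add: mult_ac)
qed

section \<open>Stability of the scheme by crossed duality\<close>

context
  fixes m w u \<omega> Y
  assumes eq: "equilibrium m w u \<omega>" and Y: "\<And>t. t \<le> T \<Longrightarrow> sqrt (l2 (\<lambda>x. m t x - mhat t x)) \<le> Y"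
begin

private lemma m: "adm m w" and b: "backward m u \<omega>" and w: "\<And>t. t < T \<Longrightarrow> w t x = m t x *\<^sub>R vel \<omega> t x"
  using eq by (auto simp: equilibrium_def)

private lemma Y0: "0 \<le> Y"
  using Y[of 0] l2_nonneg[of "\<lambda>x. m 0 x - mhat 0 x"] by (meson le0 order_trans real_sqrt_ge_zero)

private lemma mhatD: "t \<le> T \<Longrightarrow> mhat t \<in> grid_funs N" "t \<le> T \<Longrightarrow> 0 \<le> mhat t x"
  using mhat_prob[of t] by (auto simp: prob_grid_def)

private lemma f_diff:
  assumes "t \<le> T"
  shows "\<bar>f_h D T N t x (m t) - f_h D T N t x (mhat t)\<bar> \<le> L_f D * Y"
proof -
  have "\<bar>f_h D T N t x (m t) - f_h D T N t x (mhat t)\<bar> \<le> L_f D * sqrt (l2 (\<lambda>x. m t x - mhat t x))"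
    using f_h_lipschitz[OF N T assms admD(1)[OF m assms] mhat_prob[OF assms]] by (simp add: l2_def)
  also have "\<dots> \<le> L_f D * Y" using Y[OF assms] consts_pos by (intro mult_left_mono) auto
  finally show ?thesis .
qed

private lemma step_diff:
  assumes t: "t < T"
  shows "(\<lambda>x. \<omega> t x - wh t x) \<in> grid_funs N"
    and "(\<omega> t x - wh t x) - \<theta> * \<sigma> * \<delta> * lap (\<lambda>x. \<omega> t x - wh t x) x = (u (t + 1) x - uh (t + 1) x) + \<delta> * (- rho t x)"
    and "u t x - uh t x = (\<omega> t x - wh t x) + (1 - \<theta>) * \<sigma> * \<delta> * lap (\<lambda>x. \<omega> t x - wh t x) x + \<delta> *
      ((f_h D T N t x (m t) - H_h D T N t x (nab (\<omega> t) x)) -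
       (nab (wh t) x \<bullet> vh t x + lc D (tau t) (gpoint N x) (vh t x) + f_h D T N t x (mhat t) + eta_HJB t x))"
proof -
  show "(\<lambda>x. \<omega> t x - wh t x) \<in> grid_funs N"
    using b t wh_periodic[OF t] by (intro grid_funs_diff) (auto simp: backward_def)
  have "\<omega> t x - \<theta> * \<sigma> * \<delta> * lap (\<omega> t) x = u (t + 1) x" using b t by (auto simp: backward_def)
  then show "(\<omega> t x - wh t x) - \<theta> * \<sigma> * \<delta> * lap (\<lambda>x. \<omega> t x - wh t x) x = (u (t + 1) x - uh (t + 1) x) + \<delta> * (- rho t x)"
    using wh_eq[of t x] unfolding laplacian_h_linear by (simp add: algebra_simps)
  have "u t x = \<omega> t x + (1 - \<theta>) * \<sigma> * \<delta> * lap (\<omega> t) x + \<delta> * (f_h D T N t x (m t) - H_h D T N t x (nab (\<omega> t) x))"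
    using b t by (auto simp: backward_def)
  then show "u t x - uh t x = (\<omega> t x - wh t x) + (1 - \<theta>) * \<sigma> * \<delta> * lap (\<lambda>x. \<omega> t x - wh t x) x + \<delta> *
      ((f_h D T N t x (m t) - H_h D T N t x (nab (\<omega> t) x)) -
       (nab (wh t) x \<bullet> vh t x + lc D (tau t) (gpoint N x) (vh t x) + f_h D T N t x (mhat t) + eta_HJB t x))"
    using uh_eq[of t x] unfolding laplacian_h_linear by (simp add: algebra_simps)
qed

text \<open>Error per half step in the comparison: \<open>L_f Y\<close> from the coupling,
  \<open>\<epsilon>\<close> from the residuals and \<open>2 M \<epsilon>\<close> from the linear
  gradient gap.\<close>

private definition "e = L_f D * Y + (1 + 2 * M) * \<epsilon>"

private lemma e: "0 \<le> e" "L_f D * Y + \<epsilon> \<le> e" "L_f D * Y + \<epsilon> + 2 * M * \<epsilon> \<le> e" "\<epsilon> \<le> e"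
proof -
  have "0 \<le> L_f D * Y" "0 \<le> M * \<epsilon>" using Y0 consts_pos eps radius_pos by auto
  moreover have "e = L_f D * Y + \<epsilon> + 2 * (M * \<epsilon>)" by (simp add: e_def algebra_simps)
  ultimately show "0 \<le> e" "L_f D * Y + \<epsilon> \<le> e" "L_f D * Y + \<epsilon> + 2 * M * \<epsilon> \<le> e" "\<epsilon> \<le> e"
    using eps by linarith+
qed

private lemma terminal: "u T x - uh T x = 0"
  using b T equations(5) by (simp add: backward_def uh_def)

private lemma value_gap:
  shows "t \<le> T \<Longrightarrow> \<bar>u t x - uh t x\<bar> \<le> 2 * e" and "t < T \<Longrightarrow> \<bar>\<omega> t x - wh t x\<bar> \<le> 2 * e"
proof -
  have rho: "\<delta> * \<bar>rho t x\<bar> \<le> \<delta> * e" if "t < T" for t x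
    using residuals(1)[OF that, of x] e(4) delta by (intro mult_left_mono) auto
  \<comment> \<open>The trace velocity is a competitor in the truncated Hamiltonian; the bound of
    \<open>vs\<close> by \<open>M\<close> enters here.\<close>
  have up: "u t x - uh t x \<le> \<omega> t x - wh t x + (1 - \<theta>) * \<sigma> * \<delta> * lap (\<lambda>x. \<omega> t x - wh t x) x
       + \<delta> * (vh t x \<bullet> nab (\<lambda>x. \<omega> t x - wh t x) x) + \<delta> * e" if t: "t < T" for t x
  proof -
    have "- (nab (\<omega> t) x \<bullet> vh t x) - lc D (tau t) (gpoint N x) (vh t x) \<le> H_h D T N t x (nab (\<omega> t) x)"
      unfolding H_h_vel[OF less_imp_le[OF t]]
      using trace_optimal(2)[OF t, of x] t by (intro legendre_max_le[OF vel_max _ consts_pos(4)]) auto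
    then have "(f_h D T N t x (m t) - H_h D T N t x (nab (\<omega> t) x)) -
       (nab (wh t) x \<bullet> vh t x + lc D (tau t) (gpoint N x) (vh t x) + f_h D T N t x (mhat t) + eta_HJB t x)
       \<le> vh t x \<bullet> (nab (\<omega> t) x - nab (wh t) x) + e"
      using f_diff[of t x] t residuals(3)[OF t, of x] e(2) by (simp add: inner_diff_right inner_commute)
    then have "\<delta> * ((f_h D T N t x (m t) - H_h D T N t x (nab (\<omega> t) x)) -
       (nab (wh t) x \<bullet> vh t x + lc D (tau t) (gpoint N x) (vh t x) + f_h D T N t x (mhat t) + eta_HJB t x))
       \<le> \<delta> * (vh t x \<bullet> (nab (\<omega> t) x - nab (wh t) x) + e)" using delta by (intro mult_left_mono) auto
    then show ?thesis unfolding step_diff(3)[OF t] nabla_h_linear by (simp only: distrib_left)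
  qed
  \<comment> \<open>The roles are reversed, but \<open>vh\<close> is optimal for \<open>ph\<close>
    only, so the gradient gap is added.\<close>
  have down: "uh t x - u t x \<le> wh t x - \<omega> t x + (1 - \<theta>) * \<sigma> * \<delta> * lap (\<lambda>x. wh t x - \<omega> t x) x
       + \<delta> * (vel \<omega> t x \<bullet> nab (\<lambda>x. wh t x - \<omega> t x) x) + \<delta> * e" if t: "t < T" for t x
  proof -
    have "(nab (wh t) x \<bullet> vh t x + lc D (tau t) (gpoint N x) (vh t x) + f_h D T N t x (mhat t) + eta_HJB t x) -
       (f_h D T N t x (m t) - H_h D T N t x (nab (\<omega> t) x))
       \<le> vel \<omega> t x \<bullet> (nab (wh t) x - nab (\<omega> t) x) + e"
      using f_diff[of t x] t residuals(3)[OF t, of x] e(3) gradient_gap(2)[OF t vel_norm[of t \<omega> x], of x]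
      unfolding H_h_vel[OF less_imp_le[OF t]]
      by (simp add: inner_diff_right inner_commute)
    then have "\<delta> * ((nab (wh t) x \<bullet> vh t x + lc D (tau t) (gpoint N x) (vh t x) + f_h D T N t x (mhat t) + eta_HJB t x) -
       (f_h D T N t x (m t) - H_h D T N t x (nab (\<omega> t) x)))
       \<le> \<delta> * (vel \<omega> t x \<bullet> (nab (wh t) x - nab (\<omega> t) x) + e)" using delta by (intro mult_left_mono) auto
    moreover have "lap (\<lambda>x. wh t x - \<omega> t x) x = - lap (\<lambda>x. \<omega> t x - wh t x) x" unfolding laplacian_h_linear by simp
    ultimately show ?thesis using step_diff(3)[OF t, of x] unfolding nabla_h_linear by (simp add: algebra_simps)
  qed
  have half: "\<omega> t x - wh t x - \<theta> * \<sigma> * \<delta> * lap (\<lambda>x. \<omega> t x - wh t x) x \<le> u (t + 1) x - uh (t + 1) x + \<delta> * e"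
    "wh t x - \<omega> t x - \<theta> * \<sigma> * \<delta> * lap (\<lambda>x. wh t x - \<omega> t x) x \<le> uh (t + 1) x - u (t + 1) x + \<delta> * e" if t: "t < T" for t x
  proof -
    have "\<bar>\<delta> * rho t x\<bar> \<le> \<delta> * e" using rho[OF t, of x] delta by (simp add: abs_mult)
    moreover have "lap (\<lambda>x. wh t x - \<omega> t x) x = - lap (\<lambda>x. \<omega> t x - wh t x) x" unfolding laplacian_h_linear by simp
    ultimately show "\<omega> t x - wh t x - \<theta> * \<sigma> * \<delta> * lap (\<lambda>x. \<omega> t x - wh t x) x \<le> u (t + 1) x - uh (t + 1) x + \<delta> * e"
      "wh t x - \<omega> t x - \<theta> * \<sigma> * \<delta> * lap (\<lambda>x. wh t x - \<omega> t x) x \<le> uh (t + 1) x - u (t + 1) x + \<delta> * e"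
      using step_diff(2)[OF t, of x] by (simp_all add: abs_le_iff algebra_simps)
  qed
  have per: "(\<lambda>x. wh t x - \<omega> t x) \<in> grid_funs N" if "t < T" for t
    using grid_funs_uminus[OF step_diff(1)[OF that]] by simp
  have vn: "norm (vel \<omega> t x) \<le> M" "norm (vh t x) \<le> M" if "t < T" for t x
    using vel_norm[of t] trace_optimal(2)[OF that] that by auto
  have T0: "u T x - uh T x \<le> 0" "uh T x - u T x \<le> 0" for x using terminal[of x] by auto
  have c1: "t \<le> T \<Longrightarrow> u t x - uh t x \<le> 2 * e" "t < T \<Longrightarrow> \<omega> t x - wh t x \<le> 2 * e" for t x
    using comparison[where \<phi> = "\<lambda>t x. u t x - uh t x" and \<omega> = "\<lambda>t x. \<omega> t x - wh t x" and v = vh and e = e,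
      OF step_diff(1) vn(2) T0(1) half(1) up e(1)] by simp_all
  have c2: "t \<le> T \<Longrightarrow> uh t x - u t x \<le> 2 * e" "t < T \<Longrightarrow> wh t x - \<omega> t x \<le> 2 * e" for t x
    using comparison[where \<phi> = "\<lambda>t x. uh t x - u t x" and \<omega> = "\<lambda>t x. wh t x - \<omega> t x" and v = "vel \<omega>" and e = e,
      OF per vn(1) T0(2) half(2) down e(1)] by simp_all
  show "\<bar>u t x - uh t x\<bar> \<le> 2 * e" if "t \<le> T" using c1(1)[OF that, of x] c2(1)[OF that, of x] by linarith
  show "\<bar>\<omega> t x - wh t x\<bar> \<le> 2 * e" if "t < T" using c1(2)[OF that, of x] c2(2)[OF that, of x] by linarith
qed

lemma value_error: "t \<le> T \<Longrightarrow> \<bar>u t x - uh t x\<bar> \<le> 2 * (L_f D * Y + (1 + 2 * M) * \<epsilon>)"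
  using value_gap(1) unfolding e_def .

private definition "Q t = (\<Sum>x\<in>ibox. (norm (vel \<omega> t x - vh t x))\<^sup>2 * mhat t x)"

text \<open>Crossing the two duality identities: the Hamiltonian terms are controlled from both sides by
  strong convexity, the coupling by monotonicity.\<close>

private lemma pointwise:
  assumes t: "t < T"
  shows "nab (\<lambda>x. \<omega> t x - wh t x) x \<bullet> (m t x *\<^sub>R vel \<omega> t x - mhat t x *\<^sub>R vh t x)
     - ((f_h D T N t x (m t) - H_h D T N t x (nab (\<omega> t) x)) -
       (nab (wh t) x \<bullet> vh t x + lc D (tau t) (gpoint N x) (vh t x) + f_h D T N t x (mhat t) + eta_HJB t x)) * (m t x - mhat t x)
    \<le> \<epsilon>\<^sup>2 / (2 * alpha D) * m t x - alpha D / 2 * ((norm (vel \<omega> t x - vh t x))\<^sup>2 * mhat t x)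
      - (f_h D T N t x (m t) - f_h D T N t x (mhat t)) * (m t x - mhat t x) + \<epsilon> * \<bar>m t x - mhat t x\<bar>"
proof -
  have t': "t \<le> T" using t by simp
  define p p' v v' where "p = nab (\<omega> t) x" and "p' = nab (wh t) x" and "v = vel \<omega> t x" and "v' = vh t x"
  define l l' where "l = lc D (tau t) (gpoint N x) v" and "l' = lc D (tau t) (gpoint N x) v'"
  define H where "H = H_h D T N t x p"
  define f f' \<eta> where "f = f_h D T N t x (m t)" and "f' = f_h D T N t x (mhat t)" and "\<eta> = eta_HJB t x"
  define \<mu> \<mu>' where "\<mu> = m t x" and "\<mu>' = mhat t x"
  have H: "H = - (p \<bullet> v) - l" unfolding H_def p_def v_def l_def by (rule H_h_vel[OF t'])
  have g1: "(p' \<bullet> v' + l') - (p' \<bullet> v + l) \<le> \<epsilon>\<^sup>2 / (2 * alpha D)"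
    unfolding p'_def v'_def l'_def v_def l_def by (rule gradient_gap(1)[OF t vel_norm[OF t']])
  have g2: "- (p \<bullet> v') - l' + alpha D / 2 * (norm (v - v'))\<^sup>2 \<le> - (p \<bullet> v) - l"
    unfolding p_def v_def v'_def l_def l'_def norm_minus_commute[of "vel \<omega> t x"]
    by (rule legendre_maxD(1)[OF vel_max[OF t']]) (use trace_optimal(2)[OF t] in simp)
  have pos: "0 \<le> \<mu>" "0 \<le> \<mu>'" unfolding \<mu>_def \<mu>'_def using admD(3)[OF m t'] mhatD(2)[OF t'] by auto
  have "\<eta> * (\<mu> - \<mu>') \<le> \<epsilon> * \<bar>\<mu> - \<mu>'\<bar>"
  proof -
    have "\<eta> * (\<mu> - \<mu>') \<le> \<bar>\<eta>\<bar> * \<bar>\<mu> - \<mu>'\<bar>" unfolding abs_mult[symmetric] by (rule abs_ge_self)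
    also have "\<dots> \<le> \<epsilon> * \<bar>\<mu> - \<mu>'\<bar>" unfolding \<eta>_def using residuals(3)[OF t, of x] by (intro mult_right_mono) auto
    finally show ?thesis .
  qed
  moreover have "((p' \<bullet> v' + l') - (p' \<bullet> v + l)) * \<mu> \<le> \<epsilon>\<^sup>2 / (2 * alpha D) * \<mu>" using g1 pos by (intro mult_right_mono)
  moreover have "(- (p \<bullet> v') - l' + p \<bullet> v + l) * \<mu>' \<le> - (alpha D / 2 * (norm (v - v'))\<^sup>2) * \<mu>'"
    using g2 pos by (intro mult_right_mono) auto
  \<comment> \<open>Lasry-Lions splitting: the discrete density \<open>\<mu>\<close> collects the
    optimality of the trace velocity, the trace density \<open>\<mu>'\<close> that of the discrete
    one. The quadratic term survives with weight \<open>\<mu>'\<close>, and this density has a sup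
    bound of order \<open>h^d\<close>.\<close>
  moreover have "(p - p') \<bullet> (\<mu> *\<^sub>R v - \<mu>' *\<^sub>R v') - ((f - H) - (p' \<bullet> v' + l' + f' + \<eta>)) * (\<mu> - \<mu>') =
     ((p' \<bullet> v' + l') - (p' \<bullet> v + l)) * \<mu> + (- (p \<bullet> v') - l' + p \<bullet> v + l) * \<mu>' - (f - f') * (\<mu> - \<mu>') + \<eta> * (\<mu> - \<mu>')"
    unfolding H by (simp add: inner_diff_left inner_diff_right algebra_simps)
  ultimately have "(p - p') \<bullet> (\<mu> *\<^sub>R v - \<mu>' *\<^sub>R v') - ((f - H) - (p' \<bullet> v' + l' + f' + \<eta>)) * (\<mu> - \<mu>') \<le>
     \<epsilon>\<^sup>2 / (2 * alpha D) * \<mu> - alpha D / 2 * ((norm (v - v'))\<^sup>2 * \<mu>') - (f - f') * (\<mu> - \<mu>') + \<epsilon> * \<bar>\<mu> - \<mu>'\<bar>"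
    by (simp add: mult.assoc)
  then show ?thesis
    unfolding nabla_h_linear p_def p'_def v_def v'_def l_def l'_def H_def f_def f'_def \<eta>_def \<mu>_def \<mu>'_def .
qed

private lemma l1_Y: "t \<le> T \<Longrightarrow> (\<Sum>x\<in>ibox. \<bar>m t x - mhat t x\<bar>) \<le> Y"
  using l1_le_l2 Y order_trans by blast

text \<open>The pairing \<open>S\<close> vanishes at both ends, since terminal costs and initial
  averages coincide, so its increments sum to zero. In each increment the backward residuals meet a
  difference of densities and the forward residual meets a difference of half-step values, which
  makes every first-order residual contribute a product of small quantities.\<close>

private lemma velocity_error: "\<delta> * (\<Sum>t<T. Q t) \<le> 2 / alpha D * (\<epsilon>\<^sup>2 / (2 * alpha D) + 2 * \<epsilon> * Y + \<epsilon> * (2 * e))"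
proof -
  define S where "S t = (\<Sum>x\<in>ibox. (u t x - uh t x) * (m t x - mhat t x))" for t
  let ?B = "\<epsilon>\<^sup>2 / (2 * alpha D) + 2 * \<epsilon> * Y + \<epsilon> * (2 * e)"
  have step: "S (Suc t) - S t \<le> \<delta> * (?B - alpha D / 2 * Q t)" if t: "t < T" for t
  proof -
    have t': "t \<le> T" "t + 1 \<le> T" using t by auto
    let ?G = "\<lambda>x. (f_h D T N t x (m t) - H_h D T N t x (nab (\<omega> t) x)) -
       (nab (wh t) x \<bullet> vh t x + lc D (tau t) (gpoint N x) (vh t x) + f_h D T N t x (mhat t) + eta_HJB t x)"
    let ?q = "\<lambda>x. m t x *\<^sub>R vel \<omega> t x - mhat t x *\<^sub>R vh t x"
    have \<omega>per: "\<omega> t \<in> grid_funs N" using b t by (auto simp: backward_def)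
    have qper: "?q \<in> grid_funs N"
      by (intro grid_funs_diff grid_funs_scaleR admD(2)[OF m] mhatD vel_periodic vh_periodic t' \<omega>per)
    have wt: "w t = (\<lambda>x. m t x *\<^sub>R vel \<omega> t x)" using w[OF t] by auto
    have fwd: "(m (t + 1) x - mhat (t + 1) x) - \<theta> * \<sigma> * \<delta> * lap (\<lambda>x. m (t + 1) x - mhat (t + 1) x) x =
       (m t x - mhat t x) + (1 - \<theta>) * \<sigma> * \<delta> * lap (\<lambda>x. m t x - mhat t x) x - \<delta> * div_h N ?q x + \<delta> * (- eta_FP t x)" for x
      using admD(8)[OF m t, of x] mhat_eq[of t x] unfolding wt laplacian_h_linear div_h_linear by (simp add: algebra_simps)
    have "S (t + 1) - S t = \<delta> * ((\<Sum>x\<in>ibox. nab (\<lambda>x. \<omega> t x - wh t x) x \<bullet> ?q x) - (\<Sum>x\<in>ibox. ?G x * (m t x - mhat t x))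
       + (\<Sum>x\<in>ibox. (\<omega> t x - wh t x) * (- eta_FP t x)) - (\<Sum>x\<in>ibox. - rho t x * (m (t + 1) x - mhat (t + 1) x)))"
      unfolding S_def
      by (rule one_step_duality[OF N step_diff(1)[OF t] grid_funs_diff[OF admD(2)[OF m t'(1)] mhatD(1)[OF t'(1)]]
          grid_funs_diff[OF admD(2)[OF m t'(2)] mhatD(1)[OF t'(2)]] qper step_diff(2,3)[OF t] fwd])
    also have "\<dots> \<le> \<delta> * (?B - alpha D / 2 * Q t)"
    proof (rule mult_left_mono)
      have "(\<Sum>x\<in>ibox. nab (\<lambda>x. \<omega> t x - wh t x) x \<bullet> ?q x) - (\<Sum>x\<in>ibox. ?G x * (m t x - mhat t x)) =
         (\<Sum>x\<in>ibox. nab (\<lambda>x. \<omega> t x - wh t x) x \<bullet> ?q x - ?G x * (m t x - mhat t x))"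
        by (rule sum_subtractf[symmetric])
      also have "\<dots> \<le> (\<Sum>x\<in>ibox. \<epsilon>\<^sup>2 / (2 * alpha D) * m t x - alpha D / 2 * ((norm (vel \<omega> t x - vh t x))\<^sup>2 * mhat t x)
         - (f_h D T N t x (m t) - f_h D T N t x (mhat t)) * (m t x - mhat t x) + \<epsilon> * \<bar>m t x - mhat t x\<bar>)"
        by (intro sum_mono pointwise[OF t])
      also have "\<dots> = \<epsilon>\<^sup>2 / (2 * alpha D) * (\<Sum>x\<in>ibox. m t x) - alpha D / 2 * Q t
         - (\<Sum>x\<in>ibox. (f_h D T N t x (m t) - f_h D T N t x (mhat t)) * (m t x - mhat t x)) + \<epsilon> * (\<Sum>x\<in>ibox. \<bar>m t x - mhat t x\<bar>)"
        unfolding Q_def sum.distrib sum_subtractf sum_distrib_left ..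
      also have "\<dots> \<le> \<epsilon>\<^sup>2 / (2 * alpha D) - alpha D / 2 * Q t + \<epsilon> * Y"
      proof -
        have "0 \<le> (\<Sum>x\<in>ibox. (f_h D T N t x (m t) - f_h D T N t x (mhat t)) * (m t x - mhat t x))"
          by (rule f_h_monotone[OF N T t'(1) admD(1)[OF m t'(1)] mhat_prob[OF t'(1)]])
        moreover have "\<epsilon> * (\<Sum>x\<in>ibox. \<bar>m t x - mhat t x\<bar>) \<le> \<epsilon> * Y" using l1_Y[OF t'(1)] eps by (intro mult_left_mono) auto
        ultimately show ?thesis using admD(4)[OF m t'(1)] by simp
      qed
      finally have 1: "(\<Sum>x\<in>ibox. nab (\<lambda>x. \<omega> t x - wh t x) x \<bullet> ?q x) - (\<Sum>x\<in>ibox. ?G x * (m t x - mhat t x))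
         \<le> \<epsilon>\<^sup>2 / (2 * alpha D) - alpha D / 2 * Q t + \<epsilon> * Y" .
      have "(\<Sum>x\<in>ibox. (\<omega> t x - wh t x) * (- eta_FP t x)) \<le> (\<Sum>x\<in>ibox. (2 * e) * (\<epsilon> * h ^ CARD('d)))"
      proof (rule sum_mono)
        fix x
        have "(\<omega> t x - wh t x) * (- eta_FP t x) \<le> \<bar>\<omega> t x - wh t x\<bar> * \<bar>eta_FP t x\<bar>"
          using abs_ge_self[of "(\<omega> t x - wh t x) * (- eta_FP t x)"] by (simp add: abs_mult)
        also have "\<dots> \<le> (2 * e) * (\<epsilon> * h ^ CARD('d))"
          using value_gap(2)[OF t, of x] residuals(4)[OF t, of x] e(1) by (intro mult_mono) auto
        finally show "(\<omega> t x - wh t x) * (- eta_FP t x) \<le> (2 * e) * (\<epsilon> * h ^ CARD('d))" .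
      qed
      also have "\<dots> = \<epsilon> * (2 * e)" using N by (simp add: card_index_box power_one_over)
      finally have 2: "(\<Sum>x\<in>ibox. (\<omega> t x - wh t x) * (- eta_FP t x)) \<le> \<epsilon> * (2 * e)" .
      have "- (\<Sum>x\<in>ibox. - rho t x * (m (t + 1) x - mhat (t + 1) x)) \<le> (\<Sum>x\<in>ibox. \<epsilon> * \<bar>m (t + 1) x - mhat (t + 1) x\<bar>)"
        unfolding sum_negf[symmetric]
      proof (rule sum_mono)
        fix x
        have "- (- rho t x * (m (t + 1) x - mhat (t + 1) x)) \<le> \<bar>rho t x\<bar> * \<bar>m (t + 1) x - mhat (t + 1) x\<bar>"
          using abs_ge_self[of "rho t x * (m (t + 1) x - mhat (t + 1) x)"] by (simp add: abs_mult)
        also have "\<dots> \<le> \<epsilon> * \<bar>m (t + 1) x - mhat (t + 1) x\<bar>" using residuals(1)[OF t, of x] by (intro mult_right_mono) auto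
        finally show "- (- rho t x * (m (t + 1) x - mhat (t + 1) x)) \<le> \<epsilon> * \<bar>m (t + 1) x - mhat (t + 1) x\<bar>" .
      qed
      also have "\<dots> = \<epsilon> * (\<Sum>x\<in>ibox. \<bar>m (t + 1) x - mhat (t + 1) x\<bar>)" by (rule sum_distrib_left[symmetric])
      also have "\<dots> \<le> \<epsilon> * Y" using l1_Y[OF t'(2)] eps by (intro mult_left_mono) auto
      finally have 3: "- (\<Sum>x\<in>ibox. - rho t x * (m (t + 1) x - mhat (t + 1) x)) \<le> \<epsilon> * Y" .
      show "(\<Sum>x\<in>ibox. nab (\<lambda>x. \<omega> t x - wh t x) x \<bullet> ?q x) - (\<Sum>x\<in>ibox. ?G x * (m t x - mhat t x))
       + (\<Sum>x\<in>ibox. (\<omega> t x - wh t x) * (- eta_FP t x)) - (\<Sum>x\<in>ibox. - rho t x * (m (t + 1) x - mhat (t + 1) x))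
       \<le> ?B - alpha D / 2 * Q t"
        using 1 2 3 by linarith
    qed (use delta in simp)
    finally show ?thesis by simp
  qed
  have "S T = 0" using terminal by (simp add: S_def)
  moreover have "S 0 = 0" using admD(5)[OF m] by (simp add: S_def mhat_initial)
  ultimately have "0 = (\<Sum>t<T. S (Suc t) - S t)" by (simp add: sum_lessThan_telescope)
  also have "\<dots> \<le> (\<Sum>t<T. \<delta> * (?B - alpha D / 2 * Q t))" using step by (intro sum_mono) auto
  also have "\<dots> = (\<delta> * real T) * ?B - alpha D / 2 * (\<delta> * (\<Sum>t<T. Q t))"
    by (simp add: sum_subtractf right_diff_distrib sum_distrib_left mult_ac)
  finally have "alpha D / 2 * (\<delta> * (\<Sum>t<T. Q t)) \<le> ?B" unfolding delta(3) by simp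
  then have "2 / alpha D * (alpha D / 2 * (\<delta> * (\<Sum>t<T. Q t))) \<le> 2 / alpha D * ?B"
    using consts_pos by (intro mult_left_mono) auto
  then show ?thesis using consts_pos by simp
qed

private lemma Q_nonneg: "t \<le> T \<Longrightarrow> 0 \<le> Q t"
  unfolding Q_def using mhatD(2) by (intro sum_nonneg mult_nonneg_nonneg) auto

private lemma density_error:
  assumes t: "t \<le> T"
  shows "l2 (\<lambda>x. m t x - mhat t x) \<le> exp K_growth * K_source * (K * (\<delta> * (\<Sum>t<T. Q t)) + \<epsilon>\<^sup>2)"
proof -
  let ?a = "h ^ CARD('d)"
  have "(\<Sum>x\<in>ibox. (m t x - mhat t x)\<^sup>2) \<le> exp K_growth * ((\<Sum>x\<in>ibox. (m 0 x - mhat 0 x)\<^sup>2) +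
     \<delta> * (\<Sum>s<t. K_source * ((\<Sum>x\<in>ibox. (norm (mhat s x *\<^sub>R (vel \<omega> s x - vh s x)))\<^sup>2) + (\<Sum>x\<in>ibox. (- eta_FP s x)\<^sup>2))))"
  proof (rule energy_bound[where q = "\<lambda>s x. m s x *\<^sub>R vel \<omega> s x - mhat s x *\<^sub>R vh s x"])
    fix s assume "s \<le> T"
    then show "(\<lambda>x. m s x - mhat s x) \<in> grid_funs N" using admD(2)[OF m] mhatD(1) by (intro grid_funs_diff) auto
  next
    fix s assume s: "s < T"
    then have s': "s \<le> T" by simp
    have \<omega>per: "\<omega> s \<in> grid_funs N" using b s by (auto simp: backward_def)
    show "(\<lambda>x. m s x *\<^sub>R vel \<omega> s x - mhat s x *\<^sub>R vh s x) \<in> grid_funs N"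
      by (intro grid_funs_diff grid_funs_scaleR admD(2)[OF m] mhatD vel_periodic vh_periodic s' \<omega>per)
    fix x
    have "m s x *\<^sub>R vel \<omega> s x - mhat s x *\<^sub>R vh s x = (m s x - mhat s x) *\<^sub>R vel \<omega> s x + mhat s x *\<^sub>R (vel \<omega> s x - vh s x)"
      by (simp add: algebra_simps)
    then have "norm (m s x *\<^sub>R vel \<omega> s x - mhat s x *\<^sub>R vh s x) \<le> \<bar>m s x - mhat s x\<bar> * norm (vel \<omega> s x) + norm (mhat s x *\<^sub>R (vel \<omega> s x - vh s x))"
      using norm_triangle_ineq[of "(m s x - mhat s x) *\<^sub>R vel \<omega> s x" "mhat s x *\<^sub>R (vel \<omega> s x - vh s x)"] by simp
    also have "\<bar>m s x - mhat s x\<bar> * norm (vel \<omega> s x) \<le> \<bar>m s x - mhat s x\<bar> * M"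
      using vel_norm[OF s'] by (intro mult_left_mono) auto
    finally show "norm (m s x *\<^sub>R vel \<omega> s x - mhat s x *\<^sub>R vh s x) \<le> M * \<bar>m s x - mhat s x\<bar> + norm (mhat s x *\<^sub>R (vel \<omega> s x - vh s x))"
      by (simp add: mult.commute)
    have wt: "w s = (\<lambda>x. m s x *\<^sub>R vel \<omega> s x)" using w[OF s] by auto
    show "(m (s + 1) x - mhat (s + 1) x) - \<theta> * \<sigma> * \<delta> * lap (\<lambda>x. m (s + 1) x - mhat (s + 1) x) x =
       (m s x - mhat s x) + (1 - \<theta>) * \<sigma> * \<delta> * lap (\<lambda>x. m s x - mhat s x) x
        - \<delta> * div_h N (\<lambda>x. m s x *\<^sub>R vel \<omega> s x - mhat s x *\<^sub>R vh s x) x + \<delta> * (- eta_FP s x)"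
      using admD(8)[OF m s, of x] mhat_eq[of s x] unfolding wt laplacian_h_linear div_h_linear by (simp add: algebra_simps)
  qed (rule t)
  also have "\<dots> = exp K_growth * (\<delta> * (\<Sum>s<t. K_source * ((\<Sum>x\<in>ibox. (norm (mhat s x *\<^sub>R (vel \<omega> s x - vh s x)))\<^sup>2) + (\<Sum>x\<in>ibox. (- eta_FP s x)\<^sup>2))))"
    using admD(5)[OF m] by (simp add: mhat_initial)
  also have "\<dots> \<le> exp K_growth * (\<delta> * (\<Sum>s<t. K_source * (?a * (K * Q s + \<epsilon>\<^sup>2))))"
  proof (intro mult_left_mono sum_mono)
    fix s assume "s \<in> {..<t}"
    then have s: "s < T" "s \<le> T" using t by auto
    \<comment> \<open>One factor \<open>mhat\<close>, at most \<open>K h^d\<close>, is taken out of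
      the square; it cancels the factor \<open>N^d\<close> of \<open>l2\<close>, and the other
      remains as the weight in \<open>Q\<close>.\<close>
    have "(\<Sum>x\<in>ibox. (norm (mhat s x *\<^sub>R (vel \<omega> s x - vh s x)))\<^sup>2) \<le> (\<Sum>x\<in>ibox. K * ?a * ((norm (vel \<omega> s x - vh s x))\<^sup>2 * mhat s x))"
    proof (rule sum_mono)
      fix x
      have "(norm (mhat s x *\<^sub>R (vel \<omega> s x - vh s x)))\<^sup>2 = mhat s x * ((norm (vel \<omega> s x - vh s x))\<^sup>2 * mhat s x)"
        by (simp add: power2_eq_square)
      also have "\<dots> \<le> K * ?a * ((norm (vel \<omega> s x - vh s x))\<^sup>2 * mhat s x)"
        using mhat_le[OF s(2)] mhatD(2)[OF s(2)] by (intro mult_right_mono mult_nonneg_nonneg) auto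
      finally show "(norm (mhat s x *\<^sub>R (vel \<omega> s x - vh s x)))\<^sup>2 \<le> K * ?a * ((norm (vel \<omega> s x - vh s x))\<^sup>2 * mhat s x)" .
    qed
    also have "\<dots> = ?a * (K * Q s)" unfolding Q_def by (simp only: sum_distrib_left mult_ac)
    finally have 1: "(\<Sum>x\<in>ibox. (norm (mhat s x *\<^sub>R (vel \<omega> s x - vh s x)))\<^sup>2) \<le> ?a * (K * Q s)" .
    have "(\<Sum>x\<in>ibox. (- eta_FP s x)\<^sup>2) \<le> (\<Sum>x\<in>ibox. (\<epsilon> * ?a)\<^sup>2)"
      using residuals(4)[OF s(1)] by (intro sum_mono abs_le_square_iff[THEN iffD1]) (auto intro: order_trans[OF _ abs_ge_self])
    also have "\<dots> = (real N ^ CARD('d) * ?a) * (?a * \<epsilon>\<^sup>2)" by (simp add: card_index_box power2_eq_square mult_ac)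
    also have "\<dots> = ?a * \<epsilon>\<^sup>2" using N by (simp add: power_one_over)
    finally show "(\<Sum>x\<in>ibox. (norm (mhat s x *\<^sub>R (vel \<omega> s x - vh s x)))\<^sup>2) + (\<Sum>x\<in>ibox. (- eta_FP s x)\<^sup>2) \<le> ?a * (K * Q s + \<epsilon>\<^sup>2)"
      using 1 by (simp add: distrib_left)
  qed (use delta K_pos in auto)
  also have "\<dots> \<le> exp K_growth * (\<delta> * (\<Sum>s<T. K_source * (?a * (K * Q s + \<epsilon>\<^sup>2))))"
    using t delta K_pos Q_nonneg K1 h by (intro mult_left_mono sum_mono2 mult_nonneg_nonneg add_nonneg_nonneg) auto
  also have "\<dots> = ?a * (exp K_growth * K_source * (K * (\<delta> * (\<Sum>t<T. Q t)) + (\<delta> * real T) * \<epsilon>\<^sup>2))"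
  proof -
    have "(\<Sum>s<T. K_source * (?a * (K * Q s + \<epsilon>\<^sup>2))) = K_source * (?a * (K * (\<Sum>t<T. Q t) + real T * \<epsilon>\<^sup>2))"
      unfolding sum_distrib_left[symmetric] sum.distrib by simp
    then show ?thesis by (simp only: distrib_left mult_ac)
  qed
  finally have "real N ^ CARD('d) * (\<Sum>x\<in>ibox. (m t x - mhat t x)\<^sup>2) \<le> real N ^ CARD('d) * (?a * (exp K_growth * K_source * (K * (\<delta> * (\<Sum>t<T. Q t)) + (\<delta> * real T) * \<epsilon>\<^sup>2)))"
    by (rule mult_left_mono) simp
  also have "\<dots> = (real N ^ CARD('d) * ?a) * (exp K_growth * K_source * (K * (\<delta> * (\<Sum>t<T. Q t)) + \<epsilon>\<^sup>2))"
    unfolding delta(3) by simp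
  also have "\<dots> = exp K_growth * K_source * (K * (\<delta> * (\<Sum>t<T. Q t)) + \<epsilon>\<^sup>2)" using N by (simp add: power_one_over)
  finally show ?thesis unfolding l2_def .
qed

lemma density_error_self_bound:
  assumes t: "t \<le> T"
  shows "l2 (\<lambda>x. m t x - mhat t x) \<le> c_1 * \<epsilon>\<^sup>2 + c_2 * (\<epsilon> * Y)"
proof -
  have "l2 (\<lambda>x. m t x - mhat t x) \<le> exp K_growth * K_source * (K * (\<delta> * (\<Sum>t<T. Q t)) + \<epsilon>\<^sup>2)"
    by (rule density_error[OF t])
  also have "\<dots> \<le> exp K_growth * K_source * (K * (2 / alpha D * (\<epsilon>\<^sup>2 / (2 * alpha D) + 2 * \<epsilon> * Y + \<epsilon> * (2 * e))) + \<epsilon>\<^sup>2)"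
    using velocity_error K_pos K1 by (intro mult_left_mono add_right_mono) auto
  also have "\<epsilon>\<^sup>2 / (2 * alpha D) + 2 * \<epsilon> * Y + \<epsilon> * (2 * e) = (1 / (2 * alpha D) + 2 * (1 + 2 * M)) * \<epsilon>\<^sup>2 + (2 + 2 * L_f D) * (\<epsilon> * Y)"
    unfolding e_def by (simp add: power2_eq_square algebra_simps)
  also have "exp K_growth * K_source * (K * (2 / alpha D * ((1 / (2 * alpha D) + 2 * (1 + 2 * M)) * \<epsilon>\<^sup>2 + (2 + 2 * L_f D) * (\<epsilon> * Y))) + \<epsilon>\<^sup>2)
     = c_1 * \<epsilon>\<^sup>2 + c_2 * (\<epsilon> * Y)"
    unfolding c_1_def c_2_def by (simp only: distrib_left distrib_right mult_1_left mult_1_right mult.assoc)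
  finally show ?thesis .
qed

end

lemma theta_scheme_error:
  assumes eq: "equilibrium m w u \<omega>" and t: "t \<le> T"
  shows "sqrt (l2 (\<lambda>x. m t x - mhat t x)) \<le> C_m * hr" and "\<bar>u t x - uh t x\<bar> \<le> C_u * hr"
proof -
  define Y where "Y = Max ((\<lambda>t. sqrt (l2 (\<lambda>x. m t x - mhat t x))) ` {..T})"
  have Y: "sqrt (l2 (\<lambda>x. m t x - mhat t x)) \<le> Y" if "t \<le> T" for t
    unfolding Y_def using that by (intro Max_ge) auto
  have "Y \<in> (\<lambda>t. sqrt (l2 (\<lambda>x. m t x - mhat t x))) ` {..T}" unfolding Y_def by (intro Max_in) auto
  then obtain t0 where t0: "t0 \<le> T" "Y = sqrt (l2 (\<lambda>x. m t0 x - mhat t0 x))" by auto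
  have Y0: "0 \<le> Y" unfolding t0(2) by (simp add: l2_nonneg)
  have Y2: "Y\<^sup>2 \<le> c_1 * \<epsilon>\<^sup>2 + c_2 * (\<epsilon> * Y)"
    using density_error_self_bound[OF eq Y t0(1)] l2_nonneg unfolding t0(2) by simp
  \<comment> \<open>\<open>Y\<close> is attained, so it satisfies the quadratic inequality itself.
    If it exceeds \<open>\<epsilon>\<close>, then
    \<open>\<epsilon>\<^sup>2 \<le> \<epsilon> Y\<close> and one factor \<open>Y\<close> can be
    divided out.\<close>
  have Yle: "Y \<le> (1 + c_1 + c_2) * \<epsilon>"
  proof (cases "Y \<le> \<epsilon>")
    case True
    have "1 * \<epsilon> \<le> (1 + c_1 + c_2) * \<epsilon>" using c_nonneg eps by (intro mult_right_mono) auto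
    then show ?thesis using True by linarith
  next
    case False
    have "\<epsilon> * \<epsilon> \<le> \<epsilon> * Y" using False eps by (intro mult_left_mono) auto
    then have "c_1 * \<epsilon>\<^sup>2 \<le> c_1 * (\<epsilon> * Y)" using c_nonneg by (intro mult_left_mono) (auto simp: power2_eq_square)
    then have "Y * Y \<le> ((c_1 + c_2) * \<epsilon>) * Y" using Y2 by (simp add: power2_eq_square algebra_simps)
    moreover have "Y > 0" using False eps by linarith
    ultimately have "Y \<le> (c_1 + c_2) * \<epsilon>" by (rule mult_right_le_imp_le)
    then show ?thesis using eps by (simp add: algebra_simps)
  qed
  also have "(1 + c_1 + c_2) * \<epsilon> = C_m * hr" by (simp add: C_m_def \<epsilon>_def)
  finally have Ym: "Y \<le> C_m * hr" .
  then show "sqrt (l2 (\<lambda>x. m t x - mhat t x)) \<le> C_m * hr" using Y[OF t] by linarith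
  have "\<bar>u t x - uh t x\<bar> \<le> 2 * (L_f D * Y + (1 + 2 * M) * \<epsilon>)"
    by (rule value_error[OF eq Y t])
  also have "\<dots> \<le> 2 * (L_f D * (C_m * hr) + (1 + 2 * M) * \<epsilon>)"
    using Ym consts_pos by (intro mult_left_mono add_right_mono) auto
  also have "\<dots> = C_u * hr" by (simp add: C_u_def \<epsilon>_def algebra_simps)
  finally show "\<bar>u t x - uh t x\<bar> \<le> C_u * hr" .
qed

end

section \<open>Passage to the norms and rates of the statement\<close>

lemma norm_inf_inf_le:
  assumes N: "N > 0" and le: "\<And>t x. t \<le> T \<Longrightarrow> \<bar>\<mu> t x\<bar> \<le> c"
  shows "norm_inf_inf T N \<mu> \<le> c"
proof -
  have "Max ((\<lambda>x. \<bar>\<mu> t x\<bar>) ` index_box N) \<le> c" if "t \<le> T" for t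
    using le[OF that] finite_index_box index_box_nonempty[OF N] by (intro Max.boundedI) auto
  then show ?thesis unfolding norm_inf_inf_def by (intro Max.boundedI) auto
qed

lemma norm_inf_1_le:
  assumes "\<And>t. t \<le> T \<Longrightarrow> (\<Sum>x\<in>index_box N. \<bar>\<mu> t x\<bar>) \<le> c"
  shows "norm_inf_1 T N \<mu> \<le> c"
  unfolding norm_inf_1_def using assms by (intro Max.boundedI) auto

definition (in theta_data) "fw_density_const = exp K_growth * K_source * (2 / alpha D) * sqrt K_L2 * gap_const"

context scheme
begin

lemma fw_density_const_nonneg: "0 \<le> fw_density_const"
  unfolding fw_density_const_def using K_pos consts_pos gap_const_pos by simp

lemma frank_wolfe_error:
  assumes C: "assumption_C D" and mfg: "discrete_mfg D \<sigma> \<theta> T N u_h v_h m_h"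
    and fw: "frank_wolfe D \<sigma> \<theta> T N (\<lambda>k. 2 / (real k + 2)) m w"
    and hjb: "HJB D \<sigma> \<theta> T N (m k) u" and k: "k \<ge> 1"
  defines "e \<equiv> sqrt fw_density_const / sqrt (real k * (1 / real N) powr (real CARD('d) / 2))"
  shows "J_tilde D T N (m k) (w k) - J_tilde D T N m_h (\<lambda>t x. m_h t x *\<^sub>R v_h t x) \<le> ereal (gap_const / real k)"
    and "t \<le> T \<Longrightarrow> sqrt (l2 (\<lambda>x. m k t x - m_h t x)) \<le> e"
    and "t \<le> T \<Longrightarrow> \<bar>u t x - u_h t x\<bar> \<le> 2 * L_f D * e"
proof -
  obtain \<omega>h where eq: "equilibrium m_h (\<lambda>t x. m_h t x *\<^sub>R v_h t x) u_h \<omega>h"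
    using mfg by (rule discrete_mfg_equilibrium)
  then have mh: "adm m_h (\<lambda>t x. m_h t x *\<^sub>R v_h t x)" and bh: "backward m_h u_h \<omega>h"
    by (auto simp: equilibrium_def)
  note rate = frank_wolfe_rate[OF C eq fw k]
  show "J_tilde D T N (m k) (w k) - J_tilde D T N m_h (\<lambda>t x. m_h t x *\<^sub>R v_h t x) \<le> ereal (gap_const / real k)"
    using rate(2) by (simp add: J_tilde_eq[OF rate(1)] J_tilde_eq[OF mh])
  have pw: "(1 / real N) powr (real CARD('d) / 2) = 1 / sqrt (real N ^ CARD('d))"
  proof -
    have "(1 / real N) powr (real CARD('d) / 2) = 1 / real N powr (real CARD('d) / 2)"
      using N by (simp add: powr_divide)
    also have "real N powr (real CARD('d) / 2) = sqrt (real N powr real CARD('d))"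
      using N by (simp add: powr_half_sqrt[symmetric] powr_powr)
    also have "real N powr real CARD('d) = real N ^ CARD('d)" using N by (simp add: powr_realpow)
    finally show ?thesis .
  qed
  have ee: "e = sqrt (fw_density_const * sqrt (real N ^ CARD('d)) / real k)"
    unfolding e_def pw by (simp add: real_sqrt_divide real_sqrt_mult)
  have density: "sqrt (l2 (\<lambda>x. m k t x - m_h t x)) \<le> e" if "t \<le> T" for t
  proof -
    have "l2 (\<lambda>x. m k t x - m_h t x) \<le> exp K_growth * K_source * (2 / alpha D) * sqrt (K_L2 * real N ^ CARD('d)) *
       (total_cost (m k) (w k) - total_cost m_h (\<lambda>t x. m_h t x *\<^sub>R v_h t x))"
      by (rule adm_distance[OF C eq rate(1) that])
    also have "\<dots> \<le> exp K_growth * K_source * (2 / alpha D) * sqrt (K_L2 * real N ^ CARD('d)) * (gap_const / real k)"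
      using rate(2) K_pos consts_pos by (intro mult_left_mono) auto
    also have "\<dots> = fw_density_const * sqrt (real N ^ CARD('d)) / real k"
      by (simp add: fw_density_const_def real_sqrt_mult)
    finally show ?thesis unfolding ee by simp
  qed
  then show "sqrt (l2 (\<lambda>x. m k t x - m_h t x)) \<le> e" if "t \<le> T" using that by blast
  obtain \<omega> where b: "backward (m k) u \<omega>" by (rule HJB_backward[OF hjb])
  have e0: "0 \<le> e" unfolding e_def using fw_density_const_nonneg by simp
  have "\<bar>u t x - u_h t x\<bar> \<le> 2 * (L_f D * e)" if "t \<le> T"
    by (rule backward_distance[OF b bh that _ _ e0])
      (rule admD(1)[OF rate(1)] admD(1)[OF mh] density; assumption)+
  then show "\<bar>u t x - u_h t x\<bar> \<le> 2 * L_f D * e" if "t \<le> T" using that by (simp only: mult.assoc)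
qed

end

theorem theorem4p5:
  fixes D :: "('d::finite) mfg_data"
    and \<sigma> \<theta> r :: real
    and u_star m_star :: "real \<Rightarrow> real ^ 'd \<Rightarrow> real"
    and v_star :: "real \<Rightarrow> real ^ 'd \<Rightarrow> real ^ 'd"
  assumes "\<sigma> > 0" and "1 / 2 < \<theta>" and "\<theta> < 1" and "0 < r" and "r < 1"
    and "torus_data D" and "assumption_A D"
    and "assumption_B D \<sigma> r u_star v_star m_star" and "assumption_C D"
  shows "\<exists>C > 0. \<exists>C' > 0. \<forall>(T::nat) (N::nat) u_h v_h m_h m w u.
    T > 0 \<longrightarrow> N > 0 \<longrightarrow>
    1 / real T \<le> (1 / real N)\<^sup>2 / (2 * real CARD('d) * (1 - \<theta>) * \<sigma>) \<longrightarrow>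
    1 / real N \<le> 2 * (1 - \<theta>) * \<sigma> / radius_M D \<longrightarrow>
    discrete_mfg D \<sigma> \<theta> T N u_h v_h m_h \<longrightarrow>
    frank_wolfe D \<sigma> \<theta> T N (\<lambda>k. 2 / (real k + 2)) m w \<longrightarrow>
    (\<forall>k\<ge>1. HJB D \<sigma> \<theta> T N (m k) (u k)) \<longrightarrow>
    (\<forall>k\<ge>1.
       J_tilde D T N (m k) (w k) - J_tilde D T N m_h (\<lambda>t x. m_h t x *\<^sub>R v_h t x)
         \<le> ereal (C / real k) \<and>
       norm_inf_inf T N (\<lambda>t x. u k t x - u_h t x) + norm_inf_1 T N (\<lambda>t x. m k t x - m_h t x)
         \<le> C' / sqrt (real k * (1 / real N) powr (real CARD('d) / 2)) \<and>
       norm_inf_inf T N (\<lambda>t x. u k t x - u_star (real t / real T) (gpoint N x))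
         + norm_inf_1 T N (\<lambda>t x. m k t x - I_h N (m_star (real t / real T)) x)
         \<le> C' * ((1 / real N) powr r
                  + 1 / sqrt (real k * (1 / real N) powr (real CARD('d) / 2))) \<and>
       (real k \<ge> (1 / real N) powr (- (2 * r + real CARD('d) / 2)) \<longrightarrow>
          norm_inf_inf T N (\<lambda>t x. u k t x - u_star (real t / real T) (gpoint N x))
            + norm_inf_1 T N (\<lambda>t x. m k t x - I_h N (m_star (real t / real T)) x)
            \<le> 2 * C' * (1 / real N) powr r))"
proof -
  interpret mfg_regular D \<sigma> \<theta> r u_star m_star v_star
    using assms by unfold_locales (auto simp: assumption_B_def)
  obtain K where "regular_bounds D \<sigma> \<theta> r u_star m_star v_star K"
  proof (rule uniform_constant, goal_cases)
    case (1 K)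
    show ?case by (rule 1(1)[of K], intro regular_bounds.intro regular_bounds_axioms.intro mfg_regular_axioms 1)
  qed
  then interpret regular_bounds D \<sigma> \<theta> r u_star m_star v_star K .
  define a where "a = sqrt fw_density_const"
  \<comment> \<open>\<open>(1 + 2 L_f) a\<close> collects the optimization errors of density and
    value, \<open>C_m + C_u\<close> the discretization errors; the 1 ensures positivity.\<close>
  define C' where "C' = 1 + (1 + 2 * L_f D) * a + C_m + C_u"
  have a: "0 \<le> a" "0 \<le> L_f D * a"
    unfolding a_def fw_density_const_def using K_pos consts_pos gap_const_pos by simp_all
  have C': "C' > 0" "(1 + 2 * L_f D) * a \<le> C'" "C_m + C_u \<le> C'"
    unfolding C'_def using a c_nonneg by (auto simp: algebra_simps)
  define rate where "rate N k = 1 / sqrt (real k * (1 / real N) powr (real CARD('d) / 2))" for N k :: nat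
  \<comment> \<open>The constants are fixed before the grid: the locale that contains
    \<open>T\<close> and \<open>N\<close> is interpreted inside this claim only, which makes their
    independence of both visible.\<close>
  have goal: "J_tilde D T N (m k) (w k) - J_tilde D T N m_h (\<lambda>t x. m_h t x *\<^sub>R v_h t x) \<le> ereal (gap_const / real k) \<and>
       norm_inf_inf T N (\<lambda>t x. u k t x - u_h t x) + norm_inf_1 T N (\<lambda>t x. m k t x - m_h t x) \<le> C' * rate N k \<and>
       norm_inf_inf T N (\<lambda>t x. u k t x - u_star (real t / real T) (gpoint N x))
         + norm_inf_1 T N (\<lambda>t x. m k t x - I_h N (m_star (real t / real T)) x)
         \<le> C' * ((1 / real N) powr r + rate N k) \<and>
       (real k \<ge> (1 / real N) powr (- (2 * r + real CARD('d) / 2)) \<longrightarrow> rate N k \<le> (1 / real N) powr r)"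
    if T: "T > 0" and N: "N > 0"
      and dt: "1 / real T \<le> (1 / real N)\<^sup>2 / (2 * real CARD('d) * (1 - \<theta>) * \<sigma>)"
      and dx: "1 / real N \<le> 2 * (1 - \<theta>) * \<sigma> / M"
      and mfg: "discrete_mfg D \<sigma> \<theta> T N u_h v_h m_h"
      and fw: "frank_wolfe D \<sigma> \<theta> T N (\<lambda>k. 2 / (real k + 2)) m w"
      and hjb: "HJB D \<sigma> \<theta> T N (m k) (u k)" and k: "k \<ge> 1" for T N k :: nat and u_h v_h m_h m w u
  proof -
    interpret convergence D \<sigma> \<theta> r u_star m_star v_star K T N
      using T N dt dx by unfold_locales
    obtain \<omega> where eq: "equilibrium m_h (\<lambda>t x. m_h t x *\<^sub>R v_h t x) u_h \<omega>"
      using mfg by (rule discrete_mfg_equilibrium)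
    let ?e = "rate N k"
    have e0: "0 \<le> ?e" by (simp add: rate_def)
    have J: "J_tilde D T N (m k) (w k) - J_tilde D T N m_h (\<lambda>t x. m_h t x *\<^sub>R v_h t x) \<le> ereal (gap_const / real k)"
      by (rule frank_wolfe_error(1)[OF assms(9) mfg fw hjb k])
    have m1: "(\<Sum>x\<in>ibox. \<bar>m k t x - m_h t x\<bar>) \<le> a * ?e" if "t \<le> T" for t
      using order_trans[OF l1_le_l2 frank_wolfe_error(2)[OF assms(9) mfg fw hjb k that]] by (simp add: a_def rate_def)
    have u1: "\<bar>u k t x - u_h t x\<bar> \<le> 2 * L_f D * (a * ?e)" if "t \<le> T" for t x
      using frank_wolfe_error(3)[OF assms(9) mfg fw hjb k that, of x] by (simp add: a_def rate_def)
    have m2: "(\<Sum>x\<in>ibox. \<bar>m_h t x - I_h N (m_star (tau t)) x\<bar>) \<le> C_m * hr" if "t \<le> T" for t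
      using order_trans[OF l1_le_l2 theta_scheme_error(1)[OF eq that]] by (simp add: mhat_def)
    have u2: "\<bar>u_h t x - u_star (tau t) (gpoint N x)\<bar> \<le> C_u * hr" if "t \<le> T" for t x
      using theta_scheme_error(2)[OF eq that, of x] by (simp add: uh_def)
    have D1: "norm_inf_inf T N (\<lambda>t x. u k t x - u_h t x) \<le> 2 * L_f D * (a * ?e)"
      by (rule norm_inf_inf_le[OF N u1])
    have D2: "norm_inf_1 T N (\<lambda>t x. m k t x - m_h t x) \<le> a * ?e"
      by (rule norm_inf_1_le[OF m1])
    have D3: "norm_inf_inf T N (\<lambda>t x. u k t x - u_star (tau t) (gpoint N x)) \<le> 2 * L_f D * (a * ?e) + C_u * hr"
    proof (rule norm_inf_inf_le[OF N])
      fix t x assume t: "t \<le> T"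
      show "\<bar>u k t x - u_star (tau t) (gpoint N x)\<bar> \<le> 2 * L_f D * (a * ?e) + C_u * hr"
        using u1[OF t, of x] u2[OF t, of x] by linarith
    qed
    have D4: "norm_inf_1 T N (\<lambda>t x. m k t x - I_h N (m_star (tau t)) x) \<le> a * ?e + C_m * hr"
    proof (rule norm_inf_1_le)
      fix t assume t: "t \<le> T"
      have "(\<Sum>x\<in>ibox. \<bar>m k t x - I_h N (m_star (tau t)) x\<bar>)
          \<le> (\<Sum>x\<in>ibox. \<bar>m k t x - m_h t x\<bar> + \<bar>m_h t x - I_h N (m_star (tau t)) x\<bar>)"
        by (intro sum_mono) linarith
      then show "(\<Sum>x\<in>ibox. \<bar>m k t x - I_h N (m_star (tau t)) x\<bar>) \<le> a * ?e + C_m * hr"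
        using m1[OF t] m2[OF t] unfolding sum.distrib by linarith
    qed
    have s1: "2 * L_f D * (a * ?e) + a * ?e \<le> C' * ?e"
      using mult_right_mono[OF C'(2) e0] by (simp add: algebra_simps)
    have s2: "C_u * hr + C_m * hr \<le> C' * hr"
      using mult_right_mono[OF C'(3), of hr] hr by (simp add: algebra_simps)
    \<comment> \<open>The threshold is the value of \<open>k\<close> at which
      \<open>k h^(d/2) = h^(-2r)\<close>, that is, at which both errors balance.\<close>
    have "?e \<le> hr" if large: "real k \<ge> h powr (- (2 * r + real CARD('d) / 2))"
    proof -
      have h2: "h powr (- (2 * r)) = (1 / hr)\<^sup>2"
        unfolding hr_def using h by (simp add: powr_minus_divide power_one_over powr_power)
      have "h powr (- (2 * r)) = h powr (- (2 * r + real CARD('d) / 2)) * h powr (real CARD('d) / 2)"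
        by (simp only: powr_add[symmetric]) simp
      also have "\<dots> \<le> real k * h powr (real CARD('d) / 2)" using large by (intro mult_right_mono) auto
      finally have "1 / hr \<le> sqrt (real k * h powr (real CARD('d) / 2))" unfolding h2 by (rule real_le_rsqrt)
      then have "1 / sqrt (real k * h powr (real CARD('d) / 2)) \<le> 1 / (1 / hr)"
        using le_imp_inverse_le[of "1 / hr"] hr by (simp add: inverse_eq_divide)
      then show ?thesis by (simp add: rate_def)
    qed
    then show ?thesis using J D1 D2 D3 D4 s1 s2 by (simp add: hr_def distrib_left)
  qed
  have final: "A \<le> 2 * C' * b" if "A \<le> C' * (b + c)" "c \<le> b" for A b c
    using that(1) mult_left_mono[OF that(2) less_imp_le[OF C'(1)]] by (simp add: distrib_left)
  show ?thesis
  proof (rule exI[of _ gap_const], rule conjI[OF gap_const_pos], rule exI[of _ C'], rule conjI[OF C'(1)], intro allI impI, goal_cases)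
    case (1 T N u_h v_h m_h m w u k)
    note g = goal[where u = u and k = k, OF 1(1-6) 1(7)[rule_format, OF 1(8)] 1(8), unfolded rate_def]
    show ?case using g final[OF g[THEN conjunct2, THEN conjunct2, THEN conjunct1]] by simp
  qed
qed

end
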